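(* Let $u\colon R\to U$ be an injective epimorphism of associative rings such that $U$ is a flat left $R$-module. Let $\mathbb G$ be the related faithful perfect Gabriel topology of right ideals in $R$, and let $\mathfrak R=\varprojlim_{I\in\mathbb G}R/I$ be the completion of $R$ with respect to $\mathbb G$. Assume that $\mathbb G$ has a countable base. Then the Geigle--Lenzing perpendicular subcategory $U^{\perp_{0,1}}\subset R\text{-mod}$ coincides with the full subcategory of left $\mathfrak R$-contramodules $\mathfrak R\text{-contra}\subset R\text{-mod}$. In particular, the full subcategory $\mathfrak R\text{-contra}$ is closed under extensions in $R\text{-mod}$.
   Context: Rings are associative and unital; $R\text{-mod}$ is the category of left $R$-modules. The perfect Gabriel topology related to $u$ is $\mathbb G=\{I\subset R\text{ a right ideal}: R/I\otimes_RU=0\}$; it is called faithful when no nonzero element of $R$ is annihilated on the right by some $I\in\mathbb G$ (equivalently here, $u$ is injective). A base of $\mathbb G$ is a subset $\mathbb B\subset\mathbb G$ such that every element of $\mathbb G$ contains an element of $\mathbb B$. $U^{\perp_{0,1}}$ is the full subcategory of all left $R$-modules $C$ with $\operatorname{Hom}_R(U,C)=0=\operatorname{Ext}^1_R(U,C)$. The completion $\mathfrak R=\varprojlim_{I\in\mathbb G}R/I$ carries the projective limit topology, in which the subgroups $\mathfrak I=\ker(\mathfrak R\to R/I)$, $I\in\mathbb G$, are a base of neighborhoods of zero, and the unique topological ring structure making the natural map $R\to\mathfrak R$ a ring homomorphism; the $\mathfrak I$ are open right ideals. Contramodules. For a set $X$ and an abelian group $A$ put $A[X]=A^{(X)}$,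 and let $\mathfrak R[[X]]=\varprojlim_{\mathfrak I}(\mathfrak R/\mathfrak I)[X]$ over the open right ideals $\mathfrak I\subset\mathfrak R$; equivalently, $\mathfrak R[[X]]$ is the set of formal sums $\sum_{x\in X}r_xx$ with $r_x\in\mathfrak R$ converging to zero (for each open $\mathfrak I$ all but finitely many $r_x$ lie in $\mathfrak I$). The functor $X\mapsto\mathfrak R[[X]]$ (on maps: push-forward, summing coefficients) is a monad on the category of sets, with unit $x\mapsto 1\cdot x$ and multiplication $\mathfrak R[[\mathfrak R[[X]]]]\to\mathfrak R[[X]]$ opening parentheses. A left $\mathfrak R$-contramodule is a module (algebra) over this monad: a set $\mathfrak C$ with a map $\pi_{\mathfrak C}\colon\mathfrak R[[\mathfrak C]]\to\mathfrak C$ satisfying associativity and unitality. They form an abelian category $\mathfrak R\text{-contra}$. Restricting $\pi_{\mathfrak C}$ to finite formal sums makes $\mathfrak C$ a left $\mathfrak R$-module, and restricting scalars along $R\to\mathfrak R$ gives an exact forgetful functor $\mathfrak R\text{-contra}\to R\text{-mod}$. In the situation of the claim this functor is fully faithful, and $\mathfrak R\text{-contra}$ is viewed as a full subcategory of $R\text{-mod}$ via its essential image. *)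

theory Defs
  imports "HOL-Algebra.Module" "HOL-Algebra.AbelCoset" "HOL-Algebra.Free_Abelian_Groups" "HOL-Library.Countable_Set"
begin

section \<open>Modules over noncommutative rings\<close>

text \<open>
  The library locale \<open>module\<close> assumes a commutative ring, so only its record type
  is reused here.  The inherited fields \<open>mult\<close> and \<open>one\<close> of a module are never used.
\<close>

locale left_module = R?: ring R + M?: abelian_group M
  for R :: "'r ring" and M :: "('r, 'm) module" +
  assumes lsmult_closed: "\<lbrakk>r \<in> carrier R; m \<in> carrier M\<rbrakk> \<Longrightarrow> r \<odot>\<^bsub>M\<^esub> m \<in> carrier M"
    and lsmult_l_distr: "\<lbrakk>r \<in> carrier R; s \<in> carrier R; m \<in> carrier M\<rbrakk> \<Longrightarrow>
          (r \<oplus>\<^bsub>R\<^esub> s) \<odot>\<^bsub>M\<^esub> m = (r \<odot>\<^bsub>M\<^esub> m) \<oplus>\<^bsub>M\<^esub> (s \<odot>\<^bsub>M\<^esub> m)"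
    and lsmult_r_distr: "\<lbrakk>r \<in> carrier R; m \<in> carrier M; n \<in> carrier M\<rbrakk> \<Longrightarrow>
          r \<odot>\<^bsub>M\<^esub> (m \<oplus>\<^bsub>M\<^esub> n) = (r \<odot>\<^bsub>M\<^esub> m) \<oplus>\<^bsub>M\<^esub> (r \<odot>\<^bsub>M\<^esub> n)"
    and lsmult_assoc: "\<lbrakk>r \<in> carrier R; s \<in> carrier R; m \<in> carrier M\<rbrakk> \<Longrightarrow>
          (r \<otimes>\<^bsub>R\<^esub> s) \<odot>\<^bsub>M\<^esub> m = r \<odot>\<^bsub>M\<^esub> (s \<odot>\<^bsub>M\<^esub> m)"
    and lsmult_one: "m \<in> carrier M \<Longrightarrow> \<one>\<^bsub>R\<^esub> \<odot>\<^bsub>M\<^esub> m = m"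

text \<open>For a right module, \<open>r \<odot> m\<close> stands for the product \<open>m r\<close>.\<close>

locale right_module = R?: ring R + M?: abelian_group M
  for R :: "'r ring" and M :: "('r, 'm) module" +
  assumes rsmult_closed: "\<lbrakk>r \<in> carrier R; m \<in> carrier M\<rbrakk> \<Longrightarrow> r \<odot>\<^bsub>M\<^esub> m \<in> carrier M"
    and rsmult_l_distr: "\<lbrakk>r \<in> carrier R; s \<in> carrier R; m \<in> carrier M\<rbrakk> \<Longrightarrow>
          (r \<oplus>\<^bsub>R\<^esub> s) \<odot>\<^bsub>M\<^esub> m = (r \<odot>\<^bsub>M\<^esub> m) \<oplus>\<^bsub>M\<^esub> (s \<odot>\<^bsub>M\<^esub> m)"
    and rsmult_r_distr: "\<lbrakk>r \<in> carrier R; m \<in> carrier M; n \<in> carrier M\<rbrakk> \<Longrightarrow>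
          r \<odot>\<^bsub>M\<^esub> (m \<oplus>\<^bsub>M\<^esub> n) = (r \<odot>\<^bsub>M\<^esub> m) \<oplus>\<^bsub>M\<^esub> (r \<odot>\<^bsub>M\<^esub> n)"
    and rsmult_assoc: "\<lbrakk>r \<in> carrier R; s \<in> carrier R; m \<in> carrier M\<rbrakk> \<Longrightarrow>
          (r \<otimes>\<^bsub>R\<^esub> s) \<odot>\<^bsub>M\<^esub> m = s \<odot>\<^bsub>M\<^esub> (r \<odot>\<^bsub>M\<^esub> m)"
    and rsmult_one: "m \<in> carrier M \<Longrightarrow> \<one>\<^bsub>R\<^esub> \<odot>\<^bsub>M\<^esub> m = m"

text \<open>
  Homomorphisms of left modules (equally of right modules, in the encoding above) are
  extensional functions, so that equality of homomorphisms is equality of functions.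
\<close>

definition mod_hom :: "'r ring \<Rightarrow> ('r, 'm) module \<Rightarrow> ('r, 'n) module \<Rightarrow> ('m \<Rightarrow> 'n) set" where
  "mod_hom R M N = {f \<in> carrier M \<rightarrow>\<^sub>E carrier N.
     (\<forall>x \<in> carrier M. \<forall>y \<in> carrier M. f (x \<oplus>\<^bsub>M\<^esub> y) = f x \<oplus>\<^bsub>N\<^esub> f y) \<and>
     (\<forall>r \<in> carrier R. \<forall>x \<in> carrier M. f (r \<odot>\<^bsub>M\<^esub> x) = r \<odot>\<^bsub>N\<^esub> f x)}"

definition hom_group :: "'r ring \<Rightarrow> ('r, 'm) module \<Rightarrow> ('r, 'n) module \<Rightarrow> ('m \<Rightarrow> 'n) monoid" where
  "hom_group R M N = \<lparr>carrier = mod_hom R M N,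
     monoid.mult = (\<lambda>f g. \<lambda>x \<in> carrier M. f x \<oplus>\<^bsub>N\<^esub> g x),
     one = (\<lambda>x \<in> carrier M. \<zero>\<^bsub>N\<^esub>)\<rparr>"

definition regular_module :: "'s ring \<Rightarrow> ('s, 's) module" where
  "regular_module S = \<lparr>carrier = carrier S, monoid.mult = monoid.mult S, one = \<one>\<^bsub>S\<^esub>,
     ring.zero = \<zero>\<^bsub>S\<^esub>, ring.add = add S, smult = monoid.mult S\<rparr>"

definition restrict_scalars :: "('r \<Rightarrow> 's) \<Rightarrow> ('s, 'm) module \<Rightarrow> ('r, 'm) module" where
  "restrict_scalars h M = \<lparr>carrier = carrier M, monoid.mult = monoid.mult M, one = \<one>\<^bsub>M\<^esub>,
     ring.zero = \<zero>\<^bsub>M\<^esub>, ring.add = add M, smult = (\<lambda>r m. h r \<odot>\<^bsub>M\<^esub> m)\<rparr>"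

definition short_exact ::
  "'r ring \<Rightarrow> ('r, 'a) module \<Rightarrow> ('r, 'b) module \<Rightarrow> ('r, 'c) module \<Rightarrow> ('a \<Rightarrow> 'b) \<Rightarrow> ('b \<Rightarrow> 'c) \<Rightarrow> bool"
where
  "short_exact R A B C f g \<longleftrightarrow> f \<in> mod_hom R A B \<and> g \<in> mod_hom R B C \<and>
     inj_on f (carrier A) \<and> f ` carrier A = {b \<in> carrier B. g b = \<zero>\<^bsub>C\<^esub>} \<and>
     g ` carrier B = carrier C"


section \<open>First extension groups\<close>

text \<open>
  \<open>Ext1\<close> is the first cohomology of \<open>Hom\<^sub>R(P\<^sub>\<bullet>, C)\<close>, where \<open>P\<^sub>\<bullet>\<close> is the canonical free
  resolution of \<open>M\<close>: \<open>P\<^sub>0\<close> is free on the elements of \<open>M\<close>, and \<open>P\<^sub>i\<^sub>+\<^sub>1\<close> is free on the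
  elements of the \<open>i\<close>-th syzygy module.
\<close>

definition free_module :: "'r ring \<Rightarrow> 'x set \<Rightarrow> ('r, 'x \<Rightarrow> 'r) module" where
  "free_module R X = \<lparr>carrier = {p \<in> X \<rightarrow>\<^sub>E carrier R. finite {x \<in> X. p x \<noteq> \<zero>\<^bsub>R\<^esub>}},
     monoid.mult = undefined, one = undefined,
     ring.zero = (\<lambda>x \<in> X. \<zero>\<^bsub>R\<^esub>),
     ring.add = (\<lambda>p q. \<lambda>x \<in> X. p x \<oplus>\<^bsub>R\<^esub> q x),
     smult = (\<lambda>r p. \<lambda>x \<in> X. r \<otimes>\<^bsub>R\<^esub> p x)\<rparr>"

definition free_cover :: "'r ring \<Rightarrow> ('r, 'm) module \<Rightarrow> ('m \<Rightarrow> 'r) \<Rightarrow> 'm" where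
  "free_cover R M p = finsum M (\<lambda>x. p x \<odot>\<^bsub>M\<^esub> x) {x \<in> carrier M. p x \<noteq> \<zero>\<^bsub>R\<^esub>}"

definition syzygy :: "'r ring \<Rightarrow> ('r, 'm) module \<Rightarrow> ('r, 'm \<Rightarrow> 'r) module" where
  "syzygy R M = (free_module R (carrier M))
     \<lparr>carrier := {p \<in> carrier (free_module R (carrier M)). free_cover R M p = \<zero>\<^bsub>M\<^esub>}\<rparr>"

definition Ext1 :: "'r ring \<Rightarrow> ('r, 'm) module \<Rightarrow> ('r, 'c) module \<Rightarrow>
    ((('m \<Rightarrow> 'r) \<Rightarrow> 'r) \<Rightarrow> 'c) set monoid" where
  "Ext1 R M C =
    (let K0 = syzygy R M; K1 = syzygy R K0;
         P0 = free_module R (carrier M);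
         P1 = free_module R (carrier K0);
         P2 = free_module R (carrier K1);
         d1 = free_cover R K0; d2 = free_cover R K1;
         cocycles = {f \<in> mod_hom R P1 C. \<forall>p \<in> carrier P2. f (d2 p) = \<zero>\<^bsub>C\<^esub>};
         coboundaries = {\<lambda>p \<in> carrier P1. g (d1 p) | g. g \<in> mod_hom R P0 C}
     in (hom_group R P1 C)\<lparr>carrier := cocycles\<rparr> Mod coboundaries)"

definition perp01 :: "'r ring \<Rightarrow> ('r, 'u) module \<Rightarrow> ('r, 'c) module set" where
  "perp01 R U = {C. left_module R C \<and>
     trivial_group (hom_group R U C) \<and> trivial_group (Ext1 R U C)}"


section \<open>Tensor products and flatness\<close>

definition tensor_relations ::
  "'r ring \<Rightarrow> ('r, 'a) module \<Rightarrow> ('r, 'm) module \<Rightarrow> ('a \<times> 'm \<Rightarrow>\<^sub>0 int) set" where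
  "tensor_relations R A M =
     {frag_of (a \<oplus>\<^bsub>A\<^esub> b, m) - frag_of (a, m) - frag_of (b, m) | a b m.
        a \<in> carrier A \<and> b \<in> carrier A \<and> m \<in> carrier M} \<union>
     {frag_of (a, m \<oplus>\<^bsub>M\<^esub> n) - frag_of (a, m) - frag_of (a, n) | a m n.
        a \<in> carrier A \<and> m \<in> carrier M \<and> n \<in> carrier M} \<union>
     {frag_of (r \<odot>\<^bsub>A\<^esub> a, m) - frag_of (a, r \<odot>\<^bsub>M\<^esub> m) | a r m.
        a \<in> carrier A \<and> r \<in> carrier R \<and> m \<in> carrier M}"

definition tensor_kernel ::
  "'r ring \<Rightarrow> ('r, 'a) module \<Rightarrow> ('r, 'm) module \<Rightarrow> ('a \<times> 'm \<Rightarrow>\<^sub>0 int) set" where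
  "tensor_kernel R A M =
     generate (free_Abelian_group (carrier A \<times> carrier M)) (tensor_relations R A M)"

text \<open>\<open>A\<close> is a right and \<open>M\<close> a left module.\<close>

definition tensor ::
  "'r ring \<Rightarrow> ('r, 'a) module \<Rightarrow> ('r, 'm) module \<Rightarrow> ('a \<times> 'm \<Rightarrow>\<^sub>0 int) set monoid" where
  "tensor R A M = free_Abelian_group (carrier A \<times> carrier M) Mod tensor_kernel R A M"

text \<open>The map \<open>A \<otimes> M \<rightarrow> B \<otimes> M\<close> induced by \<open>f : A \<rightarrow> B\<close>; the union is one of equal cosets.\<close>

definition tensor_map ::
  "'r ring \<Rightarrow> ('r, 'b) module \<Rightarrow> ('r, 'm) module \<Rightarrow> ('a \<Rightarrow> 'b) \<Rightarrow>
     ('a \<times> 'm \<Rightarrow>\<^sub>0 int) set \<Rightarrow> ('b \<times> 'm \<Rightarrow>\<^sub>0 int) set" where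
  "tensor_map R B M f t =
     (\<Union>c \<in> t. tensor_kernel R B M #>\<^bsub>free_Abelian_group (carrier B \<times> carrier M)\<^esub>
        frag_extend (\<lambda>(a, m). frag_of (f a, m)) c)"

text \<open>
  Flatness: \<open>- \<otimes> M\<close> preserves injectivity of homomorphisms of right modules.  HOL cannot
  quantify over all types here, but right modules with carrier in \<open>'r list\<close> are enough: every
  finitely generated right \<open>R\<close>-module (a quotient of some \<open>R\<^sup>n\<close>, whose elements are lists over
  \<open>R\<close>) has an isomorphic copy there, and an element of the kernel of \<open>A \<otimes> M \<rightarrow> B \<otimes> M\<close>, as well as
  a witness of its vanishing in \<open>B \<otimes> M\<close>, involves only finitely many elements of \<open>A\<close> and \<open>B\<close>.
\<close>

definition flat_left_module :: "'r ring \<Rightarrow> ('r, 'm) module \<Rightarrow> bool" where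
  "flat_left_module R M \<longleftrightarrow> left_module R M \<and>
     (\<forall>(A :: ('r, 'r list) module) (B :: ('r, 'r list) module) f.
        right_module R A \<and> right_module R B \<and> f \<in> mod_hom R A B \<and> inj_on f (carrier A) \<longrightarrow>
        inj_on (tensor_map R B M f) (carrier (tensor R A M)))"


section \<open>Ring epimorphisms and the related Gabriel topology\<close>

text \<open>
  Epimorphisms in the category of rings.  Testing on target rings with carrier in \<open>'u list\<close> is
  enough: given two homomorphisms from \<open>U\<close> to any ring, the subring generated by their images
  has cardinality at most \<open>max(|U|, \<aleph>\<^sub>0)\<close>, hence an isomorphic copy inside the infinite type
  \<open>'u list\<close>.
\<close>

definition ring_epimorphism :: "'r ring \<Rightarrow> 'u ring \<Rightarrow> ('r \<Rightarrow> 'u) \<Rightarrow> bool" where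
  "ring_epimorphism R U u \<longleftrightarrow> u \<in> ring_hom R U \<and>
     (\<forall>S :: 'u list ring. ring S \<longrightarrow>
       (\<forall>f \<in> ring_hom U S. \<forall>g \<in> ring_hom U S.
          (\<forall>r \<in> carrier R. f (u r) = g (u r)) \<longrightarrow> (\<forall>v \<in> carrier U. f v = g v)))"

definition right_ideal :: "'r set \<Rightarrow> 'r ring \<Rightarrow> bool" where
  "right_ideal I R \<longleftrightarrow> additive_subgroup I R \<and>
     (\<forall>i \<in> I. \<forall>r \<in> carrier R. i \<otimes>\<^bsub>R\<^esub> r \<in> I)"

definition quotient_right_module :: "'r ring \<Rightarrow> 'r set \<Rightarrow> ('r, 'r set) module" where
  "quotient_right_module R I = \<lparr>carrier = a_rcosets\<^bsub>R\<^esub> I,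
     monoid.mult = undefined, one = undefined,
     ring.zero = I, ring.add = (\<lambda>X Y. X <+>\<^bsub>R\<^esub> Y),
     smult = (\<lambda>r X. \<Union>x \<in> X. I +>\<^bsub>R\<^esub> (x \<otimes>\<^bsub>R\<^esub> r))\<rparr>"

definition gabriel_topology :: "'r ring \<Rightarrow> 'u ring \<Rightarrow> ('r \<Rightarrow> 'u) \<Rightarrow> 'r set set" where
  "gabriel_topology R U u = {I. right_ideal I R \<and>
     trivial_group (tensor R (quotient_right_module R I) (restrict_scalars u (regular_module U)))}"

definition has_countable_base :: "'r set set \<Rightarrow> bool" where
  "has_countable_base G \<longleftrightarrow> (\<exists>B \<subseteq> G. countable B \<and> (\<forall>I \<in> G. \<exists>J \<in> B. J \<subseteq> I))"


section \<open>The completion\<close>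

text \<open>
  Elements of the projective limit are compatible families of cosets: the transition map
  \<open>R/I \<rightarrow> R/J\<close>, for \<open>I \<subseteq> J\<close>, takes a coset of \<open>I\<close> to the coset of \<open>J\<close> containing it.
  In the definition of the product, \<open>(I : r) = {s. rs \<in> I}\<close> belongs to \<open>G\<close> and \<open>rs + I\<close> depends
  only on \<open>r + I\<close> and the component of \<open>y\<close> at \<open>(I : r)\<close>, so the union is one of equal cosets;
  this is the unique multiplication continuous in the projective limit topology and
  extending that of \<open>R\<close>.
\<close>

definition ideal_colon :: "'r ring \<Rightarrow> 'r set \<Rightarrow> 'r \<Rightarrow> 'r set" where
  "ideal_colon R I r = {s \<in> carrier R. r \<otimes>\<^bsub>R\<^esub> s \<in> I}"

definition completion :: "'r ring \<Rightarrow> 'r set set \<Rightarrow> ('r set \<Rightarrow> 'r set) ring" where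
  "completion R G = \<lparr>
     carrier = {x \<in> (\<Pi>\<^sub>E I \<in> G. a_rcosets\<^bsub>R\<^esub> I). \<forall>I \<in> G. \<forall>J \<in> G. I \<subseteq> J \<longrightarrow> x I \<subseteq> x J},
     monoid.mult = (\<lambda>x y. \<lambda>I \<in> G. \<Union>r \<in> x I. \<Union>s \<in> y (ideal_colon R I r). I +>\<^bsub>R\<^esub> (r \<otimes>\<^bsub>R\<^esub> s)),
     one = (\<lambda>I \<in> G. I +>\<^bsub>R\<^esub> \<one>\<^bsub>R\<^esub>),
     ring.zero = (\<lambda>I \<in> G. I),
     ring.add = (\<lambda>x y. \<lambda>I \<in> G. x I <+>\<^bsub>R\<^esub> y I)\<rparr>"

definition completion_map :: "'r ring \<Rightarrow> 'r set set \<Rightarrow> 'r \<Rightarrow> ('r set \<Rightarrow> 'r set)" where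
  "completion_map R G r = (\<lambda>I \<in> G. I +>\<^bsub>R\<^esub> r)"

text \<open>A subgroup is open iff it contains one of the basic neighborhoods \<open>ker (\<RR> \<rightarrow> R/I)\<close>.\<close>

definition open_right_ideals :: "'r ring \<Rightarrow> 'r set set \<Rightarrow> ('r set \<Rightarrow> 'r set) set set" where
  "open_right_ideals R G = {J. right_ideal J (completion R G) \<and>
     (\<exists>I \<in> G. {x \<in> carrier (completion R G). x I = I} \<subseteq> J)}"


section \<open>Contramodules\<close>

text \<open>
  In this section \<open>S\<close> is a complete, separated topological ring and \<open>\<JJ>\<close> is the set of its open
  right ideals, which is assumed to be a base of neighborhoods of zero.  A formal sum
  \<open>\<Sum> r\<^sub>x x\<close> in \<open>S[[X]]\<close> is the family of its coefficients, extensional on \<open>X\<close>.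
\<close>

definition formal_sums :: "'s ring \<Rightarrow> 's set set \<Rightarrow> 'x set \<Rightarrow> ('x \<Rightarrow> 's) set" where
  "formal_sums S \<JJ> X = {a \<in> X \<rightarrow>\<^sub>E carrier S. \<forall>J \<in> \<JJ>. finite {x \<in> X. a x \<notin> J}}"

text \<open>The sum in \<open>S\<close> of a family converging to zero, i.e. the limit of its finite partial sums.\<close>

definition convergent_sum :: "'s ring \<Rightarrow> 's set set \<Rightarrow> 'x set \<Rightarrow> ('x \<Rightarrow> 's) \<Rightarrow> 's" where
  "convergent_sum S \<JJ> X a = (THE s. s \<in> carrier S \<and>
     (\<forall>J \<in> \<JJ>. s \<ominus>\<^bsub>S\<^esub> finsum S a {x \<in> X. a x \<notin> J} \<in> J))"

definition formal_push ::
  "'s ring \<Rightarrow> 's set set \<Rightarrow> 'x set \<Rightarrow> 'y set \<Rightarrow> ('x \<Rightarrow> 'y) \<Rightarrow> ('x \<Rightarrow> 's) \<Rightarrow> ('y \<Rightarrow> 's)" where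
  "formal_push S \<JJ> X Y f a = (\<lambda>y \<in> Y. convergent_sum S \<JJ> {x \<in> X. f x = y} a)"

text \<open>The formal sum with the single term \<open>s x\<close>.\<close>

definition formal_single :: "'s ring \<Rightarrow> 'x set \<Rightarrow> 's \<Rightarrow> 'x \<Rightarrow> ('x \<Rightarrow> 's)" where
  "formal_single S X s x = (\<lambda>z \<in> X. if z = x then s else \<zero>\<^bsub>S\<^esub>)"

definition open_parentheses ::
  "'s ring \<Rightarrow> 's set set \<Rightarrow> 'x set \<Rightarrow> (('x \<Rightarrow> 's) \<Rightarrow> 's) \<Rightarrow> ('x \<Rightarrow> 's)" where
  "open_parentheses S \<JJ> X A =
     (\<lambda>x \<in> X. convergent_sum S \<JJ> (formal_sums S \<JJ> X) (\<lambda>a. A a \<otimes>\<^bsub>S\<^esub> a x))"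

definition contramodule :: "'s ring \<Rightarrow> 's set set \<Rightarrow> 'c set \<Rightarrow> (('c \<Rightarrow> 's) \<Rightarrow> 'c) \<Rightarrow> bool" where
  "contramodule S \<JJ> C \<pi> \<longleftrightarrow>
     \<pi> \<in> formal_sums S \<JJ> C \<rightarrow> C \<and>
     (\<forall>A \<in> formal_sums S \<JJ> (formal_sums S \<JJ> C).
        \<pi> (open_parentheses S \<JJ> C A) = \<pi> (formal_push S \<JJ> (formal_sums S \<JJ> C) C \<pi> A)) \<and>
     (\<forall>c \<in> C. \<pi> (formal_single S C \<one>\<^bsub>S\<^esub> c) = c)"

definition contra_hom :: "'s ring \<Rightarrow> 's set set \<Rightarrow> 'c set \<Rightarrow> (('c \<Rightarrow> 's) \<Rightarrow> 'c) \<Rightarrow>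
    'd set \<Rightarrow> (('d \<Rightarrow> 's) \<Rightarrow> 'd) \<Rightarrow> ('c \<Rightarrow> 'd) set" where
  "contra_hom S \<JJ> C \<pi> D \<rho> = {f \<in> C \<rightarrow>\<^sub>E D.
     \<forall>a \<in> formal_sums S \<JJ> C. f (\<pi> a) = \<rho> (formal_push S \<JJ> C D f a)}"

definition contra_module :: "'s ring \<Rightarrow> 'c set \<Rightarrow> (('c \<Rightarrow> 's) \<Rightarrow> 'c) \<Rightarrow> ('s, 'c) module" where
  "contra_module S C \<pi> = \<lparr>carrier = C, monoid.mult = undefined, one = undefined,
     ring.zero = \<pi> (\<lambda>z \<in> C. \<zero>\<^bsub>S\<^esub>),
     ring.add = (\<lambda>c d. \<pi> (\<lambda>z \<in> C. formal_single S C \<one>\<^bsub>S\<^esub> c z \<oplus>\<^bsub>S\<^esub> formal_single S C \<one>\<^bsub>S\<^esub> d z)),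
     smult = (\<lambda>s c. \<pi> (formal_single S C s c))\<rparr>"

definition contra_forget :: "'r ring \<Rightarrow> 'r set set \<Rightarrow>
    'c set \<Rightarrow> (('c \<Rightarrow> 'r set \<Rightarrow> 'r set) \<Rightarrow> 'c) \<Rightarrow> ('r, 'c) module" where
  "contra_forget R G C \<pi> =
     restrict_scalars (completion_map R G) (contra_module (completion R G) C \<pi>)"

abbreviation completion_contramodule :: "'r ring \<Rightarrow> 'r set set \<Rightarrow>
    'c set \<Rightarrow> (('c \<Rightarrow> 'r set \<Rightarrow> 'r set) \<Rightarrow> 'c) \<Rightarrow> bool" where
  "completion_contramodule R G \<equiv> contramodule (completion R G) (open_right_ideals R G)"

abbreviation completion_contra_hom :: "'r ring \<Rightarrow> 'r set set \<Rightarrow>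
    'c set \<Rightarrow> (('c \<Rightarrow> 'r set \<Rightarrow> 'r set) \<Rightarrow> 'c) \<Rightarrow>
    'd set \<Rightarrow> (('d \<Rightarrow> 'r set \<Rightarrow> 'r set) \<Rightarrow> 'd) \<Rightarrow> ('c \<Rightarrow> 'd) set" where
  "completion_contra_hom R G \<equiv> contra_hom (completion R G) (open_right_ideals R G)"

text \<open>
  The essential image of the forgetful functor.  A contramodule whose underlying module is
  isomorphic to \<open>M\<close> may be transported to the type of \<open>M\<close>, so fixing that type loses nothing.
\<close>

definition contra_modules :: "'r ring \<Rightarrow> 'r set set \<Rightarrow> ('r, 'c) module set" where
  "contra_modules R G = {M :: ('r, 'c) module. left_module R M \<and>
     (\<exists>(C :: 'c set) \<pi>. completion_contramodule R G C \<pi> \<and>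
       (\<exists>f \<in> mod_hom R (contra_forget R G C \<pi>) M. bij_betw f C (carrier M)))}"

end

theory Submission
  imports Defs
begin

text \<open>
  Both categories are compared through the left \<open>R\<close>-modules \<open>F(X)\<close> of formal sums over a set \<open>X\<close>
  with coefficients in the completion; write \<open>P(X)\<close> for the free module of finite formal sums and
  regard \<open>R\<close> as a subring of \<open>U\<close>.

  The Gabriel topology has an elementary description: a right ideal \<open>I\<close> belongs to it iff
  \<open>I U = U\<close> (\<open>gabriel_iff\<close>), and for every \<open>v\<close> in \<open>U\<close> the right ideal \<open>den v = {r. v r \<in> R}\<close> belongs
  to it (\<open>den_in_gabriel\<close>).  The latter is where the hypotheses on \<open>u\<close> enter: an epimorphism
  satisfies \<open>v \<otimes> 1 = 1 \<otimes> v\<close> in \<open>U \<otimes> U\<close> (\<open>tensor_commutes\<close>), and flatness restricts this equation to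
  \<open>(v R + R) \<otimes> U\<close>.  The axioms of a topology of right ideals follow.

  Consequently \<open>F(X)/P(X)\<close> is a left \<open>U\<close>-module.  Indeed, if a finite sum \<open>s\<close> approximates a formal
  sum \<open>a\<close> modulo \<open>den v\<close>, then \<open>v (a - s)\<close> is a formal sum, well defined up to finite sums.  Let \<open>M\<close>
  be a module with \<open>Hom(U, M) = 0 = Ext\<^sup>1(U, M)\<close>.  Then every map \<open>g\<close> from \<open>X\<close> to \<open>M\<close> extends
  uniquely to a linear map on \<open>F(X)\<close>: the difference of two extensions is a linear map out of
  a \<open>U\<close>-module, which vanishes because \<open>Hom(U, M) = 0\<close> (\<open>linear_extension_unique\<close>); and for a given
  \<open>a\<close>, the extension of \<open>U\<close> by \<open>P(X)\<close> pulled back from \<open>F(X)\<close> along \<open>v \<mapsto> v a\<close> splits after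
  pushing it out to \<open>M\<close>, because \<open>Ext\<^sup>1(U, M) = 0\<close> (\<open>linear_extension_exists\<close>).  For the identity
  map of \<open>M\<close> this is an operation of infinite summation on \<open>M\<close>, and uniqueness yields associativity.
  So \<open>M\<close> is a contramodule (\<open>perp_imp_contra\<close>).

  Conversely, let \<open>C\<close> be a contramodule.  A countable base allows one to choose a decreasing base
  \<open>J\<^sub>n\<close> and finite sums \<open>\<rho>\<^sub>n = \<Sum> r\<^sub>i [w\<^sub>i]\<close> in \<open>P(U)\<close> with \<open>r\<^sub>i\<close> in \<open>J\<^sub>n\<close>, with \<open>\<Sum> r\<^sub>i w\<^sub>i = 1\<close>, and
  with \<open>w\<^sub>i J\<^bsub>n+1\<^esub> \<subseteq> R\<close> (\<open>fraction_chain_exists\<close>).  When \<open>v J\<^sub>n \<subseteq> R\<close>, the finite sums \<open>v \<rho>\<^sub>k\<close> with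
  \<open>k \<ge> n\<close> all represent \<open>v\<close>, and their coefficients \<open>v \<rho>\<^sub>k(w)\<close> tend to zero, so that sums over all
  \<open>k \<ge> n\<close> and \<open>w\<close> with these coefficients can be formed in \<open>C\<close>.  If \<open>h\<close> is a linear map from \<open>U\<close> to
  \<open>C\<close>, the sum \<open>H\<^sub>n\<close> of the terms \<open>(v \<rho>\<^sub>k(w)) h(w)\<close> satisfies \<open>H\<^sub>n = h v + H\<^bsub>n+1\<^esub>\<close>; but replacing
  each \<open>w\<close> by \<open>w \<rho>\<^bsub>k+1\<^esub>\<close>, which represents the same element of \<open>U\<close>, turns \<open>v \<rho>\<^sub>k\<close> into
  \<open>v \<rho>\<^bsub>k+1\<^esub>\<close> and shows \<open>H\<^sub>n = H\<^bsub>n+1\<^esub>\<close>.  Hence \<open>h v = 0\<close>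
  (\<open>contra_hom_trivial\<close>).  A map \<open>\<phi>\<close> on the kernel of \<open>P(U) \<rightarrow> U\<close> is extended to \<open>P(U)\<close> by the
  telescoping series \<open>p \<mapsto> \<phi>(p - v \<rho>\<^sub>n) + \<Sum> \<phi>(v \<rho>\<^sub>k - v \<rho>\<^bsub>k+1\<^esub>)\<close>, where \<open>v\<close> is the image of \<open>p\<close>
  (\<open>contra_syzygy_maps_extend\<close>); this is the vanishing of \<open>Ext\<^sup>1(U, C)\<close>.

  Linear maps between contramodules are homomorphisms by the uniqueness of linear extensions
  (\<open>contra_hom_eq_mod_hom\<close>), and the perpendicular category is closed under extensions by the long
  exact sequence of \<open>Ext\<close> (\<open>perpendicular_extension\<close>).
\<close>

section \<open>Linear maps and free modules\<close>

text \<open>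
  \<open>mod_hom\<close> without extensionality, which the composition of functions does not preserve.
\<close>

definition linear_map :: "'r ring \<Rightarrow> ('r, 'm) module \<Rightarrow> ('r, 'n) module \<Rightarrow> ('m \<Rightarrow> 'n) \<Rightarrow> bool" where
  "linear_map R M N f \<longleftrightarrow> f \<in> carrier M \<rightarrow> carrier N \<and>
     (\<forall>x \<in> carrier M. \<forall>y \<in> carrier M. f (x \<oplus>\<^bsub>M\<^esub> y) = f x \<oplus>\<^bsub>N\<^esub> f y) \<and>
     (\<forall>r \<in> carrier R. \<forall>x \<in> carrier M. f (r \<odot>\<^bsub>M\<^esub> x) = r \<odot>\<^bsub>N\<^esub> f x)"

lemma mod_hom_iff: "f \<in> mod_hom R M N \<longleftrightarrow> linear_map R M N f \<and> f \<in> extensional (carrier M)"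
  by (auto simp: mod_hom_def linear_map_def PiE_def)

lemma (in abelian_group) diff_eq_zero_iff:
  assumes "a \<in> carrier G" "b \<in> carrier G"
  shows "a \<ominus> b = \<zero> \<longleftrightarrow> a = b"
proof
  assume "a \<ominus> b = \<zero>"
  then have "\<ominus> (\<ominus> b) = a" using assms by (intro minus_equality) (auto simp: a_minus_def)
  then show "a = b" using assms by simp
qed (use assms in \<open>simp add: a_minus_def r_neg\<close>)

lemma (in abelian_group) add_diff_left:
  "a \<in> carrier G \<Longrightarrow> b \<in> carrier G \<Longrightarrow> (a \<oplus> b) \<ominus> a = b"
  by (simp add: a_minus_def a_comm r_neg1)

lemma linear_mapI:
  assumes "\<And>x. x \<in> carrier M \<Longrightarrow> f x \<in> carrier N"
    and "\<And>x y. x \<in> carrier M \<Longrightarrow> y \<in> carrier M \<Longrightarrow> f (x \<oplus>\<^bsub>M\<^esub> y) = f x \<oplus>\<^bsub>N\<^esub> f y"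
    and "\<And>r x. r \<in> carrier R \<Longrightarrow> x \<in> carrier M \<Longrightarrow> f (r \<odot>\<^bsub>M\<^esub> x) = r \<odot>\<^bsub>N\<^esub> f x"
  shows "linear_map R M N f"
  using assms by (auto simp: linear_map_def)

lemma linear_map_closed: "linear_map R M N f \<Longrightarrow> x \<in> carrier M \<Longrightarrow> f x \<in> carrier N"
  by (auto simp: linear_map_def)

lemma linear_map_add: "linear_map R M N f \<Longrightarrow> x \<in> carrier M \<Longrightarrow> y \<in> carrier M \<Longrightarrow>
    f (x \<oplus>\<^bsub>M\<^esub> y) = f x \<oplus>\<^bsub>N\<^esub> f y"
  by (auto simp: linear_map_def)

lemma linear_map_smult: "linear_map R M N f \<Longrightarrow> r \<in> carrier R \<Longrightarrow> x \<in> carrier M \<Longrightarrow>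
    f (r \<odot>\<^bsub>M\<^esub> x) = r \<odot>\<^bsub>N\<^esub> f x"
  by (auto simp: linear_map_def)

lemma linear_map_cong:
  assumes "linear_map R M N f" "\<And>x. x \<in> carrier M \<Longrightarrow> g x = f x" "left_module R M"
  shows "linear_map R M N g"
proof -
  interpret M: left_module R M by fact
  show ?thesis
    using assms(1,2) by (auto simp: linear_map_def M.lsmult_closed)
qed

lemma linear_map_comp:
  "linear_map R M N f \<Longrightarrow> linear_map R N L g \<Longrightarrow> linear_map R M L (\<lambda>x. g (f x))"
  by (auto simp: linear_map_def Pi_def)

context
  fixes R :: "'r ring" and M :: "('r, 'm) module" and N :: "('r, 'n) module" and f
  assumes M: "left_module R M" and N: "left_module R N" and f: "linear_map R M N f"
begin

interpretation M: left_module R M by (fact M)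
interpretation N: left_module R N by (fact N)

lemma linear_map_zero: "f \<zero>\<^bsub>M\<^esub> = \<zero>\<^bsub>N\<^esub>"
proof -
  have "f \<zero>\<^bsub>M\<^esub> \<oplus>\<^bsub>N\<^esub> f \<zero>\<^bsub>M\<^esub> = f \<zero>\<^bsub>M\<^esub>"
    using linear_map_add[OF f M.M.zero_closed M.M.zero_closed] by simp
  then show ?thesis
    using linear_map_closed[OF f] N.M.add.l_cancel_one by blast
qed

lemma linear_map_neg:
  assumes "x \<in> carrier M" shows "f (\<ominus>\<^bsub>M\<^esub> x) = \<ominus>\<^bsub>N\<^esub> f x"
proof -
  have "f (\<ominus>\<^bsub>M\<^esub> x) \<oplus>\<^bsub>N\<^esub> f x = \<zero>\<^bsub>N\<^esub>"
    using linear_map_add[OF f _ assms, of "\<ominus>\<^bsub>M\<^esub> x"] assms linear_map_zero by (simp add: M.M.l_neg)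
  then show ?thesis
    using assms linear_map_closed[OF f] by (simp add: N.M.minus_equality)
qed

lemma linear_map_diff:
  assumes "x \<in> carrier M" "y \<in> carrier M" shows "f (x \<ominus>\<^bsub>M\<^esub> y) = f x \<ominus>\<^bsub>N\<^esub> f y"
  using assms by (simp add: a_minus_def linear_map_add[OF f] linear_map_neg)

end

lemma left_module_smult_zero:
  assumes "left_module R M"
  shows "x \<in> carrier M \<Longrightarrow> \<zero>\<^bsub>R\<^esub> \<odot>\<^bsub>M\<^esub> x = \<zero>\<^bsub>M\<^esub>"
    and "r \<in> carrier R \<Longrightarrow> r \<odot>\<^bsub>M\<^esub> \<zero>\<^bsub>M\<^esub> = \<zero>\<^bsub>M\<^esub>"
proof -
  interpret left_module R M by fact
  show "\<zero>\<^bsub>R\<^esub> \<odot>\<^bsub>M\<^esub> x = \<zero>\<^bsub>M\<^esub>" if x: "x \<in> carrier M"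
  proof -
    have "\<zero>\<^bsub>R\<^esub> \<odot>\<^bsub>M\<^esub> x \<oplus>\<^bsub>M\<^esub> \<zero>\<^bsub>R\<^esub> \<odot>\<^bsub>M\<^esub> x = \<zero>\<^bsub>R\<^esub> \<odot>\<^bsub>M\<^esub> x"
      using lsmult_l_distr[OF R.zero_closed R.zero_closed x] by simp
    then show ?thesis using x by (simp add: lsmult_closed)
  qed
  show "r \<odot>\<^bsub>M\<^esub> \<zero>\<^bsub>M\<^esub> = \<zero>\<^bsub>M\<^esub>" if r: "r \<in> carrier R"
  proof -
    have "r \<odot>\<^bsub>M\<^esub> \<zero>\<^bsub>M\<^esub> \<oplus>\<^bsub>M\<^esub> r \<odot>\<^bsub>M\<^esub> \<zero>\<^bsub>M\<^esub> = r \<odot>\<^bsub>M\<^esub> \<zero>\<^bsub>M\<^esub>"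
      using lsmult_r_distr[OF r M.zero_closed M.zero_closed] by simp
    then show ?thesis using r by (simp add: lsmult_closed)
  qed
qed

text \<open>
  The axioms of a module are equations, hence pass to the image of a linear map.  This is how the
  operations on a contramodule will be recognised as those of a module.
\<close>

lemma left_module_image:
  assumes L: "left_module R L" and f: "linear_map R L M f" and surj: "f ` carrier L = carrier M"
    and z: "f \<zero>\<^bsub>L\<^esub> = \<zero>\<^bsub>M\<^esub>"
  shows "left_module R M"
proof -
  interpret L: left_module R L by fact
  have pre: "\<exists>x \<in> carrier L. m = f x" if "m \<in> carrier M" for m
    using that surj by auto
  note ops = linear_map_add[OF f, symmetric] linear_map_smult[OF f, symmetric]
  note cl = linear_map_closed[OF f] L.lsmult_closed
  have "abelian_group M"
  proof (rule abelian_groupI)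
    fix x y assume "x \<in> carrier M" "y \<in> carrier M"
    then obtain x' y' where "x' \<in> carrier L" "y' \<in> carrier L" "x = f x'" "y = f y'"
      using pre by meson
    then show "x \<oplus>\<^bsub>M\<^esub> y \<in> carrier M" "x \<oplus>\<^bsub>M\<^esub> y = y \<oplus>\<^bsub>M\<^esub> x"
      by (simp_all add: cl ops L.M.add.m_comm)
  next
    show "\<zero>\<^bsub>M\<^esub> \<in> carrier M" using z surj L.M.zero_closed by (metis imageI)
  next
    fix x y w assume "x \<in> carrier M" "y \<in> carrier M" "w \<in> carrier M"
    then obtain x' y' w' where "x' \<in> carrier L" "y' \<in> carrier L" "w' \<in> carrier L"
        "x = f x'" "y = f y'" "w = f w'"
      using pre by meson
    then show "x \<oplus>\<^bsub>M\<^esub> y \<oplus>\<^bsub>M\<^esub> w = x \<oplus>\<^bsub>M\<^esub> (y \<oplus>\<^bsub>M\<^esub> w)"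
      by (simp add: ops L.M.a_assoc)
  next
    fix x assume "x \<in> carrier M"
    then obtain x' where x': "x' \<in> carrier L" "x = f x'"
      using pre by meson
    then show "\<zero>\<^bsub>M\<^esub> \<oplus>\<^bsub>M\<^esub> x = x"
      by (simp add: ops z[symmetric])
    have "f (\<ominus>\<^bsub>L\<^esub> x') \<oplus>\<^bsub>M\<^esub> x = \<zero>\<^bsub>M\<^esub>"
      using x' z by (simp add: ops L.M.l_neg)
    then show "\<exists>y\<in>carrier M. y \<oplus>\<^bsub>M\<^esub> x = \<zero>\<^bsub>M\<^esub>"
      using linear_map_closed[OF f] x' by blast
  qed
  moreover have "left_module_axioms R M"
  proof
    fix m assume "m \<in> carrier M"
    then obtain x where x: "x \<in> carrier L" "m = f x" using pre by meson
    show "\<one>\<^bsub>R\<^esub> \<odot>\<^bsub>M\<^esub> m = m"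
      using x by (simp add: ops L.lsmult_one)
    fix r assume r: "r \<in> carrier R"
    show "r \<odot>\<^bsub>M\<^esub> m \<in> carrier M"
      using x r by (simp add: ops cl)
    fix s assume s: "s \<in> carrier R"
    show "(r \<oplus>\<^bsub>R\<^esub> s) \<odot>\<^bsub>M\<^esub> m = r \<odot>\<^bsub>M\<^esub> m \<oplus>\<^bsub>M\<^esub> s \<odot>\<^bsub>M\<^esub> m"
      using x r s by (simp add: ops cl L.lsmult_l_distr)
    show "(r \<otimes>\<^bsub>R\<^esub> s) \<odot>\<^bsub>M\<^esub> m = r \<odot>\<^bsub>M\<^esub> (s \<odot>\<^bsub>M\<^esub> m)"
      using x r s by (simp add: ops cl L.lsmult_assoc)
  next
    fix r m n assume r: "r \<in> carrier R" and "m \<in> carrier M" "n \<in> carrier M"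
    then obtain x y where "x \<in> carrier L" "m = f x" "y \<in> carrier L" "n = f y"
      using pre by meson
    then show "r \<odot>\<^bsub>M\<^esub> (m \<oplus>\<^bsub>M\<^esub> n) = r \<odot>\<^bsub>M\<^esub> m \<oplus>\<^bsub>M\<^esub> r \<odot>\<^bsub>M\<^esub> n"
      using r by (simp add: ops cl L.lsmult_r_distr)
  qed
  ultimately show ?thesis by (simp add: left_module_def L.R.ring_axioms)
qed

lemma free_module_carrier:
  "p \<in> carrier (free_module R X) \<longleftrightarrow>
     p \<in> X \<rightarrow>\<^sub>E carrier R \<and> finite {x \<in> X. p x \<noteq> \<zero>\<^bsub>R\<^esub>}"
  by (simp add: free_module_def)

lemma free_module_closed: "p \<in> carrier (free_module R X) \<Longrightarrow> x \<in> X \<Longrightarrow> p x \<in> carrier R"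
  by (auto simp: free_module_def)

lemma free_module_finite: "p \<in> carrier (free_module R X) \<Longrightarrow> finite {x \<in> X. p x \<noteq> \<zero>\<^bsub>R\<^esub>}"
  by (auto simp: free_module_def)

lemma free_module_ext:
  "p \<in> carrier (free_module R X) \<Longrightarrow> q \<in> carrier (free_module R X) \<Longrightarrow>
     (\<And>x. x \<in> X \<Longrightarrow> p x = q x) \<Longrightarrow> p = q"
  by (auto simp: free_module_def intro: PiE_ext)

lemma free_module_apply:
  "x \<in> X \<Longrightarrow> (p \<oplus>\<^bsub>free_module R X\<^esub> q) x = p x \<oplus>\<^bsub>R\<^esub> q x"
  "x \<in> X \<Longrightarrow> (r \<odot>\<^bsub>free_module R X\<^esub> p) x = r \<otimes>\<^bsub>R\<^esub> p x"
  "x \<in> X \<Longrightarrow> \<zero>\<^bsub>free_module R X\<^esub> x = \<zero>\<^bsub>R\<^esub>"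
  by (simp_all add: free_module_def)

text \<open>
  Facts about free modules belong to this copy of \<open>ring\<close>, so that they are inherited exactly
  where it is interpreted.
\<close>

locale plain_ring = ring R for R :: "'r ring" (structure)

sublocale left_module \<subseteq> R?: plain_ring R
  by unfold_locales

context plain_ring
begin

lemma free_module_add_closed:
  assumes "p \<in> carrier (free_module R X)" "q \<in> carrier (free_module R X)"
  shows "p \<oplus>\<^bsub>free_module R X\<^esub> q \<in> carrier (free_module R X)"
proof -
  have "finite {x \<in> X. p x \<oplus> q x \<noteq> \<zero>}"
    by (rule finite_subset[OF _ finite_UnI[OF free_module_finite[OF assms(1)] free_module_finite[OF assms(2)]]])
      auto
  then show ?thesis
    using assms by (auto simp: free_module_def cong: conj_cong)
qed

lemma free_module_smult_closed:
  assumes "r \<in> carrier R" "p \<in> carrier (free_module R X)"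
  shows "r \<odot>\<^bsub>free_module R X\<^esub> p \<in> carrier (free_module R X)"
proof -
  have "finite {x \<in> X. r \<otimes> p x \<noteq> \<zero>}"
    by (rule finite_subset[OF _ free_module_finite[OF assms(2)]]) (use assms in auto)
  then show ?thesis
    using assms by (auto simp: free_module_def cong: conj_cong)
qed

lemma free_module_left_module: "left_module R (free_module R X)"
proof -
  let ?F = "free_module R X"
  have zero: "\<zero>\<^bsub>?F\<^esub> \<in> carrier ?F"
    by (auto simp: free_module_def cong: conj_cong)
  have "abelian_group ?F"
  proof (rule abelian_groupI)
    fix p assume p: "p \<in> carrier ?F"
    have neg: "(\<ominus> \<one>) \<odot>\<^bsub>?F\<^esub> p \<in> carrier ?F" by (rule free_module_smult_closed) (use p in auto)
    moreover have "(\<ominus> \<one>) \<odot>\<^bsub>?F\<^esub> p \<oplus>\<^bsub>?F\<^esub> p = \<zero>\<^bsub>?F\<^esub>"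
      by (rule free_module_ext[OF free_module_add_closed[OF neg p] zero])
        (use free_module_closed[OF p] in \<open>simp add: free_module_apply l_minus l_neg\<close>)
    ultimately show "\<exists>y\<in>carrier ?F. y \<oplus>\<^bsub>?F\<^esub> p = \<zero>\<^bsub>?F\<^esub>" by blast
  qed (auto simp: zero free_module_add_closed free_module_apply free_module_closed a_ac
        intro!: free_module_ext[where R = R and X = X])
  moreover have "left_module_axioms R ?F"
    by standard (auto simp: free_module_smult_closed free_module_add_closed free_module_apply
        free_module_closed l_distr r_distr m_assoc intro!: free_module_ext[where R = R and X = X])
  ultimately show ?thesis by (simp add: left_module_def ring_axioms)
qed

lemma free_module_minus_apply:
  assumes "p \<in> carrier (free_module R X)" "q \<in> carrier (free_module R X)" "x \<in> X"
  shows "(\<ominus>\<^bsub>free_module R X\<^esub> p) x = \<ominus> p x"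
    and "(p \<ominus>\<^bsub>free_module R X\<^esub> q) x = p x \<ominus> q x"
proof -
  interpret F: left_module R "free_module R X" by (rule free_module_left_module)
  have neg: "(\<ominus>\<^bsub>free_module R X\<^esub> q) x = \<ominus> q x" if q: "q \<in> carrier (free_module R X)" for q
  proof -
    have "(\<ominus>\<^bsub>free_module R X\<^esub> q) x \<oplus> q x = \<zero>"
      using F.M.l_neg[OF q] assms(3) by (metis free_module_apply(1,3))
    then show ?thesis
      using q assms(3) free_module_closed by (metis F.M.a_inv_closed minus_equality)
  qed
  show "(\<ominus>\<^bsub>free_module R X\<^esub> p) x = \<ominus> p x" by (rule neg) fact
  show "(p \<ominus>\<^bsub>free_module R X\<^esub> q) x = p x \<ominus> q x"
    using assms by (simp add: a_minus_def free_module_apply neg)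
qed

lemma formal_single_closed:
  "r \<in> carrier R \<Longrightarrow> formal_single R X r x \<in> carrier (free_module R X)"
proof -
  assume "r \<in> carrier R"
  moreover have "finite {z \<in> X. formal_single R X r x z \<noteq> \<zero>}"
    by (rule finite_subset[of _ "{x}"]) (auto simp: formal_single_def)
  ultimately show ?thesis by (auto simp: free_module_carrier formal_single_def)
qed

lemma formal_single_smult:
  "r \<in> carrier R \<Longrightarrow> s \<in> carrier R \<Longrightarrow>
     r \<odot>\<^bsub>free_module R X\<^esub> formal_single R X s x = formal_single R X (r \<otimes> s) x"
  by (rule free_module_ext[where R = R and X = X])
    (auto simp: free_module_smult_closed formal_single_closed free_module_apply,
     auto simp: formal_single_def)

lemma free_module_induct [consumes 1, case_names zero step]:
  assumes p: "p \<in> carrier (free_module R X)"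
    and zero: "P (\<zero>\<^bsub>free_module R X\<^esub>)"
    and step: "\<And>p r x. p \<in> carrier (free_module R X) \<Longrightarrow> r \<in> carrier R \<Longrightarrow> x \<in> X \<Longrightarrow> P p \<Longrightarrow>
      P (formal_single R X r x \<oplus>\<^bsub>free_module R X\<^esub> p)"
  shows "P p"
proof -
  interpret F: left_module R "free_module R X" by (rule free_module_left_module)
  have "finite F \<Longrightarrow> p \<in> carrier (free_module R X) \<Longrightarrow> {x \<in> X. p x \<noteq> \<zero>} \<subseteq> F \<Longrightarrow> P p" for F p
  proof (induction F arbitrary: p rule: finite_induct)
    case empty
    then have "p = \<zero>\<^bsub>free_module R X\<^esub>"
      by (intro free_module_ext) (auto simp: free_module_apply)
    then show ?case using zero by simp
  next
    case (insert x F)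
    define q where "q = (\<lambda>z \<in> X. if z = x then \<zero> else p z)"
    have "finite {z \<in> X. q z \<noteq> \<zero>}"
      by (rule finite_subset[OF _ free_module_finite[OF insert.prems(1)]]) (auto simp: q_def)
    then have q: "q \<in> carrier (free_module R X)"
      using free_module_closed[OF insert.prems(1)] by (auto simp: free_module_carrier q_def)
    show ?case
    proof (cases "x \<in> X")
      case True
      have px: "p x \<in> carrier R" using free_module_closed[OF insert.prems(1) True] .
      have eq: "p = formal_single R X (p x) x \<oplus>\<^bsub>free_module R X\<^esub> q"
        by (rule free_module_ext[OF insert.prems(1)])
          (use free_module_closed[OF insert.prems(1)] px in
            \<open>auto simp: free_module_add_closed formal_single_closed q free_module_apply\<close>,
           auto simp: formal_single_def q_def)
      have "P q" by (rule insert.IH[OF q]) (use insert.prems in \<open>auto simp: q_def\<close>)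
      from step[OF q px True this] show ?thesis using eq by simp
    next
      case False
      then show ?thesis using insert by blast
    qed
  qed
  from this[OF free_module_finite[OF p] p] show ?thesis by blast
qed

lemma linear_map_eq_on_basis:
  assumes M: "left_module R M" and f: "linear_map R (free_module R X) M f"
    and g: "linear_map R (free_module R X) M g"
    and eq: "\<And>x. x \<in> X \<Longrightarrow> f (formal_single R X \<one> x) = g (formal_single R X \<one> x)"
    and p: "p \<in> carrier (free_module R X)"
  shows "f p = g p"
  using p
proof (induction rule: free_module_induct)
  case zero
  show ?case using linear_map_zero[OF free_module_left_module M] f g by metis
next
  case (step p r x)
  have "h (formal_single R X r x) = r \<odot>\<^bsub>M\<^esub> h (formal_single R X \<one> x)"
    if "linear_map R (free_module R X) M h" for h
    using linear_map_smult[OF that step(2) formal_single_closed[OF one_closed]] step(2)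
    by (simp add: formal_single_smult)
  note this[OF f] this[OF g]
  with step show ?case
    by (simp add: linear_map_add[OF f] linear_map_add[OF g] formal_single_closed f g eq)
qed

end

text \<open>
  The linear map from the free module on \<open>X\<close> that takes the basis element \<open>x\<close> to \<open>g x\<close>.
\<close>

definition lin_ext :: "'r ring \<Rightarrow> ('r, 'm) module \<Rightarrow> 'x set \<Rightarrow> ('x \<Rightarrow> 'm) \<Rightarrow> ('x \<Rightarrow> 'r) \<Rightarrow> 'm" where
  "lin_ext R M X g p = finsum M (\<lambda>x. p x \<odot>\<^bsub>M\<^esub> g x) {x \<in> X. p x \<noteq> \<zero>\<^bsub>R\<^esub>}"

lemma free_cover_eq_lin_ext: "free_cover R M = lin_ext R M (carrier M) (\<lambda>x. x)"
  by (simp add: fun_eq_iff free_cover_def lin_ext_def)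

context left_module
begin

lemma lin_ext_over:
  assumes "p \<in> carrier (free_module R X)" "g \<in> X \<rightarrow> carrier M"
    and "finite F" "F \<subseteq> X" "{x \<in> X. p x \<noteq> \<zero>\<^bsub>R\<^esub>} \<subseteq> F"
  shows "lin_ext R M X g p = finsum M (\<lambda>x. p x \<odot>\<^bsub>M\<^esub> g x) F"
  unfolding lin_ext_def
  by (rule M.add.finprod_mono_neutral_cong_left)
    (use assms left_module_smult_zero[OF left_module_axioms] free_module_closed[OF assms(1)]
      in \<open>auto simp: Pi_def lsmult_closed subset_iff\<close>)

lemma lin_ext_linear:
  assumes g: "g \<in> X \<rightarrow> carrier M"
  shows "linear_map R (free_module R X) M (lin_ext R M X g)"
proof (rule linear_mapI)
  fix p assume p: "p \<in> carrier (free_module R X)"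
  show "lin_ext R M X g p \<in> carrier M"
    using p g unfolding lin_ext_def
    by (intro M.finsum_closed) (auto simp: free_module_closed Pi_def lsmult_closed)
next
  fix p q assume p: "p \<in> carrier (free_module R X)" and q: "q \<in> carrier (free_module R X)"
  let ?F = "{x \<in> X. p x \<noteq> \<zero>\<^bsub>R\<^esub>} \<union> {x \<in> X. q x \<noteq> \<zero>\<^bsub>R\<^esub>}"
  have F: "finite ?F" "?F \<subseteq> X" using free_module_finite p q by auto
  have *: "finsum M (\<lambda>x. (p \<oplus>\<^bsub>free_module R X\<^esub> q) x \<odot>\<^bsub>M\<^esub> g x) ?F
      = finsum M (\<lambda>x. p x \<odot>\<^bsub>M\<^esub> g x \<oplus>\<^bsub>M\<^esub> q x \<odot>\<^bsub>M\<^esub> g x) ?F"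
    by (rule M.add.finprod_cong')
      (use p q g F in \<open>auto simp: free_module_apply free_module_closed Pi_def lsmult_closed lsmult_l_distr\<close>)
  show "lin_ext R M X g (p \<oplus>\<^bsub>free_module R X\<^esub> q) = lin_ext R M X g p \<oplus>\<^bsub>M\<^esub> lin_ext R M X g q"
    using p q g F
    by (simp add: lin_ext_over[where F = ?F] R.free_module_add_closed *)
      (subst lin_ext_over[where F = ?F], auto simp: free_module_apply R.free_module_add_closed *
        free_module_closed Pi_def lsmult_closed intro!: M.finsum_addf)
next
  fix r p assume r: "r \<in> carrier R" and p: "p \<in> carrier (free_module R X)"
  let ?F = "{x \<in> X. p x \<noteq> \<zero>\<^bsub>R\<^esub>}"
  have F: "finite ?F" "?F \<subseteq> X" using free_module_finite p by auto
  have cl: "(\<lambda>x. p x \<odot>\<^bsub>M\<^esub> g x) \<in> ?F \<rightarrow> carrier M"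
    using p g by (auto simp: free_module_closed Pi_def lsmult_closed)
  have sm: "r \<odot>\<^bsub>M\<^esub> finsum M h F = finsum M (\<lambda>x. r \<odot>\<^bsub>M\<^esub> h x) F"
    if "finite F" "h \<in> F \<rightarrow> carrier M" for h and F :: "'c set"
    using that
  proof (induction F)
    case empty then show ?case by (simp add: left_module_smult_zero[OF left_module_axioms] r)
  next
    case (insert x F)
    have "(\<lambda>x. r \<odot>\<^bsub>M\<^esub> h x) \<in> F \<rightarrow> carrier M" "r \<odot>\<^bsub>M\<^esub> h x \<in> carrier M"
      using insert.prems r by (auto simp: Pi_def lsmult_closed)
    then show ?case using insert r by (simp add: Pi_def lsmult_r_distr)
  qed
  have "lin_ext R M X g (r \<odot>\<^bsub>free_module R X\<^esub> p)
      = finsum M (\<lambda>x. (r \<odot>\<^bsub>free_module R X\<^esub> p) x \<odot>\<^bsub>M\<^esub> g x) ?F"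
    by (rule lin_ext_over) (use p r g F in \<open>auto simp: free_module_apply R.free_module_smult_closed\<close>)
  also have "\<dots> = finsum M (\<lambda>x. r \<odot>\<^bsub>M\<^esub> (p x \<odot>\<^bsub>M\<^esub> g x)) ?F"
    by (rule M.add.finprod_cong')
      (use p r g F in \<open>auto simp: free_module_apply free_module_closed Pi_def lsmult_closed lsmult_assoc\<close>)
  also have "\<dots> = r \<odot>\<^bsub>M\<^esub> lin_ext R M X g p"
    unfolding lin_ext_def using sm[OF F(1) cl] by simp
  finally show "lin_ext R M X g (r \<odot>\<^bsub>free_module R X\<^esub> p) = r \<odot>\<^bsub>M\<^esub> lin_ext R M X g p" .
qed

lemma lin_ext_single:
  assumes g: "g \<in> X \<rightarrow> carrier M" and r: "r \<in> carrier R" and x: "x \<in> X"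
  shows "lin_ext R M X g (formal_single R X r x) = r \<odot>\<^bsub>M\<^esub> g x"
proof -
  have "lin_ext R M X g (formal_single R X r x)
      = finsum M (\<lambda>z. formal_single R X r x z \<odot>\<^bsub>M\<^esub> g z) {x}"
    by (rule lin_ext_over)
      (use g r x in \<open>auto simp: R.formal_single_closed, auto simp: formal_single_def split: if_splits\<close>)
  also have "\<dots> = r \<odot>\<^bsub>M\<^esub> g x"
    using g r x by (simp add: Pi_def lsmult_closed formal_single_def)
  finally show ?thesis .
qed

lemma lin_ext_basis:
  assumes g: "g \<in> X \<rightarrow> carrier M" and x: "x \<in> X"
  shows "lin_ext R M X g (formal_single R X \<one>\<^bsub>R\<^esub> x) = g x"
  using lin_ext_single[OF g R.one_closed x] g x by (auto simp: lsmult_one Pi_def)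

lemma linear_map_eq_lin_ext:
  assumes f: "linear_map R (free_module R X) M f"
    and g: "\<And>x. x \<in> X \<Longrightarrow> f (formal_single R X \<one>\<^bsub>R\<^esub> x) = g x"
    and p: "p \<in> carrier (free_module R X)"
  shows "f p = lin_ext R M X g p"
proof -
  have gc: "g \<in> X \<rightarrow> carrier M"
    using linear_map_closed[OF f R.formal_single_closed[OF R.one_closed]] g by (metis Pi_I)
  show ?thesis
    by (rule R.linear_map_eq_on_basis[OF left_module_axioms f lin_ext_linear[OF gc]])
      (auto simp: lin_ext_basis[OF gc] g p)
qed

lemma linear_map_lin_ext:
  assumes N: "left_module R N" and f: "linear_map R M N f" and g: "g \<in> X \<rightarrow> carrier M"
    and p: "p \<in> carrier (free_module R X)"
  shows "f (lin_ext R M X g p) = lin_ext R N X (\<lambda>x. f (g x)) p"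
proof -
  interpret N: left_module R N by fact
  show ?thesis
    by (rule N.linear_map_eq_lin_ext[OF linear_map_comp[OF lin_ext_linear[OF g] f] _ p])
      (simp add: lin_ext_basis[OF g])
qed

lemma free_cover_linear: "linear_map R (free_module R (carrier M)) M (free_cover R M)"
  unfolding free_cover_eq_lin_ext by (rule lin_ext_linear) auto

lemma free_cover_basis:
  "x \<in> carrier M \<Longrightarrow> free_cover R M (formal_single R (carrier M) \<one>\<^bsub>R\<^esub> x) = x"
  unfolding free_cover_eq_lin_ext by (rule lin_ext_basis) auto

end

section \<open>Vanishing of Hom and of the first extension group\<close>

definition hom_trivial :: "'r ring \<Rightarrow> ('r, 'm) module \<Rightarrow> ('r, 'c) module \<Rightarrow> bool" where
  "hom_trivial R M C \<longleftrightarrow> (\<forall>h. linear_map R M C h \<longrightarrow> (\<forall>x \<in> carrier M. h x = \<zero>\<^bsub>C\<^esub>))"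

text \<open>
  For the canonical presentation \<open>0 \<rightarrow> K \<rightarrow> P \<rightarrow> M \<rightarrow> 0\<close> with \<open>P\<close> free, \<open>Ext\<^sup>1(M, C)\<close> is the cokernel
  of the restriction \<open>Hom(P, C) \<rightarrow> Hom(K, C)\<close>; the predicate says that the latter is surjective.
\<close>

definition syzygy_maps_extend :: "'r ring \<Rightarrow> ('r, 'm) module \<Rightarrow> ('r, 'c) module \<Rightarrow> bool" where
  "syzygy_maps_extend R M C \<longleftrightarrow> (\<forall>\<phi>. linear_map R (syzygy R M) C \<phi> \<longrightarrow>
     (\<exists>g. linear_map R (free_module R (carrier M)) C g \<and> (\<forall>p \<in> carrier (syzygy R M). g p = \<phi> p)))"

lemma syzygy_simps:
  "p \<in> carrier (syzygy R M) \<longleftrightarrow>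
     p \<in> carrier (free_module R (carrier M)) \<and> free_cover R M p = \<zero>\<^bsub>M\<^esub>"
  "p \<oplus>\<^bsub>syzygy R M\<^esub> q = p \<oplus>\<^bsub>free_module R (carrier M)\<^esub> q"
  "r \<odot>\<^bsub>syzygy R M\<^esub> p = r \<odot>\<^bsub>free_module R (carrier M)\<^esub> p"
  "\<zero>\<^bsub>syzygy R M\<^esub> = \<zero>\<^bsub>free_module R (carrier M)\<^esub>"
  by (auto simp: syzygy_def)

lemma syzygy_left_module:
  assumes "left_module R M"
  shows "left_module R (syzygy R M)"
proof -
  interpret left_module R M by fact
  interpret F: left_module R "free_module R (carrier M)" by (rule R.free_module_left_module)
  note cover = free_cover_linear
  note cov = linear_map_add[OF cover] linear_map_smult[OF cover]
    linear_map_zero[OF F.left_module_axioms left_module_axioms cover]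
    linear_map_neg[OF F.left_module_axioms left_module_axioms cover]
  have "abelian_group (syzygy R M)"
  proof (rule abelian_groupI)
    fix p assume p: "p \<in> carrier (syzygy R M)"
    have "\<ominus>\<^bsub>free_module R (carrier M)\<^esub> p \<in> carrier (syzygy R M)"
      using p by (simp add: syzygy_simps cov)
    moreover have "\<ominus>\<^bsub>free_module R (carrier M)\<^esub> p \<oplus>\<^bsub>syzygy R M\<^esub> p = \<zero>\<^bsub>syzygy R M\<^esub>"
      using p by (simp add: syzygy_simps F.M.l_neg)
    ultimately show "\<exists>q\<in>carrier (syzygy R M). q \<oplus>\<^bsub>syzygy R M\<^esub> p = \<zero>\<^bsub>syzygy R M\<^esub>" by blast
  qed (auto simp: syzygy_simps cov F.M.a_ac)
  moreover have "left_module_axioms R (syzygy R M)"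
    by standard (auto simp: syzygy_simps cov F.lsmult_closed F.lsmult_l_distr F.lsmult_r_distr
        F.lsmult_assoc F.lsmult_one left_module_smult_zero[OF left_module_axioms])
  ultimately show ?thesis by (simp add: left_module_def R.ring_axioms)
qed

lemma trivial_group_singleton:
  assumes "carrier G = {\<one>\<^bsub>G\<^esub>}" "\<one>\<^bsub>G\<^esub> \<otimes>\<^bsub>G\<^esub> \<one>\<^bsub>G\<^esub> = \<one>\<^bsub>G\<^esub>"
  shows "trivial_group G"
proof -
  have "group G" by (rule groupI) (use assms in auto)
  then show ?thesis using assms by (simp add: trivial_group_def)
qed

lemma zero_linear_map:
  assumes "left_module R C"
  shows "linear_map R M C (\<lambda>x. \<zero>\<^bsub>C\<^esub>)"
proof -
  interpret left_module R C by fact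
  show ?thesis by (rule linear_mapI) (auto simp: left_module_smult_zero[OF assms])
qed

lemma linear_map_sum:
  assumes N: "left_module R N" and f: "linear_map R M N f" and g: "linear_map R M N g"
  shows "linear_map R M N (\<lambda>x. f x \<oplus>\<^bsub>N\<^esub> g x)"
proof -
  interpret N: left_module R N by fact
  show ?thesis
    by (rule linear_mapI)
      (simp_all add: linear_map_closed[OF f] linear_map_closed[OF g] linear_map_add[OF f] linear_map_add[OF g]
        linear_map_smult[OF f] linear_map_smult[OF g] N.lsmult_r_distr N.M.a_ac)
qed

lemma linear_map_uminus:
  assumes N: "left_module R N" and f: "linear_map R M N f"
  shows "linear_map R M N (\<lambda>x. \<ominus>\<^bsub>N\<^esub> f x)"
proof -
  interpret N: left_module R N by fact
  have sm: "\<ominus>\<^bsub>N\<^esub> (r \<odot>\<^bsub>N\<^esub> x) = r \<odot>\<^bsub>N\<^esub> (\<ominus>\<^bsub>N\<^esub> x)" if "r \<in> carrier R" "x \<in> carrier N" for r x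
  proof (rule N.M.minus_equality)
    show "r \<odot>\<^bsub>N\<^esub> (\<ominus>\<^bsub>N\<^esub> x) \<oplus>\<^bsub>N\<^esub> r \<odot>\<^bsub>N\<^esub> x = \<zero>\<^bsub>N\<^esub>"
      using that by (simp add: N.M.l_neg left_module_smult_zero[OF N] flip: N.lsmult_r_distr)
  qed (use that in \<open>auto simp: N.lsmult_closed\<close>)
  show ?thesis
    by (rule linear_mapI)
      (simp_all add: linear_map_closed[OF f] linear_map_add[OF f] linear_map_smult[OF f] N.M.minus_add sm)
qed

lemma linear_map_difference:
  assumes N: "left_module R N" and f: "linear_map R M N f" and g: "linear_map R M N g"
  shows "linear_map R M N (\<lambda>x. f x \<ominus>\<^bsub>N\<^esub> g x)"
  unfolding a_minus_def by (rule linear_map_sum[OF N f linear_map_uminus[OF N g]])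

lemma syzygy_elements:
  assumes M: "left_module R M"
  defines "e \<equiv> formal_single R (carrier M) \<one>\<^bsub>R\<^esub>" and "P0 \<equiv> free_module R (carrier M)"
  shows "x \<in> carrier M \<Longrightarrow> y \<in> carrier M \<Longrightarrow> e (x \<oplus>\<^bsub>M\<^esub> y) \<ominus>\<^bsub>P0\<^esub> (e x \<oplus>\<^bsub>P0\<^esub> e y) \<in> carrier (syzygy R M)"
    and "r \<in> carrier R \<Longrightarrow> x \<in> carrier M \<Longrightarrow> e (r \<odot>\<^bsub>M\<^esub> x) \<ominus>\<^bsub>P0\<^esub> r \<odot>\<^bsub>P0\<^esub> e x \<in> carrier (syzygy R M)"
proof -
  interpret M: left_module R M by fact
  interpret P0: left_module R P0 unfolding P0_def by (rule M.R.free_module_left_module)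
  have e: "e x \<in> carrier P0" for x unfolding e_def P0_def by (simp add: M.R.formal_single_closed)
  have cov: "linear_map R P0 M (free_cover R M)" unfolding P0_def by (rule M.free_cover_linear)
  have ce: "free_cover R M (e x) = x" if "x \<in> carrier M" for x unfolding e_def by (rule M.free_cover_basis[OF that])
  note diff = linear_map_diff[OF P0.left_module_axioms M cov]
  show "e (x \<oplus>\<^bsub>M\<^esub> y) \<ominus>\<^bsub>P0\<^esub> (e x \<oplus>\<^bsub>P0\<^esub> e y) \<in> carrier (syzygy R M)" if "x \<in> carrier M" "y \<in> carrier M"
    using that e unfolding syzygy_simps P0_def[symmetric]
    by (simp add: diff linear_map_add[OF cov] ce M.M.diff_eq_zero_iff)
  show "e (r \<odot>\<^bsub>M\<^esub> x) \<ominus>\<^bsub>P0\<^esub> r \<odot>\<^bsub>P0\<^esub> e x \<in> carrier (syzygy R M)" if "r \<in> carrier R" "x \<in> carrier M"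
    using that e unfolding syzygy_simps P0_def[symmetric]
    by (simp add: diff linear_map_smult[OF cov] ce M.M.diff_eq_zero_iff P0.lsmult_closed M.lsmult_closed)
qed

text \<open>\<open>M\<close> is the quotient of the free module on its elements by the syzygy.\<close>

lemma linear_map_factors_through_cover:
  assumes M: "left_module R M" and N: "left_module R N"
    and f: "linear_map R (free_module R (carrier M)) N f"
    and z: "\<And>p. p \<in> carrier (syzygy R M) \<Longrightarrow> f p = \<zero>\<^bsub>N\<^esub>"
  shows "linear_map R M N (\<lambda>x. f (formal_single R (carrier M) \<one>\<^bsub>R\<^esub> x))"
proof -
  interpret M: left_module R M by fact
  interpret N: left_module R N by fact
  let ?P0 = "free_module R (carrier M)"
  interpret P0: left_module R ?P0 by (rule M.R.free_module_left_module)
  let ?e = "formal_single R (carrier M) \<one>\<^bsub>R\<^esub>"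
  have e: "?e x \<in> carrier ?P0" for x by (simp add: M.R.formal_single_closed)
  note diff = linear_map_diff[OF P0.left_module_axioms N f]
  show ?thesis
  proof (rule linear_mapI)
    fix x y assume "x \<in> carrier M" "y \<in> carrier M"
    from z[OF syzygy_elements(1)[OF M this]]
    show "f (?e (x \<oplus>\<^bsub>M\<^esub> y)) = f (?e x) \<oplus>\<^bsub>N\<^esub> f (?e y)"
      using e linear_map_closed[OF f] by (simp add: diff linear_map_add[OF f] N.M.diff_eq_zero_iff)
  next
    fix r x assume r: "r \<in> carrier R" and "x \<in> carrier M"
    from z[OF syzygy_elements(2)[OF M this]]
    show "f (?e (r \<odot>\<^bsub>M\<^esub> x)) = r \<odot>\<^bsub>N\<^esub> f (?e x)"
      using e r linear_map_closed[OF f]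
      by (simp add: diff linear_map_smult[OF f] N.M.diff_eq_zero_iff P0.lsmult_closed N.lsmult_closed)
  qed (use e linear_map_closed[OF f] in auto)
qed

lemma trivial_hom_group_iff:
  assumes M: "left_module R M" and C: "left_module R C"
  shows "trivial_group (hom_group R M C) \<longleftrightarrow> hom_trivial R M C"
proof -
  interpret C: left_module R C by fact
  define z where "z = (\<lambda>x \<in> carrier M. \<zero>\<^bsub>C\<^esub>)"
  have one: "\<one>\<^bsub>hom_group R M C\<^esub> = z" by (simp add: hom_group_def z_def)
  have z: "z \<in> mod_hom R M C"
    unfolding mod_hom_iff z_def
    by (intro conjI linear_map_cong[OF zero_linear_map[OF C] _ M]) auto
  show ?thesis
  proof
    assume "trivial_group (hom_group R M C)"
    then have eq: "mod_hom R M C = {z}"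
      by (simp add: trivial_group_def one) (simp add: hom_group_def)
    show "hom_trivial R M C"
      unfolding hom_trivial_def
    proof (intro allI impI ballI)
      fix h x assume h: "linear_map R M C h" and x: "x \<in> carrier M"
      have "restrict h (carrier M) \<in> mod_hom R M C"
        unfolding mod_hom_iff by (intro conjI linear_map_cong[OF h _ M]) auto
      then have "restrict h (carrier M) = z" using eq by simp
      then show "h x = \<zero>\<^bsub>C\<^esub>" using x by (metis restrict_apply' z_def)
    qed
  next
    assume triv: "hom_trivial R M C"
    have "h = z" if "h \<in> mod_hom R M C" for h
      using that triv unfolding mod_hom_iff hom_trivial_def z_def
      by (intro extensionalityI[of _ "carrier M"]) auto
    then have "mod_hom R M C = {z}" using z by blast
    then have "carrier (hom_group R M C) = {\<one>\<^bsub>hom_group R M C\<^esub>}"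
      unfolding one by (simp add: hom_group_def)
    moreover have "z \<otimes>\<^bsub>hom_group R M C\<^esub> z = z"
      by (auto simp: hom_group_def z_def)
    ultimately show "trivial_group (hom_group R M C)"
      using trivial_group_singleton one by metis
  qed
qed

text \<open>
  A cocycle \<open>P\<^sub>1 \<rightarrow> C\<close> vanishes on the kernel of the cover \<open>P\<^sub>1 \<rightarrow> K\<close> of the syzygy \<open>K\<close>, so it is a
  linear map \<open>K \<rightarrow> C\<close>; it is a coboundary iff this map extends to the free module containing \<open>K\<close>.
\<close>

lemma trivial_Ext1_iff:
  fixes M :: "('r, 'm) module" and C :: "('r, 'c) module"
  assumes M: "left_module R M" and C: "left_module R C"
  shows "trivial_group (Ext1 R M C) \<longleftrightarrow> syzygy_maps_extend R M C"
proof -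
  interpret M: left_module R M by fact
  interpret C: left_module R C by fact
  define K0 where "K0 = syzygy R M"
  define K1 where "K1 = syzygy R K0"
  interpret K0: left_module R K0 unfolding K0_def by (rule syzygy_left_module[OF M])
  interpret K1: left_module R K1 unfolding K1_def by (rule syzygy_left_module) unfold_locales
  define P0 where "P0 = free_module R (carrier M)"
  define P1 where "P1 = free_module R (carrier K0)"
  define P2 where "P2 = free_module R (carrier K1)"
  interpret P0: left_module R P0 unfolding P0_def by (rule M.R.free_module_left_module)
  interpret P1: left_module R P1 unfolding P1_def by (rule M.R.free_module_left_module)
  define d1 where "d1 = free_cover R K0"
  define d2 where "d2 = free_cover R K1"
  define Z where "Z = {f \<in> mod_hom R P1 C. \<forall>p \<in> carrier P2. f (d2 p) = \<zero>\<^bsub>C\<^esub>}"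
  define B where "B = {\<lambda>p \<in> carrier P1. g (d1 p) | g. g \<in> mod_hom R P0 C}"
  define H where "H = (hom_group R P1 C)\<lparr>carrier := Z\<rparr>"
  have Ext: "Ext1 R M C = H Mod B"
    unfolding Ext1_def Let_def Z_def B_def H_def P0_def P1_def P2_def d1_def d2_def K0_def K1_def ..
  have d1: "linear_map R P1 K0 d1" unfolding P1_def d1_def by (rule K0.free_cover_linear)
  have d2: "linear_map R P2 K1 d2" unfolding P2_def d2_def by (rule K1.free_cover_linear)
  let ?e = "formal_single R (carrier K0) \<one>\<^bsub>R\<^esub>"
  have e: "?e k \<in> carrier P1" for k
    unfolding P1_def by (rule M.R.formal_single_closed) simp
  have d1e: "d1 (?e k) = k" if "k \<in> carrier K0" for k
    unfolding d1_def by (rule K0.free_cover_basis[OF that])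
  have K1: "p \<in> carrier K1 \<longleftrightarrow> p \<in> carrier P1 \<and> d1 p = \<zero>\<^bsub>K0\<^esub>" for p
    unfolding K1_def P1_def d1_def by (simp add: syzygy_simps)
  have K0P0: "k \<in> carrier K0 \<Longrightarrow> k \<in> carrier P0" for k
    unfolding K0_def P0_def by (simp add: syzygy_simps)
  have K0ops: "k \<oplus>\<^bsub>K0\<^esub> l = k \<oplus>\<^bsub>P0\<^esub> l" "r \<odot>\<^bsub>K0\<^esub> k = r \<odot>\<^bsub>P0\<^esub> k" for k l r
    unfolding K0_def P0_def by (simp_all add: syzygy_simps)
  \<comment> \<open>Cocycles are exactly the maps that factor through \<open>d1\<close>.\<close>
  have factor: "f p = f (?e (d1 p))" if f: "f \<in> Z" and p: "p \<in> carrier P1" for f p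
  proof -
    have lf: "linear_map R P1 C f" and van: "\<And>q. q \<in> carrier P2 \<Longrightarrow> f (d2 q) = \<zero>\<^bsub>C\<^esub>"
      using f by (auto simp: Z_def mod_hom_iff)
    have k: "d1 p \<in> carrier K0" using linear_map_closed[OF d1 p] .
    have q: "p \<ominus>\<^bsub>P1\<^esub> ?e (d1 p) \<in> carrier K1"
      using p e k by (simp add: K1 linear_map_diff[OF P1.left_module_axioms K0.left_module_axioms d1]
          d1e K0.M.diff_eq_zero_iff)
    have "d2 (formal_single R (carrier K1) \<one>\<^bsub>R\<^esub> (p \<ominus>\<^bsub>P1\<^esub> ?e (d1 p))) = p \<ominus>\<^bsub>P1\<^esub> ?e (d1 p)"
      unfolding d2_def by (rule K1.free_cover_basis[OF q])
    then have "f (p \<ominus>\<^bsub>P1\<^esub> ?e (d1 p)) = \<zero>\<^bsub>C\<^esub>"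
      using van[of "formal_single R (carrier K1) \<one>\<^bsub>R\<^esub> (p \<ominus>\<^bsub>P1\<^esub> ?e (d1 p))"]
        M.R.formal_single_closed[OF M.R.one_closed, of "carrier K1"] unfolding P2_def by simp
    then have "f p \<ominus>\<^bsub>C\<^esub> f (?e (d1 p)) = \<zero>\<^bsub>C\<^esub>"
      using p e by (simp add: linear_map_diff[OF P1.left_module_axioms C lf])
    then show ?thesis
      using linear_map_closed[OF lf p] linear_map_closed[OF lf e] by (simp add: C.M.diff_eq_zero_iff)
  qed
  have pull: "(\<lambda>p \<in> carrier P1. \<phi> (d1 p)) \<in> Z" if \<phi>: "linear_map R K0 C \<phi>" for \<phi>
  proof -
    have lin: "linear_map R P1 C (\<lambda>p. \<phi> (d1 p))" by (rule linear_map_comp[OF d1 \<phi>])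
    have "restrict (\<lambda>p. \<phi> (d1 p)) (carrier P1) \<in> mod_hom R P1 C"
      unfolding mod_hom_iff by (intro conjI linear_map_cong[OF lin _ P1.left_module_axioms]) auto
    moreover have "d2 p \<in> carrier P1" "d1 (d2 p) = \<zero>\<^bsub>K0\<^esub>" if "p \<in> carrier P2" for p
      using linear_map_closed[OF d2 that] by (auto simp: K1)
    ultimately show ?thesis
      by (auto simp: Z_def linear_map_zero[OF K0.left_module_axioms C \<phi>])
  qed
  have BZ: "B \<subseteq> Z"
  proof
    fix f assume "f \<in> B"
    then obtain g where g: "g \<in> mod_hom R P0 C" and f: "f = (\<lambda>p \<in> carrier P1. g (d1 p))"
      by (auto simp: B_def)
    have "linear_map R K0 C g"
      using g by (auto simp: mod_hom_iff linear_map_def K0P0 K0ops)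
    from pull[OF this] show "f \<in> Z" using f by simp
  qed
  have zeroB: "(\<lambda>x \<in> carrier P1. \<zero>\<^bsub>C\<^esub>) \<in> B"
  proof -
    have "restrict (\<lambda>x. \<zero>\<^bsub>C\<^esub>) (carrier P0) \<in> mod_hom R P0 C"
      unfolding mod_hom_iff
      by (intro conjI linear_map_cong[OF zero_linear_map[OF C] _ P0.left_module_axioms]) auto
    moreover have "(\<lambda>x \<in> carrier P1. \<zero>\<^bsub>C\<^esub>) = (\<lambda>p \<in> carrier P1. restrict (\<lambda>x. \<zero>\<^bsub>C\<^esub>) (carrier P0) (d1 p))"
      using linear_map_closed[OF d1] K0P0 by (auto simp: fun_eq_iff)
    ultimately show ?thesis unfolding B_def by blast
  qed
  have mult: "f \<otimes>\<^bsub>H\<^esub> g = (\<lambda>x \<in> carrier P1. f x \<oplus>\<^bsub>C\<^esub> g x)" for f g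
    by (simp add: H_def hom_group_def)
  have zmult: "(\<lambda>x \<in> carrier P1. \<zero>\<^bsub>C\<^esub>) \<otimes>\<^bsub>H\<^esub> f = f" if "f \<in> Z" for f
    using that unfolding mult
    by (intro extensionalityI[of _ "carrier P1"]) (auto simp: Z_def mod_hom_iff linear_map_def Pi_def)
  have "trivial_group (H Mod B) \<longleftrightarrow> Z \<subseteq> B"
  proof
    assume "trivial_group (H Mod B)"
    moreover have "carrier (H Mod B) = (\<lambda>f. B #>\<^bsub>H\<^esub> f) ` Z" "\<one>\<^bsub>H Mod B\<^esub> = B"
      by (auto simp: FactGroup_def RCOSETS_def H_def)
    ultimately have cos: "(\<lambda>f. B #>\<^bsub>H\<^esub> f) ` Z = {B}"
      by (simp add: trivial_group_def)
    show "Z \<subseteq> B"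
    proof
      fix f assume f: "f \<in> Z"
      have "(\<lambda>x \<in> carrier P1. \<zero>\<^bsub>C\<^esub>) \<otimes>\<^bsub>H\<^esub> f \<in> B #>\<^bsub>H\<^esub> f"
        using zeroB by (auto simp: r_coset_def)
      then have "f \<in> B #>\<^bsub>H\<^esub> f" using zmult[OF f] by simp
      then show "f \<in> B" using cos f by blast
    qed
  next
    assume "Z \<subseteq> B"
    then have ZB: "Z = B" using BZ by simp
    have addZ: "f \<otimes>\<^bsub>H\<^esub> g \<in> Z" if "f \<in> Z" "g \<in> Z" for f g
    proof -
      have lf: "linear_map R P1 C f" and lg: "linear_map R P1 C g"
        using that by (auto simp: Z_def mod_hom_iff)
      from linear_map_sum[OF C lf lg]
      have "f \<otimes>\<^bsub>H\<^esub> g \<in> mod_hom R P1 C"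
        unfolding mod_hom_iff mult by (auto intro: linear_map_cong[OF _ _ P1.left_module_axioms])
      moreover have "d2 p \<in> carrier P1" if "p \<in> carrier P2" for p
        using linear_map_closed[OF d2 that] by (simp add: K1)
      ultimately show ?thesis using that by (auto simp: Z_def mult)
    qed
    have negZ: "\<exists>g \<in> Z. \<forall>x \<in> carrier P1. g x = \<ominus>\<^bsub>C\<^esub> f x" if "f \<in> Z" for f
    proof -
      have lf: "linear_map R P1 C f"
        using that by (auto simp: Z_def mod_hom_iff)
      from linear_map_uminus[OF C lf]
      have "restrict (\<lambda>x. \<ominus>\<^bsub>C\<^esub> f x) (carrier P1) \<in> mod_hom R P1 C"
        unfolding mod_hom_iff by (auto intro: linear_map_cong[OF _ _ P1.left_module_axioms])
      moreover have "d2 p \<in> carrier P1" if "p \<in> carrier P2" for p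
        using linear_map_closed[OF d2 that] by (simp add: K1)
      ultimately have "restrict (\<lambda>x. \<ominus>\<^bsub>C\<^esub> f x) (carrier P1) \<in> Z" using that by (auto simp: Z_def)
      then show ?thesis by (intro bexI) auto
    qed
    have coset: "Z #>\<^bsub>H\<^esub> f = Z" if f: "f \<in> Z" for f
    proof
      show "Z #>\<^bsub>H\<^esub> f \<subseteq> Z" using addZ f by (auto simp: r_coset_def)
      show "Z \<subseteq> Z #>\<^bsub>H\<^esub> f"
      proof
        fix g assume g: "g \<in> Z"
        obtain h where h: "h \<in> Z" "\<forall>x \<in> carrier P1. h x = \<ominus>\<^bsub>C\<^esub> f x" using negZ[OF f] by blast
        have "(g \<otimes>\<^bsub>H\<^esub> h) \<otimes>\<^bsub>H\<^esub> f = g"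
          unfolding mult
          by (rule extensionalityI[of _ "carrier P1"])
            (use f g h(2) in \<open>auto simp: Z_def mod_hom_iff linear_map_def Pi_def C.M.a_assoc C.M.l_neg\<close>)
        then show "g \<in> Z #>\<^bsub>H\<^esub> f" using addZ[OF g h(1)] by (force simp: r_coset_def)
      qed
    qed
    have "(\<lambda>f. Z #>\<^bsub>H\<^esub> f) ` Z = {Z}" using coset zeroB ZB by auto
    moreover have "Z <#>\<^bsub>H\<^esub> Z = (\<Union>f\<in>Z. Z #>\<^bsub>H\<^esub> f)"
      by (auto simp: set_mult_def r_coset_def)
    then have "Z <#>\<^bsub>H\<^esub> Z = Z"
      using coset zeroB ZB by auto
    moreover have "carrier (H Mod B) = (\<lambda>f. B #>\<^bsub>H\<^esub> f) ` Z" "\<one>\<^bsub>H Mod B\<^esub> = B"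
      "B \<otimes>\<^bsub>H Mod B\<^esub> B = B <#>\<^bsub>H\<^esub> B"
      by (auto simp: FactGroup_def RCOSETS_def H_def)
    ultimately have "carrier (H Mod B) = {\<one>\<^bsub>H Mod B\<^esub>}"
      "\<one>\<^bsub>H Mod B\<^esub> \<otimes>\<^bsub>H Mod B\<^esub> \<one>\<^bsub>H Mod B\<^esub> = \<one>\<^bsub>H Mod B\<^esub>"
      by (simp_all add: ZB)
    then show "trivial_group (H Mod B)"
      by (rule trivial_group_singleton)
  qed
  also have "Z \<subseteq> B \<longleftrightarrow> syzygy_maps_extend R M C"
  proof
    assume ZB: "Z \<subseteq> B"
    show "syzygy_maps_extend R M C"
      unfolding syzygy_maps_extend_def K0_def[symmetric] P0_def[symmetric]
    proof (intro allI impI)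
      fix \<phi> assume \<phi>: "linear_map R K0 C \<phi>"
      then have "(\<lambda>p \<in> carrier P1. \<phi> (d1 p)) \<in> B"
        using pull ZB by blast
      then obtain g where g: "g \<in> mod_hom R P0 C"
        and eq: "(\<lambda>p \<in> carrier P1. \<phi> (d1 p)) = (\<lambda>p \<in> carrier P1. g (d1 p))"
        unfolding B_def by auto
      have "g k = \<phi> k" if "k \<in> carrier K0" for k
        using fun_cong[OF eq, of "?e k"] e d1e[OF that] by simp
      then show "\<exists>g. linear_map R P0 C g \<and> (\<forall>p\<in>carrier K0. g p = \<phi> p)"
        using g by (auto simp: mod_hom_iff)
    qed
  next
    assume ext: "syzygy_maps_extend R M C"
    show "Z \<subseteq> B"
    proof
      fix f assume f: "f \<in> Z"
      then have lf: "linear_map R P1 C f" by (auto simp: Z_def mod_hom_iff)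
      have "f p = \<zero>\<^bsub>C\<^esub>" if p: "p \<in> carrier K1" for p
        using factor[OF f, of p] factor[OF f P1.M.zero_closed] p linear_map_zero[OF P1.left_module_axioms C lf]
          linear_map_zero[OF P1.left_module_axioms K0.left_module_axioms d1] by (simp add: K1)
      then have "linear_map R K0 C (\<lambda>k. f (?e k))"
        using linear_map_factors_through_cover[OF K0.left_module_axioms C lf[unfolded P1_def]] by (simp add: K1_def)
      then obtain g where g: "linear_map R P0 C g" and eq: "\<And>k. k \<in> carrier K0 \<Longrightarrow> g k = f (?e k)"
        using ext unfolding syzygy_maps_extend_def K0_def[symmetric] P0_def[symmetric] by blast
      have "restrict g (carrier P0) \<in> mod_hom R P0 C"
        unfolding mod_hom_iff by (auto intro: linear_map_cong[OF g _ P0.left_module_axioms])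
      moreover have "f = (\<lambda>p \<in> carrier P1. restrict g (carrier P0) (d1 p))"
      proof (rule extensionalityI[of _ "carrier P1"])
        show "f \<in> extensional (carrier P1)" using f by (auto simp: Z_def mod_hom_iff)
        fix p assume p: "p \<in> carrier P1"
        show "f p = (\<lambda>p\<in>carrier P1. restrict g (carrier P0) (d1 p)) p"
          using p factor[OF f p] linear_map_closed[OF d1 p] by (simp add: K0P0 eq)
      qed auto
      ultimately show "f \<in> B" unfolding B_def by blast
    qed
  qed
  finally show ?thesis unfolding Ext .
qed

lemma perp01_iff:
  assumes "left_module R M"
  shows "C \<in> perp01 R M \<longleftrightarrow> left_module R C \<and> hom_trivial R M C \<and> syzygy_maps_extend R M C"
  using assms by (auto simp: perp01_def trivial_hom_group_iff trivial_Ext1_iff)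

section \<open>Cosets of additive subgroups\<close>

context abelian_group
begin

lemma coset_iff:
  assumes "additive_subgroup I G" "r \<in> carrier G"
  shows "s \<in> I +> r \<longleftrightarrow> s \<in> carrier G \<and> s \<ominus> r \<in> I"
proof -
  interpret I: additive_subgroup I G by fact
  show ?thesis
  proof
    assume "s \<in> I +> r"
    then obtain i where i: "i \<in> I" "s = i \<oplus> r" by (auto simp: a_r_coset_def')
    then show "s \<in> carrier G \<and> s \<ominus> r \<in> I"
      using assms(2) I.a_Hcarr by (simp add: a_minus_def a_assoc r_neg)
  next
    assume "s \<in> carrier G \<and> s \<ominus> r \<in> I"
    moreover from this have "s = (s \<ominus> r) \<oplus> r"
      using assms(2) by (simp add: a_minus_def a_assoc l_neg)
    ultimately show "s \<in> I +> r" by (force simp: a_r_coset_def')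
  qed
qed

lemma coset_self: "additive_subgroup I G \<Longrightarrow> r \<in> carrier G \<Longrightarrow> r \<in> I +> r"
  by (simp add: coset_iff diff_eq_zero_iff additive_subgroup.zero_closed a_minus_def r_neg)

lemma subgroup_diff_closed:
  assumes "additive_subgroup I G" "x \<in> I" "y \<in> I" shows "x \<ominus> y \<in> I"
proof -
  interpret I: additive_subgroup I G by fact
  have "\<ominus> y \<in> I"
    using subgroup.m_inv_closed[OF I.a_subgroup assms(3)] by (simp add: a_inv_def)
  then show ?thesis using assms(2) by (simp add: a_minus_def)
qed

lemma subgroup_neg_closed:
  assumes "additive_subgroup I G" "y \<in> I" shows "\<ominus> y \<in> I"
  using subgroup_diff_closed[OF assms(1) additive_subgroup.zero_closed[OF assms(1)] assms(2)] assms
    additive_subgroup.a_Hcarr[OF assms(1)]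
  by (simp add: a_minus_def)

lemma coset_eqI:
  assumes I: "additive_subgroup I G" and r: "r \<in> carrier G" and s: "s \<in> carrier G"
    and rs: "r \<ominus> s \<in> I"
  shows "I +> r = I +> s"
proof -
  interpret I: additive_subgroup I G by fact
  have "t \<ominus> s \<in> I \<longleftrightarrow> t \<ominus> r \<in> I" if t: "t \<in> carrier G" for t
  proof
    assume a: "t \<ominus> s \<in> I"
    have "(r \<ominus> s) \<oplus> (t \<ominus> r) = t \<ominus> s"
      using r s t by (simp add: a_minus_def a_ac r_neg2 r_neg1)
    then have "t \<ominus> r = \<ominus> (r \<ominus> s) \<oplus> (t \<ominus> s)"
      using r s t by (metis minus_closed r_neg1)
    then have "t \<ominus> r = (t \<ominus> s) \<ominus> (r \<ominus> s)"
      using r s t by (simp add: a_minus_def a_comm)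
    then show "t \<ominus> r \<in> I" using subgroup_diff_closed[OF I a rs] by simp
  next
    assume a: "t \<ominus> r \<in> I"
    have "t \<ominus> s = (t \<ominus> r) \<oplus> (r \<ominus> s)"
      using r s t by (simp add: a_minus_def a_assoc r_neg1)
    then show "t \<ominus> s \<in> I" using I.a_closed[OF a rs] by simp
  qed
  then show ?thesis using coset_iff[OF I] r s by blast
qed

lemma coset_eq_iff:
  assumes I: "additive_subgroup I G" and r: "r \<in> carrier G" and s: "s \<in> carrier G"
  shows "I +> r = I +> s \<longleftrightarrow> r \<ominus> s \<in> I"
  using coset_eqI[OF assms] coset_self[OF I r] coset_iff[OF I s] by blast

lemma coset_eq_self_iff:
  assumes I: "additive_subgroup I G" and r: "r \<in> carrier G"
  shows "I +> r = I \<longleftrightarrow> r \<in> I"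
proof -
  interpret I: additive_subgroup I G by fact
  have "I +> \<zero> = I" using I.a_subset by (auto simp: a_r_coset_def' subset_iff)
  moreover have "\<ominus> \<zero> = \<zero>" by (rule minus_equality) simp_all
  then have "r \<ominus> \<zero> = r" unfolding a_minus_def using r by (metis r_zero)
  ultimately show ?thesis using coset_eq_iff[OF I r zero_closed] by metis
qed

lemma coset_eq_of_mem:
  assumes I: "additive_subgroup I G" and "X \<in> a_rcosets I" and r: "r \<in> X"
  shows "r \<in> carrier G" "X = I +> r"
proof -
  obtain s where s: "s \<in> carrier G" "X = I +> s" using assms(2) by (auto simp: A_RCOSETS_def')
  then show rG: "r \<in> carrier G" using r coset_iff[OF I] by auto
  show "X = I +> r" using s r rG coset_iff[OF I s(1)] coset_eq_iff[OF I rG s(1)] by auto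
qed

end

section \<open>Relations in tensor products\<close>

text \<open>
  All that the calculus of tensor relations needs of the operations.  It holds for left and right
  modules alike, so that one set of lemmas serves both arguments of the tensor product.
\<close>

definition ops_closed :: "'r ring \<Rightarrow> ('r, 'm) module \<Rightarrow> bool" where
  "ops_closed R M \<longleftrightarrow> (\<forall>x \<in> carrier M. \<forall>y \<in> carrier M. x \<oplus>\<^bsub>M\<^esub> y \<in> carrier M) \<and>
     (\<forall>r \<in> carrier R. \<forall>x \<in> carrier M. r \<odot>\<^bsub>M\<^esub> x \<in> carrier M)"

lemma left_module_ops_closed: "left_module R M \<Longrightarrow> ops_closed R M"
proof -
  assume "left_module R M"
  then interpret left_module R M .
  show ?thesis by (auto simp: ops_closed_def lsmult_closed)
qed

lemma right_module_ops_closed: "right_module R M \<Longrightarrow> ops_closed R M"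
proof -
  assume "right_module R M"
  then interpret right_module R M .
  show ?thesis by (auto simp: ops_closed_def rsmult_closed)
qed

lemma frag_of_keys: "x \<in> S \<Longrightarrow> Poly_Mapping.keys (frag_of x) \<subseteq> S"
  by (simp add: keys_frag_of)

lemma keys_add_subset: "Poly_Mapping.keys a \<subseteq> S \<Longrightarrow> Poly_Mapping.keys b \<subseteq> S \<Longrightarrow>
    Poly_Mapping.keys (a + b) \<subseteq> S"
  using keys_add[of a b] by blast

lemma keys_diff_subset: "Poly_Mapping.keys a \<subseteq> S \<Longrightarrow> Poly_Mapping.keys b \<subseteq> S \<Longrightarrow>
    Poly_Mapping.keys (a - b :: 'a \<Rightarrow>\<^sub>0 int) \<subseteq> S"
  using keys_diff[of a b] by blast

lemma tensor_relations_keys: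
  assumes "ops_closed R A" "ops_closed R M" "c \<in> tensor_relations R A M"
  shows "Poly_Mapping.keys c \<subseteq> carrier A \<times> carrier M"
  using assms(3) unfolding tensor_relations_def
  by (elim UnE CollectE exE conjE; hypsubst; intro keys_diff_subset frag_of_keys;
      use assms(1,2) in \<open>auto simp: ops_closed_def\<close>)

context
  fixes R :: "'r ring" and A :: "('r, 'a) module" and M :: "('r, 'm) module"
  assumes A: "ops_closed R A" and M: "ops_closed R M"
begin

lemma tensor_relations_carrier:
  "tensor_relations R A M \<subseteq> carrier (free_Abelian_group (carrier A \<times> carrier M))"
  by (intro subsetI) (simp add: tensor_relations_keys[OF A M])

lemma tensor_kernel_keys:
  "c \<in> tensor_kernel R A M \<Longrightarrow> Poly_Mapping.keys c \<subseteq> carrier A \<times> carrier M"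
  using group.generate_in_carrier[OF group_free_Abelian_group tensor_relations_carrier]
  by (simp add: tensor_kernel_def)

lemma tensor_kernel_incl: "c \<in> tensor_relations R A M \<Longrightarrow> c \<in> tensor_kernel R A M"
  by (simp add: tensor_kernel_def generate.incl)

lemma tensor_kernel_zero: "0 \<in> tensor_kernel R A M"
  using generate.one[of "free_Abelian_group (carrier A \<times> carrier M)"] by (simp add: tensor_kernel_def)

lemma tensor_kernel_add:
  "c \<in> tensor_kernel R A M \<Longrightarrow> d \<in> tensor_kernel R A M \<Longrightarrow> c + d \<in> tensor_kernel R A M"
  using generate.eng[of c "free_Abelian_group (carrier A \<times> carrier M)"] by (simp add: tensor_kernel_def)

lemma tensor_kernel_neg:
  assumes "c \<in> tensor_kernel R A M" shows "- c \<in> tensor_kernel R A M"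
proof -
  have "inv\<^bsub>free_Abelian_group (carrier A \<times> carrier M)\<^esub> c \<in> tensor_kernel R A M"
    using group.generate_m_inv_closed[OF group_free_Abelian_group tensor_relations_carrier] assms
    by (simp add: tensor_kernel_def)
  then show ?thesis using tensor_kernel_keys[OF assms] by simp
qed

lemma tensor_kernel_diff:
  "c \<in> tensor_kernel R A M \<Longrightarrow> d \<in> tensor_kernel R A M \<Longrightarrow> c - d \<in> tensor_kernel R A M"
  using tensor_kernel_add[of c "- d"] tensor_kernel_neg by simp

lemma tensor_kernel_induct [consumes 1, case_names zero rel neg add]:
  assumes "c \<in> tensor_kernel R A M"
    and "P 0" and rel: "\<And>c. c \<in> tensor_relations R A M \<Longrightarrow> P c"
    and neg: "\<And>c. c \<in> tensor_kernel R A M \<Longrightarrow> P c \<Longrightarrow> P (- c)"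
    and "\<And>c d. c \<in> tensor_kernel R A M \<Longrightarrow> d \<in> tensor_kernel R A M \<Longrightarrow> P c \<Longrightarrow> P d \<Longrightarrow> P (c + d)"
  shows "P c"
  using assms(1) unfolding tensor_kernel_def
proof (induction rule: generate.induct)
  case (inv h)
  then have "inv\<^bsub>free_Abelian_group (carrier A \<times> carrier M)\<^esub> h = - h"
    using tensor_relations_keys[OF A M] by simp
  then show ?case using neg[OF tensor_kernel_incl rel] inv by simp
qed (use assms in \<open>auto simp: tensor_kernel_def\<close>)

lemma tensor_kernel_left_add:
  "a \<in> carrier A \<Longrightarrow> b \<in> carrier A \<Longrightarrow> m \<in> carrier M \<Longrightarrow>
     frag_of (a \<oplus>\<^bsub>A\<^esub> b, m) - frag_of (a, m) - frag_of (b, m) \<in> tensor_kernel R A M"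
  by (rule tensor_kernel_incl) (auto simp: tensor_relations_def)

lemma tensor_kernel_right_add:
  "a \<in> carrier A \<Longrightarrow> m \<in> carrier M \<Longrightarrow> n \<in> carrier M \<Longrightarrow>
     frag_of (a, m \<oplus>\<^bsub>M\<^esub> n) - frag_of (a, m) - frag_of (a, n) \<in> tensor_kernel R A M"
  by (rule tensor_kernel_incl) (auto simp: tensor_relations_def)

lemma tensor_kernel_balanced:
  "a \<in> carrier A \<Longrightarrow> r \<in> carrier R \<Longrightarrow> m \<in> carrier M \<Longrightarrow>
     frag_of (r \<odot>\<^bsub>A\<^esub> a, m) - frag_of (a, r \<odot>\<^bsub>M\<^esub> m) \<in> tensor_kernel R A M"
  by (rule tensor_kernel_incl) (auto simp: tensor_relations_def)

text \<open>Pure tensors generate, so the tensor product vanishes iff all of them do.\<close>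

lemma trivial_tensor_iff:
  "trivial_group (tensor R A M) \<longleftrightarrow>
     (\<forall>a \<in> carrier A. \<forall>m \<in> carrier M. frag_of (a, m) \<in> tensor_kernel R A M)"
proof -
  let ?F = "free_Abelian_group (carrier A \<times> carrier M)" and ?K = "tensor_kernel R A M"
  have carr: "carrier (tensor R A M) = (\<lambda>c. ?K #>\<^bsub>?F\<^esub> c) ` carrier ?F"
    by (auto simp: tensor_def FactGroup_def RCOSETS_def)
  have one: "\<one>\<^bsub>tensor R A M\<^esub> = ?K" by (simp add: tensor_def FactGroup_def)
  show ?thesis
  proof
    assume "trivial_group (tensor R A M)"
    then have *: "?K #>\<^bsub>?F\<^esub> c = ?K" if "c \<in> carrier ?F" for c
      using that carr one by (auto simp: trivial_group_def)
    show "\<forall>a \<in> carrier A. \<forall>m \<in> carrier M. frag_of (a, m) \<in> ?K"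
    proof (intro ballI)
      fix a m assume "a \<in> carrier A" "m \<in> carrier M"
      then have eq: "?K #>\<^bsub>?F\<^esub> frag_of (a, m) = ?K" by (intro *) auto
      have "0 + frag_of (a, m) \<in> ?K #>\<^bsub>?F\<^esub> frag_of (a, m)"
        using tensor_kernel_zero by (force simp: r_coset_def)
      then show "frag_of (a, m) \<in> ?K" using eq by simp
    qed
  next
    assume pure: "\<forall>a \<in> carrier A. \<forall>m \<in> carrier M. frag_of (a, m) \<in> ?K"
    have all: "c \<in> ?K" if "Poly_Mapping.keys c \<subseteq> carrier A \<times> carrier M" for c
      by (rule free_Abelian_group_induct[OF that, where P = "\<lambda>c. c \<in> ?K"])
        (use pure in \<open>auto intro: tensor_kernel_zero tensor_kernel_diff\<close>)
    have cos: "?K #>\<^bsub>?F\<^esub> c = ?K" if "c \<in> carrier ?F" for c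
    proof
      show "?K #>\<^bsub>?F\<^esub> c \<subseteq> ?K"
        using all that by (auto simp: r_coset_def intro!: tensor_kernel_add)
      show "?K \<subseteq> ?K #>\<^bsub>?F\<^esub> c"
      proof
        fix k assume "k \<in> ?K"
        then have "k - c \<in> ?K" using all that by (auto intro: tensor_kernel_diff)
        then show "k \<in> ?K #>\<^bsub>?F\<^esub> c"
          by (auto simp: r_coset_def intro!: bexI[of _ "k - c"])
      qed
    qed
    have "?K <#>\<^bsub>?F\<^esub> ?K = (\<Union>c \<in> ?K. ?K #>\<^bsub>?F\<^esub> c)"
      by (auto simp: set_mult_def r_coset_def)
    also have "\<dots> = ?K" using cos tensor_kernel_zero tensor_kernel_keys by auto
    finally have mult: "?K <#>\<^bsub>?F\<^esub> ?K = ?K" .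
    show "trivial_group (tensor R A M)"
    proof (rule trivial_group_singleton)
      have "0 \<in> carrier ?F" by simp
      then show "carrier (tensor R A M) = {\<one>\<^bsub>tensor R A M\<^esub>}"
        unfolding carr one using cos by (auto intro!: image_eqI[of _ _ 0])
      show "\<one>\<^bsub>tensor R A M\<^esub> \<otimes>\<^bsub>tensor R A M\<^esub> \<one>\<^bsub>tensor R A M\<^esub> = \<one>\<^bsub>tensor R A M\<^esub>"
        unfolding one using mult by (simp add: tensor_def FactGroup_def)
    qed
  qed
qed

text \<open>
  A pairing that is biadditive and balanced modulo a subgroup \<open>N\<close> extends to the free abelian group
  on the pairs and maps every consequence of the tensor relations into \<open>N\<close>.  It turns the vanishing
  of an element of a tensor product into information about \<open>N\<close>.
\<close>

lemma tensor_kernel_eval: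
  assumes Z: "abelian_group Z" and N: "additive_subgroup N Z"
    and \<beta>: "\<And>a m. a \<in> carrier A \<Longrightarrow> m \<in> carrier M \<Longrightarrow> \<beta> a m \<in> carrier Z"
    and l: "\<And>a b m. a \<in> carrier A \<Longrightarrow> b \<in> carrier A \<Longrightarrow> m \<in> carrier M \<Longrightarrow>
      \<beta> (a \<oplus>\<^bsub>A\<^esub> b) m \<ominus>\<^bsub>Z\<^esub> \<beta> a m \<ominus>\<^bsub>Z\<^esub> \<beta> b m \<in> N"
    and r: "\<And>a m n. a \<in> carrier A \<Longrightarrow> m \<in> carrier M \<Longrightarrow> n \<in> carrier M \<Longrightarrow>
      \<beta> a (m \<oplus>\<^bsub>M\<^esub> n) \<ominus>\<^bsub>Z\<^esub> \<beta> a m \<ominus>\<^bsub>Z\<^esub> \<beta> a n \<in> N"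
    and b: "\<And>a s m. a \<in> carrier A \<Longrightarrow> s \<in> carrier R \<Longrightarrow> m \<in> carrier M \<Longrightarrow>
      \<beta> (s \<odot>\<^bsub>A\<^esub> a) m \<ominus>\<^bsub>Z\<^esub> \<beta> a (s \<odot>\<^bsub>M\<^esub> m) \<in> N"
  obtains h where "\<And>c. Poly_Mapping.keys c \<subseteq> carrier A \<times> carrier M \<Longrightarrow> h c \<in> carrier Z"
    and "\<And>c d. Poly_Mapping.keys c \<subseteq> carrier A \<times> carrier M \<Longrightarrow>
      Poly_Mapping.keys d \<subseteq> carrier A \<times> carrier M \<Longrightarrow> h (c - d) = h c \<ominus>\<^bsub>Z\<^esub> h d"
    and "\<And>a m. a \<in> carrier A \<Longrightarrow> m \<in> carrier M \<Longrightarrow> h (frag_of (a, m)) = \<beta> a m"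
    and "\<And>c. c \<in> tensor_kernel R A M \<Longrightarrow> h c \<in> N"
proof -
  interpret Z: abelian_group Z by fact
  interpret N: additive_subgroup N Z by fact
  let ?F = "free_Abelian_group (carrier A \<times> carrier M)"
  have "(\<lambda>(a, m). \<beta> a m) ` (carrier A \<times> carrier M) \<subseteq> carrier (add_monoid Z)"
    using \<beta> by auto
  then obtain h where h: "h \<in> hom ?F (add_monoid Z)"
    and hf: "\<And>x. x \<in> carrier A \<times> carrier M \<Longrightarrow> h (frag_of x) = (\<lambda>(a, m). \<beta> a m) x"
    by (rule comm_group.free_Abelian_group_universal[OF Z.a_comm_group]) blast
  have cl: "h c \<in> carrier Z" if "Poly_Mapping.keys c \<subseteq> carrier A \<times> carrier M" for c
    using h that by (auto simp: hom_def Pi_def)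
  have add: "h (c + d) = h c \<oplus>\<^bsub>Z\<^esub> h d"
    if "Poly_Mapping.keys c \<subseteq> carrier A \<times> carrier M" "Poly_Mapping.keys d \<subseteq> carrier A \<times> carrier M" for c d
    using hom_mult[OF h, of c d] that by simp
  have diff: "h (c - d) = h c \<ominus>\<^bsub>Z\<^esub> h d"
    if c: "Poly_Mapping.keys c \<subseteq> carrier A \<times> carrier M" and d: "Poly_Mapping.keys d \<subseteq> carrier A \<times> carrier M" for c d
  proof -
    have "h c = h (c - d) \<oplus>\<^bsub>Z\<^esub> h d"
      using add[OF keys_diff_subset[OF c d] d] by simp
    then show ?thesis
      using cl[OF c] cl[OF d] cl[OF keys_diff_subset[OF c d]]
      by (simp add: a_minus_def Z.a_assoc Z.r_neg)
  qed
  have hf': "h (frag_of (a, m)) = \<beta> a m" if "a \<in> carrier A" "m \<in> carrier M" for a m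
    using hf that by auto
  have "h c \<in> N" if "c \<in> tensor_kernel R A M" for c
    using that
  proof (induction rule: tensor_kernel_induct)
    case zero
    have "h 0 = h 0 \<ominus>\<^bsub>Z\<^esub> h 0" using diff[of 0 0] by simp
    then show ?case using cl[of 0] by (simp add: a_minus_def Z.r_neg)
  next
    case (rel c)
    have d3: "h (frag_of (p, q) - frag_of (p', q') - frag_of (p'', q''))
        = \<beta> p q \<ominus>\<^bsub>Z\<^esub> \<beta> p' q' \<ominus>\<^bsub>Z\<^esub> \<beta> p'' q''"
      if "p \<in> carrier A" "p' \<in> carrier A" "p'' \<in> carrier A" "q \<in> carrier M" "q' \<in> carrier M" "q'' \<in> carrier M"
      for p q p' q' p'' q''
    proof -
      have "Poly_Mapping.keys (frag_of (p, q) - frag_of (p', q')) \<subseteq> carrier A \<times> carrier M"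
        using that by (intro keys_diff_subset frag_of_keys) auto
      then show ?thesis
        using that by (simp add: diff frag_of_keys hf')
    qed
    have d2: "h (frag_of (p, q) - frag_of (p', q')) = \<beta> p q \<ominus>\<^bsub>Z\<^esub> \<beta> p' q'"
      if "p \<in> carrier A" "p' \<in> carrier A" "q \<in> carrier M" "q' \<in> carrier M" for p q p' q'
      using that by (simp add: diff frag_of_keys hf')
    from rel show ?case
      unfolding tensor_relations_def
      using A M l r b by (auto simp: d3 d2 ops_closed_def)
  next
    case (neg c)
    have "h (- c) = h 0 \<ominus>\<^bsub>Z\<^esub> h c" using diff[of 0 c] tensor_kernel_keys[OF neg(1)] by simp
    moreover have "h 0 = \<zero>\<^bsub>Z\<^esub>" using diff[of 0 0] cl[of 0] by (simp add: a_minus_def Z.r_neg)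
    ultimately show ?case using Z.subgroup_diff_closed[OF N N.zero_closed neg(2)] by simp
  next
    case (add c d)
    then show ?case using \<open>\<And>c d. _ \<Longrightarrow> _ \<Longrightarrow> h (c + d) = _\<close> tensor_kernel_keys N.a_closed by auto
  qed
  then show thesis using that[of h] cl diff hf' by blast
qed

end

abbreviation frag_map2 :: "('a \<Rightarrow> 'b) \<Rightarrow> ('m \<Rightarrow> 'n) \<Rightarrow> ('a \<times> 'm \<Rightarrow>\<^sub>0 int) \<Rightarrow> ('b \<times> 'n \<Rightarrow>\<^sub>0 int)" where
  "frag_map2 f g \<equiv> frag_extend (\<lambda>(a, m). frag_of (f a, g m))"

text \<open>Functoriality of the tensor product, on representatives.\<close>

lemma frag_map2_tensor_kernel:
  assumes A: "ops_closed R A" "ops_closed R M" and B: "ops_closed R B" "ops_closed R N"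
    and f: "linear_map R A B f" and g: "linear_map R M N g"
    and c: "c \<in> tensor_kernel R A M"
  shows "frag_map2 f g c \<in> tensor_kernel R B N"
  using c
proof (induction rule: tensor_kernel_induct[OF A, consumes 1, case_names zero rel neg add])
  case (rel c)
  then show ?case
    unfolding tensor_relations_def
    by (auto simp: frag_extend_diff linear_map_add[OF f] linear_map_add[OF g] linear_map_smult[OF f]
      linear_map_smult[OF g] linear_map_closed[OF f] linear_map_closed[OF g]
      intro!: tensor_kernel_left_add[OF B] tensor_kernel_right_add[OF B] tensor_kernel_balanced[OF B])
qed (simp_all add: tensor_kernel_zero[OF B] tensor_kernel_add[OF B] tensor_kernel_neg[OF B]
    frag_extend_add frag_extend_minus)

text \<open>
  Flatness on representatives: a relation that holds in \<open>B \<otimes> M\<close> between elements of \<open>A \<subseteq> B\<close>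
  already holds in \<open>A \<otimes> M\<close>.
\<close>

lemma flat_left_module_kernel:
  fixes A B :: "('r, 'r list) module"
  assumes flat: "flat_left_module R M" and A: "right_module R A" and B: "right_module R B"
    and f: "f \<in> mod_hom R A B" "inj_on f (carrier A)"
    and c: "Poly_Mapping.keys c \<subseteq> carrier A \<times> carrier M"
    and fc: "frag_map2 f (\<lambda>m. m) c \<in> tensor_kernel R B M"
  shows "c \<in> tensor_kernel R A M"
proof -
  have M: "left_module R M" using flat by (simp add: flat_left_module_def)
  note opA = right_module_ops_closed[OF A] and opB = right_module_ops_closed[OF B]
    and opM = left_module_ops_closed[OF M]
  let ?FA = "free_Abelian_group (carrier A \<times> carrier M)" and ?FB = "free_Abelian_group (carrier B \<times> carrier M)"
  let ?KA = "tensor_kernel R A M" and ?KB = "tensor_kernel R B M"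
  have inj: "inj_on (tensor_map R B M f) (carrier (tensor R A M))"
    using flat A B f by (simp add: flat_left_module_def)
  have lf: "linear_map R A B f" using f by (simp add: mod_hom_iff)
  have lid: "linear_map R M M (\<lambda>m. m)" by (simp add: linear_map_def)
  have img: "tensor_map R B M f (?KA #>\<^bsub>?FA\<^esub> d) = ?KB"
    if d: "frag_map2 f (\<lambda>m. m) d \<in> ?KB" for d
  proof -
    have e: "frag_map2 f (\<lambda>m. m) d' \<in> ?KB" if "d' \<in> ?KA #>\<^bsub>?FA\<^esub> d" for d'
      using that d frag_map2_tensor_kernel[OF opA opM opB opM lf lid]
      by (auto simp: r_coset_def frag_extend_add intro!: tensor_kernel_add[OF opB opM])
    have cos: "?KB #>\<^bsub>?FB\<^esub> e = ?KB" if "e \<in> ?KB" for e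
    proof
      show "?KB #>\<^bsub>?FB\<^esub> e \<subseteq> ?KB"
        using that by (auto simp: r_coset_def intro!: tensor_kernel_add[OF opB opM])
      show "?KB \<subseteq> ?KB #>\<^bsub>?FB\<^esub> e"
      proof
        fix k assume "k \<in> ?KB"
        then have "k - e \<in> ?KB" using that tensor_kernel_diff[OF opB opM] by blast
        then show "k \<in> ?KB #>\<^bsub>?FB\<^esub> e"
          by (auto simp: r_coset_def intro!: bexI[of _ "k - e"])
      qed
    qed
    have "0 + d \<in> ?KA #>\<^bsub>?FA\<^esub> d"
      using tensor_kernel_zero[OF opA opM] by (force simp: r_coset_def)
    then show ?thesis unfolding tensor_map_def using e cos by fastforce
  qed
  have "?KA #>\<^bsub>?FA\<^esub> c = ?KA #>\<^bsub>?FA\<^esub> 0"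
  proof (rule inj_onD[OF inj])
    show "tensor_map R B M f (?KA #>\<^bsub>?FA\<^esub> c) = tensor_map R B M f (?KA #>\<^bsub>?FA\<^esub> 0)"
      using img[OF fc] img[of 0] tensor_kernel_zero[OF opB opM] by simp
  qed (use c in \<open>auto simp: tensor_def FactGroup_def RCOSETS_def\<close>)
  moreover have "0 + c \<in> ?KA #>\<^bsub>?FA\<^esub> c"
    using tensor_kernel_zero[OF opA opM] by (force simp: r_coset_def)
  ultimately show ?thesis by (auto simp: r_coset_def)
qed

section \<open>The Gabriel topology of a flat ring epimorphism\<close>

text \<open>
  The quotient of a set \<open>P\<close> of representatives by a congruence, realised in a prescribed type by a
  function \<open>enc\<close> whose fibres are the classes; the ring laws are required only up to \<open>enc\<close>.  It
  serves to apply the epimorphism property, which speaks about rings with carrier in \<open>'u list\<close>.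
\<close>

lemma coded_ring_exists:
  fixes enc :: "'p \<Rightarrow> 'l" and pl ml :: "'p \<Rightarrow> 'p \<Rightarrow> 'p"
  assumes cl: "\<And>p q. p \<in> P \<Longrightarrow> q \<in> P \<Longrightarrow> pl p q \<in> P" "\<And>p q. p \<in> P \<Longrightarrow> q \<in> P \<Longrightarrow> ml p q \<in> P"
      "z \<in> P" "e \<in> P"
    and cong: "\<And>p p' q q'. p \<in> P \<Longrightarrow> p' \<in> P \<Longrightarrow> q \<in> P \<Longrightarrow> q' \<in> P \<Longrightarrow> enc p = enc p' \<Longrightarrow> enc q = enc q' \<Longrightarrow>
      enc (pl p q) = enc (pl p' q') \<and> enc (ml p q) = enc (ml p' q')"
    and add: "\<And>p q r. p \<in> P \<Longrightarrow> q \<in> P \<Longrightarrow> r \<in> P \<Longrightarrow> enc (pl (pl p q) r) = enc (pl p (pl q r))"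
      "\<And>p q. p \<in> P \<Longrightarrow> q \<in> P \<Longrightarrow> enc (pl p q) = enc (pl q p)"
      "\<And>p. p \<in> P \<Longrightarrow> enc (pl z p) = enc p"
      "\<And>p. p \<in> P \<Longrightarrow> \<exists>q \<in> P. enc (pl q p) = enc z"
    and mul: "\<And>p q r. p \<in> P \<Longrightarrow> q \<in> P \<Longrightarrow> r \<in> P \<Longrightarrow> enc (ml (ml p q) r) = enc (ml p (ml q r))"
      "\<And>p. p \<in> P \<Longrightarrow> enc (ml e p) = enc p" "\<And>p. p \<in> P \<Longrightarrow> enc (ml p e) = enc p"
      "\<And>p q r. p \<in> P \<Longrightarrow> q \<in> P \<Longrightarrow> r \<in> P \<Longrightarrow> enc (ml (pl p q) r) = enc (pl (ml p r) (ml q r))"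
      "\<And>p q r. p \<in> P \<Longrightarrow> q \<in> P \<Longrightarrow> r \<in> P \<Longrightarrow> enc (ml r (pl p q)) = enc (pl (ml r p) (ml r q))"
  obtains S :: "'l ring" where "ring S" "carrier S = enc ` P"
    "\<And>p q. p \<in> P \<Longrightarrow> q \<in> P \<Longrightarrow> enc p \<oplus>\<^bsub>S\<^esub> enc q = enc (pl p q)"
    "\<And>p q. p \<in> P \<Longrightarrow> q \<in> P \<Longrightarrow> enc p \<otimes>\<^bsub>S\<^esub> enc q = enc (ml p q)"
    "\<one>\<^bsub>S\<^esub> = enc e"
proof -
  define dec where "dec = inv_into P enc"
  have dec: "dec (enc p) \<in> P" "enc (dec (enc p)) = enc p" if "p \<in> P" for p
    using that by (auto simp: dec_def inv_into_into f_inv_into_f)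
  define S :: "'l ring" where "S = \<lparr>carrier = enc ` P, monoid.mult = (\<lambda>x y. enc (ml (dec x) (dec y))),
    one = enc e, ring.zero = enc z, ring.add = (\<lambda>x y. enc (pl (dec x) (dec y)))\<rparr>"
  have S: "carrier S = enc ` P" "\<one>\<^bsub>S\<^esub> = enc e" "\<zero>\<^bsub>S\<^esub> = enc z" by (simp_all add: S_def)
  have Sadd: "enc p \<oplus>\<^bsub>S\<^esub> enc q = enc (pl p q)" if "p \<in> P" "q \<in> P" for p q
    using cong[of "dec (enc p)" p "dec (enc q)" q] dec that by (simp add: S_def)
  have Smul: "enc p \<otimes>\<^bsub>S\<^esub> enc q = enc (ml p q)" if "p \<in> P" "q \<in> P" for p q
    using cong[of "dec (enc p)" p "dec (enc q)" q] dec that by (simp add: S_def)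
  have "abelian_group S"
  proof (rule abelian_groupI)
    fix x assume "x \<in> carrier S"
    then obtain p where p: "p \<in> P" "x = enc p" by (auto simp: S)
    obtain q where q: "q \<in> P" "enc (pl q p) = enc z" using add(4)[OF p(1)] by blast
    then have "enc q \<oplus>\<^bsub>S\<^esub> x = \<zero>\<^bsub>S\<^esub>" using p by (simp add: S Sadd)
    then show "\<exists>y\<in>carrier S. y \<oplus>\<^bsub>S\<^esub> x = \<zero>\<^bsub>S\<^esub>" using q S by blast
  qed (auto simp: S Sadd cl add(1,3) intro: add(2))
  moreover have "monoid S"
    by (rule monoidI) (auto simp: S Smul cl mul)
  ultimately have "ring S"
    by (rule ringI) (auto simp: S Sadd Smul cl mul)
  then show thesis using that[of S] S Sadd Smul by blast
qed

definition right_restrict :: "'u ring \<Rightarrow> ('r \<Rightarrow> 'u) \<Rightarrow> ('r, 'u) module" where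
  "right_restrict U u = \<lparr>carrier = carrier U, monoid.mult = monoid.mult U, one = \<one>\<^bsub>U\<^esub>,
     ring.zero = \<zero>\<^bsub>U\<^esub>, ring.add = add U, smult = (\<lambda>r x. x \<otimes>\<^bsub>U\<^esub> u r)\<rparr>"

text \<open>
  The right ideal \<open>I U\<close> of \<open>U\<close> generated by the image of \<open>I\<close>.
\<close>

inductive_set ideal_span :: "'u ring \<Rightarrow> ('r \<Rightarrow> 'u) \<Rightarrow> 'r set \<Rightarrow> 'u set" for U u I where
  zero: "\<zero>\<^bsub>U\<^esub> \<in> ideal_span U u I"
| step: "x \<in> ideal_span U u I \<Longrightarrow> i \<in> I \<Longrightarrow> w \<in> carrier U \<Longrightarrow> x \<oplus>\<^bsub>U\<^esub> u i \<otimes>\<^bsub>U\<^esub> w \<in> ideal_span U u I"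

text \<open>
  The set \<open>{r. v r \<in> I}\<close>, where \<open>R\<close> is identified with its image in \<open>U\<close>.  For \<open>I = R\<close> it
  consists of the right denominators of \<open>v\<close>.
\<close>

definition colon :: "'r ring \<Rightarrow> 'u ring \<Rightarrow> ('r \<Rightarrow> 'u) \<Rightarrow> 'r set \<Rightarrow> 'u \<Rightarrow> 'r set" where
  "colon R U u I v = {r \<in> carrier R. v \<otimes>\<^bsub>U\<^esub> u r \<in> u ` I}"

locale flat_epi =
  fixes R :: "'r ring" and U :: "'u ring" (structure) and u :: "'r \<Rightarrow> 'u"
  assumes ring_R: "ring R" and ring_U: "ring U"
    and epi: "ring_epimorphism R U u"
    and inj: "inj_on u (carrier R)"
    and flat: "flat_left_module R (restrict_scalars u (regular_module U))"
begin

sublocale R: plain_ring R using ring_R by (simp add: plain_ring_def)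
sublocale U: plain_ring U using ring_U by (simp add: plain_ring_def)

abbreviation UL :: "('r, 'u) module" where "UL \<equiv> restrict_scalars u (regular_module U)"
abbreviation UR :: "('r, 'u) module" where "UR \<equiv> right_restrict U u"
abbreviation \<GG> :: "'r set set" where "\<GG> \<equiv> gabriel_topology R U u"
abbreviation IU :: "'r set \<Rightarrow> 'u set" where "IU \<equiv> ideal_span U u"
abbreviation Colon :: "'r set \<Rightarrow> 'u \<Rightarrow> 'r set" where "Colon \<equiv> colon R U u"
abbreviation den :: "'u \<Rightarrow> 'r set" where "den \<equiv> Colon (carrier R)"

lemma u_hom: "u \<in> ring_hom R U"
  using epi by (simp add: ring_epimorphism_def)

lemma u_simps [simp]:
  "r \<in> carrier R \<Longrightarrow> u r \<in> carrier U"
  "r \<in> carrier R \<Longrightarrow> s \<in> carrier R \<Longrightarrow> u (r \<oplus>\<^bsub>R\<^esub> s) = u r \<oplus> u s"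
  "r \<in> carrier R \<Longrightarrow> s \<in> carrier R \<Longrightarrow> u (r \<otimes>\<^bsub>R\<^esub> s) = u r \<otimes> u s"
  "u \<one>\<^bsub>R\<^esub> = \<one>"
  using u_hom by (auto simp: ring_hom_def)

lemma u_zero [simp]: "u \<zero>\<^bsub>R\<^esub> = \<zero>"
  using u_hom ring_R ring_U by (rule ring_hom_zero)

lemma u_neg [simp]: "r \<in> carrier R \<Longrightarrow> u (\<ominus>\<^bsub>R\<^esub> r) = \<ominus> u r"
  by (metis R.a_inv_closed R.l_neg U.minus_equality u_simps(1,2) u_zero)

lemma u_minus [simp]: "r \<in> carrier R \<Longrightarrow> s \<in> carrier R \<Longrightarrow> u (r \<ominus>\<^bsub>R\<^esub> s) = u r \<ominus> u s"
  by (simp add: a_minus_def)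

lemma u_eq_iff: "r \<in> carrier R \<Longrightarrow> s \<in> carrier R \<Longrightarrow> u r = u s \<longleftrightarrow> r = s"
  using inj by (auto simp: inj_on_def)

lemma UL_simps [simp]: "carrier UL = carrier U" "x \<oplus>\<^bsub>UL\<^esub> y = x \<oplus> y" "\<zero>\<^bsub>UL\<^esub> = \<zero>"
  "r \<odot>\<^bsub>UL\<^esub> x = u r \<otimes> x"
  by (simp_all add: restrict_scalars_def regular_module_def)

lemma UR_simps [simp]: "carrier UR = carrier U" "x \<oplus>\<^bsub>UR\<^esub> y = x \<oplus> y" "\<zero>\<^bsub>UR\<^esub> = \<zero>"
  "r \<odot>\<^bsub>UR\<^esub> x = x \<otimes> u r"
  by (simp_all add: right_restrict_def)

lemma UL_module: "left_module R UL" using flat by (simp add: flat_left_module_def)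

lemma UL_ops: "ops_closed R UL" by (rule left_module_ops_closed[OF UL_module])

lemma UR_ops: "ops_closed R UR" by (simp add: ops_closed_def)

lemma right_ideal_subset: "right_ideal I R \<Longrightarrow> i \<in> I \<Longrightarrow> i \<in> carrier R"
  using additive_subgroup.a_Hcarr by (auto simp: right_ideal_def)

lemma right_idealI:
  assumes "I \<subseteq> carrier R" "\<zero>\<^bsub>R\<^esub> \<in> I" "\<And>i j. i \<in> I \<Longrightarrow> j \<in> I \<Longrightarrow> i \<oplus>\<^bsub>R\<^esub> j \<in> I"
    "\<And>i r. i \<in> I \<Longrightarrow> r \<in> carrier R \<Longrightarrow> i \<otimes>\<^bsub>R\<^esub> r \<in> I"
  shows "right_ideal I R"
proof -
  have "\<ominus>\<^bsub>R\<^esub> i \<in> I" if "i \<in> I" for i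
    using assms(4)[OF that, of "\<ominus>\<^bsub>R\<^esub> \<one>\<^bsub>R\<^esub>"] assms(1) that by (auto simp: R.r_minus)
  then have "subgroup I (add_monoid R)"
    using assms by (intro R.add.subgroupI) (auto simp: a_inv_def)
  then show ?thesis using assms(4) by (simp add: right_ideal_def additive_subgroupI)
qed

subsection \<open>The span of a right ideal\<close>

lemma ideal_span_closed: "x \<in> IU I \<Longrightarrow> I \<subseteq> carrier R \<Longrightarrow> x \<in> carrier U"
  by (induction rule: ideal_span.induct) auto

lemma ideal_span_add:
  assumes "I \<subseteq> carrier R" "x \<in> IU I" "y \<in> IU I"
  shows "x \<oplus> y \<in> IU I"
  using assms(3)
proof (induction rule: ideal_span.induct)
  case zero then show ?case using assms ideal_span_closed by simp
next
  case (step y i w)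
  have "x \<oplus> (y \<oplus> u i \<otimes> w) = (x \<oplus> y) \<oplus> u i \<otimes> w"
    using step assms ideal_span_closed by (intro U.a_assoc[symmetric]) auto
  then show ?case using ideal_span.step[OF step.IH step(2,3)] by simp
qed

lemma ideal_span_incl:
  assumes "I \<subseteq> carrier R" "i \<in> I" "w \<in> carrier U"
  shows "u i \<otimes> w \<in> IU I"
proof -
  have "u i \<otimes> w \<in> carrier U" using assms by auto
  then show ?thesis using ideal_span.step[OF ideal_span.zero[of U u I] assms(2,3)] by simp
qed

lemma ideal_span_rmult:
  assumes I: "I \<subseteq> carrier R" and v: "v \<in> carrier U" and "x \<in> IU I"
  shows "x \<otimes> v \<in> IU I"
  using assms(3)
proof (induction rule: ideal_span.induct)
  case zero then show ?case using v by (simp add: ideal_span.zero)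
next
  case (step x i w)
  have "(x \<oplus> u i \<otimes> w) \<otimes> v = x \<otimes> v \<oplus> u i \<otimes> (w \<otimes> v)"
    using step ideal_span_closed[OF step(1) I] I v by (auto simp: U.l_distr U.m_assoc subset_iff)
  then show ?case using ideal_span.step[OF step.IH step(2)] step v by simp
qed

lemma ideal_span_subgroup:
  assumes I: "I \<subseteq> carrier R" shows "additive_subgroup (IU I) U"
proof -
  have "\<ominus> x \<in> IU I" if "x \<in> IU I" for x
    using ideal_span_rmult[OF I _ that, of "\<ominus> \<one>"] ideal_span_closed[OF that I] by (simp add: U.r_minus)
  then have "subgroup (IU I) (add_monoid U)"
    using ideal_span_closed[OF _ I] ideal_span_add[OF I] ideal_span.zero[of U u I]
    by (intro U.add.subgroupI) (auto simp: a_inv_def)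
  then show ?thesis by (rule additive_subgroupI)
qed

lemma ideal_span_left:
  assumes s: "s \<in> carrier R" and K: "K \<subseteq> carrier R" and L: "L \<subseteq> carrier R"
    and sK: "\<And>t. t \<in> K \<Longrightarrow> s \<otimes>\<^bsub>R\<^esub> t \<in> L" and "x \<in> IU K"
  shows "u s \<otimes> x \<in> IU L"
  using assms(5)
proof (induction rule: ideal_span.induct)
  case zero then show ?case using s by (simp add: ideal_span.zero)
next
  case (step x i w)
  have "u s \<otimes> (x \<oplus> u i \<otimes> w) = u s \<otimes> x \<oplus> u (s \<otimes>\<^bsub>R\<^esub> i) \<otimes> w"
    using step ideal_span_closed[OF step(1) K] K s by (auto simp: U.r_distr U.m_assoc subset_iff)
  then show ?case using ideal_span.step[OF step.IH sK[OF step(2)] step(3)] by simp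
qed

lemma ideal_span_mono:
  assumes "x \<in> IU I" "I \<subseteq> J" shows "x \<in> IU J"
  using assms(1) by (induction rule: ideal_span.induct) (use assms(2) in \<open>auto intro: ideal_span.intros\<close>)

lemma quotient_right_module_facts:
  assumes I: "right_ideal I R"
  defines "Q \<equiv> quotient_right_module R I"
  shows "ops_closed R Q"
    and "carrier Q = {I +>\<^bsub>R\<^esub> r | r. r \<in> carrier R}"
    and "\<And>a b. a \<in> carrier R \<Longrightarrow> b \<in> carrier R \<Longrightarrow> (I +>\<^bsub>R\<^esub> a) \<oplus>\<^bsub>Q\<^esub> (I +>\<^bsub>R\<^esub> b) = I +>\<^bsub>R\<^esub> (a \<oplus>\<^bsub>R\<^esub> b)"
    and "\<And>a r. a \<in> carrier R \<Longrightarrow> r \<in> carrier R \<Longrightarrow> r \<odot>\<^bsub>Q\<^esub> (I +>\<^bsub>R\<^esub> a) = I +>\<^bsub>R\<^esub> (a \<otimes>\<^bsub>R\<^esub> r)"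
proof -
  have add: "additive_subgroup I R" using I by (simp add: right_ideal_def)
  interpret I: abelian_subgroup I R
    by (rule abelian_subgroupI3[OF add R.abelian_group_axioms])
  show carr: "carrier Q = {I +>\<^bsub>R\<^esub> r | r. r \<in> carrier R}"
    by (auto simp: Q_def quotient_right_module_def A_RCOSETS_def')
  show sum: "(I +>\<^bsub>R\<^esub> a) \<oplus>\<^bsub>Q\<^esub> (I +>\<^bsub>R\<^esub> b) = I +>\<^bsub>R\<^esub> (a \<oplus>\<^bsub>R\<^esub> b)" if "a \<in> carrier R" "b \<in> carrier R" for a b
    using that by (simp add: Q_def quotient_right_module_def I.a_rcos_sum)
  show s: "r \<odot>\<^bsub>Q\<^esub> (I +>\<^bsub>R\<^esub> a) = I +>\<^bsub>R\<^esub> (a \<otimes>\<^bsub>R\<^esub> r)" if "a \<in> carrier R" "r \<in> carrier R" for a r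
  proof -
    have "I +>\<^bsub>R\<^esub> (x \<otimes>\<^bsub>R\<^esub> r) = I +>\<^bsub>R\<^esub> (a \<otimes>\<^bsub>R\<^esub> r)" if "x \<in> I +>\<^bsub>R\<^esub> a" for x
    proof (rule R.coset_eqI[OF add])
      have x: "x \<in> carrier R" "x \<ominus>\<^bsub>R\<^esub> a \<in> I" using that R.coset_iff[OF add] \<open>a \<in> carrier R\<close> by auto
      then show "x \<otimes>\<^bsub>R\<^esub> r \<in> carrier R" "a \<otimes>\<^bsub>R\<^esub> r \<in> carrier R"
        using \<open>a \<in> carrier R\<close> \<open>r \<in> carrier R\<close> by auto
      have "x \<otimes>\<^bsub>R\<^esub> r \<ominus>\<^bsub>R\<^esub> a \<otimes>\<^bsub>R\<^esub> r = (x \<ominus>\<^bsub>R\<^esub> a) \<otimes>\<^bsub>R\<^esub> r"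
        using x \<open>a \<in> carrier R\<close> \<open>r \<in> carrier R\<close> by (simp add: a_minus_def R.l_distr R.l_minus)
      then show "x \<otimes>\<^bsub>R\<^esub> r \<ominus>\<^bsub>R\<^esub> a \<otimes>\<^bsub>R\<^esub> r \<in> I"
        using I x \<open>r \<in> carrier R\<close> by (auto simp: right_ideal_def)
    qed
    moreover have "I +>\<^bsub>R\<^esub> a \<noteq> {}" using R.coset_self[OF add] that by blast
    ultimately have "(\<Union>x \<in> I +>\<^bsub>R\<^esub> a. I +>\<^bsub>R\<^esub> (x \<otimes>\<^bsub>R\<^esub> r)) = I +>\<^bsub>R\<^esub> (a \<otimes>\<^bsub>R\<^esub> r)"
      by (intro SUP_eq_const) auto
    then show ?thesis by (simp add: Q_def quotient_right_module_def)
  qed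
  show "ops_closed R Q"
    unfolding ops_closed_def
  proof (intro conjI ballI)
    fix X Y assume "X \<in> carrier Q" "Y \<in> carrier Q"
    then obtain a b where "a \<in> carrier R" "b \<in> carrier R" "X = I +>\<^bsub>R\<^esub> a" "Y = I +>\<^bsub>R\<^esub> b"
      unfolding carr by auto
    then show "X \<oplus>\<^bsub>Q\<^esub> Y \<in> carrier Q"
      unfolding carr by (intro CollectI exI[of _ "a \<oplus>\<^bsub>R\<^esub> b"]) (simp add: sum)
  next
    fix r X assume "r \<in> carrier R" "X \<in> carrier Q"
    then obtain a where "a \<in> carrier R" "X = I +>\<^bsub>R\<^esub> a" unfolding carr by auto
    then show "r \<odot>\<^bsub>Q\<^esub> X \<in> carrier Q"
      unfolding carr using \<open>r \<in> carrier R\<close> by (intro CollectI exI[of _ "a \<otimes>\<^bsub>R\<^esub> r"]) (simp add: s)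
  qed
qed

text \<open>
  \<open>(R/I) \<otimes> U\<close> is \<open>U/IU\<close>.  If it vanishes, the pairing \<open>(r + I, w) \<mapsto> r w\<close>, which is well
  defined modulo \<open>I U\<close>, takes \<open>(1 + I) \<otimes> 1\<close> to an element of \<open>I U\<close>.  Conversely, if \<open>1\<close> is a
  sum of products \<open>i w\<close> with \<open>i\<close> in \<open>I\<close>, then so is every element of \<open>U\<close>, and
  \<open>(1 + I) \<otimes> i w = (i + I) \<otimes> w = 0\<close>.
\<close>

lemma gabriel_iff: "I \<in> \<GG> \<longleftrightarrow> right_ideal I R \<and> \<one> \<in> IU I"
proof (cases "right_ideal I R")
  case I: True
  let ?Q = "quotient_right_module R I"
  note Q = quotient_right_module_facts[OF I]
  have add: "additive_subgroup I R" using I by (simp add: right_ideal_def)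
  have IR: "I \<subseteq> carrier R" using right_ideal_subset[OF I] by blast
  interpret N: additive_subgroup "IU I" U by (rule ideal_span_subgroup[OF IR])
  let ?K = "tensor_kernel R ?Q UL"
  have "trivial_group (tensor R ?Q UL) \<longleftrightarrow> \<one> \<in> IU I"
  proof
    assume "trivial_group (tensor R ?Q UL)"
    then have pure: "frag_of (X, w) \<in> ?K" if "X \<in> carrier ?Q" "w \<in> carrier U" for X w
      using trivial_tensor_iff[OF Q(1) UL_ops] that by simp
    \<comment> \<open>The pairing on cosets is evaluated at chosen representatives.\<close>
    define rep where "rep X = (SOME r. r \<in> X)" for X :: "'r set"
    have rep: "rep (I +>\<^bsub>R\<^esub> a) \<in> carrier R" "rep (I +>\<^bsub>R\<^esub> a) \<ominus>\<^bsub>R\<^esub> a \<in> I" if "a \<in> carrier R" for a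
      using R.coset_iff[OF add that] someI[of "\<lambda>r. r \<in> I +>\<^bsub>R\<^esub> a", OF R.coset_self[OF add that]]
      by (auto simp: rep_def)
    have reps: "I +>\<^bsub>R\<^esub> rep (I +>\<^bsub>R\<^esub> a) = I +>\<^bsub>R\<^esub> a" if "a \<in> carrier R" for a
      by (rule R.coset_eqI[OF add]) (use rep that in auto)
    obtain h where h: "\<And>a m. a \<in> carrier ?Q \<Longrightarrow> m \<in> carrier UL \<Longrightarrow> h (frag_of (a, m)) = u (rep a) \<otimes> m"
      and hK: "\<And>c. c \<in> ?K \<Longrightarrow> h c \<in> IU I"
    proof (rule tensor_kernel_eval[OF Q(1) UL_ops U.abelian_group_axioms ideal_span_subgroup[OF IR],
          where \<beta> = "\<lambda>X w. u (rep X) \<otimes> w"])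
      fix X m assume "X \<in> carrier ?Q" and m: "m \<in> carrier UL"
      then obtain a where a: "a \<in> carrier R" "X = I +>\<^bsub>R\<^esub> a" unfolding Q(2) by auto
      then show "u (rep X) \<otimes> m \<in> carrier U" using rep m by simp
      fix n assume n: "n \<in> carrier UL"
      show "u (rep X) \<otimes> (m \<oplus>\<^bsub>UL\<^esub> n) \<ominus> u (rep X) \<otimes> m \<ominus> u (rep X) \<otimes> n \<in> IU I"
      proof -
        have "u (rep X) \<otimes> (m \<oplus>\<^bsub>UL\<^esub> n) \<ominus> u (rep X) \<otimes> m \<ominus> u (rep X) \<otimes> n = \<zero>"
          using rep a m n by (simp add: U.r_distr U.add_diff_left U.diff_eq_zero_iff)
        then show ?thesis using N.zero_closed by simp
      qed
    next
      fix X Y m assume "X \<in> carrier ?Q" "Y \<in> carrier ?Q" and m: "m \<in> carrier UL"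
      then obtain a b where a: "a \<in> carrier R" "X = I +>\<^bsub>R\<^esub> a" and b: "b \<in> carrier R" "Y = I +>\<^bsub>R\<^esub> b"
        unfolding Q(2) by auto
      let ?r = "rep (X \<oplus>\<^bsub>?Q\<^esub> Y)"
      have XY: "X \<oplus>\<^bsub>?Q\<^esub> Y = I +>\<^bsub>R\<^esub> (rep X \<oplus>\<^bsub>R\<^esub> rep Y)"
        using Q(3)[of "rep X" "rep Y"] a b rep reps by simp
      have r: "?r \<in> carrier R" "?r \<ominus>\<^bsub>R\<^esub> (rep X \<oplus>\<^bsub>R\<^esub> rep Y) \<in> I"
        using XY rep a b by auto
      have "u ?r \<otimes> m \<ominus> u (rep X) \<otimes> m \<ominus> u (rep Y) \<otimes> m
          = u (?r \<ominus>\<^bsub>R\<^esub> (rep X \<oplus>\<^bsub>R\<^esub> rep Y)) \<otimes> m"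
        using r rep a b m by (simp add: a_minus_def U.l_distr U.l_minus U.minus_add U.a_ac)
      then show "u ?r \<otimes> m \<ominus> u (rep X) \<otimes> m \<ominus> u (rep Y) \<otimes> m \<in> IU I"
        using ideal_span_incl[OF IR r(2)] m by simp
    next
      fix X s m assume "X \<in> carrier ?Q" and s: "s \<in> carrier R" and m: "m \<in> carrier UL"
      then obtain a where a: "a \<in> carrier R" "X = I +>\<^bsub>R\<^esub> a" unfolding Q(2) by auto
      have X: "X = I +>\<^bsub>R\<^esub> rep X"
        using a reps by simp
      let ?r = "rep (s \<odot>\<^bsub>?Q\<^esub> X)"
      have r: "?r \<in> carrier R" "?r \<ominus>\<^bsub>R\<^esub> rep X \<otimes>\<^bsub>R\<^esub> s \<in> I"
        using rep[of "rep X \<otimes>\<^bsub>R\<^esub> s"] Q(4)[of "rep X" s] X rep[of a] a s by auto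
      have "u ?r \<otimes> m \<ominus> u (rep X) \<otimes> (s \<odot>\<^bsub>UL\<^esub> m) = u (?r \<ominus>\<^bsub>R\<^esub> rep X \<otimes>\<^bsub>R\<^esub> s) \<otimes> m"
        using r rep a s m by (simp add: a_minus_def U.l_distr U.l_minus U.m_assoc)
      then show "u ?r \<otimes> m \<ominus> u (rep X) \<otimes> (s \<odot>\<^bsub>UL\<^esub> m) \<in> IU I"
        using ideal_span_incl[OF IR r(2)] m by simp
    qed blast
    let ?E = "I +>\<^bsub>R\<^esub> \<one>\<^bsub>R\<^esub>"
    have E: "?E \<in> carrier ?Q" unfolding Q(2) by auto
    have 1: "u (rep ?E) \<in> IU I"
      using hK[OF pure[OF E U.one_closed]] h[OF E] rep[of "\<one>\<^bsub>R\<^esub>"] by simp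
    have 2: "u (rep ?E \<ominus>\<^bsub>R\<^esub> \<one>\<^bsub>R\<^esub>) \<in> IU I"
      using ideal_span_incl[OF IR rep(2)[OF R.one_closed] U.one_closed] rep[of "\<one>\<^bsub>R\<^esub>"] by simp
    have "\<one> = u (rep ?E) \<ominus> u (rep ?E \<ominus>\<^bsub>R\<^esub> \<one>\<^bsub>R\<^esub>)"
      using rep[of "\<one>\<^bsub>R\<^esub>"] by (simp add: a_minus_def U.minus_add U.r_neg2)
    then show "\<one> \<in> IU I"
      using U.subgroup_diff_closed[OF ideal_span_subgroup[OF IR] 1 2] by simp
  next
    assume one: "\<one> \<in> IU I"
    let ?E = "I +>\<^bsub>R\<^esub> \<one>\<^bsub>R\<^esub>"
    have E: "?E \<in> carrier ?Q" unfolding Q(2) by auto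
    have I0: "I \<in> carrier ?Q"
      unfolding Q(2) using R.coset_eq_self_iff[OF add R.zero_closed] additive_subgroup.zero_closed[OF add]
      by (intro CollectI exI[of _ "\<zero>\<^bsub>R\<^esub>"]) simp
    have II: "I \<oplus>\<^bsub>?Q\<^esub> I = I"
      using Q(3)[OF R.zero_closed R.zero_closed] R.coset_eq_self_iff[OF add R.zero_closed]
        additive_subgroup.zero_closed[OF add] by simp
    note K = tensor_kernel_left_add[OF Q(1) UL_ops] tensor_kernel_right_add[OF Q(1) UL_ops]
      tensor_kernel_balanced[OF Q(1) UL_ops]
    note Kdiff = tensor_kernel_diff[OF Q(1) UL_ops] and Kadd = tensor_kernel_add[OF Q(1) UL_ops]
      and Kneg = tensor_kernel_neg[OF Q(1) UL_ops]
    have KI: "frag_of (I, w) \<in> ?K" if "w \<in> carrier U" for w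
      using Kneg[OF K(1)[OF I0 I0, of w]] that by (simp add: II)
    have KE: "frag_of (?E, x) \<in> ?K" if "x \<in> IU I" for x
      using that
    proof (induction rule: ideal_span.induct)
      case zero
      show ?case using Kneg[OF K(2)[OF E, of "\<zero>" "\<zero>"]] by simp
    next
      case (step x i w)
      have x: "x \<in> carrier U" using ideal_span_closed[OF step(1) IR] .
      have i: "i \<in> carrier R" using step IR by auto
      have "i \<odot>\<^bsub>?Q\<^esub> ?E = I"
        using Q(4)[OF R.one_closed i] i R.coset_eq_self_iff[OF add i] step by simp
      then have "frag_of (I, w) - frag_of (?E, u i \<otimes> w) \<in> ?K"
        using K(3)[OF E i, of w] step by simp
      then have c: "frag_of (?E, u i \<otimes> w) \<in> ?K"
        using Kdiff[OF KI[OF step(3)]] by fastforce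
      have d: "frag_of (?E, x \<oplus> u i \<otimes> w) - frag_of (?E, x) - frag_of (?E, u i \<otimes> w) \<in> ?K"
        using K(2)[OF E, of x "u i \<otimes> w"] x i step by simp
      show ?case using Kadd[OF Kadd[OF d step.IH] c] by simp
    qed
    have "frag_of (X, w) \<in> ?K" if X: "X \<in> carrier ?Q" and w: "w \<in> carrier U" for X w
    proof -
      obtain r where r: "r \<in> carrier R" "X = I +>\<^bsub>R\<^esub> r" using X unfolding Q(2) by auto
      have "r \<odot>\<^bsub>?Q\<^esub> ?E = X" using Q(4)[OF R.one_closed r(1)] r by simp
      then have "frag_of (X, w) - frag_of (?E, u r \<otimes> w) \<in> ?K"
        using K(3)[OF E r(1), of w] w by simp
      moreover have "u r \<otimes> w \<in> IU I"
        using ideal_span_rmult[OF IR _ one, of "u r \<otimes> w"] r w by simp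
      ultimately show ?thesis using KE Kadd by fastforce
    qed
    then show "trivial_group (tensor R ?Q UL)"
      using trivial_tensor_iff[OF Q(1) UL_ops] by simp
  qed
  then show ?thesis by (simp add: gabriel_topology_def)
qed (simp add: gabriel_topology_def)

end

context flat_epi
begin

subsection \<open>Denominators of elements of the overring\<close>

text \<open>
  The list \<open>[x\<^sub>1, y\<^sub>1, x\<^sub>2, y\<^sub>2, \<dots>]\<close> stands for \<open>\<Sum> x\<^sub>i \<otimes> y\<^sub>i\<close>.
\<close>

fun tensor_decode :: "'u list \<Rightarrow> ('u \<times> 'u \<Rightarrow>\<^sub>0 int)" where
  "tensor_decode (x # y # l) = frag_of (x, y) + tensor_decode l"
| "tensor_decode l = 0"

lemma tensor_decode_append: "even (length l) \<Longrightarrow> tensor_decode (l @ l') = tensor_decode l + tensor_decode l'"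
  by (induction l rule: tensor_decode.induct) (auto simp: add.assoc)

abbreviation KU :: "('u \<times> 'u \<Rightarrow>\<^sub>0 int) set" where "KU \<equiv> tensor_kernel R UR UL"

lemmas KU_zero = tensor_kernel_zero[OF UR_ops UL_ops]
  and KU_add = tensor_kernel_add[OF UR_ops UL_ops]
  and KU_diff = tensor_kernel_diff[OF UR_ops UL_ops]
  and KU_neg = tensor_kernel_neg[OF UR_ops UL_ops]
  and KU_left_add = tensor_kernel_left_add[OF UR_ops UL_ops, simplified]
  and KU_right_add = tensor_kernel_right_add[OF UR_ops UL_ops, simplified]
  and KU_balanced = tensor_kernel_balanced[OF UR_ops UL_ops, simplified]

text \<open>
  Every element of \<open>U \<otimes> U\<close> is a sum of pure tensors.  The claim about \<open>- c\<close> is carried along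
  because the induction principle for the free abelian group forms differences.
\<close>

lemma tensor_decode_surj:
  assumes "Poly_Mapping.keys c \<subseteq> carrier U \<times> carrier U"
  shows "\<exists>l. even (length l) \<and> c - tensor_decode l \<in> KU \<and> (\<exists>l'. even (length l') \<and> - c - tensor_decode l' \<in> KU)"
proof (rule free_Abelian_group_induct[OF assms])
  show "\<exists>l. even (length l) \<and> 0 - tensor_decode l \<in> KU \<and> (\<exists>l'. even (length l') \<and> - 0 - tensor_decode l' \<in> KU)"
    by (rule exI[of _ "[]"]) (auto simp: KU_zero intro!: exI[of _ "[]"])
next
  fix c d
  assume "\<exists>l. even (length l) \<and> c - tensor_decode l \<in> KU \<and> (\<exists>l'. even (length l') \<and> - c - tensor_decode l' \<in> KU)"
    and "\<exists>l. even (length l) \<and> d - tensor_decode l \<in> KU \<and> (\<exists>l'. even (length l') \<and> - d - tensor_decode l' \<in> KU)"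
  then obtain l l' m m' where l: "even (length l)" "c - tensor_decode l \<in> KU" "even (length l')" "- c - tensor_decode l' \<in> KU"
    and m: "even (length m)" "d - tensor_decode m \<in> KU" "even (length m')" "- d - tensor_decode m' \<in> KU" by blast
  have 1: "c - d - tensor_decode (l @ m') \<in> KU"
    using KU_add[OF l(2) m(4)] l by (simp add: tensor_decode_append algebra_simps)
  have 2: "- (c - d) - tensor_decode (l' @ m) \<in> KU"
    using KU_add[OF l(4) m(2)] l by (simp add: tensor_decode_append algebra_simps)
  show "\<exists>l. even (length l) \<and> c - d - tensor_decode l \<in> KU \<and>
      (\<exists>l'. even (length l') \<and> - (c - d) - tensor_decode l' \<in> KU)"
    using 1 2 l m by (intro exI[of _ "l @ m'"] conjI exI[of _ "l' @ m"]) auto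
next
  fix a assume "a \<in> carrier U \<times> carrier U"
  then obtain x y where a: "a = (x, y)" "x \<in> carrier U" "y \<in> carrier U" by blast
  have z: "frag_of (\<zero>, y) \<in> KU"
    using KU_neg[OF KU_left_add[of "\<zero>" "\<zero>" y]] a by simp
  have "frag_of (\<zero>, y) - frag_of (x, y) - frag_of (\<ominus> x, y) \<in> KU"
    using KU_left_add[of x "\<ominus> x" y] a by (simp add: U.r_neg)
  then have "- frag_of (x, y) - tensor_decode [\<ominus> x, y] \<in> KU"
    using KU_diff[OF _ z] by fastforce
  then show "\<exists>l. even (length l) \<and> frag_of a - tensor_decode l \<in> KU \<and>
      (\<exists>l'. even (length l') \<and> - frag_of a - tensor_decode l' \<in> KU)"
    using a KU_zero by (intro exI[of _ "[x, y]"] conjI exI[of _ "[\<ominus> x, y]"]) auto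
qed

text \<open>
  The set of lists among which the choice is made depends only on the class of \<open>c\<close>, so this is an
  injection of \<open>U \<otimes> U\<close> into the lists.
\<close>

definition tensor_code :: "('u \<times> 'u \<Rightarrow>\<^sub>0 int) \<Rightarrow> 'u list" where
  "tensor_code c = (SOME l. c - tensor_decode l \<in> KU)"

lemma tensor_code_eq_iff:
  assumes c: "Poly_Mapping.keys c \<subseteq> carrier U \<times> carrier U" and d: "Poly_Mapping.keys d \<subseteq> carrier U \<times> carrier U"
  shows "tensor_code c = tensor_code d \<longleftrightarrow> c - d \<in> KU"
proof
  have *: "e - tensor_decode (tensor_code e) \<in> KU" if "Poly_Mapping.keys e \<subseteq> carrier U \<times> carrier U" for e
    unfolding tensor_code_def using tensor_decode_surj[OF that] by (metis (mono_tags, lifting) someI_ex)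
  assume "tensor_code c = tensor_code d"
  then show "c - d \<in> KU" using KU_diff[OF *[OF c] *[OF d]] by simp
next
  assume cd: "c - d \<in> KU"
  have "c - tensor_decode l \<in> KU \<longleftrightarrow> d - tensor_decode l \<in> KU" for l
    using KU_diff[OF _ cd, of "c - tensor_decode l"] KU_add[OF _ cd, of "d - tensor_decode l"] by auto
  then show "tensor_code c = tensor_code d" by (simp add: tensor_code_def)
qed

abbreviation lact :: "'u \<Rightarrow> ('u \<times> 'u \<Rightarrow>\<^sub>0 int) \<Rightarrow> ('u \<times> 'u \<Rightarrow>\<^sub>0 int)" where
  "lact w \<equiv> frag_map2 (\<lambda>x. w \<otimes> x) (\<lambda>y. y)"
abbreviation ract :: "('u \<times> 'u \<Rightarrow>\<^sub>0 int) \<Rightarrow> 'u \<Rightarrow> ('u \<times> 'u \<Rightarrow>\<^sub>0 int)" where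
  "ract c w \<equiv> frag_map2 (\<lambda>x. x) (\<lambda>y. y \<otimes> w) c"

lemma lact_kernel: "w \<in> carrier U \<Longrightarrow> c \<in> KU \<Longrightarrow> lact w c \<in> KU"
  by (rule frag_map2_tensor_kernel[OF UR_ops UL_ops UR_ops UL_ops])
    (auto simp: linear_map_def U.r_distr U.m_assoc)

lemma ract_kernel: "w \<in> carrier U \<Longrightarrow> c \<in> KU \<Longrightarrow> ract c w \<in> KU"
  by (rule frag_map2_tensor_kernel[OF UR_ops UL_ops UR_ops UL_ops])
    (auto simp: linear_map_def U.l_distr U.m_assoc)

lemma frag_map2_keys:
  assumes "Poly_Mapping.keys c \<subseteq> A \<times> B" "f \<in> A \<rightarrow> A'" "g \<in> B \<rightarrow> B'"
  shows "Poly_Mapping.keys (frag_map2 f g c) \<subseteq> A' \<times> B'"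
proof -
  have "Poly_Mapping.keys (frag_map2 f g c) \<subseteq>
      (\<Union>x \<in> Poly_Mapping.keys c. Poly_Mapping.keys ((\<lambda>(a, m). frag_of (f a, g m)) x))"
    by (rule keys_frag_extend)
  also have "\<dots> \<subseteq> A' \<times> B'" using assms by (fastforce simp: keys_frag_of)
  finally show ?thesis .
qed

text \<open>
  The trivial extension of \<open>U\<close> by the bimodule \<open>U \<otimes> U\<close> (pairs with product
  \<open>(w, c) (w', c') = (w w', w c' + c w')\<close>) receives two homomorphisms from \<open>U\<close>: the inclusion, and
  its sum with the inner derivation \<open>w \<mapsto> w \<otimes> 1 - 1 \<otimes> w\<close>.  They agree on \<open>R\<close>, hence on \<open>U\<close>,
  because \<open>u\<close> is an epimorphism; so the derivation vanishes.
\<close>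

lemma tensor_commutes:
  assumes v: "v \<in> carrier U"
  shows "frag_of (v, \<one>) - frag_of (\<one>, v) \<in> KU"
proof -
  let ?F = "{c. Poly_Mapping.keys c \<subseteq> carrier U \<times> carrier U} :: ('u \<times> 'u \<Rightarrow>\<^sub>0 int) set"
  define P where "P = carrier U \<times> ?F"
  define pl where "pl = (\<lambda>p q :: 'u \<times> ('u \<times> 'u \<Rightarrow>\<^sub>0 int). (fst p \<oplus> fst q, snd p + snd q))"
  define ml where "ml = (\<lambda>p q :: 'u \<times> ('u \<times> 'u \<Rightarrow>\<^sub>0 int).
    (fst p \<otimes> fst q, lact (fst p) (snd q) + ract (snd p) (fst q)))"
  define enc where "enc = (\<lambda>p :: 'u \<times> ('u \<times> 'u \<Rightarrow>\<^sub>0 int). fst p # tensor_code (snd p))"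
  have P: "p \<in> P \<longleftrightarrow> fst p \<in> carrier U \<and> snd p \<in> ?F" for p by (cases p) (auto simp: P_def)
  have enc_eq: "enc p = enc q \<longleftrightarrow> fst p = fst q \<and> snd p - snd q \<in> KU" if "p \<in> P" "q \<in> P" for p q
    using that tensor_code_eq_iff by (auto simp: enc_def P)
  have lF: "lact w c \<in> ?F" if "w \<in> carrier U" "c \<in> ?F" for w c
    by (intro CollectI frag_map2_keys[where A = "carrier U" and B = "carrier U"]) (use that in auto)
  have rF: "ract c w \<in> ?F" if "w \<in> carrier U" "c \<in> ?F" for w c
    by (intro CollectI frag_map2_keys[where A = "carrier U" and B = "carrier U"]) (use that in auto)
  have addF: "c + d \<in> ?F" if "c \<in> ?F" "d \<in> ?F" for c d using that keys_add_subset by (intro CollectI) simp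
  have ind: "c \<in> ?F \<Longrightarrow> Q 0 \<Longrightarrow> (\<And>c d. c \<in> ?F \<Longrightarrow> d \<in> ?F \<Longrightarrow> Q c \<Longrightarrow> Q d \<Longrightarrow> Q (c - d)) \<Longrightarrow>
      (\<And>x y. x \<in> carrier U \<Longrightarrow> y \<in> carrier U \<Longrightarrow> Q (frag_of (x, y))) \<Longrightarrow> Q c" for Q c
    using free_Abelian_group_induct[of c "carrier U \<times> carrier U" Q] by auto
  note lin = frag_extend_add frag_extend_diff frag_extend_minus
  have ll: "lact (w \<otimes> w') c = lact w (lact w' c)" if w: "w \<in> carrier U" "w' \<in> carrier U" and c: "c \<in> ?F" for w w' c
    by (rule ind[OF c]) (use w in \<open>auto simp: lin U.m_assoc\<close>)
  have rr: "ract c (w \<otimes> w') = ract (ract c w) w'" if w: "w \<in> carrier U" "w' \<in> carrier U" and c: "c \<in> ?F" for w w' c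
    by (rule ind[OF c]) (use w in \<open>auto simp: lin U.m_assoc\<close>)
  have lr: "ract (lact w c) w' = lact w (ract c w')" if c: "c \<in> ?F" for w w' c
    by (rule ind[OF c]) (auto simp: lin)
  have l1: "lact \<one> c = c" if c: "c \<in> ?F" for c
    by (rule ind[OF c]) (auto simp: lin)
  have r1: "ract c \<one> = c" if c: "c \<in> ?F" for c
    by (rule ind[OF c]) (auto simp: lin)
  have la: "lact (w \<oplus> w') c - lact w c - lact w' c \<in> KU" if w: "w \<in> carrier U" "w' \<in> carrier U" and c: "c \<in> ?F" for w w' c
  proof (rule ind[OF c])
    fix c d assume "lact (w \<oplus> w') c - lact w c - lact w' c \<in> KU" "lact (w \<oplus> w') d - lact w d - lact w' d \<in> KU"
    from KU_diff[OF this] show "lact (w \<oplus> w') (c - d) - lact w (c - d) - lact w' (c - d) \<in> KU"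
      by (simp add: lin algebra_simps)
  next
    fix x y assume "x \<in> carrier U" "y \<in> carrier U"
    then show "lact (w \<oplus> w') (frag_of (x, y)) - lact w (frag_of (x, y)) - lact w' (frag_of (x, y)) \<in> KU"
      using KU_left_add[of "w \<otimes> x" "w' \<otimes> x" y] w by (simp add: U.l_distr)
  qed (simp add: KU_zero)
  have ra: "ract c (w \<oplus> w') - ract c w - ract c w' \<in> KU" if w: "w \<in> carrier U" "w' \<in> carrier U" and c: "c \<in> ?F" for w w' c
  proof (rule ind[OF c])
    fix c d assume "ract c (w \<oplus> w') - ract c w - ract c w' \<in> KU" "ract d (w \<oplus> w') - ract d w - ract d w' \<in> KU"
    from KU_diff[OF this] show "ract (c - d) (w \<oplus> w') - ract (c - d) w - ract (c - d) w' \<in> KU"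
      by (simp add: lin algebra_simps)
  next
    fix x y assume "x \<in> carrier U" "y \<in> carrier U"
    then show "ract (frag_of (x, y)) (w \<oplus> w') - ract (frag_of (x, y)) w - ract (frag_of (x, y)) w' \<in> KU"
      using KU_right_add[of x "y \<otimes> w" "y \<otimes> w'"] w by (simp add: U.r_distr)
  qed (simp add: KU_zero)
  have plP: "pl p q \<in> P" if "p \<in> P" "q \<in> P" for p q
    using that addF[of "snd p" "snd q"] by (simp add: P pl_def)
  have mlP: "ml p q \<in> P" if "p \<in> P" "q \<in> P" for p q
    using that addF[OF lF rF, of "fst p" "snd q" "fst q" "snd p"] by (simp add: P ml_def)
  let ?z = "(\<zero>, 0) :: 'u \<times> ('u \<times> 'u \<Rightarrow>\<^sub>0 int)" and ?e = "(\<one>, 0) :: 'u \<times> ('u \<times> 'u \<Rightarrow>\<^sub>0 int)"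
  obtain S :: "'u list ring" where S: "ring S" "carrier S = enc ` P"
    and Sadd: "\<And>p q. p \<in> P \<Longrightarrow> q \<in> P \<Longrightarrow> enc p \<oplus>\<^bsub>S\<^esub> enc q = enc (pl p q)"
    and Smul: "\<And>p q. p \<in> P \<Longrightarrow> q \<in> P \<Longrightarrow> enc p \<otimes>\<^bsub>S\<^esub> enc q = enc (ml p q)"
    and Sone: "\<one>\<^bsub>S\<^esub> = enc ?e"
  proof (rule coded_ring_exists[where P = P and pl = pl and ml = ml and enc = enc and z = ?z and e = ?e])
    show "?z \<in> P" "?e \<in> P" by (auto simp: P)
  next
    fix p p' q q' assume pq: "p \<in> P" "p' \<in> P" "q \<in> P" "q' \<in> P" and e: "enc p = enc p'" "enc q = enc q'"
    have e': "fst p = fst p'" "snd p - snd p' \<in> KU" "fst q = fst q'" "snd q - snd q' \<in> KU"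
      using pq e enc_eq by auto
    have "(lact (fst p) (snd q) + ract (snd p) (fst q)) - (lact (fst p) (snd q') + ract (snd p') (fst q)) \<in> KU"
      using KU_add[OF lact_kernel[OF _ e'(4), of "fst p"] ract_kernel[OF _ e'(2), of "fst q"]] pq
      by (simp add: P lin algebra_simps)
    moreover have "snd p + snd q - (snd p' + snd q') \<in> KU"
      using KU_add[OF e'(2,4)] by (simp add: algebra_simps)
    ultimately show "enc (pl p q) = enc (pl p' q') \<and> enc (ml p q) = enc (ml p' q')"
      using e' pq by (simp add: enc_eq plP mlP) (simp add: pl_def ml_def)
  next
    fix p assume p: "p \<in> P"
    show "\<exists>q\<in>P. enc (pl q p) = enc ?z"
      by (rule bexI[of _ "(\<ominus> fst p, - snd p)"]) (use p in \<open>auto simp: P pl_def U.l_neg\<close>)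
    show "enc (pl ?z p) = enc p" using p by (simp add: pl_def P enc_def)
    show "enc (ml ?e p) = enc p" "enc (ml p ?e) = enc p" using p by (simp_all add: ml_def P enc_def l1 r1)
    fix q assume q: "q \<in> P"
    show "enc (pl p q) = enc (pl q p)" using p q by (simp add: pl_def P U.a_comm add.commute)
    fix r assume r: "r \<in> P"
    show "enc (pl (pl p q) r) = enc (pl p (pl q r))"
      using p q r by (simp add: pl_def P U.a_assoc add.assoc)
    show "enc (ml (ml p q) r) = enc (ml p (ml q r))"
      using p q r by (simp add: ml_def P U.m_assoc ll rr lr lin lF[simplified] rF[simplified] algebra_simps)
    have "lact (fst p \<oplus> fst q) (snd r) + ract (snd p + snd q) (fst r) -
        (lact (fst p) (snd r) + ract (snd p) (fst r) + (lact (fst q) (snd r) + ract (snd q) (fst r))) \<in> KU"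
      using la[of "fst p" "fst q" "snd r"] p q r by (simp add: P lin algebra_simps)
    then show "enc (ml (pl p q) r) = enc (pl (ml p r) (ml q r))"
      using p q r by (simp add: enc_eq plP mlP) (simp add: pl_def ml_def P U.l_distr)
    have "lact (fst r) (snd p + snd q) + ract (snd r) (fst p \<oplus> fst q) -
        (lact (fst r) (snd p) + ract (snd r) (fst p) + (lact (fst r) (snd q) + ract (snd r) (fst q))) \<in> KU"
      using ra[of "fst p" "fst q" "snd r"] p q r by (simp add: P lin algebra_simps)
    then show "enc (ml r (pl p q)) = enc (pl (ml r p) (ml r q))"
      using p q r by (simp add: enc_eq plP mlP) (simp add: pl_def ml_def P U.r_distr)
  qed (use plP mlP in auto)
  define \<delta> where "\<delta> w = frag_of (w, \<one>) - frag_of (\<one>, w)" for w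
  have \<delta>F: "\<delta> w \<in> ?F" if "w \<in> carrier U" for w
    unfolding \<delta>_def by (intro CollectI keys_diff_subset frag_of_keys) (use that in auto)
  have dP: "(w, \<delta> w) \<in> P" "(w, 0) \<in> P" if "w \<in> carrier U" for w using \<delta>F[OF that] that by (auto simp: P_def)
  have f: "(\<lambda>w. enc (w, 0)) \<in> ring_hom U S"
    by (rule ring_hom_memI) (auto simp: S dP Sadd Smul Sone, auto simp: pl_def ml_def)
  have g: "(\<lambda>w. enc (w, \<delta> w)) \<in> ring_hom U S"
  proof (rule ring_hom_memI)
    fix w assume w: "w \<in> carrier U"
    then show "enc (w, \<delta> w) \<in> carrier S" using dP S by auto
    fix x assume x: "x \<in> carrier U"
    have "\<delta> (w \<otimes> x) = lact w (\<delta> x) + ract (\<delta> w) x"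
      using w x by (simp add: \<delta>_def lin)
    then show "enc (w \<otimes> x, \<delta> (w \<otimes> x)) = enc (w, \<delta> w) \<otimes>\<^bsub>S\<^esub> enc (x, \<delta> x)"
      using w x by (simp add: Smul dP ml_def)
    have "\<delta> (w \<oplus> x) - (\<delta> w + \<delta> x) \<in> KU"
      using KU_diff[OF KU_left_add[OF w x U.one_closed] KU_right_add[OF U.one_closed w x]]
      by (simp add: \<delta>_def algebra_simps)
    then show "enc (w \<oplus> x, \<delta> (w \<oplus> x)) = enc (w, \<delta> w) \<oplus>\<^bsub>S\<^esub> enc (x, \<delta> x)"
      using w x by (simp add: Sadd dP enc_eq plP) (simp add: pl_def)
  next
    show "enc (\<one>, \<delta> \<one>) = \<one>\<^bsub>S\<^esub>" by (simp add: Sone \<delta>_def)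
  qed
  have agree: "enc (u r, 0) = enc (u r, \<delta> (u r))" if r: "r \<in> carrier R" for r
  proof -
    have "0 - \<delta> (u r) \<in> KU"
      using KU_neg[OF KU_balanced[of "\<one>" r "\<one>"]] r by (simp add: \<delta>_def)
    then show ?thesis using r by (simp add: enc_eq dP)
  qed
  have "\<forall>f \<in> ring_hom U S. \<forall>g \<in> ring_hom U S.
      (\<forall>r \<in> carrier R. f (u r) = g (u r)) \<longrightarrow> (\<forall>v \<in> carrier U. f v = g v)"
    using epi S(1) by (simp add: ring_epimorphism_def)
  from this[rule_format, OF f g agree v] have "enc (v, 0) = enc (v, \<delta> v)" .
  then have "0 - \<delta> v \<in> KU" using v enc_eq dP by simp
  then show ?thesis using KU_neg[of "0 - \<delta> v"] by (simp add: \<delta>_def)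
qed

end

context flat_epi
begin

text \<open>
  Flatness is given for right modules with carrier in \<open>'r list\<close>.  The submodules of \<open>U\<close> that can be
  transported there include the finitely generated ones: a code for the elements of \<open>B\<close> and one for
  the elements of \<open>C\<close> are concatenated to a code for those of \<open>B + C\<close>.  Requiring the codes to have a
  fixed length makes the concatenation injective.
\<close>

definition submod :: "'u set \<Rightarrow> bool" where
  "submod B \<longleftrightarrow> B \<subseteq> carrier U \<and> \<zero> \<in> B \<and> (\<forall>x \<in> B. \<forall>y \<in> B. x \<oplus> y \<in> B) \<and>
     (\<forall>x \<in> B. \<forall>r \<in> carrier R. x \<otimes> u r \<in> B)"

definition small_submod :: "'u set \<Rightarrow> bool" where
  "small_submod B \<longleftrightarrow> submod B \<and>
     (\<exists>(enc :: 'u \<Rightarrow> 'r list) n. inj_on enc B \<and> (\<forall>x \<in> B. length (enc x) = n))"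

definition submod_sum :: "'u set \<Rightarrow> 'u set \<Rightarrow> 'u set" where
  "submod_sum B C = {x \<oplus> y | x y. x \<in> B \<and> y \<in> C}"

definition cyclic_submod :: "'u \<Rightarrow> 'u set" where
  "cyclic_submod w = {w \<otimes> u r | r. r \<in> carrier R}"

lemma submod_cyclic:
  assumes w: "w \<in> carrier U" shows "submod (cyclic_submod w)" "w \<in> cyclic_submod w"
proof -
  have m: "w \<otimes> u r \<in> cyclic_submod w" if "r \<in> carrier R" for r
    using that by (auto simp: cyclic_submod_def)
  show "w \<in> cyclic_submod w" using m[of "\<one>\<^bsub>R\<^esub>"] w by simp
  have "\<zero> \<in> cyclic_submod w" using m[of "\<zero>\<^bsub>R\<^esub>"] w by simp
  moreover have "w \<otimes> u r \<oplus> w \<otimes> u s \<in> cyclic_submod w" if "r \<in> carrier R" "s \<in> carrier R" for r s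
    using m[of "r \<oplus>\<^bsub>R\<^esub> s"] w that by (simp add: U.r_distr)
  moreover have "w \<otimes> u r \<otimes> u s \<in> cyclic_submod w" if "r \<in> carrier R" "s \<in> carrier R" for r s
    using m[of "r \<otimes>\<^bsub>R\<^esub> s"] w that by (simp add: U.m_assoc)
  ultimately show "submod (cyclic_submod w)"
    using w unfolding submod_def by (auto simp: cyclic_submod_def)
qed

lemma small_cyclic:
  assumes w: "w \<in> carrier U" shows "small_submod (cyclic_submod w)"
proof -
  define enc where "enc x = [SOME r. x = w \<otimes> u r]" for x
  have "x = w \<otimes> u (hd (enc x))" if "x \<in> cyclic_submod w" for x
    using that unfolding enc_def cyclic_submod_def by (auto intro: someI)
  then have "inj_on enc (cyclic_submod w)" by (metis inj_onI)
  then show ?thesis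
    unfolding small_submod_def using submod_cyclic[OF w] by (auto simp: enc_def)
qed

lemma submod_sum_props:
  assumes B: "submod B" and C: "submod C"
  shows "submod (submod_sum B C)" "B \<subseteq> submod_sum B C" "C \<subseteq> submod_sum B C"
proof -
  have BU: "x \<in> carrier U" if "x \<in> B" for x using that B by (auto simp: submod_def)
  have CU: "x \<in> carrier U" if "x \<in> C" for x using that C by (auto simp: submod_def)
  have m: "x \<oplus> y \<in> submod_sum B C" if "x \<in> B" "y \<in> C" for x y
    using that by (auto simp: submod_sum_def)
  have z: "\<zero> \<in> B" "\<zero> \<in> C" using B C by (auto simp: submod_def)
  show "B \<subseteq> submod_sum B C"
  proof
    fix x assume "x \<in> B" then show "x \<in> submod_sum B C" using m[OF _ z(2), of x] BU by simp
  qed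
  show "C \<subseteq> submod_sum B C"
  proof
    fix x assume "x \<in> C" then show "x \<in> submod_sum B C" using m[OF z(1), of x] CU by simp
  qed
  have "(x \<oplus> y) \<oplus> (x' \<oplus> y') \<in> submod_sum B C" if "x \<in> B" "y \<in> C" "x' \<in> B" "y' \<in> C" for x y x' y'
  proof -
    have "(x \<oplus> y) \<oplus> (x' \<oplus> y') = (x \<oplus> x') \<oplus> (y \<oplus> y')"
      using that BU CU by (simp add: U.a_ac)
    then show ?thesis using that B C by (auto simp: submod_def intro!: m)
  qed
  moreover have "(x \<oplus> y) \<otimes> u r \<in> submod_sum B C" if "x \<in> B" "y \<in> C" "r \<in> carrier R" for x y r
    using m[of "x \<otimes> u r" "y \<otimes> u r"] that B C BU CU by (auto simp: submod_def U.l_distr)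
  moreover have "\<zero> \<in> submod_sum B C" using m[OF z] by simp
  ultimately show "submod (submod_sum B C)"
    unfolding submod_def using BU CU by (auto simp: submod_sum_def)
qed

lemma small_sum:
  assumes B: "small_submod B" and C: "small_submod C"
  shows "small_submod (submod_sum B C)"
proof -
  obtain e1 :: "'u \<Rightarrow> 'r list" and n1 where e1: "inj_on e1 B" "\<And>x. x \<in> B \<Longrightarrow> length (e1 x) = n1"
    using B by (auto simp: small_submod_def)
  obtain e2 :: "'u \<Rightarrow> 'r list" and n2 where e2: "inj_on e2 C" "\<And>x. x \<in> C \<Longrightarrow> length (e2 x) = n2"
    using C by (auto simp: small_submod_def)
  have "\<exists>x y. x \<in> B \<and> y \<in> C \<and> z = x \<oplus> y" if "z \<in> submod_sum B C" for z
    using that by (auto simp: submod_sum_def)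
  then obtain f g where fg: "\<And>z. z \<in> submod_sum B C \<Longrightarrow> f z \<in> B \<and> g z \<in> C \<and> z = f z \<oplus> g z"
    by metis
  define enc where "enc z = e1 (f z) @ e2 (g z)" for z
  have "inj_on enc (submod_sum B C)"
  proof (rule inj_onI)
    fix z z' assume z: "z \<in> submod_sum B C" "z' \<in> submod_sum B C" "enc z = enc z'"
    then have "e1 (f z) = e1 (f z')" "e2 (g z) = e2 (g z')"
      using fg e1(2) e2(2) by (simp_all add: enc_def append_eq_append_conv)
    then have "f z = f z'" "g z = g z'"
      using fg[OF z(1)] fg[OF z(2)] inj_onD[OF e1(1)] inj_onD[OF e2(1)] by auto
    then show "z = z'" using fg[OF z(1)] fg[OF z(2)] by simp
  qed
  moreover have "\<forall>z \<in> submod_sum B C. length (enc z) = n1 + n2"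
    using fg e1(2) e2(2) by (simp add: enc_def)
  ultimately show ?thesis
    using submod_sum_props(1) B C unfolding small_submod_def by blast
qed

abbreviation sub_UR :: "'u set \<Rightarrow> ('r, 'u) module" where
  "sub_UR B \<equiv> UR\<lparr>carrier := B\<rparr>"

lemma sub_UR_simps [simp]: "x \<oplus>\<^bsub>sub_UR B\<^esub> y = x \<oplus> y" "r \<odot>\<^bsub>sub_UR B\<^esub> x = x \<otimes> u r"
  using UR_simps by simp_all

lemma sub_UR_ops: "submod B \<Longrightarrow> ops_closed R (sub_UR B)"
  by (simp add: ops_closed_def submod_def)

lemma sub_UR_mono:
  assumes "submod B" "submod C" "B \<subseteq> C" "c \<in> tensor_kernel R (sub_UR B) UL"
  shows "c \<in> tensor_kernel R (sub_UR C) UL"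
proof -
  have "frag_map2 (\<lambda>x. x) (\<lambda>x. x) c \<in> tensor_kernel R (sub_UR C) UL"
    by (rule frag_map2_tensor_kernel[OF sub_UR_ops[OF assms(1)] UL_ops sub_UR_ops[OF assms(2)] UL_ops _ _ assms(4)])
      (use assms in \<open>auto simp: linear_map_def\<close>)
  moreover have "frag_map2 (\<lambda>x. x) (\<lambda>x. x) c = c"
    using frag_expansion[of c] by (simp add: case_prod_beta')
  ultimately show ?thesis by simp
qed

text \<open>
  A proof that an element of \<open>U \<otimes> U\<close> vanishes uses finitely many elements of the left factor.
\<close>

lemma tensor_kernel_small:
  assumes "c \<in> KU"
  shows "\<exists>B. small_submod B \<and> c \<in> tensor_kernel R (sub_UR B) UL"
  using assms
proof (induction rule: tensor_kernel_induct[OF UR_ops UL_ops, consumes 1, case_names zero rel neg add])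
  case zero
  have "small_submod (cyclic_submod \<zero>)" by (rule small_cyclic) simp
  then show ?case
    using tensor_kernel_zero[OF sub_UR_ops UL_ops] by (auto simp: small_submod_def)
next
  case (rel c)
  have two: "\<exists>B. small_submod B \<and> a \<in> B \<and> b \<in> B" if "a \<in> carrier U" "b \<in> carrier U" for a b
    using small_sum[OF small_cyclic small_cyclic, OF that]
      submod_sum_props[OF submod_cyclic(1) submod_cyclic(1), OF that] submod_cyclic(2) that by blast
  have sm: "submod B" if "small_submod B" for B using that by (simp add: small_submod_def)
  from rel consider
    (1) a b m where "a \<in> carrier U" "b \<in> carrier U" "m \<in> carrier U"
      "c = frag_of (a \<oplus> b, m) - frag_of (a, m) - frag_of (b, m)"
  | (2) a m n where "a \<in> carrier U" "m \<in> carrier U" "n \<in> carrier U"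
      "c = frag_of (a, m \<oplus> n) - frag_of (a, m) - frag_of (a, n)"
  | (3) a r m where "a \<in> carrier U" "r \<in> carrier R" "m \<in> carrier U"
      "c = frag_of (a \<otimes> u r, m) - frag_of (a, u r \<otimes> m)"
    unfolding tensor_relations_def by auto
  then show ?case
  proof cases
    case 1
    obtain B where B: "small_submod B" "a \<in> B" "b \<in> B" using two 1 by blast
    have "c \<in> tensor_kernel R (sub_UR B) UL"
      using tensor_kernel_left_add[OF sub_UR_ops[OF sm[OF B(1)]] UL_ops, of a b m] 1 B by simp
    then show ?thesis using B by blast
  next
    case 2
    obtain B where B: "small_submod B" "a \<in> B" using two 2 by blast
    have "c \<in> tensor_kernel R (sub_UR B) UL"
      using tensor_kernel_right_add[OF sub_UR_ops[OF sm[OF B(1)]] UL_ops, of a m n] 2 B by simp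
    then show ?thesis using B by blast
  next
    case 3
    obtain B where B: "small_submod B" "a \<in> B" using two 3 by blast
    have "c \<in> tensor_kernel R (sub_UR B) UL"
      using tensor_kernel_balanced[OF sub_UR_ops[OF sm[OF B(1)]] UL_ops, of a r m] 3 B by simp
    then show ?thesis using B by blast
  qed
next
  case (neg c)
  then show ?case using tensor_kernel_neg[OF sub_UR_ops UL_ops] by (auto simp: small_submod_def)
next
  case (add c d)
  then obtain B C where B: "small_submod B" "c \<in> tensor_kernel R (sub_UR B) UL"
    and C: "small_submod C" "d \<in> tensor_kernel R (sub_UR C) UL" by blast
  have sm: "submod B" "submod C" using B C by (auto simp: small_submod_def)
  note S = submod_sum_props[OF sm]
  have "c + d \<in> tensor_kernel R (sub_UR (submod_sum B C)) UL"
    using tensor_kernel_add[OF sub_UR_ops[OF S(1)] UL_ops]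
      sub_UR_mono[OF sm(1) S(1,2) B(2)] sub_UR_mono[OF sm(2) S(1,3) C(2)] by blast
  then show ?case using small_sum B C by blast
qed

text \<open>
  The submodule \<open>D\<close> transported along a code for the larger submodule \<open>B\<close>; sharing the code turns an
  inclusion of submodules into an inclusion of the transported modules.
\<close>

definition coded_module :: "('u \<Rightarrow> 'l) \<Rightarrow> 'u set \<Rightarrow> 'u set \<Rightarrow> ('r, 'l) module" where
  "coded_module enc B D = \<lparr>carrier = enc ` D, monoid.mult = undefined, one = undefined,
     ring.zero = enc \<zero>,
     ring.add = (\<lambda>x y. enc (inv_into B enc x \<oplus> inv_into B enc y)),
     smult = (\<lambda>r x. enc (inv_into B enc x \<otimes> u r))\<rparr>"

lemma coded_module_props:
  assumes inj: "inj_on enc B" and DB: "D \<subseteq> B" and D: "submod D"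
  shows "right_module R (coded_module enc B D)"
    and "\<And>x y. x \<in> D \<Longrightarrow> y \<in> D \<Longrightarrow> enc x \<oplus>\<^bsub>coded_module enc B D\<^esub> enc y = enc (x \<oplus> y)"
    and "\<And>x r. x \<in> D \<Longrightarrow> r \<odot>\<^bsub>coded_module enc B D\<^esub> enc x = enc (x \<otimes> u r)"
    and "carrier (coded_module enc B D) = enc ` D"
proof -
  let ?D = "coded_module enc B D"
  have inv: "inv_into B enc (enc x) = x" if "x \<in> D" for x
    using inj DB that by (auto intro: inv_into_f_f)
  show add: "enc x \<oplus>\<^bsub>?D\<^esub> enc y = enc (x \<oplus> y)" if "x \<in> D" "y \<in> D" for x y
    using that by (simp add: coded_module_def inv)
  show sm: "r \<odot>\<^bsub>?D\<^esub> enc x = enc (x \<otimes> u r)" if "x \<in> D" for x r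
    using that by (simp add: coded_module_def inv)
  show carr: "carrier ?D = enc ` D" by (simp add: coded_module_def)
  have zero: "\<zero>\<^bsub>?D\<^esub> = enc \<zero>" by (simp add: coded_module_def)
  have zD: "\<zero> \<in> D" and addD: "\<And>x y. x \<in> D \<Longrightarrow> y \<in> D \<Longrightarrow> x \<oplus> y \<in> D"
    and smD: "\<And>x r. x \<in> D \<Longrightarrow> r \<in> carrier R \<Longrightarrow> x \<otimes> u r \<in> D"
    and DU: "\<And>x. x \<in> D \<Longrightarrow> x \<in> carrier U"
    using D by (auto simp: submod_def)
  have "abelian_group ?D"
  proof (rule abelian_groupI)
    fix x assume "x \<in> carrier ?D"
    then obtain x' where x: "x' \<in> D" "x = enc x'" by (auto simp: carr)
    have n: "x' \<otimes> u (\<ominus>\<^bsub>R\<^esub> \<one>\<^bsub>R\<^esub>) \<in> D"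
      by (rule smD[OF x(1) R.a_inv_closed[OF R.one_closed]])
    have "x' \<otimes> u (\<ominus>\<^bsub>R\<^esub> \<one>\<^bsub>R\<^esub>) \<oplus> x' = \<zero>"
      using DU x by (simp add: U.r_minus U.l_neg)
    then have "enc (x' \<otimes> u (\<ominus>\<^bsub>R\<^esub> \<one>\<^bsub>R\<^esub>)) \<oplus>\<^bsub>?D\<^esub> x = \<zero>\<^bsub>?D\<^esub>"
      using x n by (simp add: add zero)
    then show "\<exists>y\<in>carrier ?D. y \<oplus>\<^bsub>?D\<^esub> x = \<zero>\<^bsub>?D\<^esub>" using n carr by blast
  qed (auto simp: carr add zero zD addD DU U.a_assoc U.a_comm U.a_lcomm)
  moreover have "right_module_axioms R ?D"
    by standard (auto simp: carr add sm zD addD smD DU U.l_distr U.r_distr U.m_assoc)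
  ultimately show "right_module R ?D"
    by (simp add: right_module_def R.ring_axioms)
qed

lemma colon_right_ideal:
  assumes I: "right_ideal I R" and v: "v \<in> carrier U"
  shows "right_ideal (Colon I v) R"
proof (rule right_idealI)
  have IR: "i \<in> carrier R" if "i \<in> I" for i using right_ideal_subset[OF I that] .
  interpret I: additive_subgroup I R using I by (simp add: right_ideal_def)
  show "Colon I v \<subseteq> carrier R" by (auto simp: colon_def)
  show "\<zero>\<^bsub>R\<^esub> \<in> Colon I v"
    using v I.zero_closed by (auto simp: colon_def intro!: image_eqI[of _ u "\<zero>\<^bsub>R\<^esub>"])
  fix i j assume "i \<in> Colon I v" "j \<in> Colon I v"
  then obtain a b where ij: "i \<in> carrier R" "j \<in> carrier R" "a \<in> I" "b \<in> I"
      "v \<otimes> u i = u a" "v \<otimes> u j = u b"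
    by (auto simp: colon_def)
  then show "i \<oplus>\<^bsub>R\<^esub> j \<in> Colon I v"
    using v IR I.a_closed by (auto simp: colon_def U.r_distr intro!: image_eqI[of _ u "a \<oplus>\<^bsub>R\<^esub> b"])
next
  have IR: "i \<in> carrier R" if "i \<in> I" for i using right_ideal_subset[OF I that] .
  fix i r assume "i \<in> Colon I v" and r: "r \<in> carrier R"
  then obtain a where i: "i \<in> carrier R" "a \<in> I" "v \<otimes> u i = u a"
    by (auto simp: colon_def)
  have "v \<otimes> u (i \<otimes>\<^bsub>R\<^esub> r) = u (a \<otimes>\<^bsub>R\<^esub> r)"
    using i r v IR by (simp flip: U.m_assoc)
  moreover have "a \<otimes>\<^bsub>R\<^esub> r \<in> I" using I i r by (auto simp: right_ideal_def)
  ultimately show "i \<otimes>\<^bsub>R\<^esub> r \<in> Colon I v"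
    using i r by (auto simp: colon_def)
qed

lemma carrier_right_ideal: "right_ideal (carrier R) R"
  by (rule right_idealI) auto

text \<open>
  By \<open>tensor_commutes\<close> and flatness, the equation \<open>v \<otimes> 1 = 1 \<otimes> v\<close> holds in \<open>A \<otimes> U\<close> for the
  submodule \<open>A = v R + R\<close> of \<open>U\<close>.  The map \<open>v r + s \<mapsto> r\<close> from \<open>A\<close> to \<open>R/den v\<close> is well defined
  and induces a map \<open>A \<otimes> U \<rightarrow> U/(den v) U\<close> that takes \<open>v \<otimes> 1\<close> to \<open>1\<close> and \<open>1 \<otimes> v\<close> to \<open>0\<close>.
  Hence \<open>1\<close> belongs to \<open>(den v) U\<close>.
\<close>

lemma den_in_gabriel:
  assumes v: "v \<in> carrier U" shows "den v \<in> \<GG>"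
proof -
  let ?J = "den v"
  have J: "right_ideal ?J R" by (rule colon_right_ideal[OF carrier_right_ideal v])
  have JR: "?J \<subseteq> carrier R" by (auto simp: colon_def)
  define c where "c = frag_of (v, \<one>) - frag_of (\<one>, v)"
  obtain B0 where B0: "small_submod B0" "c \<in> tensor_kernel R (sub_UR B0) UL"
    using tensor_kernel_small[OF tensor_commutes[OF v]] unfolding c_def by blast
  define A where "A = submod_sum (cyclic_submod v) (cyclic_submod \<one>)"
  define B where "B = submod_sum B0 A"
  have A: "small_submod A" unfolding A_def by (intro small_sum small_cyclic v) simp
  have smA: "submod A" and smB0: "submod B0" using A B0 by (auto simp: small_submod_def)
  have vA: "v \<in> A" "\<one> \<in> A"
    using submod_sum_props[OF submod_cyclic(1)[OF v] submod_cyclic(1)[OF U.one_closed]]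
      submod_cyclic(2)[OF v] submod_cyclic(2)[OF U.one_closed] unfolding A_def by auto
  have smB: "submod B" and AB: "A \<subseteq> B" and B0B: "B0 \<subseteq> B"
    using submod_sum_props[OF smB0 smA] by (auto simp: B_def)
  obtain enc :: "'u \<Rightarrow> 'r list" where enc: "inj_on enc B"
    using small_sum[OF B0(1) A] by (auto simp: B_def small_submod_def)
  note MB = coded_module_props[OF enc subset_refl smB] and MA = coded_module_props[OF enc AB smA]
  let ?A = "coded_module enc B A" and ?B = "coded_module enc B B"
  have opA: "ops_closed R ?A" by (rule right_module_ops_closed[OF MA(1)])
  have "frag_map2 enc (\<lambda>x. x) c \<in> tensor_kernel R ?B UL"
    by (rule frag_map2_tensor_kernel[OF sub_UR_ops[OF smB] UL_ops right_module_ops_closed[OF MB(1)] UL_ops])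
      (use MB smB sub_UR_mono[OF smB0 smB B0B B0(2)] in \<open>auto simp: linear_map_def\<close>)
  moreover define c' where "c' = frag_of (enc v, \<one>) - frag_of (enc \<one>, v)"
  ultimately have c': "c' \<in> tensor_kernel R ?B UL"
    by (simp add: c_def c'_def frag_extend_diff)
  have "c' \<in> tensor_kernel R ?A UL"
  proof (rule flat_left_module_kernel[OF flat MA(1) MB(1)])
    show "restrict (\<lambda>x. x) (carrier ?A) \<in> mod_hom R ?A ?B"
      using opA AB MA(4) MB(4) unfolding mod_hom_iff
      by (auto simp: linear_map_def ops_closed_def coded_module_def)
    show "Poly_Mapping.keys c' \<subseteq> carrier ?A \<times> carrier UL"
      unfolding c'_def by (intro keys_diff_subset frag_of_keys) (use vA v MA(4) in auto)
    show "frag_map2 (restrict (\<lambda>x. x) (carrier ?A)) (\<lambda>m. m) c' \<in> tensor_kernel R ?B UL"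
      using c' vA MA(4) by (simp add: c'_def frag_extend_diff)
  qed auto
  \<comment> \<open>The map \<open>v r + s \<mapsto> r\<close> is well defined modulo \<open>den v\<close> and separates \<open>v\<close> from \<open>1\<close>.\<close>
  define num where "num y = (SOME r. r \<in> carrier R \<and> (\<exists>s \<in> carrier R. y = v \<otimes> u r \<oplus> u s))" for y
  have num: "num y \<in> carrier R" "\<exists>s \<in> carrier R. y = v \<otimes> u (num y) \<oplus> u s" if y: "y \<in> A" for y
  proof -
    obtain a b where ab: "a \<in> cyclic_submod v" "b \<in> cyclic_submod \<one>" "y = a \<oplus> b"
      using y unfolding A_def submod_sum_def by auto
    obtain r where "r \<in> carrier R" "a = v \<otimes> u r"
      using ab(1) by (auto simp: cyclic_submod_def)
    moreover obtain s where "s \<in> carrier R" "b = u s"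
      using ab(2) by (auto simp: cyclic_submod_def)
    ultimately have "\<exists>r. r \<in> carrier R \<and> (\<exists>s \<in> carrier R. y = v \<otimes> u r \<oplus> u s)"
      using ab(3) by blast
    from someI_ex[OF this] show "num y \<in> carrier R" "\<exists>s \<in> carrier R. y = v \<otimes> u (num y) \<oplus> u s"
      unfolding num_def by auto
  qed
  have well: "r \<ominus>\<^bsub>R\<^esub> r' \<in> ?J"
    if "r \<in> carrier R" "s \<in> carrier R" "r' \<in> carrier R" "s' \<in> carrier R"
      "v \<otimes> u r \<oplus> u s = v \<otimes> u r' \<oplus> u s'" for r s r' s'
  proof -
    have "v \<otimes> u (r \<ominus>\<^bsub>R\<^esub> r') = (v \<otimes> u r \<oplus> u s) \<ominus> v \<otimes> u r' \<ominus> u s"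
      using that(1-4) v by (simp add: a_minus_def U.r_distr U.r_minus U.a_ac U.r_neg1 U.r_neg2 U.r_neg)
    also have "\<dots> = u (s' \<ominus>\<^bsub>R\<^esub> s)"
      using that v by (simp add: U.add_diff_left)
    finally have eq: "v \<otimes> u (r \<ominus>\<^bsub>R\<^esub> r') = u (s' \<ominus>\<^bsub>R\<^esub> s)" .
    have "u (s' \<ominus>\<^bsub>R\<^esub> s) \<in> u ` carrier R" using that by (intro imageI) simp
    then show ?thesis unfolding colon_def mem_Collect_eq eq using that by simp
  qed
  let ?dec = "inv_into B enc"
  have dec: "?dec (enc x) = x" if "x \<in> A" for x using enc AB that by (auto intro: inv_into_f_f)
  have IJ: "additive_subgroup (IU ?J) U" by (rule ideal_span_subgroup[OF JR])
  interpret IJ: additive_subgroup "IU ?J" U by (rule IJ)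
  obtain h where hd: "\<And>c d. Poly_Mapping.keys c \<subseteq> carrier ?A \<times> carrier UL \<Longrightarrow>
      Poly_Mapping.keys d \<subseteq> carrier ?A \<times> carrier UL \<Longrightarrow> h (c - d) = h c \<ominus> h d"
    and h: "\<And>a m. a \<in> carrier ?A \<Longrightarrow> m \<in> carrier UL \<Longrightarrow> h (frag_of (a, m)) = u (num (?dec a)) \<otimes> m"
    and hK: "\<And>c. c \<in> tensor_kernel R ?A UL \<Longrightarrow> h c \<in> IU ?J"
  proof (rule tensor_kernel_eval[OF opA UL_ops U.abelian_group_axioms IJ,
        where \<beta> = "\<lambda>a w. u (num (?dec a)) \<otimes> w"])
    fix x m assume "x \<in> carrier ?A" and m: "m \<in> carrier UL"
    then obtain a where a: "a \<in> A" "x = enc a" using MA(4) by auto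
    show "u (num (?dec x)) \<otimes> m \<in> carrier U" using a m num by (simp add: dec)
    fix n assume n: "n \<in> carrier UL"
    have "u (num (?dec x)) \<otimes> (m \<oplus>\<^bsub>UL\<^esub> n) \<ominus> u (num (?dec x)) \<otimes> m \<ominus> u (num (?dec x)) \<otimes> n = \<zero>"
      using a m n num by (simp add: dec U.r_distr U.add_diff_left U.diff_eq_zero_iff)
    then show "u (num (?dec x)) \<otimes> (m \<oplus>\<^bsub>UL\<^esub> n) \<ominus> u (num (?dec x)) \<otimes> m \<ominus> u (num (?dec x)) \<otimes> n \<in> IU ?J"
      using IJ.zero_closed by simp
  next
    fix x y m assume "x \<in> carrier ?A" "y \<in> carrier ?A" and m: "m \<in> carrier UL"
    then obtain a b where ab: "a \<in> A" "x = enc a" "b \<in> A" "y = enc b" using MA(4) by auto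
    have abA: "a \<oplus> b \<in> A" using smA ab by (auto simp: submod_def)
    obtain s t p where s: "s \<in> carrier R" "a = v \<otimes> u (num a) \<oplus> u s"
      and t: "t \<in> carrier R" "b = v \<otimes> u (num b) \<oplus> u t"
      and p: "p \<in> carrier R" "a \<oplus> b = v \<otimes> u (num (a \<oplus> b)) \<oplus> u p"
      using num(2) ab abA by meson
    note n = num(1)[OF ab(1)] num(1)[OF ab(3)] num(1)[OF abA]
    have "v \<otimes> u (num a \<oplus>\<^bsub>R\<^esub> num b) \<oplus> u (s \<oplus>\<^bsub>R\<^esub> t)
        = (v \<otimes> u (num a) \<oplus> u s) \<oplus> (v \<otimes> u (num b) \<oplus> u t)"
      using n s(1) t(1) v by (simp add: U.r_distr U.a_ac)
    also have "\<dots> = v \<otimes> u (num (a \<oplus> b)) \<oplus> u p"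
      using s(2) t(2) p(2) by simp
    finally have J': "num (a \<oplus> b) \<ominus>\<^bsub>R\<^esub> (num a \<oplus>\<^bsub>R\<^esub> num b) \<in> ?J"
      using well[of "num (a \<oplus> b)" p "num a \<oplus>\<^bsub>R\<^esub> num b" "s \<oplus>\<^bsub>R\<^esub> t"] n s(1) t(1) p(1) by simp
    have "u (num (a \<oplus> b)) \<otimes> m \<ominus> u (num a) \<otimes> m \<ominus> u (num b) \<otimes> m
        = u (num (a \<oplus> b) \<ominus>\<^bsub>R\<^esub> (num a \<oplus>\<^bsub>R\<^esub> num b)) \<otimes> m"
      using n m by (simp add: a_minus_def U.l_distr U.l_minus U.minus_add U.a_ac)
    then show "u (num (?dec (x \<oplus>\<^bsub>?A\<^esub> y))) \<otimes> m \<ominus> u (num (?dec x)) \<otimes> m \<ominus> u (num (?dec y)) \<otimes> m \<in> IU ?J"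
      using ideal_span_incl[OF JR J'] m ab abA by (simp add: MA(2) dec)
  next
    fix x q m assume "x \<in> carrier ?A" and q: "q \<in> carrier R" and m: "m \<in> carrier UL"
    then obtain a where a: "a \<in> A" "x = enc a" using MA(4) by auto
    have aq: "a \<otimes> u q \<in> A" using smA a q by (auto simp: submod_def)
    obtain s p where s: "s \<in> carrier R" "a = v \<otimes> u (num a) \<oplus> u s"
      and p: "p \<in> carrier R" "a \<otimes> u q = v \<otimes> u (num (a \<otimes> u q)) \<oplus> u p"
      using num(2) a aq by meson
    note n = num(1)[OF a(1)] num(1)[OF aq]
    have "v \<otimes> u (num a \<otimes>\<^bsub>R\<^esub> q) \<oplus> u (s \<otimes>\<^bsub>R\<^esub> q) = (v \<otimes> u (num a) \<oplus> u s) \<otimes> u q"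
      using n s(1) q v by (simp add: U.l_distr U.m_assoc)
    also have "\<dots> = v \<otimes> u (num (a \<otimes> u q)) \<oplus> u p"
      using s(2) p(2) by simp
    finally have J': "num (a \<otimes> u q) \<ominus>\<^bsub>R\<^esub> num a \<otimes>\<^bsub>R\<^esub> q \<in> ?J"
      using well[of "num (a \<otimes> u q)" p "num a \<otimes>\<^bsub>R\<^esub> q" "s \<otimes>\<^bsub>R\<^esub> q"] n s(1) p(1) q by simp
    have "u (num (a \<otimes> u q)) \<otimes> m \<ominus> u (num a) \<otimes> (u q \<otimes> m)
        = u (num (a \<otimes> u q) \<ominus>\<^bsub>R\<^esub> num a \<otimes>\<^bsub>R\<^esub> q) \<otimes> m"
      using n q m by (simp add: a_minus_def U.l_distr U.l_minus U.m_assoc)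
    then show "u (num (?dec (q \<odot>\<^bsub>?A\<^esub> x))) \<otimes> m \<ominus> u (num (?dec x)) \<otimes> (q \<odot>\<^bsub>UL\<^esub> m) \<in> IU ?J"
      using ideal_span_incl[OF JR J'] m a aq by (simp add: MA(3) dec)
  qed blast
  have "h c' = u (num v) \<ominus> u (num \<one>) \<otimes> v"
    unfolding c'_def using vA v num MA(4)
    by (subst hd) (auto simp: h dec intro!: frag_of_keys)
  then have 1: "u (num v) \<ominus> u (num \<one>) \<otimes> v \<in> IU ?J"
    using hK[OF \<open>c' \<in> tensor_kernel R ?A UL\<close>] by simp
  obtain s where s: "s \<in> carrier R" "v = v \<otimes> u (num v) \<oplus> u s" using num(2) vA by meson
  have "num v \<ominus>\<^bsub>R\<^esub> \<one>\<^bsub>R\<^esub> \<in> ?J"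
    by (rule well[of _ s _ "\<zero>\<^bsub>R\<^esub>"]) (use s v num vA in auto)
  from ideal_span_incl[OF JR this U.one_closed]
  have 2: "u (num v) \<ominus> \<one> \<in> IU ?J" using num vA by simp
  obtain t where t: "t \<in> carrier R" "\<one> = v \<otimes> u (num \<one>) \<oplus> u t" using num(2) vA by meson
  have "num \<one> \<ominus>\<^bsub>R\<^esub> \<zero>\<^bsub>R\<^esub> \<in> ?J"
    by (rule well[of _ t _ "\<one>\<^bsub>R\<^esub>"]) (use t v num vA in auto)
  from ideal_span_incl[OF JR this v]
  have 3: "u (num \<one>) \<otimes> v \<in> IU ?J" using num vA by (simp add: a_minus_def)
  have "(u (num v) \<ominus> u (num \<one>) \<otimes> v) \<oplus> u (num \<one>) \<otimes> v = u (num v)"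
    using num vA v by (simp add: a_minus_def U.a_assoc U.l_neg)
  then have "u (num v) \<in> IU ?J" using IJ.a_closed[OF 1 3] by simp
  from U.subgroup_diff_closed[OF IJ this 2]
  have "u (num v) \<ominus> (u (num v) \<ominus> \<one>) \<in> IU ?J" .
  moreover have "u (num v) \<ominus> (u (num v) \<ominus> \<one>) = \<one>"
    using num vA by (simp add: a_minus_def U.minus_add U.r_neg2)
  ultimately show ?thesis using J by (simp add: gabriel_iff)
qed

subsection \<open>Closure properties of the Gabriel topology\<close>

lemma gabriel_right_ideal: "I \<in> \<GG> \<Longrightarrow> right_ideal I R" by (simp add: gabriel_iff)

lemma gabriel_subset: "I \<in> \<GG> \<Longrightarrow> I \<subseteq> carrier R"
  using right_ideal_subset gabriel_right_ideal by blast

text \<open>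
  If \<open>1\<close> is a sum of products \<open>s w\<close> with \<open>s\<close> in \<open>J\<close>, it lies in \<open>K U\<close>, because
  \<open>s \<in> s (K : s) U \<subseteq> K U\<close>.
\<close>

lemma gabriel_transitive:
  assumes J: "J \<in> \<GG>" and K: "right_ideal K R" and JK: "\<And>s. s \<in> J \<Longrightarrow> Colon K (u s) \<in> \<GG>"
  shows "K \<in> \<GG>"
proof -
  have KR: "K \<subseteq> carrier R" using right_ideal_subset[OF K] by blast
  have "x \<in> IU K" if "x \<in> IU J" for x
    using that
  proof (induction rule: ideal_span.induct)
    case zero show ?case by (rule ideal_span.zero)
  next
    case (step x s w)
    have s: "s \<in> carrier R" using step gabriel_subset[OF J] by auto
    have one: "\<one> \<in> IU (Colon K (u s))" using JK[OF step(2)] by (simp add: gabriel_iff)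
    have "s \<otimes>\<^bsub>R\<^esub> t \<in> K" if "t \<in> Colon K (u s)" for t
      using that s KR u_eq_iff by (auto simp: colon_def subset_iff) (metis R.m_closed u_simps(3))
    then have "u s \<otimes> \<one> \<in> IU K"
      using ideal_span_left[OF s _ KR _ one] by (auto simp: colon_def)
    then have "u s \<otimes> w \<in> IU K"
      using ideal_span_rmult[OF KR step(3)] s by simp
    then show ?case using ideal_span_add[OF KR step.IH] by simp
  qed
  then show ?thesis using J K by (simp add: gabriel_iff)
qed

lemma gabriel_mono: "J \<in> \<GG> \<Longrightarrow> J \<subseteq> K \<Longrightarrow> right_ideal K R \<Longrightarrow> K \<in> \<GG>"
  using ideal_span_mono by (auto simp: gabriel_iff)

lemma carrier_in_gabriel: "carrier R \<in> \<GG>"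
  using ideal_span_incl[of "carrier R" "\<one>\<^bsub>R\<^esub>" "\<one>"] carrier_right_ideal by (simp add: gabriel_iff)

lemma right_ideal_inter: "right_ideal I R \<Longrightarrow> right_ideal J R \<Longrightarrow> right_ideal (I \<inter> J) R"
  by (rule right_idealI)
    (auto simp: right_ideal_subset right_ideal_def additive_subgroup.zero_closed additive_subgroup.a_closed)

lemma colon_iff:
  assumes I: "I \<subseteq> carrier R" and s: "s \<in> carrier R"
  shows "t \<in> Colon I (u s) \<longleftrightarrow> t \<in> carrier R \<and> s \<otimes>\<^bsub>R\<^esub> t \<in> I"
proof -
  have "u (s \<otimes>\<^bsub>R\<^esub> t) \<in> u ` I \<longleftrightarrow> s \<otimes>\<^bsub>R\<^esub> t \<in> I" if "t \<in> carrier R"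
    by (rule inj_on_image_mem_iff[OF inj _ I]) (use s that in simp)
  then show ?thesis using s by (auto simp: colon_def)
qed

lemma gabriel_inter_den:
  assumes J: "J \<in> \<GG>" and w: "w \<in> carrier U" shows "J \<inter> den w \<in> \<GG>"
proof (rule gabriel_transitive[OF J])
  note rJ = gabriel_right_ideal[OF J] and rw = colon_right_ideal[OF carrier_right_ideal w]
  show "right_ideal (J \<inter> den w) R" by (rule right_ideal_inter[OF rJ rw])
  fix s assume s: "s \<in> J"
  then have sR: "s \<in> carrier R" using gabriel_subset[OF J] by auto
  have "Colon (J \<inter> den w) (u s) = den (w \<otimes> u s)"
  proof -
    have "t \<in> Colon (J \<inter> den w) (u s) \<longleftrightarrow> t \<in> den (w \<otimes> u s)" for t
    proof -
      have "J \<inter> den w \<subseteq> carrier R" using gabriel_subset[OF J] by blast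
      moreover have "s \<otimes>\<^bsub>R\<^esub> t \<in> J" if "t \<in> carrier R" using rJ s that by (auto simp: right_ideal_def)
      moreover have "s \<otimes>\<^bsub>R\<^esub> t \<in> den w \<longleftrightarrow> t \<in> den (w \<otimes> u s)" if "t \<in> carrier R"
        using that sR w by (simp add: colon_def U.m_assoc)
      ultimately show ?thesis using sR by (auto simp: colon_iff) (auto simp: colon_def)
    qed
    then show ?thesis by blast
  qed
  then show "Colon (J \<inter> den w) (u s) \<in> \<GG>" using den_in_gabriel w sR by simp
qed

text \<open>
  Write \<open>1 = \<Sum> i w\<close> with \<open>i\<close> in \<open>I\<close>.  Whenever all \<open>w v t\<close> lie in \<open>R\<close>, the element
  \<open>v t = \<Sum> i (w v t)\<close> lies in \<open>I\<close>; and such \<open>t\<close> form a finite intersection of denominator ideals.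
\<close>

lemma colon_in_gabriel:
  assumes I: "I \<in> \<GG>" and v: "v \<in> carrier U" shows "Colon I v \<in> \<GG>"
proof -
  note IR = gabriel_subset[OF I] and rI = gabriel_right_ideal[OF I]
  interpret I: additive_subgroup I R using rI by (simp add: right_ideal_def)
  have "\<exists>J \<in> \<GG>. J \<subseteq> Colon I (x \<otimes> v)" if "x \<in> IU I" for x
    using that
  proof (induction rule: ideal_span.induct)
    case zero
    have "carrier R \<subseteq> Colon I (\<zero> \<otimes> v)"
      using v I.zero_closed by (auto simp: colon_def intro!: image_eqI[of _ u "\<zero>\<^bsub>R\<^esub>"])
    then show ?case using carrier_in_gabriel by blast
  next
    case (step x i w)
    then obtain J where J: "J \<in> \<GG>" "J \<subseteq> Colon I (x \<otimes> v)" by blast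
    have i: "i \<in> carrier R" using step IR by auto
    have x: "x \<in> carrier U" using ideal_span_closed[OF step(1) IR] .
    have "t \<in> Colon I ((x \<oplus> u i \<otimes> w) \<otimes> v)" if t: "t \<in> J" "t \<in> den (w \<otimes> v)" for t
    proof -
      obtain a where a: "a \<in> I" "x \<otimes> v \<otimes> u t = u a" using t J by (auto simp: colon_def)
      obtain b where b: "b \<in> carrier R" "w \<otimes> v \<otimes> u t = u b" using t by (auto simp: colon_def)
      have tR: "t \<in> carrier R" using t by (auto simp: colon_def)
      have aR: "a \<in> carrier R" using a IR by auto
      have "(x \<oplus> u i \<otimes> w) \<otimes> v \<otimes> u t = x \<otimes> v \<otimes> u t \<oplus> u i \<otimes> (w \<otimes> v \<otimes> u t)"
        using x i step v tR by (simp add: U.l_distr U.m_assoc)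
      also have "\<dots> = u (a \<oplus>\<^bsub>R\<^esub> i \<otimes>\<^bsub>R\<^esub> b)" using a b i aR by simp
      finally have "(x \<oplus> u i \<otimes> w) \<otimes> v \<otimes> u t = u (a \<oplus>\<^bsub>R\<^esub> i \<otimes>\<^bsub>R\<^esub> b)" .
      moreover have "a \<oplus>\<^bsub>R\<^esub> i \<otimes>\<^bsub>R\<^esub> b \<in> I" using a b step rI I.a_closed by (auto simp: right_ideal_def)
      ultimately show ?thesis using tR by (auto simp: colon_def)
    qed
    then show ?case using gabriel_inter_den[OF J(1), of "w \<otimes> v"] step v by (auto intro!: bexI[of _ "J \<inter> den (w \<otimes> v)"])
  qed
  moreover have "\<one> \<in> IU I" using I by (simp add: gabriel_iff)
  ultimately obtain J where "J \<in> \<GG>" "J \<subseteq> Colon I (\<one> \<otimes> v)" by blast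
  then show ?thesis using gabriel_mono[OF _ _ colon_right_ideal[OF rI v]] v by simp
qed

lemma gabriel_inter:
  assumes I: "I \<in> \<GG>" and J: "J \<in> \<GG>" shows "I \<inter> J \<in> \<GG>"
proof (rule gabriel_transitive[OF I])
  note rI = gabriel_right_ideal[OF I] and rJ = gabriel_right_ideal[OF J]
  show "right_ideal (I \<inter> J) R" by (rule right_ideal_inter[OF rI rJ])
  fix s assume s: "s \<in> I"
  then have sR: "s \<in> carrier R" using gabriel_subset[OF I] by auto
  have "Colon (I \<inter> J) (u s) = Colon J (u s)"
  proof -
    have "I \<inter> J \<subseteq> carrier R" using gabriel_subset[OF I] by blast
    then show ?thesis
      using s sR gabriel_subset[OF J] rI
      by (intro Set.set_eqI) (auto simp: colon_iff right_ideal_def)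
  qed
  then show "Colon (I \<inter> J) (u s) \<in> \<GG>" using colon_in_gabriel[OF J] sR by simp
qed

lemma ideal_colon_eq: "I \<subseteq> carrier R \<Longrightarrow> r \<in> carrier R \<Longrightarrow> ideal_colon R I r = Colon I (u r)"
  by (intro Set.set_eqI) (simp add: colon_iff ideal_colon_def)

end

section \<open>The completion of a ring in a right linear topology\<close>

text \<open>
  A base of neighborhoods of zero in \<open>R\<close> consisting of right ideals, subject to the conditions that
  make the completion a topological ring.
\<close>

locale right_topology = plain_ring R for R :: "'r ring" (structure) +
  fixes G :: "'r set set"
  assumes G_ideal: "I \<in> G \<Longrightarrow> right_ideal I R"
    and G_carrier: "carrier R \<in> G"
    and G_inter: "I \<in> G \<Longrightarrow> J \<in> G \<Longrightarrow> I \<inter> J \<in> G"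
    and G_colon: "I \<in> G \<Longrightarrow> r \<in> carrier R \<Longrightarrow> ideal_colon R I r \<in> G"
begin

abbreviation S :: "('r set \<Rightarrow> 'r set) ring" where "S \<equiv> completion R G"
abbreviation cmap :: "'r \<Rightarrow> ('r set \<Rightarrow> 'r set)" where "cmap \<equiv> completion_map R G"

lemma G_subgroup: "I \<in> G \<Longrightarrow> additive_subgroup I R"
  using G_ideal by (simp add: right_ideal_def)

lemma G_subset: "I \<in> G \<Longrightarrow> i \<in> I \<Longrightarrow> i \<in> carrier R"
  using additive_subgroup.a_Hcarr[OF G_subgroup] .

lemma G_zero: "I \<in> G \<Longrightarrow> \<zero> \<in> I"
  using additive_subgroup.zero_closed[OF G_subgroup] .

lemma G_add: "I \<in> G \<Longrightarrow> i \<in> I \<Longrightarrow> j \<in> I \<Longrightarrow> i \<oplus> j \<in> I"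
  using additive_subgroup.a_closed[OF G_subgroup] .

lemma G_diff: "I \<in> G \<Longrightarrow> i \<in> I \<Longrightarrow> j \<in> I \<Longrightarrow> i \<ominus> j \<in> I"
  using subgroup_diff_closed[OF G_subgroup] .

lemma G_neg: "I \<in> G \<Longrightarrow> i \<in> I \<Longrightarrow> \<ominus> i \<in> I"
  using subgroup_neg_closed[OF G_subgroup] .

lemma G_rmult: "I \<in> G \<Longrightarrow> i \<in> I \<Longrightarrow> r \<in> carrier R \<Longrightarrow> i \<otimes> r \<in> I"
  using G_ideal by (simp add: right_ideal_def)

lemma G_INT: "finite F \<Longrightarrow> (\<And>x. x \<in> F \<Longrightarrow> K x \<in> G) \<Longrightarrow> \<exists>J \<in> G. \<forall>x \<in> F. J \<subseteq> K x"
proof (induction F rule: finite_induct)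
  case empty
  then show ?case using G_carrier by blast
next
  case (insert x F)
  then obtain J where "J \<in> G" "\<forall>x \<in> F. J \<subseteq> K x" by blast
  then show ?case using insert.prems[of x] G_inter by (intro bexI[of _ "J \<inter> K x"]) auto
qed

lemma diff_swap: "I \<in> G \<Longrightarrow> r \<in> carrier R \<Longrightarrow> s \<in> carrier R \<Longrightarrow> r \<ominus> s \<in> I \<Longrightarrow> s \<ominus> r \<in> I"
  using G_neg[of I "r \<ominus> s"] by (simp add: a_minus_def minus_add a_comm)

lemma diff_trans: "I \<in> G \<Longrightarrow> r \<in> carrier R \<Longrightarrow> s \<in> carrier R \<Longrightarrow> t \<in> carrier R \<Longrightarrow>
    r \<ominus> s \<in> I \<Longrightarrow> s \<ominus> t \<in> I \<Longrightarrow> r \<ominus> t \<in> I"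
  using G_add[of I "r \<ominus> s" "s \<ominus> t"] by (simp add: a_minus_def a_assoc r_neg1)

lemma completion_carrier:
  "x \<in> carrier S \<longleftrightarrow> x \<in> extensional G \<and> (\<forall>I \<in> G. x I \<in> a_rcosets I) \<and>
     (\<forall>I \<in> G. \<forall>J \<in> G. I \<subseteq> J \<longrightarrow> x I \<subseteq> x J)"
  by (auto simp: completion_def PiE_def Pi_def)

lemma completion_mem:
  assumes "x \<in> carrier S" "I \<in> G" "r \<in> x I"
  shows "r \<in> carrier R" "x I = I +> r"
  using coset_eq_of_mem[OF G_subgroup[OF assms(2)] _ assms(3)] assms by (auto simp: completion_carrier)

lemma completion_ex:
  assumes "x \<in> carrier S" "I \<in> G" shows "\<exists>r. r \<in> x I"
proof -
  obtain r where "r \<in> carrier R" "x I = I +> r"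
    using assms by (auto simp: completion_carrier A_RCOSETS_def')
  then show ?thesis using coset_self[OF G_subgroup[OF assms(2)]] by auto
qed

lemma completion_mono: "x \<in> carrier S \<Longrightarrow> I \<in> G \<Longrightarrow> J \<in> G \<Longrightarrow> I \<subseteq> J \<Longrightarrow> r \<in> x I \<Longrightarrow> r \<in> x J"
  using completion_carrier[of x] by blast

lemma completion_mem_iff:
  assumes "x \<in> carrier S" "I \<in> G" "r \<in> x I" "s \<in> carrier R"
  shows "s \<in> x I \<longleftrightarrow> s \<ominus> r \<in> I"
  using coset_iff[OF G_subgroup[OF assms(2)], of r s] completion_mem[OF assms(1-3)] assms(4) by simp

lemma completion_mem_diff:
  assumes "x \<in> carrier S" "I \<in> G" "r \<in> x I" "s \<in> x I" shows "s \<ominus> r \<in> I"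
  using completion_mem_iff[OF assms(1-3)] completion_mem(1)[OF assms(1,2,4)] assms(4) by simp

lemma completion_eqI:
  assumes "x \<in> carrier S" "y \<in> carrier S" "\<And>I. I \<in> G \<Longrightarrow> \<exists>r. r \<in> x I \<and> r \<in> y I"
  shows "x = y"
proof (rule extensionalityI[of _ G])
  fix I assume I: "I \<in> G"
  obtain r where "r \<in> x I" "r \<in> y I" using assms(3)[OF I] by blast
  then show "x I = y I" using completion_mem(2) assms(1,2) I by metis
qed (use assms in \<open>auto simp: completion_carrier\<close>)

lemma completion_construct:
  assumes "\<And>I. I \<in> G \<Longrightarrow> f I \<in> carrier R"
    and "\<And>I J. I \<in> G \<Longrightarrow> J \<in> G \<Longrightarrow> I \<subseteq> J \<Longrightarrow> f I \<ominus> f J \<in> J"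
  shows "(\<lambda>I \<in> G. I +> f I) \<in> carrier S" "I \<in> G \<Longrightarrow> f I \<in> (\<lambda>I \<in> G. I +> f I) I"
proof -
  show "I \<in> G \<Longrightarrow> f I \<in> (\<lambda>I \<in> G. I +> f I) I"
    using assms(1) coset_self[OF G_subgroup] by simp
  have "I +> f I \<subseteq> J +> f J" if "I \<in> G" "J \<in> G" "I \<subseteq> J" for I J
  proof
    fix s assume "s \<in> I +> f I"
    then have s: "s \<in> carrier R" "s \<ominus> f I \<in> J"
      using coset_iff[OF G_subgroup[OF that(1)] assms(1)[OF that(1)]] that by auto
    then show "s \<in> J +> f J"
      using coset_iff[OF G_subgroup[OF that(2)] assms(1)[OF that(2)]] diff_trans[OF that(2)] assms that by blast
  qed
  then show "(\<lambda>I \<in> G. I +> f I) \<in> carrier S"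
    using assms(1) by (auto simp: completion_carrier A_RCOSETS_def')
qed

lemma completion_add_mem:
  assumes x: "x \<in> carrier S" "r \<in> x I" and y: "y \<in> carrier S" "s \<in> y I" and I: "I \<in> G"
  shows "(x \<oplus>\<^bsub>S\<^esub> y) I = I +> (r \<oplus> s)" "r \<oplus> s \<in> (x \<oplus>\<^bsub>S\<^esub> y) I"
proof -
  interpret I: abelian_subgroup I R
    by (rule abelian_subgroupI3[OF G_subgroup[OF I] abelian_group_axioms])
  show eq: "(x \<oplus>\<^bsub>S\<^esub> y) I = I +> (r \<oplus> s)"
    using completion_mem[OF x(1) I x(2)] completion_mem[OF y(1) I y(2)] I
    by (simp add: completion_def I.a_rcos_sum)
  show "r \<oplus> s \<in> (x \<oplus>\<^bsub>S\<^esub> y) I"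
    unfolding eq using completion_mem[OF x(1) I x(2)] completion_mem[OF y(1) I y(2)]
    by (intro coset_self[OF G_subgroup[OF I]]) simp
qed

lemma completion_add_closed:
  assumes x: "x \<in> carrier S" and y: "y \<in> carrier S"
  shows "x \<oplus>\<^bsub>S\<^esub> y \<in> carrier S"
proof -
  obtain f g where f: "\<And>I. I \<in> G \<Longrightarrow> f I \<in> x I" and g: "\<And>I. I \<in> G \<Longrightarrow> g I \<in> y I"
    using completion_ex x y by metis
  have fR: "f I \<in> carrier R" "g I \<in> carrier R" if "I \<in> G" for I
    using completion_mem(1) x y f g that by auto
  have "x \<oplus>\<^bsub>S\<^esub> y = (\<lambda>I \<in> G. I +> (f I \<oplus> g I))"
  proof (rule extensionalityI[of _ G])
    show "x \<oplus>\<^bsub>S\<^esub> y \<in> extensional G" by (simp add: completion_def)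
    show "(x \<oplus>\<^bsub>S\<^esub> y) I = (\<lambda>I \<in> G. I +> (f I \<oplus> g I)) I" if "I \<in> G" for I
      using completion_add_mem(1)[OF x f y g] that by simp
  qed simp
  also have "\<dots> \<in> carrier S"
  proof (rule completion_construct(1))
    fix I J assume IJ: "I \<in> G" "J \<in> G" "I \<subseteq> J"
    have "f I \<ominus> f J \<in> J" "g I \<ominus> g J \<in> J"
      using completion_mem_diff[OF x IJ(2) f] completion_mem_diff[OF y IJ(2) g]
        completion_mono[OF x IJ f] completion_mono[OF y IJ g] IJ by auto
    from G_add[OF IJ(2) this]
    show "(f I \<oplus> g I) \<ominus> (f J \<oplus> g J) \<in> J"
      using fR IJ by (simp add: a_minus_def minus_add a_ac)
  qed (use fR in auto)
  finally show ?thesis .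
qed

lemma completion_zero_mem: "I \<in> G \<Longrightarrow> r \<in> \<zero>\<^bsub>S\<^esub> I \<longleftrightarrow> r \<in> I"
  by (simp add: completion_def)

lemma completion_zero_closed: "\<zero>\<^bsub>S\<^esub> \<in> carrier S"
proof -
  have "\<zero>\<^bsub>S\<^esub> = (\<lambda>I \<in> G. I +> \<zero>)"
  proof (rule extensionalityI[of _ G])
    show "\<zero>\<^bsub>S\<^esub> \<in> extensional G" by (simp add: completion_def)
    show "\<zero>\<^bsub>S\<^esub> I = (\<lambda>I \<in> G. I +> \<zero>) I" if "I \<in> G" for I
      using coset_eq_self_iff[OF G_subgroup[OF that] zero_closed] G_zero[OF that] that
      by (simp add: completion_def)
  qed simp
  also have "\<dots> \<in> carrier S"
    by (rule completion_construct(1)) (auto simp: G_zero a_minus_def r_neg)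
  finally show ?thesis .
qed

lemma completion_kernel_iff:
  assumes "x \<in> carrier S" "I \<in> G" shows "x I = I \<longleftrightarrow> \<zero> \<in> x I"
  using completion_mem(2)[OF assms, of \<zero>] coset_eq_self_iff[OF G_subgroup[OF assms(2)] zero_closed]
    G_zero[OF assms(2)] by auto

sublocale S: abelian_group S
proof (rule abelian_groupI)
  fix x y z assume x: "x \<in> carrier S" and y: "y \<in> carrier S" and z: "z \<in> carrier S"
  show "x \<oplus>\<^bsub>S\<^esub> y \<in> carrier S" by (rule completion_add_closed[OF x y])
  show "x \<oplus>\<^bsub>S\<^esub> y \<oplus>\<^bsub>S\<^esub> z = x \<oplus>\<^bsub>S\<^esub> (y \<oplus>\<^bsub>S\<^esub> z)"
  proof (rule completion_eqI)
    fix I assume I: "I \<in> G"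
    obtain r s t where r: "r \<in> x I" and s: "s \<in> y I" and t: "t \<in> z I"
      using completion_ex[OF _ I] x y z by meson
    have "(r \<oplus> s) \<oplus> t \<in> (x \<oplus>\<^bsub>S\<^esub> y \<oplus>\<^bsub>S\<^esub> z) I" "r \<oplus> (s \<oplus> t) \<in> (x \<oplus>\<^bsub>S\<^esub> (y \<oplus>\<^bsub>S\<^esub> z)) I"
      by (intro completion_add_mem(2) completion_add_closed x y z r s t I)+
    then show "\<exists>q. q \<in> (x \<oplus>\<^bsub>S\<^esub> y \<oplus>\<^bsub>S\<^esub> z) I \<and> q \<in> (x \<oplus>\<^bsub>S\<^esub> (y \<oplus>\<^bsub>S\<^esub> z)) I"
      using completion_mem(1)[OF _ I] x y z r s t by (auto simp: a_assoc)
  qed (intro completion_add_closed x y z)+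
next
  fix x y assume x: "x \<in> carrier S" and y: "y \<in> carrier S"
  show "x \<oplus>\<^bsub>S\<^esub> y = y \<oplus>\<^bsub>S\<^esub> x"
  proof (rule completion_eqI)
    fix I assume I: "I \<in> G"
    obtain r s where r: "r \<in> x I" and s: "s \<in> y I" using completion_ex[OF _ I] x y by meson
    have "r \<oplus> s = s \<oplus> r" using completion_mem(1)[OF _ I] x y r s by (auto simp: a_comm)
    then show "\<exists>q. q \<in> (x \<oplus>\<^bsub>S\<^esub> y) I \<and> q \<in> (y \<oplus>\<^bsub>S\<^esub> x) I"
      using completion_add_mem(2)[OF x r y s I] completion_add_mem(2)[OF y s x r I] by auto
  qed (intro completion_add_closed x y)+
next
  fix x assume x: "x \<in> carrier S"
  show "\<zero>\<^bsub>S\<^esub> \<oplus>\<^bsub>S\<^esub> x = x"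
  proof (rule completion_eqI)
    fix I assume I: "I \<in> G"
    obtain r where r: "r \<in> x I" using completion_ex[OF x I] by blast
    have "\<zero> \<oplus> r \<in> (\<zero>\<^bsub>S\<^esub> \<oplus>\<^bsub>S\<^esub> x) I"
      by (rule completion_add_mem(2)[OF completion_zero_closed _ x r I]) (simp add: completion_zero_mem I G_zero)
    then show "\<exists>q. q \<in> (\<zero>\<^bsub>S\<^esub> \<oplus>\<^bsub>S\<^esub> x) I \<and> q \<in> x I" using r completion_mem(1)[OF x I r] by auto
  qed (intro completion_add_closed completion_zero_closed x)+
  obtain f where f: "\<And>I. I \<in> G \<Longrightarrow> f I \<in> x I" using completion_ex[OF x] by metis
  have fR: "f I \<in> carrier R" if "I \<in> G" for I using completion_mem(1) x f that by auto
  have d: "\<ominus> f I \<ominus> \<ominus> f J \<in> J" if IJ: "I \<in> G" "J \<in> G" "I \<subseteq> J" for I J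
    using G_neg[OF IJ(2) completion_mem_diff[OF x IJ(2) f[OF IJ(2)] completion_mono[OF x IJ f[OF IJ(1)]]]]
      fR IJ by (simp add: a_minus_def minus_add)
  let ?n = "\<lambda>I \<in> G. I +> \<ominus> f I"
  have n: "?n \<in> carrier S" "\<And>I. I \<in> G \<Longrightarrow> \<ominus> f I \<in> ?n I"
    by (rule completion_construct; use fR d in blast)+
  have "?n \<oplus>\<^bsub>S\<^esub> x = \<zero>\<^bsub>S\<^esub>"
  proof (rule completion_eqI)
    fix I assume I: "I \<in> G"
    have "\<ominus> f I \<oplus> f I \<in> (?n \<oplus>\<^bsub>S\<^esub> x) I"
      by (rule completion_add_mem(2)[OF n(1) n(2)[OF I] x f[OF I] I])
    then show "\<exists>q. q \<in> (?n \<oplus>\<^bsub>S\<^esub> x) I \<and> q \<in> \<zero>\<^bsub>S\<^esub> I"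
      using I fR by (intro exI[of _ \<zero>]) (simp add: l_neg completion_zero_mem G_zero)
  qed (intro completion_add_closed completion_zero_closed x n(1))+
  then show "\<exists>y\<in>carrier S. y \<oplus>\<^bsub>S\<^esub> x = \<zero>\<^bsub>S\<^esub>" using n(1) by blast
qed (rule completion_zero_closed)

lemma completion_minus_mem:
  assumes x: "x \<in> carrier S" "r \<in> x I" and y: "y \<in> carrier S" "s \<in> y I" and I: "I \<in> G"
  shows "r \<ominus> s \<in> (x \<ominus>\<^bsub>S\<^esub> y) I"
proof -
  have xy: "x \<ominus>\<^bsub>S\<^esub> y \<in> carrier S" using x y by simp
  obtain t where t: "t \<in> (x \<ominus>\<^bsub>S\<^esub> y) I" using completion_ex[OF xy I] by blast
  have "(x \<ominus>\<^bsub>S\<^esub> y) \<oplus>\<^bsub>S\<^esub> y = x" using x y by (simp add: a_minus_def S.a_assoc S.l_neg)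
  then have "t \<oplus> s \<in> x I" using completion_add_mem(2)[OF xy t y I] by simp
  then have d: "(t \<oplus> s) \<ominus> r \<in> I" using completion_mem_diff[OF x(1) I x(2)] by blast
  note c = completion_mem(1)[OF xy I t] completion_mem(1)[OF x(1) I x(2)] completion_mem(1)[OF y(1) I y(2)]
  have "(r \<ominus> s) \<ominus> t = \<ominus> ((t \<oplus> s) \<ominus> r)" using c by (simp add: a_minus_def minus_add a_ac)
  then show ?thesis
    using completion_mem_iff[OF xy I t] G_neg[OF I d] c by simp
qed

lemma completion_mult_mem:
  assumes x: "x \<in> carrier S" "r \<in> x I" and y: "y \<in> carrier S" "s \<in> y (ideal_colon R I r)" and I: "I \<in> G"
  shows "(x \<otimes>\<^bsub>S\<^esub> y) I = I +> (r \<otimes> s)" "r \<otimes> s \<in> (x \<otimes>\<^bsub>S\<^esub> y) I"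
proof -
  have r: "r \<in> carrier R" using completion_mem(1)[OF x(1) I x(2)] .
  have s: "s \<in> carrier R" using completion_mem(1)[OF y(1) G_colon[OF I r] y(2)] .
  have "I +> (r' \<otimes> s') = I +> (r \<otimes> s)" if r': "r' \<in> x I" and s': "s' \<in> y (ideal_colon R I r')" for r' s'
  proof -
    have r'R: "r' \<in> carrier R" using completion_mem(1)[OF x(1) I r'] .
    have s'R: "s' \<in> carrier R" using completion_mem(1)[OF y(1) G_colon[OF I r'R] s'] .
    let ?K = "ideal_colon R I r \<inter> ideal_colon R I r'"
    have K: "?K \<in> G" by (intro G_inter G_colon I r r'R)
    obtain t where t: "t \<in> y ?K" using completion_ex[OF y(1) K] by blast
    have tR: "t \<in> carrier R" using completion_mem(1)[OF y(1) K t] .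
    have "t \<in> y (ideal_colon R I r)"
      by (rule completion_mono[OF y(1) K G_colon[OF I r] _ t]) blast
    moreover have "t \<in> y (ideal_colon R I r')"
      by (rule completion_mono[OF y(1) K G_colon[OF I r'R] _ t]) blast
    ultimately have "s \<ominus> t \<in> ideal_colon R I r" "s' \<ominus> t \<in> ideal_colon R I r'"
      using completion_mem_diff[OF y(1) G_colon[OF I r]] completion_mem_diff[OF y(1) G_colon[OF I r'R]] y(2) s' by auto
    then have 1: "r \<otimes> (s \<ominus> t) \<in> I" "r' \<otimes> (s' \<ominus> t) \<in> I" by (auto simp: ideal_colon_def)
    have 2: "(r' \<ominus> r) \<otimes> t \<in> I"
      using G_rmult[OF I completion_mem_diff[OF x(1) I x(2) r'] tR] .
    have "r' \<otimes> s' \<ominus> r' \<otimes> t \<in> I" using 1(2) r'R s'R tR by (simp add: a_minus_def r_distr r_minus)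
    moreover have "r' \<otimes> t \<ominus> r \<otimes> t \<in> I" using 2 r'R r tR by (simp add: a_minus_def l_distr l_minus)
    moreover have "r \<otimes> t \<ominus> r \<otimes> s \<in> I"
      by (rule diff_swap[OF I]) (use 1(1) r s tR in \<open>auto simp: a_minus_def r_distr r_minus\<close>)
    ultimately have "r' \<otimes> s' \<ominus> r \<otimes> s \<in> I"
      using diff_trans[OF I, of "r' \<otimes> s'" "r' \<otimes> t" "r \<otimes> s"] diff_trans[OF I, of "r' \<otimes> t" "r \<otimes> t" "r \<otimes> s"]
        r r'R s s'R tR by simp
    then show ?thesis
      using coset_eqI[OF G_subgroup[OF I]] r r'R s s'R by simp
  qed
  then have "(\<Union>r' \<in> x I. \<Union>s' \<in> y (ideal_colon R I r'). I +> (r' \<otimes> s')) = I +> (r \<otimes> s)"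
    using x(2) y(2) by blast
  then show eq: "(x \<otimes>\<^bsub>S\<^esub> y) I = I +> (r \<otimes> s)" using I by (simp add: completion_def)
  show "r \<otimes> s \<in> (x \<otimes>\<^bsub>S\<^esub> y) I"
    unfolding eq using coset_self[OF G_subgroup[OF I]] r s by simp
qed

lemma ideal_colon_mono: "I \<subseteq> J \<Longrightarrow> ideal_colon R I r \<subseteq> ideal_colon R J r"
  by (auto simp: ideal_colon_def)

lemma completion_mult_closed:
  assumes x: "x \<in> carrier S" and y: "y \<in> carrier S"
  shows "x \<otimes>\<^bsub>S\<^esub> y \<in> carrier S"
proof -
  obtain f where f: "\<And>I. I \<in> G \<Longrightarrow> f I \<in> x I" using completion_ex[OF x] by metis
  have fR: "f I \<in> carrier R" if "I \<in> G" for I using completion_mem(1) x f that by auto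
  have "\<forall>I. \<exists>s. I \<in> G \<longrightarrow> s \<in> y (ideal_colon R I (f I))"
    using completion_ex[OF y] G_colon fR by blast
  then obtain g where g: "\<And>I. I \<in> G \<Longrightarrow> g I \<in> y (ideal_colon R I (f I))" by metis
  have gR: "g I \<in> carrier R" if "I \<in> G" for I
    using completion_mem(1)[OF y G_colon[OF that fR[OF that]] g[OF that]] .
  have "x \<otimes>\<^bsub>S\<^esub> y = (\<lambda>I \<in> G. I +> (f I \<otimes> g I))"
  proof (rule extensionalityI[of _ G])
    show "x \<otimes>\<^bsub>S\<^esub> y \<in> extensional G" by (simp add: completion_def)
    show "(x \<otimes>\<^bsub>S\<^esub> y) I = (\<lambda>I \<in> G. I +> (f I \<otimes> g I)) I" if "I \<in> G" for I
      using completion_mult_mem(1)[OF x f y g] that by simp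
  qed simp
  also have "\<dots> \<in> carrier S"
  proof (rule completion_construct(1))
    fix I J assume IJ: "I \<in> G" "J \<in> G" "I \<subseteq> J"
    have 1: "f I \<in> x J" by (rule completion_mono[OF x IJ f[OF IJ(1)]])
    have 2: "g I \<in> y (ideal_colon R J (f I))"
      by (rule completion_mono[OF y _ _ ideal_colon_mono[OF IJ(3)] g[OF IJ(1)]]) (intro G_colon IJ fR)+
    have "f I \<otimes> g I \<in> (x \<otimes>\<^bsub>S\<^esub> y) J" by (rule completion_mult_mem(2)[OF x 1 y 2 IJ(2)])
    moreover have "(x \<otimes>\<^bsub>S\<^esub> y) J = J +> (f J \<otimes> g J)"
      by (rule completion_mult_mem(1)[OF x f[OF IJ(2)] y g[OF IJ(2)] IJ(2)])
    ultimately show "f I \<otimes> g I \<ominus> f J \<otimes> g J \<in> J"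
      using coset_iff[OF G_subgroup[OF IJ(2)]] fR gR IJ by auto
  qed (use fR gR in auto)
  finally show ?thesis .
qed

lemma cmap_mem_iff: "r \<in> carrier R \<Longrightarrow> I \<in> G \<Longrightarrow> s \<in> cmap r I \<longleftrightarrow> s \<in> carrier R \<and> s \<ominus> r \<in> I"
  by (simp add: completion_map_def coset_iff[OF G_subgroup])

lemma cmap_mem: "r \<in> carrier R \<Longrightarrow> I \<in> G \<Longrightarrow> r \<in> cmap r I"
  by (simp add: completion_map_def coset_self[OF G_subgroup])

lemma cmap_closed: "r \<in> carrier R \<Longrightarrow> cmap r \<in> carrier S"
  unfolding completion_map_def by (rule completion_construct(1)) (auto simp: a_minus_def r_neg G_zero)

lemma cmap_one: "cmap \<one> = \<one>\<^bsub>S\<^esub>"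
  by (simp add: completion_map_def completion_def)

lemma cmap_zero: "cmap \<zero> = \<zero>\<^bsub>S\<^esub>"
proof (rule completion_eqI)
  fix I assume "I \<in> G"
  then show "\<exists>r. r \<in> cmap \<zero> I \<and> r \<in> \<zero>\<^bsub>S\<^esub> I"
    using cmap_mem[OF zero_closed] by (intro exI[of _ \<zero>]) (simp add: completion_zero_mem G_zero)
qed (simp_all add: cmap_closed completion_zero_closed)

lemma cmap_add: "r \<in> carrier R \<Longrightarrow> s \<in> carrier R \<Longrightarrow> cmap (r \<oplus> s) = cmap r \<oplus>\<^bsub>S\<^esub> cmap s"
  by (rule completion_eqI)
    (auto simp: cmap_closed intro!: exI[of _ "r \<oplus> s"] cmap_mem completion_add_mem(2))

subsection \<open>Open right ideals\<close>

abbreviation \<JJ> :: "('r set \<Rightarrow> 'r set) set set" where "\<JJ> \<equiv> open_right_ideals R G"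

definition kernel_ideal :: "'r set \<Rightarrow> ('r set \<Rightarrow> 'r set) set" where
  "kernel_ideal I = {x \<in> carrier S. x I = I}"

lemma kernel_ideal_iff: "I \<in> G \<Longrightarrow> x \<in> kernel_ideal I \<longleftrightarrow> x \<in> carrier S \<and> \<zero> \<in> x I"
  using completion_kernel_iff by (auto simp: kernel_ideal_def)

lemma kernel_ideal_open:
  assumes I: "I \<in> G" shows "kernel_ideal I \<in> \<JJ>"
proof -
  have z: "\<zero> \<oplus> \<zero> = \<zero>" "\<zero> \<ominus> \<zero> = \<zero>" by (simp_all add: a_minus_def r_neg)
  have "subgroup (kernel_ideal I) (add_monoid S)"
  proof (rule S.add.subgroupI)
    have 0: "\<zero>\<^bsub>S\<^esub> \<in> kernel_ideal I"
      by (simp add: kernel_ideal_iff I completion_zero_closed completion_zero_mem G_zero)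
    then show "kernel_ideal I \<noteq> {}" by blast
    fix x assume x: "x \<in> kernel_ideal I"
    have "\<zero>\<^bsub>S\<^esub> \<ominus>\<^bsub>S\<^esub> x \<in> kernel_ideal I"
      using completion_minus_mem[of "\<zero>\<^bsub>S\<^esub>" \<zero> I x \<zero>] x 0 I by (simp add: kernel_ideal_iff z)
    then show "\<ominus>\<^bsub>S\<^esub> x \<in> kernel_ideal I" using x by (simp add: a_minus_def kernel_ideal_def)
    fix y assume y: "y \<in> kernel_ideal I"
    show "x \<oplus>\<^bsub>S\<^esub> y \<in> kernel_ideal I"
      using completion_add_mem(2)[of x \<zero> I y \<zero>] x y I by (simp add: kernel_ideal_iff z)
  qed (simp add: kernel_ideal_def subset_iff)
  then have "additive_subgroup (kernel_ideal I) S" by (rule additive_subgroupI)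
  moreover have "x \<otimes>\<^bsub>S\<^esub> y \<in> kernel_ideal I" if x: "x \<in> kernel_ideal I" and y: "y \<in> carrier S" for x y
  proof -
    obtain s where s: "s \<in> y (ideal_colon R I \<zero>)"
      using completion_ex[OF y G_colon[OF I zero_closed]] by blast
    then have "\<zero> \<otimes> s \<in> (x \<otimes>\<^bsub>S\<^esub> y) I"
      using x y I by (intro completion_mult_mem(2)) (auto simp: kernel_ideal_iff)
    moreover have "s \<in> carrier R" using completion_mem(1)[OF y G_colon[OF I zero_closed] s] .
    ultimately show ?thesis using x y I by (simp add: kernel_ideal_iff completion_mult_closed)
  qed
  ultimately have "right_ideal (kernel_ideal I) S" by (auto simp: right_ideal_def)
  then show ?thesis using I by (auto simp: open_right_ideals_def kernel_ideal_def)
qed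

lemma open_right_ideal_contains: "J \<in> \<JJ> \<Longrightarrow> \<exists>I \<in> G. kernel_ideal I \<subseteq> J"
  by (auto simp: open_right_ideals_def kernel_ideal_def)

lemma open_right_ideal_subgroup: "J \<in> \<JJ> \<Longrightarrow> additive_subgroup J S"
  by (auto simp: open_right_ideals_def right_ideal_def)

subsection \<open>Convergent sums\<close>

text \<open>
  Convergence to zero.  The kernels of \<open>S \<rightarrow> R/I\<close> are a base of neighborhoods of zero, so it suffices
  to test on them.
\<close>

definition summable_family :: "'x set \<Rightarrow> ('x \<Rightarrow> 'r set \<Rightarrow> 'r set) \<Rightarrow> bool" where
  "summable_family X a \<longleftrightarrow> a \<in> X \<rightarrow> carrier S \<and> (\<forall>I \<in> G. finite {x \<in> X. \<zero> \<notin> a x I})"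

abbreviation csum :: "'x set \<Rightarrow> ('x \<Rightarrow> 'r set \<Rightarrow> 'r set) \<Rightarrow> 'r set \<Rightarrow> 'r set" where
  "csum \<equiv> convergent_sum S \<JJ>"

text \<open>
  The set \<open>X\<close> may be infinite, so the sum extends over the support of \<open>p\<close>.
\<close>

definition fsum :: "'x set \<Rightarrow> ('x \<Rightarrow> 'r) \<Rightarrow> 'r" where
  "fsum X p = finsum R p {x \<in> X. p x \<noteq> \<zero>}"

text \<open>
  A finitely supported family over \<open>R\<close> congruent to \<open>a\<close> modulo \<open>I\<close>.  All identities between formal
  sums are proved by exhibiting, for every \<open>I\<close>, a common approximation of both sides.
\<close>

definition approximates :: "'r set \<Rightarrow> 'x set \<Rightarrow> ('x \<Rightarrow> 'r) \<Rightarrow> ('x \<Rightarrow> 'r set \<Rightarrow> 'r set) \<Rightarrow> bool" where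
  "approximates I X p a \<longleftrightarrow> finite {x \<in> X. p x \<noteq> \<zero>} \<and> (\<forall>x \<in> X. p x \<in> carrier R \<and> p x \<in> a x I)"

lemma fsum_over:
  assumes "finite F" "F \<subseteq> X" "{x \<in> X. p x \<noteq> \<zero>} \<subseteq> F" "p \<in> X \<rightarrow> carrier R"
  shows "fsum X p = finsum R p F"
  unfolding fsum_def
  by (rule add.finprod_mono_neutral_cong_left) (use assms in auto)

lemma fsum_closed: "p \<in> X \<rightarrow> carrier R \<Longrightarrow> fsum X p \<in> carrier R"
  unfolding fsum_def by (rule finsum_closed) auto

lemma finsum_mem:
  assumes "I \<in> G" "finite F" "\<And>x. x \<in> F \<Longrightarrow> p x \<in> I" shows "finsum R p F \<in> I"
  using assms(2,3)
proof (induction F rule: finite_induct)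
  case (insert x F)
  then have "p \<in> F \<rightarrow> carrier R" "p x \<in> carrier R" using G_subset[OF assms(1)] by auto
  then show ?case using insert G_add[OF assms(1)] by simp
qed (simp add: G_zero assms)

lemma fsum_diff_mem:
  assumes I: "I \<in> G" and p: "finite {x \<in> X. p x \<noteq> \<zero>}" "p \<in> X \<rightarrow> carrier R"
    and q: "finite {x \<in> X. q x \<noteq> \<zero>}" "q \<in> X \<rightarrow> carrier R"
    and d: "\<And>x. x \<in> X \<Longrightarrow> p x \<ominus> q x \<in> I"
  shows "fsum X p \<ominus> fsum X q \<in> I"
proof -
  let ?F = "{x \<in> X. p x \<noteq> \<zero>} \<union> {x \<in> X. q x \<noteq> \<zero>}"
  have F: "finite ?F" "?F \<subseteq> X" using p q by auto
  have P: "fsum X p = finsum R p ?F" by (rule fsum_over[OF F _ p(2)]) auto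
  have Q: "fsum X q = finsum R q ?F" by (rule fsum_over[OF F _ q(2)]) auto
  have D: "finsum R (\<lambda>x. p x \<ominus> q x) ?F \<in> I"
    by (rule finsum_mem[OF I F(1)]) (use d in auto)
  have "finsum R (\<lambda>x. p x \<ominus> q x) ?F \<oplus> finsum R q ?F = finsum R (\<lambda>x. (p x \<ominus> q x) \<oplus> q x) ?F"
    using p(2) q(2) F(2) by (intro finsum_addf[symmetric]) auto
  also have "\<dots> = finsum R p ?F"
    using p(2) q(2) F(2) by (intro add.finprod_cong') (auto simp: a_minus_def a_assoc l_neg Pi_def)
  finally have "finsum R p ?F = finsum R (\<lambda>x. p x \<ominus> q x) ?F \<oplus> finsum R q ?F" by simp
  moreover have "finsum R q ?F \<in> carrier R" using q(2) F(2) by (intro finsum_closed) auto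
  ultimately show ?thesis
    using D G_subset[OF I D] unfolding P Q by (simp add: a_minus_def a_assoc r_neg)
qed

lemma approximates_exists:
  assumes a: "summable_family X a" and I: "I \<in> G"
  obtains p where "approximates I X p a" "\<And>x. x \<in> X \<Longrightarrow> \<zero> \<in> a x I \<Longrightarrow> p x = \<zero>"
proof -
  have "\<exists>r. x \<in> X \<longrightarrow> r \<in> a x I \<and> (\<zero> \<in> a x I \<longrightarrow> r = \<zero>)" for x
    using completion_ex[OF _ I, of "a x"] a
    by (cases "\<zero> \<in> a x I") (auto simp: summable_family_def Pi_def)
  then obtain p where p: "\<And>x. x \<in> X \<Longrightarrow> p x \<in> a x I" "\<And>x. x \<in> X \<Longrightarrow> \<zero> \<in> a x I \<Longrightarrow> p x = \<zero>"
    by metis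
  have "finite {x \<in> X. p x \<noteq> \<zero>}"
    by (rule finite_subset[of _ "{x \<in> X. \<zero> \<notin> a x I}"]) (use p a I in \<open>auto simp: summable_family_def\<close>)
  moreover have "p x \<in> carrier R" if "x \<in> X" for x
    using completion_mem(1)[of "a x" I "p x"] I p(1)[OF that] a that by (auto simp: summable_family_def)
  ultimately show thesis
    using that[of p] p by (auto simp: approximates_def)
qed

lemma approximates_mono:
  assumes "approximates I X p a" "I \<in> G" "J \<in> G" "I \<subseteq> J" "a \<in> X \<rightarrow> carrier S"
  shows "approximates J X p a"
  using assms completion_mono by (auto simp: approximates_def Pi_def)

lemma approximates_diff:
  assumes "approximates I X p a" "approximates I X q a" "I \<in> G" "a \<in> X \<rightarrow> carrier S" "x \<in> X"
  shows "p x \<ominus> q x \<in> I"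
  using assms completion_mem_diff by (auto simp: approximates_def Pi_def)

lemma completion_finsum_mem:
  assumes I: "I \<in> G" and "finite F" "a \<in> F \<rightarrow> carrier S" "\<And>x. x \<in> F \<Longrightarrow> p x \<in> a x I"
  shows "finsum R p F \<in> (finsum S a F) I"
  using assms(2-4)
proof (induction F rule: finite_induct)
  case empty then show ?case by (simp add: completion_zero_mem I G_zero)
next
  case (insert x F)
  have "p \<in> F \<rightarrow> carrier R" "p x \<in> carrier R"
    using completion_mem(1)[OF _ I] insert.prems by (auto simp: Pi_def)
  then show ?case
    using insert I by (simp add: completion_add_mem(2) Pi_def)
qed

text \<open>
  The sums of approximations of \<open>a\<close> modulo the various \<open>I\<close> are compatible, since any two
  approximations of \<open>a\<close> modulo \<open>I\<close> differ in finitely many places by elements of \<open>I\<close>.  They define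
  an element of the limit, and this is the unique one satisfying the definition of the sum.
\<close>

lemma convergent_sum_props:
  assumes a: "summable_family X a"
  shows "csum X a \<in> carrier S"
    and "\<And>I p. I \<in> G \<Longrightarrow> approximates I X p a \<Longrightarrow> fsum X p \<in> (csum X a) I"
proof -
  have aS: "a \<in> X \<rightarrow> carrier S" using a by (simp add: summable_family_def)
  have "\<forall>I. \<exists>p. I \<in> G \<longrightarrow> approximates I X p a \<and> (\<forall>x \<in> X. \<zero> \<in> a x I \<longrightarrow> p x = \<zero>)"
    using approximates_exists[OF a] by metis
  then obtain p where p: "\<And>I. I \<in> G \<Longrightarrow> approximates I X (p I) a"
    and p0: "\<And>I x. I \<in> G \<Longrightarrow> x \<in> X \<Longrightarrow> \<zero> \<in> a x I \<Longrightarrow> p I x = \<zero>" by metis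
  have pR: "p I \<in> X \<rightarrow> carrier R" "finite {x \<in> X. p I x \<noteq> \<zero>}" if "I \<in> G" for I
    using p[OF that] by (auto simp: approximates_def)
  define s where "s = (\<lambda>I \<in> G. I +> fsum X (p I))"
  have sS: "s \<in> carrier S" and sI: "\<And>I. I \<in> G \<Longrightarrow> fsum X (p I) \<in> s I"
  proof -
    have 1: "fsum X (p I) \<ominus> fsum X (p J) \<in> J" if IJ: "I \<in> G" "J \<in> G" "I \<subseteq> J" for I J
      by (rule fsum_diff_mem[OF IJ(2)])
        (use pR IJ approximates_diff[OF approximates_mono[OF p[OF IJ(1)] IJ aS] p[OF IJ(2)] IJ(2) aS] in auto)
    have 2: "fsum X (p I) \<in> carrier R" if "I \<in> G" for I by (rule fsum_closed[OF pR(1)[OF that]])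
    show "s \<in> carrier S"
      unfolding s_def by (rule completion_construct(1)) (use 1 2 in blast)+
    show "fsum X (p I) \<in> s I" if "I \<in> G" for I
      unfolding s_def by (rule completion_construct(2)) (use 1 2 that in blast)+
  qed
  have fin: "finite {x \<in> X. a x \<notin> kernel_ideal I}" if "I \<in> G" for I
  proof -
    have "{x \<in> X. a x \<notin> kernel_ideal I} = {x \<in> X. \<zero> \<notin> a x I}"
      using aS kernel_ideal_iff[OF that] by auto
    then show ?thesis using a that by (simp add: summable_family_def)
  qed
  have ker: "s \<ominus>\<^bsub>S\<^esub> finsum S a {x \<in> X. a x \<notin> kernel_ideal I} \<in> kernel_ideal I" if I: "I \<in> G" for I
  proof -
    let ?F = "{x \<in> X. a x \<notin> kernel_ideal I}"
    have aF: "a \<in> ?F \<rightarrow> carrier S" using aS by auto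
    have "fsum X (p I) = finsum R (p I) ?F"
      by (rule fsum_over[OF fin[OF I]]) (use p0[OF I] pR[OF I] kernel_ideal_iff[OF I] in auto)
    also have "\<dots> \<in> (finsum S a ?F) I"
      by (rule completion_finsum_mem[OF I fin[OF I] aF]) (use p[OF I] in \<open>auto simp: approximates_def\<close>)
    finally have 1: "fsum X (p I) \<in> (finsum S a ?F) I" .
    have fS: "finsum S a ?F \<in> carrier S" using aF by (rule S.finsum_closed)
    have "fsum X (p I) \<ominus> fsum X (p I) \<in> (s \<ominus>\<^bsub>S\<^esub> finsum S a ?F) I"
      by (rule completion_minus_mem[OF sS sI[OF I] fS 1 I])
    moreover have "fsum X (p I) \<in> carrier R" by (rule fsum_closed[OF pR(1)[OF I]])
    ultimately show ?thesis using sS fS by (simp add: kernel_ideal_iff I a_minus_def r_neg)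
  qed
  have "csum X a = s"
    unfolding convergent_sum_def
  proof (rule the_equality)
    show "s \<in> carrier S \<and> (\<forall>J \<in> \<JJ>. s \<ominus>\<^bsub>S\<^esub> finsum S a {x \<in> X. a x \<notin> J} \<in> J)"
    proof (intro conjI ballI sS)
      fix J assume J: "J \<in> \<JJ>"
      obtain I where I: "I \<in> G" "kernel_ideal I \<subseteq> J" using open_right_ideal_contains[OF J] by blast
      interpret J: additive_subgroup J S by (rule open_right_ideal_subgroup[OF J])
      let ?F = "{x \<in> X. a x \<notin> kernel_ideal I}" and ?E = "{x \<in> X. a x \<notin> J}"
      have EF: "?E \<subseteq> ?F" using I by auto
      have fF: "finite ?F" by (rule fin[OF I(1)])
      have cl: "finsum S a E \<in> carrier S" if "E \<subseteq> X" for E using aS that by (intro S.finsum_closed) auto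
      have split: "finsum S a ?F = finsum S a ?E \<oplus>\<^bsub>S\<^esub> finsum S a (?F - ?E)"
      proof -
        have "finsum S a (?E \<union> (?F - ?E)) = finsum S a ?E \<oplus>\<^bsub>S\<^esub> finsum S a (?F - ?E)"
          by (rule S.finsum_Un_disjoint) (use fF finite_subset[OF EF fF] aS in auto)
        moreover have "?E \<union> (?F - ?E) = ?F" using EF by blast
        ultimately show ?thesis by simp
      qed
      have inJ: "finsum S a E \<in> J" if "finite E" "\<And>x. x \<in> E \<Longrightarrow> a x \<in> J" for E
        using that
      proof (induction E rule: finite_induct)
        case (insert x E)
        then have "a \<in> E \<rightarrow> carrier S" "a x \<in> carrier S" using J.a_Hcarr by auto
        then show ?case using insert J.a_closed by simp
      qed (simp add: J.zero_closed)
      have 1: "s \<ominus>\<^bsub>S\<^esub> finsum S a ?F \<in> J" using ker[OF I(1)] I(2) by blast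
      have 2: "finsum S a (?F - ?E) \<in> J" using fF by (intro inJ) auto
      have c2: "finsum S a (?F - ?E) \<in> carrier S" "finsum S a ?E \<in> carrier S" by (intro cl; blast)+
      have "s \<ominus>\<^bsub>S\<^esub> finsum S a ?E = (s \<ominus>\<^bsub>S\<^esub> finsum S a ?F) \<oplus>\<^bsub>S\<^esub> finsum S a (?F - ?E)"
        unfolding split using sS c2 by (simp add: a_minus_def S.minus_add S.a_assoc S.l_neg)
      then show "s \<ominus>\<^bsub>S\<^esub> finsum S a ?E \<in> J" using J.a_closed[OF 1 2] by simp
    qed
  next
    fix t assume t: "t \<in> carrier S \<and> (\<forall>J \<in> \<JJ>. t \<ominus>\<^bsub>S\<^esub> finsum S a {x \<in> X. a x \<notin> J} \<in> J)"
    show "t = s"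
    proof (rule completion_eqI)
      fix I assume I: "I \<in> G"
      let ?f = "finsum S a {x \<in> X. a x \<notin> kernel_ideal I}"
      have fS: "?f \<in> carrier S" using aS by (intro S.finsum_closed) auto
      obtain f where f: "f \<in> ?f I" using completion_ex[OF fS I] by blast
      have fR: "f \<in> carrier R" using completion_mem(1)[OF fS I f] .
      have *: "f \<in> x I" if x: "x \<in> carrier S" "x \<ominus>\<^bsub>S\<^esub> ?f \<in> kernel_ideal I" for x
      proof -
        have "\<zero> \<oplus> f \<in> ((x \<ominus>\<^bsub>S\<^esub> ?f) \<oplus>\<^bsub>S\<^esub> ?f) I"
          by (rule completion_add_mem(2)[OF _ _ fS f I]) (use x I fS in \<open>auto simp: kernel_ideal_iff\<close>)
        moreover have "(x \<ominus>\<^bsub>S\<^esub> ?f) \<oplus>\<^bsub>S\<^esub> ?f = x" using x fS by (simp add: a_minus_def S.a_assoc S.l_neg)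
        ultimately show ?thesis using fR by simp
      qed
      show "\<exists>r. r \<in> t I \<and> r \<in> s I"
        using *[of t] *[of s] t kernel_ideal_open[OF I] ker[OF I] sS by blast
    qed (use t sS in auto)
  qed
  then show "csum X a \<in> carrier S" using sS by simp
  fix I q assume I: "I \<in> G" and q: "approximates I X q a"
  have qR: "q \<in> X \<rightarrow> carrier R" "finite {x \<in> X. q x \<noteq> \<zero>}" using q by (auto simp: approximates_def)
  have "fsum X q \<ominus> fsum X (p I) \<in> I"
    by (rule fsum_diff_mem[OF I qR(2,1) pR(2)[OF I] pR(1)[OF I]]) (use approximates_diff[OF q p[OF I] I aS] in auto)
  then show "fsum X q \<in> (csum X a) I"
    unfolding \<open>csum X a = s\<close> using completion_mem_iff[OF sS I sI[OF I]] fsum_closed[OF qR(1)] by blast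
qed

end

context right_topology
begin

section \<open>Formal sums over the completion\<close>

abbreviation FS :: "'x set \<Rightarrow> ('x \<Rightarrow> 'r set \<Rightarrow> 'r set) set" where "FS \<equiv> formal_sums S \<JJ>"
abbreviation PF :: "'x set \<Rightarrow> ('x \<Rightarrow> 'r) set" where "PF X \<equiv> carrier (free_module R X)"

lemma formal_sums_iff: "a \<in> FS X \<longleftrightarrow> a \<in> extensional X \<and> summable_family X a"
proof -
  have "(\<forall>J \<in> \<JJ>. finite {x \<in> X. a x \<notin> J}) \<longleftrightarrow> (\<forall>I \<in> G. finite {x \<in> X. \<zero> \<notin> a x I})"
    if a: "a \<in> X \<rightarrow> carrier S"
  proof -
    have eq: "{x \<in> X. a x \<notin> kernel_ideal I} = {x \<in> X. \<zero> \<notin> a x I}" if "I \<in> G" for I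
      using a kernel_ideal_iff[OF that] by auto
    show ?thesis
    proof
      assume "\<forall>J \<in> \<JJ>. finite {x \<in> X. a x \<notin> J}"
      then show "\<forall>I \<in> G. finite {x \<in> X. \<zero> \<notin> a x I}" by (simp add: kernel_ideal_open flip: eq)
    next
      assume fin: "\<forall>I \<in> G. finite {x \<in> X. \<zero> \<notin> a x I}"
      show "\<forall>J \<in> \<JJ>. finite {x \<in> X. a x \<notin> J}"
      proof
        fix J assume "J \<in> \<JJ>"
        then obtain I where I: "I \<in> G" "kernel_ideal I \<subseteq> J" using open_right_ideal_contains by blast
        then have "{x \<in> X. a x \<notin> J} \<subseteq> {x \<in> X. \<zero> \<notin> a x I}" using eq by blast
        moreover have "finite {x \<in> X. \<zero> \<notin> a x I}" using fin I(1) by blast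
        ultimately show "finite {x \<in> X. a x \<notin> J}" by (rule finite_subset)
      qed
    qed
  qed
  then show ?thesis by (auto simp: formal_sums_def summable_family_def PiE_def)
qed

lemma FS_closed: "a \<in> FS X \<Longrightarrow> x \<in> X \<Longrightarrow> a x \<in> carrier S"
  by (auto simp: formal_sums_iff summable_family_def)

lemma FS_funcset: "a \<in> FS X \<Longrightarrow> a \<in> X \<rightarrow> carrier S"
  by (auto simp: formal_sums_iff summable_family_def)

lemma FS_I:
  assumes "b \<in> extensional X" "b \<in> X \<rightarrow> carrier S" "\<And>I. I \<in> G \<Longrightarrow> \<exists>q. approximates I X q b"
  shows "b \<in> FS X"
proof -
  have "finite {x \<in> X. \<zero> \<notin> b x I}" if I: "I \<in> G" for I
  proof -
    obtain q where q: "approximates I X q b" using assms(3)[OF I] by blast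
    show ?thesis
      by (rule finite_subset[of _ "{x \<in> X. q x \<noteq> \<zero>}"]) (use q in \<open>auto simp: approximates_def\<close>)
  qed
  then show ?thesis using assms by (simp add: formal_sums_iff summable_family_def)
qed

lemma FS_eqI:
  assumes "a \<in> FS X" "b \<in> FS X" "\<And>I. I \<in> G \<Longrightarrow> \<exists>p. approximates I X p a \<and> approximates I X p b"
  shows "a = b"
proof (rule extensionalityI[of _ X])
  fix x assume x: "x \<in> X"
  show "a x = b x"
  proof (rule completion_eqI[OF FS_closed[OF assms(1) x] FS_closed[OF assms(2) x]])
    fix I assume "I \<in> G"
    then obtain p where "approximates I X p a" "approximates I X p b" using assms(3) by blast
    then show "\<exists>r. r \<in> a x I \<and> r \<in> b x I" using x by (auto simp: approximates_def)
  qed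
qed (use assms in \<open>auto simp: formal_sums_iff\<close>)

lemma FS_approx:
  assumes a: "a \<in> FS X" and I: "I \<in> G"
  obtains p where "p \<in> PF X" "approximates I X p a"
proof -
  have sa: "summable_family X a" using a by (simp add: formal_sums_iff)
  obtain p where p: "approximates I X p a"
    using approximates_exists[OF sa I] by blast
  have "restrict p X \<in> PF X" "approximates I X (restrict p X) a"
    using p by (auto simp: free_module_carrier approximates_def cong: conj_cong)
  then show thesis using that by blast
qed

lemma FS_approx_many:
  assumes a: "a \<in> FS X" and I: "I \<in> G" and F: "finite F" "F \<subseteq> carrier R"
  shows "\<exists>p. p \<in> PF X \<and> (\<forall>r \<in> F. approximates (ideal_colon R I r) X p a)"
proof -
  have K: "ideal_colon R I r \<in> G" if "r \<in> F" for r using G_colon[OF I] F(2) that by blast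
  obtain J where J: "J \<in> G" "\<And>r. r \<in> F \<Longrightarrow> J \<subseteq> ideal_colon R I r"
    using G_INT[OF F(1), of "\<lambda>r. ideal_colon R I r"] K by blast
  obtain p where p: "p \<in> PF X" "approximates J X p a" using FS_approx[OF a J(1)] .
  have "approximates (ideal_colon R I r) X p a" if "r \<in> F" for r
    by (rule approximates_mono[OF p(2) J(1) K[OF that] J(2)[OF that] FS_funcset[OF a]])
  then show ?thesis using p(1) by blast
qed

lemma approximates_apply:
  assumes "approximates I X p a" "x \<in> X" shows "p x \<in> a x I" "p x \<in> carrier R"
  using assms by (auto simp: approximates_def)

lemma approximatesI:
  assumes "p \<in> PF X" "\<And>x. x \<in> X \<Longrightarrow> p x \<in> a x I"
  shows "approximates I X p a"
  using assms free_module_closed[OF assms(1)] free_module_finite[OF assms(1)] by (auto simp: approximates_def)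

subsection \<open>Finite combinations\<close>

lemma free_module_finsum_apply:
  assumes "finite F" "h \<in> F \<rightarrow> PF X" "x \<in> X"
  shows "finsum (free_module R X) h F x = finsum R (\<lambda>y. h y x) F"
  using assms(1,2)
proof (induction F rule: finite_induct)
  interpret F: left_module R "free_module R X" by (rule free_module_left_module)
  {
    case empty
    then show ?case using assms(3) by (simp add: free_module_apply)
  next
    case (insert y F)
    have "(\<lambda>y. h y x) \<in> F \<rightarrow> carrier R" "h y x \<in> carrier R"
      using insert.prems assms(3) free_module_closed by (fastforce simp: Pi_def)+
    then show ?case using insert assms(3) by (simp add: free_module_apply Pi_def)
  }
qed

lemma lin_ext_free_apply:
  assumes P: "P \<in> PF Y" and p: "p \<in> Y \<rightarrow> PF X" and x: "x \<in> X"
  shows "lin_ext R (free_module R X) Y p P x = fsum Y (\<lambda>y. P y \<otimes> p y x)"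
proof -
  let ?F = "{y \<in> Y. P y \<noteq> \<zero>}"
  have F: "finite ?F" "?F \<subseteq> Y" using free_module_finite[OF P] by auto
  have pR: "p y x \<in> carrier R" if "y \<in> Y" for y using p that x free_module_closed by (metis Pi_mem)
  have PR: "P y \<in> carrier R" if "y \<in> Y" for y using free_module_closed[OF P that] .
  have h: "(\<lambda>y. P y \<odot>\<^bsub>free_module R X\<^esub> p y) \<in> ?F \<rightarrow> PF X"
    using p PR by (auto intro!: free_module_smult_closed simp: Pi_def)
  have "lin_ext R (free_module R X) Y p P x = finsum R (\<lambda>y. (P y \<odot>\<^bsub>free_module R X\<^esub> p y) x) ?F"
    unfolding lin_ext_def by (rule free_module_finsum_apply[OF F(1) h x])
  also have "\<dots> = finsum R (\<lambda>y. P y \<otimes> p y x) ?F" by (simp add: free_module_apply x)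
  also have "\<dots> = fsum Y (\<lambda>y. P y \<otimes> p y x)"
    by (rule fsum_over[symmetric, OF F]) (use pR PR in auto)
  finally show ?thesis .
qed

text \<open>The push-forward of finite formal sums.  It takes approximations to approximations.\<close>

definition push_fin :: "'x set \<Rightarrow> 'y set \<Rightarrow> ('x \<Rightarrow> 'y) \<Rightarrow> ('x \<Rightarrow> 'r) \<Rightarrow> ('y \<Rightarrow> 'r)" where
  "push_fin X Y f = lin_ext R (free_module R Y) X (\<lambda>x. formal_single R Y \<one> (f x))"

lemma push_fin_linear: "linear_map R (free_module R X) (free_module R Y) (push_fin X Y f)"
  unfolding push_fin_def
  by (rule left_module.lin_ext_linear[OF free_module_left_module]) (simp add: formal_single_closed)

lemma push_fin_closed: "p \<in> PF X \<Longrightarrow> push_fin X Y f p \<in> PF Y"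
  by (rule linear_map_closed[OF push_fin_linear])

lemma push_fin_single:
  assumes "r \<in> carrier R" "x \<in> X"
  shows "push_fin X Y f (formal_single R X r x) = formal_single R Y r (f x)"
  unfolding push_fin_def
  using assms by (subst left_module.lin_ext_single[OF free_module_left_module])
    (simp_all add: formal_single_closed formal_single_smult)

lemma push_fin_apply:
  assumes p: "p \<in> PF X" and f: "f \<in> X \<rightarrow> Y" and y: "y \<in> Y"
  shows "push_fin X Y f p y = fsum {x \<in> X. f x = y} p"
proof -
  let ?h = "\<lambda>x. p x \<otimes> formal_single R Y \<one> (f x) y"
  let ?F = "{x \<in> X. p x \<noteq> \<zero>}" and ?E = "{x \<in> {x \<in> X. f x = y}. p x \<noteq> \<zero>}"
  have pR: "p x \<in> carrier R" if "x \<in> X" for x using free_module_closed[OF p that] .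
  have F: "finite ?F" "?F \<subseteq> X" using free_module_finite[OF p] by auto
  have h: "?h x = (if f x = y then p x else \<zero>)" if "x \<in> X" for x
    using that y pR by (simp add: formal_single_def)
  have e: "formal_single R Y \<one> (f x) y \<in> carrier R" for x using y by (simp add: formal_single_def)
  have "push_fin X Y f p y = fsum X ?h"
    unfolding push_fin_def by (rule lin_ext_free_apply[OF p _ y]) (simp add: formal_single_closed)
  also have "\<dots> = finsum R ?h ?F"
    by (rule fsum_over[OF F]) (use e pR in auto)
  also have "\<dots> = finsum R p ?E"
    by (rule add.finprod_mono_neutral_cong_right[OF F(1)]) (use h pR in auto)
  finally show ?thesis unfolding fsum_def by simp
qed

subsection \<open>Push-forward, composition, and the module of formal sums\<close>

lemma summable_subfamily: "summable_family X a \<Longrightarrow> X' \<subseteq> X \<Longrightarrow> summable_family X' a"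
  by (auto simp: summable_family_def Pi_def elim!: rev_finite_subset)

lemma approximates_sub: "approximates I X p a \<Longrightarrow> X' \<subseteq> X \<Longrightarrow> approximates I X' p a"
  by (auto simp: approximates_def elim!: rev_finite_subset)

abbreviation push :: "'x set \<Rightarrow> 'y set \<Rightarrow> ('x \<Rightarrow> 'y) \<Rightarrow> ('x \<Rightarrow> 'r set \<Rightarrow> 'r set) \<Rightarrow> ('y \<Rightarrow> 'r set \<Rightarrow> 'r set)" where
  "push \<equiv> formal_push S \<JJ>"

lemma push_approximates:
  assumes a: "a \<in> FS X" and f: "f \<in> X \<rightarrow> Y" and I: "I \<in> G" and p: "p \<in> PF X" "approximates I X p a"
  shows "approximates I Y (push_fin X Y f p) (push X Y f a)"
proof (rule approximatesI[OF push_fin_closed[OF p(1)]])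
  fix y assume y: "y \<in> Y"
  have "fsum {x \<in> X. f x = y} p \<in> (csum {x \<in> X. f x = y} a) I"
    using a formal_sums_iff
    by (intro convergent_sum_props(2)[OF summable_subfamily I approximates_sub[OF p(2)]]) auto
  then show "push_fin X Y f p y \<in> push X Y f a y I"
    using y by (simp add: push_fin_apply[OF p(1) f y] formal_push_def)
qed

lemma push_closed:
  assumes a: "a \<in> FS X" and f: "f \<in> X \<rightarrow> Y" shows "push X Y f a \<in> FS Y"
proof (rule FS_I)
  show "push X Y f a \<in> extensional Y" by (simp add: formal_push_def)
  have "csum {x \<in> X. f x = y} a \<in> carrier S" for y
    using a formal_sums_iff by (intro convergent_sum_props(1)[OF summable_subfamily[of X]]) auto
  then show "push X Y f a \<in> Y \<rightarrow> carrier S" by (simp add: formal_push_def)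
  fix I assume I: "I \<in> G"
  obtain p where "p \<in> PF X" "approximates I X p a" using FS_approx[OF a I] .
  then show "\<exists>q. approximates I Y q (push X Y f a)" using push_approximates[OF a f I] by blast
qed

text \<open>
  The formal sum \<open>\<Sum> A\<^sub>y t\<^sub>y\<close>, with parentheses opened, for a family of formal sums \<open>t\<^sub>y\<close>.
\<close>

definition comp :: "'y set \<Rightarrow> 'x set \<Rightarrow> ('y \<Rightarrow> 'r set \<Rightarrow> 'r set) \<Rightarrow> ('y \<Rightarrow> 'x \<Rightarrow> 'r set \<Rightarrow> 'r set) \<Rightarrow>
    ('x \<Rightarrow> 'r set \<Rightarrow> 'r set)" where
  "comp Y X A t = (\<lambda>x \<in> X. csum Y (\<lambda>y. A y \<otimes>\<^bsub>S\<^esub> t y x))"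

lemma open_parentheses_eq_comp: "open_parentheses S \<JJ> X A = comp (FS X) X A (\<lambda>a. a)"
  by (simp add: open_parentheses_def comp_def)

lemma comp_summable:
  assumes A: "A \<in> FS Y" and t: "t \<in> Y \<rightarrow> FS X" and x: "x \<in> X"
  shows "summable_family Y (\<lambda>y. A y \<otimes>\<^bsub>S\<^esub> t y x)"
proof -
  have tS: "t y x \<in> carrier S" if "y \<in> Y" for y using t x that FS_closed by (metis Pi_mem)
  have "finite {y \<in> Y. \<zero> \<notin> (A y \<otimes>\<^bsub>S\<^esub> t y x) I}" if I: "I \<in> G" for I
  proof (rule finite_subset)
    show "{y \<in> Y. \<zero> \<notin> (A y \<otimes>\<^bsub>S\<^esub> t y x) I} \<subseteq> {y \<in> Y. \<zero> \<notin> A y I}"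
    proof (rule subsetI, rule ccontr)
      fix y assume "y \<in> {y \<in> Y. \<zero> \<notin> (A y \<otimes>\<^bsub>S\<^esub> t y x) I}" "y \<notin> {y \<in> Y. \<zero> \<notin> A y I}"
      then have y: "y \<in> Y" and n: "\<zero> \<notin> (A y \<otimes>\<^bsub>S\<^esub> t y x) I" "\<zero> \<in> A y I" by auto
      have K: "ideal_colon R I \<zero> \<in> G" using I by (simp add: G_colon)
      obtain s where s: "s \<in> t y x (ideal_colon R I \<zero>)" using completion_ex[OF tS[OF y] K] by blast
      have "\<zero> \<otimes> s \<in> (A y \<otimes>\<^bsub>S\<^esub> t y x) I"
        by (rule completion_mult_mem(2)[OF FS_closed[OF A y] _ tS[OF y] s I]) (use n in simp)
      then show False using n completion_mem(1)[OF tS[OF y] K s] by simp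
    qed
    show "finite {y \<in> Y. \<zero> \<notin> A y I}" using A I by (simp add: formal_sums_iff summable_family_def)
  qed
  then show ?thesis
    using FS_closed[OF A] tS by (auto simp: summable_family_def completion_mult_closed)
qed

text \<open>
  The coset modulo \<open>I\<close> of a product \<open>P\<^sub>y t\<close> depends only on \<open>t\<close> modulo \<open>(I : P\<^sub>y)\<close>.  So the
  approximations of the inner sums have to be adapted to the coefficients of the outer one.
\<close>

lemma comp_approximates:
  assumes A: "A \<in> FS Y" and t: "t \<in> Y \<rightarrow> FS X" and I: "I \<in> G"
    and P: "P \<in> PF Y" "approximates I Y P A"
    and p: "p \<in> Y \<rightarrow> PF X" "\<And>y. y \<in> Y \<Longrightarrow> approximates (ideal_colon R I (P y)) X (p y) (t y)"
  shows "approximates I X (lin_ext R (free_module R X) Y p P) (comp Y X A t)"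
proof (rule approximatesI)
  show "lin_ext R (free_module R X) Y p P \<in> PF X"
    by (rule linear_map_closed[OF left_module.lin_ext_linear[OF free_module_left_module p(1)] P(1)])
  fix x assume x: "x \<in> X"
  have PR: "P y \<in> carrier R" if "y \<in> Y" for y using free_module_closed[OF P(1) that] .
  have pR: "p y x \<in> carrier R" if "y \<in> Y" for y using p(1) that x free_module_closed by (metis Pi_mem)
  have tS: "t y x \<in> carrier S" if "y \<in> Y" for y using t x that FS_closed by (metis Pi_mem)
  have "approximates I Y (\<lambda>y. P y \<otimes> p y x) (\<lambda>y. A y \<otimes>\<^bsub>S\<^esub> t y x)"
    unfolding approximates_def
  proof (intro conjI ballI)
    show "finite {y \<in> Y. P y \<otimes> p y x \<noteq> \<zero>}"
      by (rule finite_subset[OF _ free_module_finite[OF P(1)]]) (use pR in auto)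
    fix y assume y: "y \<in> Y"
    show "P y \<otimes> p y x \<in> carrier R" using y PR pR by simp
    show "P y \<otimes> p y x \<in> (A y \<otimes>\<^bsub>S\<^esub> t y x) I"
      by (rule completion_mult_mem(2)[OF FS_closed[OF A y] approximates_apply(1)[OF P(2) y] tS[OF y]
            approximates_apply(1)[OF p(2)[OF y] x] I])
  qed
  then have "fsum Y (\<lambda>y. P y \<otimes> p y x) \<in> csum Y (\<lambda>y. A y \<otimes>\<^bsub>S\<^esub> t y x) I"
    by (rule convergent_sum_props(2)[OF comp_summable[OF A t x] I])
  then show "lin_ext R (free_module R X) Y p P x \<in> comp Y X A t x I"
    using x by (simp add: lin_ext_free_apply[OF P(1) p(1) x] comp_def)
qed

lemma approx_choice:
  assumes t: "t \<in> Y \<rightarrow> FS X" and I: "I \<in> G" and F: "\<And>y. y \<in> Y \<Longrightarrow> finite (F y)" "\<And>y. y \<in> Y \<Longrightarrow> F y \<subseteq> carrier R"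
  obtains p where "p \<in> Y \<rightarrow> PF X" "\<And>y r. y \<in> Y \<Longrightarrow> r \<in> F y \<Longrightarrow> approximates (ideal_colon R I r) X (p y) (t y)"
proof -
  have "\<exists>p. y \<in> Y \<longrightarrow> p \<in> PF X \<and> (\<forall>r \<in> F y. approximates (ideal_colon R I r) X p (t y))" for y
    using FS_approx_many[OF Pi_mem[OF t] I F] by blast
  then obtain p where p: "\<And>y. y \<in> Y \<longrightarrow> p y \<in> PF X \<and> (\<forall>r \<in> F y. approximates (ideal_colon R I r) X (p y) (t y))"
    by metis
  show thesis by (rule that[of p]) (use p in auto)
qed

lemma comp_closed:
  assumes A: "A \<in> FS Y" and t: "t \<in> Y \<rightarrow> FS X" shows "comp Y X A t \<in> FS X"
proof (rule FS_I)
  show "comp Y X A t \<in> extensional X" by (simp add: comp_def)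
  show "comp Y X A t \<in> X \<rightarrow> carrier S"
    using convergent_sum_props(1)[OF comp_summable[OF A t]] by (simp add: comp_def)
  fix I assume I: "I \<in> G"
  obtain P where P: "P \<in> PF Y" "approximates I Y P A" using FS_approx[OF A I] .
  obtain p where p: "p \<in> Y \<rightarrow> PF X"
      "\<And>y r. y \<in> Y \<Longrightarrow> r \<in> {P y} \<Longrightarrow> approximates (ideal_colon R I r) X (p y) (t y)"
    by (rule approx_choice[OF t I, of "\<lambda>y. {P y}"]) (use free_module_closed[OF P(1)] in auto)
  show "\<exists>q. approximates I X q (comp Y X A t)"
    using comp_approximates[OF A t I P p(1)] p(2) by blast
qed

text \<open>
  A family of elements of \<open>R\<close> viewed in the completion.  It is a formal sum if it tends to zero.
\<close>

definition emb :: "'x set \<Rightarrow> ('x \<Rightarrow> 'r) \<Rightarrow> ('x \<Rightarrow> 'r set \<Rightarrow> 'r set)" where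
  "emb X \<alpha> = (\<lambda>x \<in> X. cmap (\<alpha> x))"

lemma emb_approximates:
  "p \<in> PF X \<Longrightarrow> I \<in> G \<Longrightarrow> approximates I X p (emb X p)"
  by (rule approximatesI) (auto simp: emb_def cmap_mem free_module_closed)

lemma emb_null_approximates:
  assumes "\<alpha> \<in> X \<rightarrow> carrier R" "p \<in> PF X" "I \<in> G" "\<And>x. x \<in> X \<Longrightarrow> p x \<ominus> \<alpha> x \<in> I"
  shows "approximates I X p (emb X \<alpha>)"
  using assms free_module_closed[OF assms(2)]
  by (intro approximatesI) (auto simp: emb_def cmap_mem_iff Pi_def)

lemma emb_null_closed:
  assumes \<alpha>: "\<alpha> \<in> X \<rightarrow> carrier R" and null: "\<And>I. I \<in> G \<Longrightarrow> finite {x \<in> X. \<alpha> x \<notin> I}"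
  shows "emb X \<alpha> \<in> FS X"
proof (rule FS_I)
  show "emb X \<alpha> \<in> extensional X" by (simp add: emb_def)
  show "emb X \<alpha> \<in> X \<rightarrow> carrier S" using \<alpha> cmap_closed by (auto simp: emb_def Pi_def)
  fix I assume I: "I \<in> G"
  let ?p = "\<lambda>x \<in> X. if \<alpha> x \<in> I then \<zero> else \<alpha> x"
  have "finite {x \<in> X. ?p x \<noteq> \<zero>}"
    by (rule finite_subset[OF _ null[OF I]]) auto
  then have "?p \<in> PF X" using \<alpha> by (auto simp: free_module_carrier)
  moreover have "?p x \<ominus> \<alpha> x \<in> I" if "x \<in> X" for x
  proof -
    have "\<alpha> x \<in> carrier R" using \<alpha> that by auto
    then show ?thesis
      using that G_neg[OF I, of "\<alpha> x"] by (simp add: a_minus_def r_neg G_zero[OF I])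
  qed
  ultimately have "approximates I X ?p (emb X \<alpha>)" using emb_null_approximates[OF \<alpha> _ I] by blast
  then show "\<exists>q. approximates I X q (emb X \<alpha>)" by blast
qed

lemma emb_closed: "p \<in> PF X \<Longrightarrow> emb X p \<in> FS X"
proof (rule emb_null_closed)
  assume p: "p \<in> PF X"
  then show "p \<in> X \<rightarrow> carrier R" by (auto simp: free_module_closed)
  fix I assume "I \<in> G"
  then show "finite {x \<in> X. p x \<notin> I}"
    using G_zero by (intro finite_subset[OF _ free_module_finite[OF p]]) auto
qed

definition formal_module :: "'x set \<Rightarrow> ('r, 'x \<Rightarrow> 'r set \<Rightarrow> 'r set) module" where
  "formal_module X = \<lparr>carrier = FS X, monoid.mult = undefined, one = undefined,
     ring.zero = (\<lambda>x \<in> X. \<zero>\<^bsub>S\<^esub>),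
     ring.add = (\<lambda>a b. \<lambda>x \<in> X. a x \<oplus>\<^bsub>S\<^esub> b x),
     smult = (\<lambda>r a. \<lambda>x \<in> X. cmap r \<otimes>\<^bsub>S\<^esub> a x)\<rparr>"

lemma formal_module_simps [simp]: "carrier (formal_module X) = FS X"
  by (simp add: formal_module_def)

lemma formal_add_approximates:
  assumes "a \<in> FS X" "b \<in> FS X" "p \<in> PF X" "q \<in> PF X" "I \<in> G" "approximates I X p a" "approximates I X q b"
  shows "approximates I X (p \<oplus>\<^bsub>free_module R X\<^esub> q) (a \<oplus>\<^bsub>formal_module X\<^esub> b)"
proof (rule approximatesI[OF free_module_add_closed[OF assms(3,4)]])
  fix x assume x: "x \<in> X"
  have "p x \<oplus> q x \<in> (a x \<oplus>\<^bsub>S\<^esub> b x) I"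
    by (rule completion_add_mem(2)[OF FS_closed[OF assms(1) x] approximates_apply(1)[OF assms(6) x]
          FS_closed[OF assms(2) x] approximates_apply(1)[OF assms(7) x] assms(5)])
  then show "(p \<oplus>\<^bsub>free_module R X\<^esub> q) x \<in> (a \<oplus>\<^bsub>formal_module X\<^esub> b) x I"
    using x by (simp add: free_module_apply formal_module_def)
qed

lemma formal_smult_approximates:
  assumes "r \<in> carrier R" "a \<in> FS X" "p \<in> PF X" "I \<in> G" "approximates (ideal_colon R I r) X p a"
  shows "approximates I X (r \<odot>\<^bsub>free_module R X\<^esub> p) (r \<odot>\<^bsub>formal_module X\<^esub> a)"
proof (rule approximatesI[OF free_module_smult_closed[OF assms(1,3)]])
  fix x assume x: "x \<in> X"
  have "r \<otimes> p x \<in> (cmap r \<otimes>\<^bsub>S\<^esub> a x) I"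
    by (rule completion_mult_mem(2)[OF cmap_closed[OF assms(1)] cmap_mem[OF assms(1,4)]
          FS_closed[OF assms(2) x] approximates_apply(1)[OF assms(5) x] assms(4)])
  then show "(r \<odot>\<^bsub>free_module R X\<^esub> p) x \<in> (r \<odot>\<^bsub>formal_module X\<^esub> a) x I"
    using x by (simp add: free_module_apply formal_module_def)
qed

lemma formal_add_closed:
  assumes a: "a \<in> FS X" and b: "b \<in> FS X" shows "a \<oplus>\<^bsub>formal_module X\<^esub> b \<in> FS X"
proof (rule FS_I)
  fix I assume I: "I \<in> G"
  obtain p where p: "p \<in> PF X" "approximates I X p a" using FS_approx[OF a I] .
  obtain q where q: "q \<in> PF X" "approximates I X q b" using FS_approx[OF b I] .
  show "\<exists>q. approximates I X q (a \<oplus>\<^bsub>formal_module X\<^esub> b)"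
    using formal_add_approximates[OF a b p(1) q(1) I p(2) q(2)] by blast
next
  have "a x \<oplus>\<^bsub>S\<^esub> b x \<in> carrier S" if "x \<in> X" for x
    using FS_closed[OF a that] FS_closed[OF b that] by (rule S.a_closed)
  then show "a \<oplus>\<^bsub>formal_module X\<^esub> b \<in> X \<rightarrow> carrier S" by (simp add: formal_module_def)
qed (simp add: formal_module_def)

lemma formal_smult_closed:
  assumes r: "r \<in> carrier R" and a: "a \<in> FS X" shows "r \<odot>\<^bsub>formal_module X\<^esub> a \<in> FS X"
proof (rule FS_I)
  fix I assume I: "I \<in> G"
  obtain p where p: "p \<in> PF X" "approximates (ideal_colon R I r) X p a"
    using FS_approx[OF a G_colon[OF I r]] .
  show "\<exists>q. approximates I X q (r \<odot>\<^bsub>formal_module X\<^esub> a)"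
    using formal_smult_approximates[OF r a p(1) I p(2)] by blast
next
  have "cmap r \<otimes>\<^bsub>S\<^esub> a x \<in> carrier S" if "x \<in> X" for x
    using completion_mult_closed[OF cmap_closed[OF r] FS_closed[OF a that]] .
  then show "r \<odot>\<^bsub>formal_module X\<^esub> a \<in> X \<rightarrow> carrier S" by (simp add: formal_module_def)
qed (simp add: formal_module_def)

lemma emb_linear: "linear_map R (free_module R X) (formal_module X) (emb X)"
proof (rule linear_mapI)
  fix p q assume p: "p \<in> PF X" and q: "q \<in> PF X"
  show "emb X (p \<oplus>\<^bsub>free_module R X\<^esub> q) = emb X p \<oplus>\<^bsub>formal_module X\<^esub> emb X q"
  proof (rule FS_eqI)
    fix I assume I: "I \<in> G"
    show "\<exists>r. approximates I X r (emb X (p \<oplus>\<^bsub>free_module R X\<^esub> q)) \<and>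
        approximates I X r (emb X p \<oplus>\<^bsub>formal_module X\<^esub> emb X q)"
      by (intro exI[of _ "p \<oplus>\<^bsub>free_module R X\<^esub> q"] conjI emb_closed free_module_add_closed
        emb_approximates formal_add_approximates p q I)
  qed (intro emb_closed formal_add_closed free_module_add_closed p q)+
next
  fix r p assume r: "r \<in> carrier R" and p: "p \<in> PF X"
  show "emb X (r \<odot>\<^bsub>free_module R X\<^esub> p) = r \<odot>\<^bsub>formal_module X\<^esub> emb X p"
  proof (rule FS_eqI)
    fix I assume I: "I \<in> G"
    show "\<exists>q. approximates I X q (emb X (r \<odot>\<^bsub>free_module R X\<^esub> p)) \<and>
        approximates I X q (r \<odot>\<^bsub>formal_module X\<^esub> emb X p)"
      by (intro exI[of _ "r \<odot>\<^bsub>free_module R X\<^esub> p"] conjI emb_closed free_module_smult_closed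
        emb_approximates formal_smult_approximates G_colon r p I)
  qed (intro emb_closed formal_smult_closed free_module_smult_closed r p)+
qed (simp add: emb_closed)

lemma push_linear:
  assumes f: "f \<in> X \<rightarrow> Y"
  shows "linear_map R (formal_module X) (formal_module Y) (push X Y f)"
proof (rule linear_mapI)
  fix a b assume "a \<in> carrier (formal_module X)" "b \<in> carrier (formal_module X)"
  then have a: "a \<in> FS X" and b: "b \<in> FS X" by auto
  show "push X Y f (a \<oplus>\<^bsub>formal_module X\<^esub> b) = push X Y f a \<oplus>\<^bsub>formal_module Y\<^esub> push X Y f b"
  proof (rule FS_eqI)
    fix I assume I: "I \<in> G"
    obtain p where p: "p \<in> PF X" "approximates I X p a" using FS_approx[OF a I] .
    obtain q where q: "q \<in> PF X" "approximates I X q b" using FS_approx[OF b I] .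
    have "approximates I Y (push_fin X Y f (p \<oplus>\<^bsub>free_module R X\<^esub> q)) (push X Y f (a \<oplus>\<^bsub>formal_module X\<^esub> b))"
      by (intro push_approximates formal_add_closed formal_add_approximates free_module_add_closed a b f I p q)
    moreover have "approximates I Y (push_fin X Y f p \<oplus>\<^bsub>free_module R Y\<^esub> push_fin X Y f q)
        (push X Y f a \<oplus>\<^bsub>formal_module Y\<^esub> push X Y f b)"
      by (intro formal_add_approximates push_approximates push_closed push_fin_closed a b f I p q)
    ultimately show "\<exists>r. approximates I Y r (push X Y f (a \<oplus>\<^bsub>formal_module X\<^esub> b)) \<and>
        approximates I Y r (push X Y f a \<oplus>\<^bsub>formal_module Y\<^esub> push X Y f b)"
      using linear_map_add[OF push_fin_linear p(1) q(1)] by metis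
  qed (intro push_closed formal_add_closed a b f)+
next
  fix r a assume r: "r \<in> carrier R" and "a \<in> carrier (formal_module X)"
  then have a: "a \<in> FS X" by simp
  show "push X Y f (r \<odot>\<^bsub>formal_module X\<^esub> a) = r \<odot>\<^bsub>formal_module Y\<^esub> push X Y f a"
  proof (rule FS_eqI)
    fix I assume I: "I \<in> G"
    obtain p where p: "p \<in> PF X" "approximates (ideal_colon R I r) X p a" using FS_approx[OF a G_colon[OF I r]] .
    have "approximates I Y (push_fin X Y f (r \<odot>\<^bsub>free_module R X\<^esub> p)) (push X Y f (r \<odot>\<^bsub>formal_module X\<^esub> a))"
      by (intro push_approximates formal_smult_closed formal_smult_approximates free_module_smult_closed a r f I p)
    moreover have "approximates I Y (r \<odot>\<^bsub>free_module R Y\<^esub> push_fin X Y f p) (r \<odot>\<^bsub>formal_module Y\<^esub> push X Y f a)"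
      by (intro formal_smult_approximates push_approximates push_closed push_fin_closed G_colon a r f I p)
    ultimately show "\<exists>q. approximates I Y q (push X Y f (r \<odot>\<^bsub>formal_module X\<^esub> a)) \<and>
        approximates I Y q (r \<odot>\<^bsub>formal_module Y\<^esub> push X Y f a)"
      using linear_map_smult[OF push_fin_linear r p(1)] by metis
  qed (intro push_closed formal_smult_closed a r f)+
qed (use push_closed f in auto)

lemma push_emb:
  assumes f: "f \<in> X \<rightarrow> Y" and p: "p \<in> PF X"
  shows "push X Y f (emb X p) = emb Y (push_fin X Y f p)"
proof (rule FS_eqI)
  fix I assume I: "I \<in> G"
  show "\<exists>q. approximates I Y q (push X Y f (emb X p)) \<and> approximates I Y q (emb Y (push_fin X Y f p))"
    using push_approximates[OF emb_closed[OF p] f I p emb_approximates[OF p I]]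
      emb_approximates[OF push_fin_closed[OF p] I] by blast
qed (intro push_closed emb_closed push_fin_closed f p)+

lemma push_push:
  assumes a: "a \<in> FS X" and f: "f \<in> X \<rightarrow> Y" and g: "g \<in> Y \<rightarrow> Z"
  shows "push Y Z g (push X Y f a) = push X Z (\<lambda>x. g (f x)) a"
proof (rule FS_eqI)
  have gf: "(\<lambda>x. g (f x)) \<in> X \<rightarrow> Z" using f g by auto
  fix I assume I: "I \<in> G"
  obtain p where p: "p \<in> PF X" "approximates I X p a" using FS_approx[OF a I] .
  have "push_fin Y Z g (push_fin X Y f p) = push_fin X Z (\<lambda>x. g (f x)) p"
    by (rule linear_map_eq_on_basis[OF free_module_left_module
          linear_map_comp[OF push_fin_linear push_fin_linear] push_fin_linear _ p(1)])
      (use f in \<open>auto simp: push_fin_single Pi_def\<close>)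
  moreover have "approximates I Z (push_fin Y Z g (push_fin X Y f p)) (push Y Z g (push X Y f a))"
    by (intro push_approximates push_closed push_fin_closed a f g I p)
  moreover have "approximates I Z (push_fin X Z (\<lambda>x. g (f x)) p) (push X Z (\<lambda>x. g (f x)) a)"
    by (intro push_approximates a gf I p)
  ultimately show "\<exists>q. approximates I Z q (push Y Z g (push X Y f a)) \<and>
      approximates I Z q (push X Z (\<lambda>x. g (f x)) a)" by metis
next
  show "push Y Z g (push X Y f a) \<in> FS Z" by (intro push_closed a f g)
  show "push X Z (\<lambda>x. g (f x)) a \<in> FS Z" by (rule push_closed[OF a]) (use f g in auto)
qed

lemma push_id:
  assumes a: "a \<in> FS X" and f: "\<And>x. x \<in> X \<Longrightarrow> f x = x"
  shows "push X X f a = a"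
proof (rule FS_eqI)
  have fX: "f \<in> X \<rightarrow> X" using f by auto
  show "push X X f a \<in> FS X" by (rule push_closed[OF a fX])
  fix I assume I: "I \<in> G"
  obtain p where p: "p \<in> PF X" "approximates I X p a" using FS_approx[OF a I] .
  have "push_fin X X f p = p"
    by (rule linear_map_eq_on_basis[OF free_module_left_module push_fin_linear, where g = "\<lambda>p. p"])
      (use f p in \<open>auto simp: push_fin_single linear_map_def\<close>)
  then show "\<exists>q. approximates I X q (push X X f a) \<and> approximates I X q a"
    using push_approximates[OF a fX I p] p by metis
qed (rule a)

lemma comp_linear:
  assumes t: "t \<in> Y \<rightarrow> FS X"
  shows "linear_map R (formal_module Y) (formal_module X) (\<lambda>A. comp Y X A t)"
proof (rule linear_mapI)
  fix A B assume "A \<in> carrier (formal_module Y)" "B \<in> carrier (formal_module Y)"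
  then have A: "A \<in> FS Y" and B: "B \<in> FS Y" by auto
  let ?AB = "A \<oplus>\<^bsub>formal_module Y\<^esub> B"
  show "comp Y X ?AB t = comp Y X A t \<oplus>\<^bsub>formal_module X\<^esub> comp Y X B t"
  proof (rule FS_eqI)
    fix I assume I: "I \<in> G"
    obtain P where P: "P \<in> PF Y" "approximates I Y P A" using FS_approx[OF A I] .
    obtain Q where Q: "Q \<in> PF Y" "approximates I Y Q B" using FS_approx[OF B I] .
    let ?PQ = "P \<oplus>\<^bsub>free_module R Y\<^esub> Q"
    have PQ: "?PQ \<in> PF Y" by (intro free_module_add_closed P Q)
    obtain p where p: "p \<in> Y \<rightarrow> PF X"
        "\<And>y r. y \<in> Y \<Longrightarrow> r \<in> {P y, Q y, ?PQ y} \<Longrightarrow> approximates (ideal_colon R I r) X (p y) (t y)"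
      by (rule approx_choice[OF t I, of "\<lambda>y. {P y, Q y, ?PQ y}"])
        (use free_module_closed[OF P(1)] free_module_closed[OF Q(1)] free_module_closed[OF PQ] in auto)
    note lin = left_module.lin_ext_linear[OF free_module_left_module p(1)]
    have "approximates I X (lin_ext R (free_module R X) Y p ?PQ) (comp Y X ?AB t)"
      by (rule comp_approximates[OF formal_add_closed[OF A B] t I PQ formal_add_approximates[OF A B P(1) Q(1) I P(2) Q(2)] p(1)])
        (use p(2) in auto)
    moreover have "approximates I X (lin_ext R (free_module R X) Y p P \<oplus>\<^bsub>free_module R X\<^esub> lin_ext R (free_module R X) Y p Q)
        (comp Y X A t \<oplus>\<^bsub>formal_module X\<^esub> comp Y X B t)"
      by (rule formal_add_approximates[OF comp_closed[OF A t] comp_closed[OF B t] linear_map_closed[OF lin P(1)]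
            linear_map_closed[OF lin Q(1)] I comp_approximates[OF A t I P p(1)] comp_approximates[OF B t I Q p(1)]])
        (use p(2) in auto)
    ultimately show "\<exists>q. approximates I X q (comp Y X ?AB t) \<and>
        approximates I X q (comp Y X A t \<oplus>\<^bsub>formal_module X\<^esub> comp Y X B t)"
      using linear_map_add[OF lin P(1) Q(1)] by metis
  qed (intro comp_closed formal_add_closed A B t)+
next
  fix r A assume r: "r \<in> carrier R" and "A \<in> carrier (formal_module Y)"
  then have A: "A \<in> FS Y" by simp
  show "comp Y X (r \<odot>\<^bsub>formal_module Y\<^esub> A) t = r \<odot>\<^bsub>formal_module X\<^esub> comp Y X A t"
  proof (rule FS_eqI)
    fix I assume I: "I \<in> G"
    let ?K = "ideal_colon R I r"
    have K: "?K \<in> G" by (rule G_colon[OF I r])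
    obtain P where P: "P \<in> PF Y" "approximates ?K Y P A" using FS_approx[OF A K] .
    let ?rP = "r \<odot>\<^bsub>free_module R Y\<^esub> P"
    have rP: "?rP \<in> PF Y" by (intro free_module_smult_closed P r)
    obtain p where p: "p \<in> Y \<rightarrow> PF X"
        "\<And>y s. y \<in> Y \<Longrightarrow> s \<in> {?rP y} \<Longrightarrow> approximates (ideal_colon R I s) X (p y) (t y)"
      by (rule approx_choice[OF t I, of "\<lambda>y. {?rP y}"]) (use free_module_closed[OF rP] in auto)
    have col: "ideal_colon R ?K (P y) = ideal_colon R I (?rP y)" if "y \<in> Y" for y
      using free_module_closed[OF P(1) that] that r
      by (auto simp: ideal_colon_def free_module_apply m_assoc)
    note lin = left_module.lin_ext_linear[OF free_module_left_module p(1)]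
    have "approximates I X (lin_ext R (free_module R X) Y p ?rP) (comp Y X (r \<odot>\<^bsub>formal_module Y\<^esub> A) t)"
      by (rule comp_approximates[OF formal_smult_closed[OF r A] t I rP formal_smult_approximates[OF r A P(1) I P(2)] p(1)])
        (use p(2) in auto)
    moreover have "approximates I X (r \<odot>\<^bsub>free_module R X\<^esub> lin_ext R (free_module R X) Y p P) (r \<odot>\<^bsub>formal_module X\<^esub> comp Y X A t)"
      by (rule formal_smult_approximates[OF r comp_closed[OF A t] linear_map_closed[OF lin P(1)] I
            comp_approximates[OF A t K P p(1)]]) (use p(2) col in auto)
    ultimately show "\<exists>q. approximates I X q (comp Y X (r \<odot>\<^bsub>formal_module Y\<^esub> A) t) \<and>
        approximates I X q (r \<odot>\<^bsub>formal_module X\<^esub> comp Y X A t)"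
      using linear_map_smult[OF lin r P(1)] by metis
  qed (intro comp_closed formal_smult_closed A r t)+
qed (use comp_closed t in auto)

lemma comp_single:
  assumes t: "t \<in> Y \<rightarrow> FS X" and y: "y \<in> Y"
  shows "comp Y X (emb Y (formal_single R Y \<one> y)) t = t y"
proof (rule FS_eqI)
  let ?e = "formal_single R Y \<one> y"
  have e: "?e \<in> PF Y" by (simp add: formal_single_closed)
  show ty: "t y \<in> FS X" using t y by auto
  fix I assume I: "I \<in> G"
  obtain p where p: "p \<in> Y \<rightarrow> PF X"
      "\<And>y r. y \<in> Y \<Longrightarrow> r \<in> {\<one>, ?e y} \<Longrightarrow> approximates (ideal_colon R I r) X (p y) (t y)"
    by (rule approx_choice[OF t I, of "\<lambda>y. {\<one>, ?e y}"]) (use free_module_closed[OF e] in auto)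
  have "ideal_colon R I \<one> = I" using G_subset[OF I] by (auto simp: ideal_colon_def)
  then have "approximates I X (p y) (t y)" using p(2)[OF y, of \<one>] by simp
  moreover have "approximates I X (lin_ext R (free_module R X) Y p ?e) (comp Y X (emb Y ?e) t)"
    by (rule comp_approximates[OF emb_closed[OF e] t I e emb_approximates[OF e I] p(1)]) (use p(2) in auto)
  moreover have "lin_ext R (free_module R X) Y p ?e = p y"
    by (rule left_module.lin_ext_basis[OF free_module_left_module p(1) y])
  ultimately show "\<exists>q. approximates I X q (comp Y X (emb Y ?e) t) \<and> approximates I X q (t y)" by metis
next
  show "comp Y X (emb Y (formal_single R Y \<one> y)) t \<in> FS X"
    by (intro comp_closed emb_closed formal_single_closed t one_closed)
qed

lemma comp_push:
  assumes A: "A \<in> FS Y" and f: "f \<in> Y \<rightarrow> D" and t: "t \<in> D \<rightarrow> FS X"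
  shows "comp D X (push Y D f A) t = comp Y X A (\<lambda>y. t (f y))"
proof (rule FS_eqI)
  have tf: "(\<lambda>y. t (f y)) \<in> Y \<rightarrow> FS X" using f t by auto
  show "comp D X (push Y D f A) t \<in> FS X" "comp Y X A (\<lambda>y. t (f y)) \<in> FS X"
    by (intro comp_closed push_closed A f t tf)+
  fix I assume I: "I \<in> G"
  obtain P where P: "P \<in> PF Y" "approximates I Y P A" using FS_approx[OF A I] .
  let ?P' = "push_fin Y D f P"
  have P': "?P' \<in> PF D" by (rule push_fin_closed[OF P(1)])
  have fin: "finite (insert \<zero> (P ` {y \<in> Y. P y \<noteq> \<zero>}))" using free_module_finite[OF P(1)] by simp
  \<comment> \<open>One approximation of \<open>t d\<close> has to serve the coefficient of \<open>d\<close> and those of its preimages.\<close>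
  obtain p where p: "p \<in> D \<rightarrow> PF X"
      "\<And>d r. d \<in> D \<Longrightarrow> r \<in> insert (?P' d) (insert \<zero> (P ` {y \<in> Y. P y \<noteq> \<zero>})) \<Longrightarrow>
        approximates (ideal_colon R I r) X (p d) (t d)"
    by (rule approx_choice[OF t I, of "\<lambda>d. insert (?P' d) (insert \<zero> (P ` {y \<in> Y. P y \<noteq> \<zero>}))"])
      (use fin free_module_closed[OF P(1)] free_module_closed[OF P'] in auto)
  have pf: "(\<lambda>y. p (f y)) \<in> Y \<rightarrow> PF X" using p f by auto
  have "approximates I X (lin_ext R (free_module R X) D p ?P') (comp D X (push Y D f A) t)"
    by (rule comp_approximates[OF push_closed[OF A f] t I P' push_approximates[OF A f I P] p(1)]) (use p(2) in auto)
  moreover have "approximates I X (lin_ext R (free_module R X) Y (\<lambda>y. p (f y)) P) (comp Y X A (\<lambda>y. t (f y)))"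
  proof (rule comp_approximates[OF A tf I P pf])
    fix y assume y: "y \<in> Y"
    have "P y \<in> insert \<zero> (P ` {y \<in> Y. P y \<noteq> \<zero>})" using y by auto
    then show "approximates (ideal_colon R I (P y)) X (p (f y)) (t (f y))" using p(2)[of "f y"] f y by auto
  qed
  moreover have "lin_ext R (free_module R X) D p ?P' = lin_ext R (free_module R X) Y (\<lambda>y. p (f y)) P"
  proof -
    have "lin_ext R (free_module R X) D p ?P'
        = lin_ext R (free_module R X) Y (\<lambda>y. lin_ext R (free_module R X) D p (formal_single R D \<one> (f y))) P"
      unfolding push_fin_def
      by (rule left_module.linear_map_lin_ext[OF free_module_left_module free_module_left_module
            left_module.lin_ext_linear[OF free_module_left_module p(1)] _ P(1)]) (simp add: formal_single_closed)
    also have "\<dots> = lin_ext R (free_module R X) Y (\<lambda>y. p (f y)) P"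
      by (rule left_module.linear_map_eq_lin_ext[OF free_module_left_module left_module.lin_ext_linear[OF free_module_left_module] _ P(1)])
        (use f p in \<open>auto simp: left_module.lin_ext_basis[OF free_module_left_module p(1)]
          left_module.lin_ext_basis[OF free_module_left_module] Pi_def
          linear_map_closed[OF left_module.lin_ext_linear[OF free_module_left_module p(1)] formal_single_closed]\<close>)
    finally show ?thesis .
  qed
  ultimately show "\<exists>q. approximates I X q (comp D X (push Y D f A) t) \<and>
      approximates I X q (comp Y X A (\<lambda>y. t (f y)))" by metis
qed

lemma push_comp:
  assumes A: "A \<in> FS Y" and t: "t \<in> Y \<rightarrow> FS X" and g: "g \<in> X \<rightarrow> C"
  shows "push X C g (comp Y X A t) = comp Y C A (\<lambda>y. push X C g (t y))"
proof (rule FS_eqI)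
  have gt: "(\<lambda>y. push X C g (t y)) \<in> Y \<rightarrow> FS C" using push_closed[OF _ g] t by auto
  show "push X C g (comp Y X A t) \<in> FS C" "comp Y C A (\<lambda>y. push X C g (t y)) \<in> FS C"
    by (intro comp_closed push_closed A t g gt)+
  fix I assume I: "I \<in> G"
  obtain P where P: "P \<in> PF Y" "approximates I Y P A" using FS_approx[OF A I] .
  obtain p where p: "p \<in> Y \<rightarrow> PF X"
      "\<And>y r. y \<in> Y \<Longrightarrow> r \<in> {P y} \<Longrightarrow> approximates (ideal_colon R I r) X (p y) (t y)"
    by (rule approx_choice[OF t I, of "\<lambda>y. {P y}"]) (use free_module_closed[OF P(1)] in auto)
  have gp: "(\<lambda>y. push_fin X C g (p y)) \<in> Y \<rightarrow> PF C" by (intro Pi_I push_fin_closed Pi_mem[OF p(1)])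
  let ?q = "lin_ext R (free_module R X) Y p P"
  have q: "?q \<in> PF X" by (rule linear_map_closed[OF left_module.lin_ext_linear[OF free_module_left_module p(1)] P(1)])
  have "approximates I C (push_fin X C g ?q) (push X C g (comp Y X A t))"
    by (rule push_approximates[OF comp_closed[OF A t] g I q comp_approximates[OF A t I P p(1)]]) (use p(2) in auto)
  moreover have "approximates I C (lin_ext R (free_module R C) Y (\<lambda>y. push_fin X C g (p y)) P)
      (comp Y C A (\<lambda>y. push X C g (t y)))"
    by (rule comp_approximates[OF A gt I P gp])
      (use p t g I G_colon free_module_closed[OF P(1)] in \<open>auto intro!: push_approximates\<close>)
  moreover have "push_fin X C g ?q = lin_ext R (free_module R C) Y (\<lambda>y. push_fin X C g (p y)) P"
    by (rule left_module.linear_map_lin_ext[OF free_module_left_module free_module_left_module push_fin_linear p(1) P(1)])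
  ultimately show "\<exists>q. approximates I C q (push X C g (comp Y X A t)) \<and>
      approximates I C q (comp Y C A (\<lambda>y. push X C g (t y)))" by metis
qed

end

section \<open>Contramodules as modules with infinite summation\<close>

context right_topology
begin

text \<open>
  The value \<open>\<Sum> a\<^sub>x g\<^sub>x\<close> in the contramodule \<open>C\<close> of a formal sum with the family \<open>g\<close> substituted
  for its variables.
\<close>

definition contra_sum :: "'c set \<Rightarrow> (('c \<Rightarrow> 'r set \<Rightarrow> 'r set) \<Rightarrow> 'c) \<Rightarrow> 'x set \<Rightarrow> ('x \<Rightarrow> 'c) \<Rightarrow>
    ('x \<Rightarrow> 'r set \<Rightarrow> 'r set) \<Rightarrow> 'c" where
  "contra_sum C \<pi> X g a = \<pi> (push X C g a)"

lemma emb_single: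
  assumes "r \<in> carrier R"
  shows "emb X (formal_single R X r x) = formal_single S X (cmap r) x"
  by (auto simp: emb_def formal_single_def cmap_zero)

lemma contra_forget_simps:
  "carrier (contra_forget R G C \<pi>) = C"
  "\<zero>\<^bsub>contra_forget R G C \<pi>\<^esub> = \<pi> (emb C (\<lambda>z \<in> C. \<zero>))"
  "c \<oplus>\<^bsub>contra_forget R G C \<pi>\<^esub> d =
     \<pi> (emb C (formal_single R C \<one> c \<oplus>\<^bsub>free_module R C\<^esub> formal_single R C \<one> d))"
  "r \<in> carrier R \<Longrightarrow> r \<odot>\<^bsub>contra_forget R G C \<pi>\<^esub> c = \<pi> (emb C (formal_single R C r c))"
proof -
  show "carrier (contra_forget R G C \<pi>) = C"
    by (simp add: contra_forget_def restrict_scalars_def contra_module_def)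
  have "(\<lambda>z \<in> C. \<zero>\<^bsub>S\<^esub>) = emb C (\<lambda>z \<in> C. \<zero>)"
    by (auto simp: emb_def cmap_zero)
  then show "\<zero>\<^bsub>contra_forget R G C \<pi>\<^esub> = \<pi> (emb C (\<lambda>z \<in> C. \<zero>))"
    by (simp add: contra_forget_def restrict_scalars_def contra_module_def)
  have "(\<lambda>z \<in> C. formal_single S C \<one>\<^bsub>S\<^esub> c z \<oplus>\<^bsub>S\<^esub> formal_single S C \<one>\<^bsub>S\<^esub> d z) =
      emb C (formal_single R C \<one> c \<oplus>\<^bsub>free_module R C\<^esub> formal_single R C \<one> d)"
    unfolding emb_def
    by (rule restrict_ext) (auto simp: free_module_apply formal_single_def cmap_add cmap_zero cmap_one
      simp flip: cmap_one)
  then show "c \<oplus>\<^bsub>contra_forget R G C \<pi>\<^esub> d =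
      \<pi> (emb C (formal_single R C \<one> c \<oplus>\<^bsub>free_module R C\<^esub> formal_single R C \<one> d))"
    by (simp add: contra_forget_def restrict_scalars_def contra_module_def)
  show "r \<odot>\<^bsub>contra_forget R G C \<pi>\<^esub> c = \<pi> (emb C (formal_single R C r c))" if "r \<in> carrier R"
    using that by (simp add: contra_forget_def restrict_scalars_def contra_module_def emb_single)
qed

context
  fixes C :: "'c set" and \<pi> :: "('c \<Rightarrow> 'r set \<Rightarrow> 'r set) \<Rightarrow> 'c"
  assumes contra: "completion_contramodule R G C \<pi>"
begin

abbreviation M :: "('r, 'c) module" where "M \<equiv> contra_forget R G C \<pi>"

lemma contra_closed: "a \<in> FS C \<Longrightarrow> \<pi> a \<in> C"
  using contra by (auto simp: contramodule_def)

lemma contra_unit: "c \<in> C \<Longrightarrow> \<pi> (emb C (formal_single R C \<one> c)) = c"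
  using contra by (simp add: contramodule_def emb_single cmap_one)

lemma contra_sum_closed: "g \<in> X \<rightarrow> C \<Longrightarrow> a \<in> FS X \<Longrightarrow> contra_sum C \<pi> X g a \<in> C"
  by (simp add: contra_sum_def contra_closed push_closed)

text \<open>The associativity axiom, for sums over arbitrary index sets.\<close>

lemma contra_sum_assoc:
  assumes A: "A \<in> FS Y" and t: "t \<in> Y \<rightarrow> FS X" and g: "g \<in> X \<rightarrow> C"
  shows "contra_sum C \<pi> Y (\<lambda>y. contra_sum C \<pi> X g (t y)) A = contra_sum C \<pi> X g (comp Y X A t)"
proof -
  let ?f = "\<lambda>y. push X C g (t y)"
  have f: "?f \<in> Y \<rightarrow> FS C" using t push_closed[OF _ g] by (auto simp: Pi_def)
  have \<pi>: "\<pi> \<in> FS C \<rightarrow> C" using contra_closed by blast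
  have A': "push Y (FS C) ?f A \<in> FS (FS C)" by (rule push_closed[OF A f])
  have "contra_sum C \<pi> Y (\<lambda>y. contra_sum C \<pi> X g (t y)) A = \<pi> (push (FS C) C \<pi> (push Y (FS C) ?f A))"
    unfolding contra_sum_def by (subst push_push[OF A f \<pi>]) simp
  also have "\<dots> = \<pi> (open_parentheses S \<JJ> C (push Y (FS C) ?f A))"
    using contra A' by (simp add: contramodule_def)
  also have "open_parentheses S \<JJ> C (push Y (FS C) ?f A) = comp Y C A ?f"
    unfolding open_parentheses_eq_comp by (rule comp_push[OF A f]) auto
  also have "comp Y C A ?f = push X C g (comp Y X A t)"
    by (rule push_comp[OF A t g, symmetric])
  finally show ?thesis by (simp add: contra_sum_def)
qed

lemma contra_sum_emb:
  assumes g: "g \<in> X \<rightarrow> C" and p: "p \<in> PF X"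
  shows "contra_sum C \<pi> X g (emb X p) = \<pi> (emb C (push_fin X C g p))"
  by (simp add: contra_sum_def push_emb[OF g p])

lemma contra_sum_basis:
  assumes g: "g \<in> X \<rightarrow> C" and x: "x \<in> X"
  shows "contra_sum C \<pi> X g (emb X (formal_single R X \<one> x)) = g x"
proof -
  have "g x \<in> C" using g x by auto
  then show ?thesis
    by (simp add: contra_sum_emb[OF g] formal_single_closed push_fin_single x contra_unit)
qed

text \<open>
  Addition and multiplication by scalars in \<open>C\<close> are themselves sums, over two indices and over one.
  So linearity is an instance of associativity.
\<close>

lemma contra_sum_linear:
  assumes g: "g \<in> X \<rightarrow> C"
  shows "linear_map R (formal_module X) M (contra_sum C \<pi> X g)"
proof (rule linear_mapI)
  fix a assume "a \<in> carrier (formal_module X)"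
  then show "contra_sum C \<pi> X g a \<in> carrier M"
    using contra_sum_closed[OF g] by (simp add: contra_forget_simps)
next
  fix a b assume "a \<in> carrier (formal_module X)" "b \<in> carrier (formal_module X)"
  then have a: "a \<in> FS X" and b: "b \<in> FS X" by auto
  let ?Y = "UNIV :: bool set"
  let ?t = "\<lambda>y. if y then a else b"
  let ?e = "\<lambda>y. formal_single R ?Y \<one> y"
  let ?p = "?e True \<oplus>\<^bsub>free_module R ?Y\<^esub> ?e False"
  let ?h = "\<lambda>y. contra_sum C \<pi> X g (?t y)"
  have e: "?e y \<in> PF ?Y" for y by (simp add: formal_single_closed)
  have p: "?p \<in> PF ?Y" by (intro free_module_add_closed e)
  have t: "?t \<in> ?Y \<rightarrow> FS X" using a b by auto
  have h: "?h \<in> ?Y \<rightarrow> C" using t contra_sum_closed[OF g] by auto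
  have "comp ?Y X (emb ?Y ?p) ?t = comp ?Y X (emb ?Y (?e True)) ?t \<oplus>\<^bsub>formal_module X\<^esub> comp ?Y X (emb ?Y (?e False)) ?t"
    using linear_map_add[OF emb_linear e e] linear_map_add[OF comp_linear[OF t]] emb_closed[OF e] by simp
  also have "\<dots> = a \<oplus>\<^bsub>formal_module X\<^esub> b" by (simp add: comp_single[OF t])
  finally have c: "comp ?Y X (emb ?Y ?p) ?t = a \<oplus>\<^bsub>formal_module X\<^esub> b" .
  have "contra_sum C \<pi> X g (a \<oplus>\<^bsub>formal_module X\<^esub> b) = contra_sum C \<pi> ?Y ?h (emb ?Y ?p)"
    using contra_sum_assoc[OF emb_closed[OF p] t g] c by simp
  also have "\<dots> = \<pi> (emb C (push_fin ?Y C ?h ?p))" by (rule contra_sum_emb[OF h p])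
  also have "push_fin ?Y C ?h ?p = push_fin ?Y C ?h (?e True) \<oplus>\<^bsub>free_module R C\<^esub> push_fin ?Y C ?h (?e False)"
    by (rule linear_map_add[OF push_fin_linear e e])
  also have "\<dots> = formal_single R C \<one> (?h True) \<oplus>\<^bsub>free_module R C\<^esub> formal_single R C \<one> (?h False)"
    by (simp only: push_fin_single[OF one_closed UNIV_I])
  finally show "contra_sum C \<pi> X g (a \<oplus>\<^bsub>formal_module X\<^esub> b) = contra_sum C \<pi> X g a \<oplus>\<^bsub>M\<^esub> contra_sum C \<pi> X g b"
    by (simp add: contra_forget_simps)
next
  fix r a assume r: "r \<in> carrier R" and "a \<in> carrier (formal_module X)"
  then have a: "a \<in> FS X" by auto
  let ?Y = "UNIV :: unit set"
  let ?e = "formal_single R ?Y \<one> ()"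
  let ?p = "formal_single R ?Y r ()"
  let ?h = "\<lambda>y :: unit. contra_sum C \<pi> X g a"
  have e: "?e \<in> PF ?Y" and p: "?p \<in> PF ?Y" using r by (simp_all add: formal_single_closed)
  have t: "(\<lambda>y. a) \<in> ?Y \<rightarrow> FS X" using a by auto
  have h: "?h \<in> ?Y \<rightarrow> C" using a contra_sum_closed[OF g] by auto
  have pe: "?p = r \<odot>\<^bsub>free_module R ?Y\<^esub> ?e" using r by (simp add: formal_single_smult)
  have c: "comp ?Y X (emb ?Y ?p) (\<lambda>y. a) = r \<odot>\<^bsub>formal_module X\<^esub> a"
    unfolding pe using linear_map_smult[OF emb_linear r e] linear_map_smult[OF comp_linear[OF t] r] emb_closed[OF e]
    by (simp add: comp_single[OF t])
  have "contra_sum C \<pi> X g (r \<odot>\<^bsub>formal_module X\<^esub> a) = contra_sum C \<pi> ?Y ?h (emb ?Y ?p)"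
    using contra_sum_assoc[OF emb_closed[OF p] t g] c by simp
  also have "\<dots> = \<pi> (emb C (push_fin ?Y C ?h ?p))" by (rule contra_sum_emb[OF h p])
  also have "push_fin ?Y C ?h ?p = formal_single R C r (contra_sum C \<pi> X g a)"
    by (rule push_fin_single[OF r UNIV_I])
  finally show "contra_sum C \<pi> X g (r \<odot>\<^bsub>formal_module X\<^esub> a) = r \<odot>\<^bsub>M\<^esub> contra_sum C \<pi> X g a"
    using r by (simp add: contra_forget_simps)
qed

lemma contra_eq_contra_sum: "a \<in> FS C \<Longrightarrow> \<pi> a = contra_sum C \<pi> C (\<lambda>c. c) a"
  by (simp add: contra_sum_def push_id)

lemma contra_linear: "linear_map R (formal_module C) M \<pi>"
proof -
  have "linear_map R (formal_module C) M (contra_sum C \<pi> C (\<lambda>c. c))" by (rule contra_sum_linear) simp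
  note lin = this
  show ?thesis
  proof (rule linear_mapI)
    fix a assume a: "a \<in> carrier (formal_module C)"
    then show "\<pi> a \<in> carrier M" using linear_map_closed[OF lin a] by (simp add: contra_eq_contra_sum)
    fix b assume b: "b \<in> carrier (formal_module C)"
    show "\<pi> (a \<oplus>\<^bsub>formal_module C\<^esub> b) = \<pi> a \<oplus>\<^bsub>M\<^esub> \<pi> b"
      using a b linear_map_add[OF lin a b] by (simp add: contra_eq_contra_sum formal_add_closed)
  next
    fix r a assume r: "r \<in> carrier R" and a: "a \<in> carrier (formal_module C)"
    show "\<pi> (r \<odot>\<^bsub>formal_module C\<^esub> a) = r \<odot>\<^bsub>M\<^esub> \<pi> a"
      using a r linear_map_smult[OF lin r a] by (simp add: contra_eq_contra_sum formal_smult_closed)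
  qed
qed

lemma contra_left_module: "left_module R M"
proof (rule left_module_image[OF free_module_left_module])
  show "linear_map R (free_module R C) M (\<lambda>p. \<pi> (emb C p))"
    by (rule linear_map_comp[OF emb_linear contra_linear])
  show "(\<lambda>p. \<pi> (emb C p)) ` PF C = carrier M"
  proof
    show "(\<lambda>p. \<pi> (emb C p)) ` PF C \<subseteq> carrier M"
      using emb_closed contra_closed by (auto simp: contra_forget_simps)
    show "carrier M \<subseteq> (\<lambda>p. \<pi> (emb C p)) ` PF C"
    proof
      fix c assume "c \<in> carrier M"
      then have "c = \<pi> (emb C (formal_single R C \<one> c))" by (simp add: contra_forget_simps contra_unit)
      then show "c \<in> (\<lambda>p. \<pi> (emb C p)) ` PF C" using formal_single_closed[OF one_closed] by (rule image_eqI)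
    qed
  qed
  show "\<pi> (emb C \<zero>\<^bsub>free_module R C\<^esub>) = \<zero>\<^bsub>M\<^esub>"
    by (simp add: contra_forget_simps free_module_def)
qed

lemma contra_sum_finite:
  assumes g: "g \<in> X \<rightarrow> C" and p: "p \<in> PF X"
  shows "contra_sum C \<pi> X g (emb X p) = lin_ext R M X g p"
  by (rule left_module.linear_map_eq_lin_ext[OF contra_left_module
        linear_map_comp[OF emb_linear contra_sum_linear[OF g]] _ p])
    (rule contra_sum_basis[OF g])

end

text \<open>The operations of the underlying module are instances of \<open>\<pi>\<close>.\<close>

lemma contra_hom_linear:
  assumes C: "completion_contramodule R G C \<pi>" and D: "completion_contramodule R G D \<rho>"
    and f: "f \<in> completion_contra_hom R G C \<pi> D \<rho>"
  shows "linear_map R (contra_forget R G C \<pi>) (contra_forget R G D \<rho>) f"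
proof -
  have fCD: "f \<in> C \<rightarrow> D" and hom: "\<And>a. a \<in> FS C \<Longrightarrow> f (\<pi> a) = \<rho> (push C D f a)"
    using f by (auto simp: contra_hom_def)
  have e: "formal_single R C r c \<in> PF C" if "r \<in> carrier R" for r c by (rule formal_single_closed[OF that])
  show ?thesis
  proof (rule linear_mapI)
    fix c d assume "c \<in> carrier (contra_forget R G C \<pi>)" "d \<in> carrier (contra_forget R G C \<pi>)"
    then have cd: "c \<in> C" "d \<in> C" by (auto simp: contra_forget_simps)
    let ?p = "formal_single R C \<one> c \<oplus>\<^bsub>free_module R C\<^esub> formal_single R C \<one> d"
    have p: "?p \<in> PF C" by (intro free_module_add_closed e one_closed)
    have "push_fin C D f ?p = formal_single R D \<one> (f c) \<oplus>\<^bsub>free_module R D\<^esub> formal_single R D \<one> (f d)"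
      using cd by (simp add: linear_map_add[OF push_fin_linear[of C D f] e[OF one_closed] e[OF one_closed]] push_fin_single)
    then show "f (c \<oplus>\<^bsub>contra_forget R G C \<pi>\<^esub> d) = f c \<oplus>\<^bsub>contra_forget R G D \<rho>\<^esub> f d"
      using hom[OF emb_closed[OF p]] by (simp add: contra_forget_simps push_emb[OF fCD p])
  next
    fix r c assume r: "r \<in> carrier R" and "c \<in> carrier (contra_forget R G C \<pi>)"
    then have c: "c \<in> C" by (auto simp: contra_forget_simps)
    show "f (r \<odot>\<^bsub>contra_forget R G C \<pi>\<^esub> c) = r \<odot>\<^bsub>contra_forget R G D \<rho>\<^esub> f c"
      using hom[OF emb_closed[OF e[OF r]]] r c
      by (simp add: contra_forget_simps push_emb[OF fCD e[OF r]] push_fin_single)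
  next
    fix c assume "c \<in> carrier (contra_forget R G C \<pi>)"
    then show "f c \<in> carrier (contra_forget R G D \<rho>)" using fCD by (auto simp: contra_forget_simps)
  qed
qed

end

section \<open>The universal property of formal sums\<close>

lemma (in abelian_group) diff_of_diffs:
  assumes "s \<in> carrier G" "c \<in> carrier G" "d \<in> carrier G"
  shows "(s \<ominus> c) \<ominus> (s \<ominus> d) = d \<ominus> c"
proof -
  have "(s \<ominus> c) \<ominus> (s \<ominus> d) = (\<ominus> s \<oplus> (s \<oplus> \<ominus> c)) \<oplus> d"
    using assms by (simp add: a_minus_def minus_add a_ac)
  then show ?thesis using assms by (simp add: r_neg1 a_minus_def a_comm)
qed

lemma (in abelian_group) sum_of_diffs:
  assumes "a \<in> carrier G" "b \<in> carrier G" "c \<in> carrier G" "d \<in> carrier G"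
  shows "(a \<ominus> c) \<oplus> (b \<ominus> d) = (a \<oplus> b) \<ominus> (c \<oplus> d)"
  using assms by (simp add: a_minus_def minus_add a_ac)

lemma (in abelian_group) add_diff_cancel:
  assumes "x \<in> carrier G" "y \<in> carrier G" "q \<in> carrier G"
  shows "(x \<oplus> q) \<ominus> (y \<oplus> q) = x \<ominus> y"
  using sum_of_diffs[of x q y q] diff_eq_zero_iff[of q q] assms by simp

lemma (in abelian_group) subgroup_finsum:
  assumes N: "additive_subgroup N G" and "finite F" "\<And>x. x \<in> F \<Longrightarrow> h x \<in> N"
  shows "finsum G h F \<in> N"
  using assms(2,3)
proof (induction F rule: finite_induct)
  case empty then show ?case by (simp add: additive_subgroup.zero_closed[OF N])
next
  case (insert x F)
  then have "h \<in> F \<rightarrow> carrier G" "h x \<in> carrier G" using additive_subgroup.a_Hcarr[OF N] by auto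
  then show ?case using insert additive_subgroup.a_closed[OF N] by simp
qed

context left_module
begin

lemma lin_ext_zero:
  assumes p: "p \<in> carrier (free_module R X)" and g: "\<And>x. x \<in> X \<Longrightarrow> p x \<noteq> \<zero>\<^bsub>R\<^esub> \<Longrightarrow> g x = \<zero>\<^bsub>M\<^esub>"
  shows "lin_ext R M X g p = \<zero>\<^bsub>M\<^esub>"
  unfolding lin_ext_def
  by (rule M.add.finprod_one_eqI)
    (use free_module_closed[OF p] g in \<open>auto simp: left_module_smult_zero[OF left_module_axioms]\<close>)

lemma lin_ext_cong:
  assumes p: "p \<in> carrier (free_module R X)" and g: "g \<in> X \<rightarrow> carrier M"
    and eq: "\<And>x. x \<in> X \<Longrightarrow> p x \<noteq> \<zero>\<^bsub>R\<^esub> \<Longrightarrow> g x = h x"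
  shows "lin_ext R M X h p = lin_ext R M X g p"
  unfolding lin_ext_def
  by (rule M.add.finprod_cong') (use free_module_closed[OF p] g eq in \<open>auto simp: Pi_def lsmult_closed\<close>)

lemma lin_ext_sum:
  assumes g: "g \<in> X \<rightarrow> carrier M" and h: "h \<in> X \<rightarrow> carrier M" and p: "p \<in> carrier (free_module R X)"
  shows "lin_ext R M X (\<lambda>x. g x \<oplus>\<^bsub>M\<^esub> h x) p = lin_ext R M X g p \<oplus>\<^bsub>M\<^esub> lin_ext R M X h p"
  by (rule linear_map_eq_lin_ext[symmetric, OF linear_map_sum[OF left_module_axioms lin_ext_linear[OF g] lin_ext_linear[OF h]] _ p])
    (simp add: lin_ext_basis[OF g] lin_ext_basis[OF h])

lemma lin_ext_diff:
  assumes g: "g \<in> X \<rightarrow> carrier M" and h: "h \<in> X \<rightarrow> carrier M" and p: "p \<in> carrier (free_module R X)"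
  shows "lin_ext R M X (\<lambda>x. g x \<ominus>\<^bsub>M\<^esub> h x) p = lin_ext R M X g p \<ominus>\<^bsub>M\<^esub> lin_ext R M X h p"
  by (rule linear_map_eq_lin_ext[symmetric, OF linear_map_difference[OF left_module_axioms lin_ext_linear[OF g] lin_ext_linear[OF h]] _ p])
    (simp add: lin_ext_basis[OF g] lin_ext_basis[OF h])

end

context flat_epi
begin

sublocale T: right_topology R \<GG>
proof
  show "I \<in> \<GG> \<Longrightarrow> r \<in> carrier R \<Longrightarrow> ideal_colon R I r \<in> \<GG>" for I r
    using colon_in_gabriel[of I "u r"] gabriel_subset by (simp add: ideal_colon_eq)
qed (simp_all add: gabriel_right_ideal carrier_in_gabriel gabriel_inter)

lemma FS_approx_ex: "a \<in> T.FS X \<Longrightarrow> I \<in> \<GG> \<Longrightarrow> \<exists>p. p \<in> T.PF X \<and> T.approximates I X p a"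
  by (rule T.FS_approx) auto

text \<open>The inverse of the inclusion \<open>u\<close>.\<close>

definition unu :: "'u \<Rightarrow> 'r" where "unu = inv_into (carrier R) u"

lemma unu_u [simp]: "r \<in> carrier R \<Longrightarrow> unu (u r) = r"
  unfolding unu_def using inj by (rule inv_into_f_f)

lemma u_unu: "x \<in> u ` carrier R \<Longrightarrow> u (unu x) = x" "x \<in> u ` carrier R \<Longrightarrow> unu x \<in> carrier R"
  unfolding unu_def by (auto intro: f_inv_into_f inv_into_into)

lemma unu_zero [simp]: "unu \<zero> = \<zero>\<^bsub>R\<^esub>"
  using unu_u[OF R.zero_closed] by simp

lemma image_u_subgroup: "additive_subgroup (u ` carrier R) U"
proof (rule additive_subgroupI, rule U.add.subgroupI)
  fix x y assume "x \<in> u ` carrier R" "y \<in> u ` carrier R"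
  then show "x \<oplus> y \<in> u ` carrier R" by (auto simp flip: u_simps(2))
next
  fix x assume "x \<in> u ` carrier R"
  then show "\<ominus> x \<in> u ` carrier R" by (auto simp flip: u_neg)
qed auto

lemma colon_mono: "I \<subseteq> J \<Longrightarrow> Colon I v \<subseteq> Colon J v"
  by (auto simp: colon_def)

lemma colon_sub_den: "I \<in> \<GG> \<Longrightarrow> Colon I v \<subseteq> den v"
  using gabriel_subset by (intro colon_mono) auto

lemma colon_unu:
  assumes "I \<in> \<GG>" "r \<in> Colon I v"
  shows "r \<in> carrier R" "unu (v \<otimes> u r) \<in> I" "u (unu (v \<otimes> u r)) = v \<otimes> u r"
proof -
  obtain i where i: "i \<in> I" "v \<otimes> u r = u i" using assms by (auto simp: colon_def)
  moreover have "i \<in> carrier R" using i gabriel_subset[OF assms(1)] by auto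
  ultimately show "unu (v \<otimes> u r) \<in> I" "u (unu (v \<otimes> u r)) = v \<otimes> u r" by simp_all
  show "r \<in> carrier R" using assms by (simp add: colon_def)
qed

subsection \<open>Multiplying a small formal sum by a fraction\<close>

text \<open>
  The finite formal sum \<open>v (t - s)\<close>, for \<open>s\<close> and \<open>t\<close> congruent modulo the denominators of \<open>v\<close>.
\<close>

abbreviation dq :: "'x set \<Rightarrow> 'u \<Rightarrow> ('x \<Rightarrow> 'r) \<Rightarrow> ('x \<Rightarrow> 'r) \<Rightarrow> ('x \<Rightarrow> 'r)" where
  "dq X v t s \<equiv> (\<lambda>x \<in> X. unu (v \<otimes> u (t x \<ominus>\<^bsub>R\<^esub> s x)))"

lemma dq_props:
  assumes v: "v \<in> carrier U" and a: "a \<in> T.FS X"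
    and t: "t \<in> T.PF X" "T.approximates (den v) X t a" and s: "s \<in> T.PF X" "T.approximates (den v) X s a"
  shows "dq X v t s \<in> T.PF X" "x \<in> X \<Longrightarrow> u (dq X v t s x) = v \<otimes> u (t x \<ominus>\<^bsub>R\<^esub> s x)"
proof -
  have d: "t x \<ominus>\<^bsub>R\<^esub> s x \<in> den v" if "x \<in> X" for x
    by (rule T.approximates_diff[OF t(2) s(2) den_in_gabriel[OF v] T.FS_funcset[OF a] that])
  note c = colon_unu[OF carrier_in_gabriel d]
  show "x \<in> X \<Longrightarrow> u (dq X v t s x) = v \<otimes> u (t x \<ominus>\<^bsub>R\<^esub> s x)" using c(3) by simp
  have "finite {x \<in> X. dq X v t s x \<noteq> \<zero>\<^bsub>R\<^esub>}"
  proof (rule finite_subset)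
    show "{x \<in> X. dq X v t s x \<noteq> \<zero>\<^bsub>R\<^esub>} \<subseteq> {x \<in> X. t x \<noteq> \<zero>\<^bsub>R\<^esub>} \<union> {x \<in> X. s x \<noteq> \<zero>\<^bsub>R\<^esub>}"
      using v by (auto simp: a_minus_def R.l_neg)
    show "finite ({x \<in> X. t x \<noteq> \<zero>\<^bsub>R\<^esub>} \<union> {x \<in> X. s x \<noteq> \<zero>\<^bsub>R\<^esub>})"
      using free_module_finite t(1) s(1) by blast
  qed
  then show "dq X v t s \<in> T.PF X" using c(2) by (auto simp: free_module_carrier)
qed

text \<open>
  The formal sum \<open>v (a - s)\<close>: the finite sums \<open>v (t - s)\<close> converge as \<open>t\<close> approaches \<open>a\<close>, since
  \<open>t\<close> modulo \<open>(I : v)\<close> determines \<open>v t\<close> modulo \<open>I\<close>.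
\<close>

lemma fraction_multiple_exists:
  assumes v: "v \<in> carrier U" and a: "a \<in> T.FS X" and s: "s \<in> T.PF X" "T.approximates (den v) X s a"
  obtains b where "b \<in> T.FS X"
    "\<And>I t. I \<in> \<GG> \<Longrightarrow> t \<in> T.PF X \<Longrightarrow> T.approximates (Colon I v) X t a \<Longrightarrow> T.approximates I X (dq X v t s) b"
proof -
  have C: "Colon I v \<in> \<GG>" if "I \<in> \<GG>" for I by (rule colon_in_gabriel[OF that v])
  have ap: "T.approximates (den v) X t a" if "I \<in> \<GG>" "T.approximates (Colon I v) X t a" for I t
    by (rule T.approximates_mono[OF that(2) C[OF that(1)] den_in_gabriel[OF v] colon_sub_den[OF that(1)] T.FS_funcset[OF a]])
  have "\<exists>t. I \<in> \<GG> \<longrightarrow> t \<in> T.PF X \<and> T.approximates (Colon I v) X t a" for I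
    using FS_approx_ex[OF a C] by blast
  then obtain \<tau> where \<tau>: "\<And>I. I \<in> \<GG> \<Longrightarrow> \<tau> I \<in> T.PF X" "\<And>I. I \<in> \<GG> \<Longrightarrow> T.approximates (Colon I v) X (\<tau> I) a"
    by metis
  have dP: "dq X v t s \<in> T.PF X" "\<And>x. x \<in> X \<Longrightarrow> u (dq X v t s x) = v \<otimes> u (t x \<ominus>\<^bsub>R\<^esub> s x)"
    if "I \<in> \<GG>" "t \<in> T.PF X" "T.approximates (Colon I v) X t a" for I t
    using dq_props[OF v a that(2) ap[OF that(1,3)] s] by auto
  have dd: "dq X v t s x \<ominus>\<^bsub>R\<^esub> dq X v t' s x \<in> I"
    if I: "I \<in> \<GG>" and t: "t \<in> T.PF X" "T.approximates (Colon I v) X t a"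
      and t': "t' \<in> T.PF X" "T.approximates (Colon I v) X t' a" and x: "x \<in> X" for I t t' x
  proof -
    note R = free_module_closed[OF t(1) x] free_module_closed[OF t'(1) x] free_module_closed[OF s(1) x]
      free_module_closed[OF dP(1)[OF I t] x] free_module_closed[OF dP(1)[OF I t'] x]
    have d: "t x \<ominus>\<^bsub>R\<^esub> t' x \<in> Colon I v"
      by (rule T.approximates_diff[OF t(2) t'(2) C[OF I] T.FS_funcset[OF a] x])
    have "u (dq X v t s x \<ominus>\<^bsub>R\<^esub> dq X v t' s x) = v \<otimes> u (t x \<ominus>\<^bsub>R\<^esub> s x) \<ominus> v \<otimes> u (t' x \<ominus>\<^bsub>R\<^esub> s x)"
      using R(4,5) dP(2)[OF I t x] dP(2)[OF I t' x] by (simp only: u_minus)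
    also have "\<dots> = v \<otimes> u (t x \<ominus>\<^bsub>R\<^esub> t' x)"
      using R v by (simp add: a_minus_def U.r_distr U.r_minus U.minus_add U.a_ac U.r_neg1 U.r_neg2)
    also have "\<dots> = u (unu (v \<otimes> u (t x \<ominus>\<^bsub>R\<^esub> t' x)))" using colon_unu(3)[OF I d] by simp
    finally have "dq X v t s x \<ominus>\<^bsub>R\<^esub> dq X v t' s x = unu (v \<otimes> u (t x \<ominus>\<^bsub>R\<^esub> t' x))"
      using R(4,5) colon_unu(2)[OF I d] gabriel_subset[OF I] by (subst (asm) u_eq_iff) auto
    then show ?thesis using colon_unu(2)[OF I d] by simp
  qed
  define b where "b = (\<lambda>x \<in> X. \<lambda>I \<in> \<GG>. I +>\<^bsub>R\<^esub> dq X v (\<tau> I) s x)"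
  have bx: "b x \<in> carrier T.S" "\<And>I. I \<in> \<GG> \<Longrightarrow> dq X v (\<tau> I) s x \<in> b x I" if x: "x \<in> X" for x
  proof -
    have 1: "dq X v (\<tau> I) s x \<in> carrier R" if "I \<in> \<GG>" for I
      using free_module_closed[OF dP(1)[OF that \<tau>[OF that]] x] .
    have 2: "dq X v (\<tau> I) s x \<ominus>\<^bsub>R\<^esub> dq X v (\<tau> J) s x \<in> J" if IJ: "I \<in> \<GG>" "J \<in> \<GG>" "I \<subseteq> J" for I J
      by (rule dd[OF IJ(2) \<tau>(1)[OF IJ(1)] T.approximates_mono[OF \<tau>(2)[OF IJ(1)] C[OF IJ(1)] C[OF IJ(2)] colon_mono[OF IJ(3)] T.FS_funcset[OF a]] \<tau>[OF IJ(2)] x])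
    have b: "b x = (\<lambda>I \<in> \<GG>. I +>\<^bsub>R\<^esub> dq X v (\<tau> I) s x)" using x by (simp add: b_def)
    show "b x \<in> carrier T.S" unfolding b by (rule T.completion_construct(1)) (use 1 2 in blast)+
    show "dq X v (\<tau> I) s x \<in> b x I" if "I \<in> \<GG>" for I
      unfolding b by (rule T.completion_construct(2)) (use 1 2 that in blast)+
  qed
  have app: "T.approximates I X (dq X v t s) b"
    if I: "I \<in> \<GG>" and t: "t \<in> T.PF X" "T.approximates (Colon I v) X t a" for I t
  proof (rule T.approximatesI[OF dP(1)[OF I t]])
    fix x assume x: "x \<in> X"
    show "dq X v t s x \<in> b x I"
      using T.completion_mem_iff[OF bx(1)[OF x] I bx(2)[OF x I] free_module_closed[OF dP(1)[OF I t] x]]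
        dd[OF I t \<tau>[OF I] x] by blast
  qed
  have "b \<in> T.FS X"
  proof (rule T.FS_I)
    show "b \<in> extensional X" by (simp add: b_def)
    show "b \<in> X \<rightarrow> carrier T.S" using bx(1) by blast
    show "\<exists>q. T.approximates I X q b" if "I \<in> \<GG>" for I using app[OF that \<tau>[OF that]] by blast
  qed
  then show thesis using that app by blast
qed

text \<open>
  If the difference of two formal sums has the same approximation \<open>\<kappa>\<close> modulo every \<open>I\<close>, it is the
  finite formal sum with coefficients \<open>\<kappa>\<close>.
\<close>

lemma formal_sums_differ_finitely:
  assumes c: "c \<in> T.FS X" and b: "b \<in> T.FS X"
    and ap: "\<And>I. I \<in> \<GG> \<Longrightarrow> \<exists>p p'. p \<in> T.PF X \<and> p' \<in> T.PF X \<and> T.approximates I X p c \<and>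
      T.approximates I X p' b \<and> (\<forall>x \<in> X. u (p' x) \<ominus> u (p x) = \<kappa> x)"
  shows "\<exists>q \<in> T.PF X. b = c \<oplus>\<^bsub>T.formal_module X\<^esub> T.emb X q"
proof -
  let ?P = "free_module R X"
  interpret P: left_module R ?P by (rule R.free_module_left_module)
  define q where "q = (\<lambda>x \<in> X. unu (\<kappa> x))"
  have q: "q = p' \<ominus>\<^bsub>?P\<^esub> p"
    if p: "p \<in> T.PF X" "p' \<in> T.PF X" "\<forall>x \<in> X. u (p' x) \<ominus> u (p x) = \<kappa> x" for p p'
  proof (rule extensionalityI[of _ X])
    have "p' \<ominus>\<^bsub>?P\<^esub> p \<in> T.PF X" using p by simp
    then show "p' \<ominus>\<^bsub>?P\<^esub> p \<in> extensional X" by (auto simp: free_module_carrier PiE_def)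
    fix x assume x: "x \<in> X"
    have R: "p x \<in> carrier R" "p' x \<in> carrier R" using free_module_closed[OF p(1) x] free_module_closed[OF p(2) x] .
    have "q x = unu (u (p' x \<ominus>\<^bsub>R\<^esub> p x))" using p(3)[rule_format, OF x] x R by (simp add: q_def)
    also have "\<dots> = p' x \<ominus>\<^bsub>R\<^esub> p x" by (rule unu_u) (use R in simp)
    finally show "q x = (p' \<ominus>\<^bsub>?P\<^esub> p) x" by (simp only: R.free_module_minus_apply(2)[OF p(2,1) x])
  qed (simp add: q_def)
  obtain p0 p0' where p0: "p0 \<in> T.PF X" "p0' \<in> T.PF X" "\<forall>x \<in> X. u (p0' x) \<ominus> u (p0 x) = \<kappa> x"
    using ap[OF carrier_in_gabriel] by blast
  have qP: "q \<in> T.PF X" unfolding q[OF p0] using p0 by simp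
  have "c \<oplus>\<^bsub>T.formal_module X\<^esub> T.emb X q = b"
  proof (rule T.FS_eqI)
    fix I assume I: "I \<in> \<GG>"
    obtain p p' where p: "p \<in> T.PF X" "p' \<in> T.PF X" "\<forall>x \<in> X. u (p' x) \<ominus> u (p x) = \<kappa> x"
      and a: "T.approximates I X p c" "T.approximates I X p' b" using ap[OF I] by blast
    have "T.approximates I X (p \<oplus>\<^bsub>?P\<^esub> q) (c \<oplus>\<^bsub>T.formal_module X\<^esub> T.emb X q)"
      by (intro T.formal_add_approximates c T.emb_closed qP p I a T.emb_approximates)
    moreover have "p \<oplus>\<^bsub>?P\<^esub> q = p'"
      unfolding q[OF p] P.M.a_comm[OF p(1) P.M.minus_closed[OF p(2,1)]] using p
      by (simp add: a_minus_def P.M.a_assoc P.M.l_neg)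
    ultimately show "\<exists>p. T.approximates I X p (c \<oplus>\<^bsub>T.formal_module X\<^esub> T.emb X q) \<and> T.approximates I X p b"
      using a(2) by auto
  qed (intro T.formal_add_closed c b T.emb_closed qP)+
  then show ?thesis using qP by blast
qed

text \<open>
  Formal sums modulo finite ones form a left \<open>U\<close>-module: \<open>v\<close> times the class of \<open>a\<close> is the class of
  \<open>v (a - s)\<close>, for a finite \<open>s\<close> close enough to \<open>a\<close>.  The difference of \<open>\<Phi>\<close> and \<open>\<Psi>\<close> is a linear
  map out of this \<open>U\<close>-module; composed with \<open>v \<mapsto> v a\<close> it is a linear map from \<open>U\<close> to \<open>M\<close>, hence
  zero, and at \<open>v = 1\<close> it gives the claim.
\<close>

lemma linear_extension_unique:
  assumes M: "left_module R M" and triv: "hom_trivial R UL M"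
    and \<Phi>: "linear_map R (T.formal_module X) M \<Phi>" and \<Psi>: "linear_map R (T.formal_module X) M \<Psi>"
    and eq: "\<And>p. p \<in> T.PF X \<Longrightarrow> \<Phi> (T.emb X p) = \<Psi> (T.emb X p)" and a: "a \<in> T.FS X"
  shows "\<Phi> a = \<Psi> a"
proof -
  interpret M: left_module R M by fact
  let ?P = "free_module R X" and ?FM = "T.formal_module X"
  have "\<exists>s. v \<in> carrier U \<longrightarrow> s \<in> T.PF X \<and> T.approximates (den v) X s a" for v
    using FS_approx_ex[OF a den_in_gabriel] by blast
  then obtain s where s: "\<And>v. v \<in> carrier U \<Longrightarrow> s v \<in> T.PF X"
      "\<And>v. v \<in> carrier U \<Longrightarrow> T.approximates (den v) X (s v) a" by metis
  have "\<forall>v \<in> carrier U. \<exists>b. b \<in> T.FS X \<and> (\<forall>I t. I \<in> \<GG> \<longrightarrow> t \<in> T.PF X \<longrightarrow>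
      T.approximates (Colon I v) X t a \<longrightarrow> T.approximates I X (dq X v t (s v)) b)"
  proof
    fix v assume v: "v \<in> carrier U"
    show "\<exists>b. b \<in> T.FS X \<and> (\<forall>I t. I \<in> \<GG> \<longrightarrow> t \<in> T.PF X \<longrightarrow>
      T.approximates (Colon I v) X t a \<longrightarrow> T.approximates I X (dq X v t (s v)) b)"
      by (rule fraction_multiple_exists[OF v a s[OF v]]) blast
  qed
  from bchoice[OF this] obtain b where bb: "\<forall>v \<in> carrier U. b v \<in> T.FS X \<and> (\<forall>I t. I \<in> \<GG> \<longrightarrow> t \<in> T.PF X \<longrightarrow>
      T.approximates (Colon I v) X t a \<longrightarrow> T.approximates I X (dq X v t (s v)) (b v))" ..
  have b: "\<And>v. v \<in> carrier U \<Longrightarrow> b v \<in> T.FS X" using bb by blast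
  have bI: "T.approximates I X (dq X v t (s v)) (b v)"
    if "v \<in> carrier U" "I \<in> \<GG>" "t \<in> T.PF X" "T.approximates (Colon I v) X t a" for v I t
    using bb[rule_format, OF that(1)] that(2-4) by simp
  have FSb: "b v \<in> carrier ?FM" if "v \<in> carrier U" for v using b[OF that] by simp
  have sR: "s v x \<in> carrier R" if "v \<in> carrier U" "x \<in> X" for v x
    using free_module_closed[OF s(1)[OF that(1)] that(2)] .
  have dq: "dq X v t (s v) \<in> T.PF X" "\<And>x. x \<in> X \<Longrightarrow> u (dq X v t (s v) x) = v \<otimes> u (t x \<ominus>\<^bsub>R\<^esub> s v x)"
    if "v \<in> carrier U" "I \<in> \<GG>" "t \<in> T.PF X" "T.approximates (Colon I v) X t a" for v I t
  proof -
    have "T.approximates (den v) X t a"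
      by (rule T.approximates_mono[OF that(4) colon_in_gabriel[OF that(2,1)] den_in_gabriel[OF that(1)]
            colon_sub_den[OF that(2)] T.FS_funcset[OF a]])
    note p = dq_props[OF that(1) a that(3) this s(1)[OF that(1)] s(2)[OF that(1)]]
    show "dq X v t (s v) \<in> T.PF X" by (rule p(1))
    show "u (dq X v t (s v) x) = v \<otimes> u (t x \<ominus>\<^bsub>R\<^esub> s v x)" if "x \<in> X" for x
      by (rule p(2)[OF that])
  qed
  have mono: "T.approximates J X t a" if "T.approximates I X t a" "I \<in> \<GG>" "J \<in> \<GG>" "I \<subseteq> J" for I J t
    by (rule T.approximates_mono[OF that T.FS_funcset[OF a]])
  define \<Delta> where "\<Delta> c = \<Phi> c \<ominus>\<^bsub>M\<^esub> \<Psi> c" for c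
  have \<Delta>: "linear_map R ?FM M \<Delta>" unfolding \<Delta>_def by (rule linear_map_difference[OF M \<Phi> \<Psi>])
  have \<Delta>_emb: "\<Delta> (T.emb X q) = \<zero>\<^bsub>M\<^esub>" if q: "q \<in> T.PF X" for q
    using eq[OF q] linear_map_closed[OF \<Psi>] T.emb_closed[OF q] by (simp add: \<Delta>_def M.M.diff_eq_zero_iff)
  have \<Delta>_eq: "\<Delta> (b v) = \<Delta> c" if v: "v \<in> carrier U" and c: "c \<in> T.FS X"
    and ap: "\<And>I. I \<in> \<GG> \<Longrightarrow> \<exists>p p'. p \<in> T.PF X \<and> p' \<in> T.PF X \<and> T.approximates I X p c \<and>
      T.approximates I X p' (b v) \<and> (\<forall>x \<in> X. u (p' x) \<ominus> u (p x) = \<kappa> x)" for v c \<kappa>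
  proof -
    obtain q where q: "q \<in> T.PF X" "b v = c \<oplus>\<^bsub>?FM\<^esub> T.emb X q"
      using formal_sums_differ_finitely[OF c b[OF v] ap] by blast
    then show ?thesis
      using linear_map_add[OF \<Delta>, of c "T.emb X q"] linear_map_closed[OF \<Delta>, of c] c T.emb_closed[OF q(1)] \<Delta>_emb by simp
  qed
  have "linear_map R UL M (\<lambda>v. \<Delta> (b v))"
  proof (rule linear_mapI)
    fix v assume "v \<in> carrier UL"
    then show "\<Delta> (b v) \<in> carrier M" using linear_map_closed[OF \<Delta> FSb] by simp
  next
    fix v w assume "v \<in> carrier UL" "w \<in> carrier UL"
    then have v: "v \<in> carrier U" and w: "w \<in> carrier U" and vw: "v \<oplus> w \<in> carrier U" by auto
    let ?vw = "v \<oplus> w"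
    have "\<Delta> (b ?vw) = \<Delta> (b v \<oplus>\<^bsub>?FM\<^esub> b w)"
    proof (rule \<Delta>_eq[OF vw T.formal_add_closed[OF b[OF v] b[OF w]]])
      fix I assume I: "I \<in> \<GG>"
      let ?K = "Colon I v \<inter> (Colon I w \<inter> Colon I ?vw)"
      have K: "?K \<in> \<GG>" by (intro gabriel_inter colon_in_gabriel I v w vw)
      obtain t where t: "t \<in> T.PF X" "T.approximates ?K X t a" using T.FS_approx[OF a K] .
      have tv: "T.approximates (Colon I v) X t a" by (rule mono[OF t(2) K colon_in_gabriel[OF I v]]) blast
      have tw: "T.approximates (Colon I w) X t a" by (rule mono[OF t(2) K colon_in_gabriel[OF I w]]) blast
      have tvw: "T.approximates (Colon I ?vw) X t a" by (rule mono[OF t(2) K colon_in_gabriel[OF I vw]]) blast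
      note d1 = dq[OF v I t(1) tv] and d2 = dq[OF w I t(1) tw] and d3 = dq[OF vw I t(1) tvw]
      let ?p = "dq X v t (s v) \<oplus>\<^bsub>?P\<^esub> dq X w t (s w)"
      have "u (dq X ?vw t (s ?vw) x) \<ominus> u (?p x) =
          (v \<otimes> u (s v x) \<oplus> w \<otimes> u (s w x)) \<ominus> ?vw \<otimes> u (s ?vw x)" if x: "x \<in> X" for x
      proof -
        have tR: "t x \<in> carrier R" using free_module_closed[OF t(1) x] .
        let ?A = "v \<otimes> u (t x)" and ?B = "w \<otimes> u (t x)"
        have c: "?A \<in> carrier U" "?B \<in> carrier U" "v \<otimes> u (s v x) \<in> carrier U"
            "w \<otimes> u (s w x) \<in> carrier U" "?vw \<otimes> u (s ?vw x) \<in> carrier U"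
          using v w tR sR[OF v x] sR[OF w x] sR[OF vw x] by simp_all
        have "u (dq X ?vw t (s ?vw) x) = (?A \<oplus> ?B) \<ominus> ?vw \<otimes> u (s ?vw x)"
          unfolding d3(2)[OF x] using v w tR sR[OF vw x] by (simp add: a_minus_def U.r_distr U.l_distr U.r_minus)
        moreover have "u (?p x) = v \<otimes> u (t x \<ominus>\<^bsub>R\<^esub> s v x) \<oplus> w \<otimes> u (t x \<ominus>\<^bsub>R\<^esub> s w x)"
          using d1(2)[OF x] d2(2)[OF x] free_module_closed[OF d1(1) x] free_module_closed[OF d2(1) x] x
          by (simp add: free_module_apply del: restrict_apply restrict_apply')
        moreover have "\<dots> = (?A \<oplus> ?B) \<ominus> (v \<otimes> u (s v x) \<oplus> w \<otimes> u (s w x))"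
          using v w tR sR[OF v x] sR[OF w x] c U.sum_of_diffs[of ?A ?B "v \<otimes> u (s v x)" "w \<otimes> u (s w x)"]
          by (simp add: a_minus_def U.r_distr U.r_minus)
        ultimately show ?thesis using c by (simp only: U.diff_of_diffs U.a_closed)
      qed
      then show "\<exists>p p'. p \<in> T.PF X \<and> p' \<in> T.PF X \<and> T.approximates I X p (b v \<oplus>\<^bsub>?FM\<^esub> b w) \<and>
          T.approximates I X p' (b ?vw) \<and> (\<forall>x \<in> X. u (p' x) \<ominus> u (p x) =
            (v \<otimes> u (s v x) \<oplus> w \<otimes> u (s w x)) \<ominus> ?vw \<otimes> u (s ?vw x))"
        by (intro exI[of _ ?p] exI[of _ "dq X ?vw t (s ?vw)"] conjI ballI R.free_module_add_closed
            T.formal_add_approximates b v w I d1(1) d2(1) d3(1) bI[OF v I t(1) tv] bI[OF w I t(1) tw] bI[OF vw I t(1) tvw])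
    qed
    also have "\<dots> = \<Delta> (b v) \<oplus>\<^bsub>M\<^esub> \<Delta> (b w)" by (rule linear_map_add[OF \<Delta> FSb[OF v] FSb[OF w]])
    finally show "\<Delta> (b (v \<oplus>\<^bsub>UL\<^esub> w)) = \<Delta> (b v) \<oplus>\<^bsub>M\<^esub> \<Delta> (b w)" by simp
  next
    fix r v assume r: "r \<in> carrier R" and "v \<in> carrier UL"
    then have v: "v \<in> carrier U" and rv: "u r \<otimes> v \<in> carrier U" by auto
    let ?rv = "u r \<otimes> v"
    have "\<Delta> (b ?rv) = \<Delta> (r \<odot>\<^bsub>?FM\<^esub> b v)"
    proof (rule \<Delta>_eq[OF rv T.formal_smult_closed[OF r b[OF v]]])
      fix I assume I: "I \<in> \<GG>"
      have Ir: "ideal_colon R I r \<in> \<GG>" by (rule T.G_colon[OF I r])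
      let ?K = "Colon (ideal_colon R I r) v \<inter> Colon I ?rv"
      have K: "?K \<in> \<GG>" by (intro gabriel_inter colon_in_gabriel Ir I v rv)
      obtain t where t: "t \<in> T.PF X" "T.approximates ?K X t a" using T.FS_approx[OF a K] .
      have tv: "T.approximates (Colon (ideal_colon R I r) v) X t a"
        by (rule mono[OF t(2) K colon_in_gabriel[OF Ir v]]) blast
      have trv: "T.approximates (Colon I ?rv) X t a" by (rule mono[OF t(2) K colon_in_gabriel[OF I rv]]) blast
      note d1 = dq[OF v Ir t(1) tv] and d3 = dq[OF rv I t(1) trv]
      let ?p = "r \<odot>\<^bsub>?P\<^esub> dq X v t (s v)"
      have "u (dq X ?rv t (s ?rv) x) \<ominus> u (?p x) =
          u r \<otimes> (v \<otimes> u (s v x)) \<ominus> ?rv \<otimes> u (s ?rv x)" if x: "x \<in> X" for x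
      proof -
        have tR: "t x \<in> carrier R" using free_module_closed[OF t(1) x] .
        let ?A = "?rv \<otimes> u (t x)"
        have c: "?A \<in> carrier U" "u r \<otimes> (v \<otimes> u (s v x)) \<in> carrier U" "?rv \<otimes> u (s ?rv x) \<in> carrier U"
          using v rv r tR sR[OF v x] sR[OF rv x] by simp_all
        have "u (dq X ?rv t (s ?rv) x) = ?A \<ominus> ?rv \<otimes> u (s ?rv x)"
          unfolding d3(2)[OF x] using rv tR sR[OF rv x] by (simp add: a_minus_def U.r_distr U.r_minus)
        moreover have "u (?p x) = u r \<otimes> (v \<otimes> u (t x \<ominus>\<^bsub>R\<^esub> s v x))"
          using d1(2)[OF x] free_module_closed[OF d1(1) x] x r
          by (simp add: free_module_apply del: restrict_apply restrict_apply')
        moreover have "\<dots> = ?A \<ominus> u r \<otimes> (v \<otimes> u (s v x))"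
          using v r tR sR[OF v x] by (simp add: a_minus_def U.r_distr U.r_minus U.m_assoc)
        ultimately show ?thesis using c by (simp only: U.diff_of_diffs)
      qed
      then show "\<exists>p p'. p \<in> T.PF X \<and> p' \<in> T.PF X \<and> T.approximates I X p (r \<odot>\<^bsub>?FM\<^esub> b v) \<and>
          T.approximates I X p' (b ?rv) \<and> (\<forall>x \<in> X. u (p' x) \<ominus> u (p x) =
            u r \<otimes> (v \<otimes> u (s v x)) \<ominus> ?rv \<otimes> u (s ?rv x))"
        by (intro exI[of _ ?p] exI[of _ "dq X ?rv t (s ?rv)"] conjI ballI R.free_module_smult_closed
            T.formal_smult_approximates b v r I d1(1) d3(1) bI[OF v Ir t(1) tv] bI[OF rv I t(1) trv])
    qed
    also have "\<dots> = r \<odot>\<^bsub>M\<^esub> \<Delta> (b v)" by (rule linear_map_smult[OF \<Delta> r FSb[OF v]])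
    finally show "\<Delta> (b (r \<odot>\<^bsub>UL\<^esub> v)) = r \<odot>\<^bsub>M\<^esub> \<Delta> (b v)" by simp
  qed
  then have "\<Delta> (b \<one>) = \<zero>\<^bsub>M\<^esub>" using triv by (auto simp: hom_trivial_def)
  then have b1: "\<Phi> (b \<one>) = \<Psi> (b \<one>)"
    using linear_map_closed[OF \<Phi> FSb] linear_map_closed[OF \<Psi> FSb] by (simp add: \<Delta>_def M.M.diff_eq_zero_iff)
  have one: "\<one> \<in> carrier U" by simp
  have s1: "s \<one> \<in> T.PF X" by (rule s(1)[OF one])
  have "b \<one> \<oplus>\<^bsub>?FM\<^esub> T.emb X (s \<one>) = a"
  proof (rule T.FS_eqI)
    fix I assume I: "I \<in> \<GG>"
    have CI: "Colon I \<one> = I"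
      using colon_iff[OF gabriel_subset[OF I] R.one_closed] gabriel_subset[OF I] by auto
    obtain t where t: "t \<in> T.PF X" "T.approximates I X t a" using T.FS_approx[OF a I] .
    have t': "T.approximates (Colon I \<one>) X t a" using t CI by simp
    note d = dq[OF one I t(1) t']
    have "T.approximates I X (dq X \<one> t (s \<one>) \<oplus>\<^bsub>?P\<^esub> s \<one>) (b \<one> \<oplus>\<^bsub>?FM\<^esub> T.emb X (s \<one>))"
      by (intro T.formal_add_approximates b one T.emb_closed s1 d(1) I T.emb_approximates bI[OF one I t(1) t'])
    moreover have "dq X \<one> t (s \<one>) \<oplus>\<^bsub>?P\<^esub> s \<one> = t"
    proof (rule free_module_ext[OF R.free_module_add_closed[OF d(1) s1] t(1)])
      fix x assume x: "x \<in> X"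
      have "t x \<ominus>\<^bsub>R\<^esub> s \<one> x \<in> carrier R" using free_module_closed[OF t(1) x] sR[OF one x] by simp
      then have "dq X \<one> t (s \<one>) x = t x \<ominus>\<^bsub>R\<^esub> s \<one> x"
        using x by (simp del: u_minus)
      then show "(dq X \<one> t (s \<one>) \<oplus>\<^bsub>?P\<^esub> s \<one>) x = t x"
        using x free_module_closed[OF t(1) x] sR[OF one x]
        by (simp add: free_module_apply a_minus_def R.a_assoc R.l_neg del: restrict_apply restrict_apply')
    qed
    ultimately have "T.approximates I X t (b \<one> \<oplus>\<^bsub>?FM\<^esub> T.emb X (s \<one>))"
      by (simp only:)
    then show "\<exists>p. T.approximates I X p (b \<one> \<oplus>\<^bsub>?FM\<^esub> T.emb X (s \<one>)) \<and> T.approximates I X p a"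
      by (intro exI conjI) (assumption, rule t(2))
  qed (intro T.formal_add_closed b one T.emb_closed s1 a)+
  then have apl: "F a = F (b \<one>) \<oplus>\<^bsub>M\<^esub> F (T.emb X (s \<one>))" if F: "linear_map R ?FM M F" for F
    using linear_map_add[OF F, of "b \<one>" "T.emb X (s \<one>)"] b[OF one] T.emb_closed[OF s1] by simp
  show ?thesis using apl[OF \<Phi>] apl[OF \<Psi>] b1 eq[OF s1] by simp
qed

end

context flat_epi
begin

subsection \<open>Existence of linear extensions\<close>

lemma UL_group_simps [simp]: "finsum UL = finsum U" "\<ominus>\<^bsub>UL\<^esub> x = \<ominus> x" "x \<ominus>\<^bsub>UL\<^esub> y = x \<ominus> y"
proof -
  show n: "\<ominus>\<^bsub>UL\<^esub> x = \<ominus> x" for x by (simp add: a_inv_def m_inv_def)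
  show "finsum UL = finsum U"
    by (simp add: fun_eq_iff finsum_def finprod_def restrict_scalars_def regular_module_def)
  show "x \<ominus>\<^bsub>UL\<^esub> y = x \<ominus> y" by (simp add: a_minus_def n)
qed

abbreviation P0 :: "('r, 'u \<Rightarrow> 'r) module" where "P0 \<equiv> free_module R (carrier U)"
abbreviation K0 :: "('r, 'u \<Rightarrow> 'r) module" where "K0 \<equiv> syzygy R UL"
abbreviation ulin :: "('u \<Rightarrow> 'u) \<Rightarrow> ('u \<Rightarrow> 'r) \<Rightarrow> 'u" where "ulin \<equiv> lin_ext R UL (carrier U)"
abbreviation eU :: "'u \<Rightarrow> ('u \<Rightarrow> 'r)" where "eU \<equiv> formal_single R (carrier U) \<one>\<^bsub>R\<^esub>"

lemma P0_module: "left_module R P0" by (rule R.free_module_left_module)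

lemma K0_module: "left_module R K0" by (rule syzygy_left_module[OF UL_module])

lemma K0_iff: "p \<in> carrier K0 \<longleftrightarrow> p \<in> carrier P0 \<and> ulin (\<lambda>v. v) p = \<zero>"
  by (simp add: syzygy_simps free_cover_eq_lin_ext)

lemma ulin_rmult:
  assumes "p \<in> carrier P0" "w \<in> carrier U" "f \<in> carrier U \<rightarrow> carrier U"
  shows "ulin (\<lambda>v. f v \<otimes> w) p = ulin f p \<otimes> w"
  by (rule left_module.linear_map_lin_ext[OF UL_module UL_module, symmetric])
    (use assms in \<open>auto simp: linear_map_def U.l_distr U.m_assoc\<close>)

text \<open>
  A finite approximation \<open>s v\<close> of \<open>a\<close> for each \<open>v\<close>, precise enough for \<open>v (a - s v)\<close> to be a formal
  sum over the completion.
\<close>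

definition den_family :: "'x set \<Rightarrow> ('u \<Rightarrow> 'x \<Rightarrow> 'r) \<Rightarrow> ('x \<Rightarrow> 'r set \<Rightarrow> 'r set) \<Rightarrow> bool" where
  "den_family X s a \<longleftrightarrow> (\<forall>v \<in> carrier U. s v \<in> T.PF X \<and> T.approximates (den v) X (s v) a)"

text \<open>
  For \<open>p\<close> in the syzygy of \<open>U\<close>, that is \<open>\<Sum> p\<^sub>v v = 0\<close>, the sum \<open>\<Sum> p\<^sub>v v (a - s v)\<close> is equal to
  \<open>- \<Sum> p\<^sub>v v (s v)\<close>.  The latter expression is finite.
\<close>

definition correction :: "'x set \<Rightarrow> ('u \<Rightarrow> 'x \<Rightarrow> 'r) \<Rightarrow> ('u \<Rightarrow> 'r) \<Rightarrow> ('x \<Rightarrow> 'r)" where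
  "correction X s p = (\<lambda>x \<in> X. unu (\<ominus> ulin (\<lambda>v. v \<otimes> u (s v x)) p))"

lemma den_familyD:
  assumes "den_family X s a" "v \<in> carrier U"
  shows "s v \<in> T.PF X" "T.approximates (den v) X (s v) a" "x \<in> X \<Longrightarrow> s v x \<in> carrier R"
proof -
  show s: "s v \<in> T.PF X" and "T.approximates (den v) X (s v) a" using assms by (auto simp: den_family_def)
  show "x \<in> X \<Longrightarrow> s v x \<in> carrier R" by (rule free_module_closed[OF s])
qed

lemma den_family_exists:
  assumes "a \<in> T.FS X" shows "\<exists>s. den_family X s a"
proof -
  have "\<forall>v \<in> carrier U. \<exists>s. s \<in> T.PF X \<and> T.approximates (den v) X s a"
    using FS_approx_ex[OF assms den_in_gabriel] by blast
  from bchoice[OF this] show ?thesis by (simp add: den_family_def)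
qed

lemma PF_u_ext:
  assumes "p \<in> T.PF X" "q \<in> T.PF X" "\<And>x. x \<in> X \<Longrightarrow> u (p x) = u (q x)"
  shows "p = q"
  by (rule free_module_ext[OF assms(1,2)])
    (use assms free_module_closed u_eq_iff in metis)

text \<open>
  The coefficients lie in \<open>R\<close>: if the finite sum \<open>t\<close> approximates \<open>a\<close> modulo the denominators of
  each \<open>v\<close> in the support of \<open>p\<close>, then \<open>- \<Sum> p\<^sub>v v (s v) = \<Sum> p\<^sub>v v (t - s v)\<close>, and every
  \<open>v (t - s v)\<close> has coefficients in \<open>R\<close>.
\<close>

lemma correction_props:
  assumes a: "a \<in> T.FS X" and s: "den_family X s a" and p: "p \<in> carrier K0"
  shows "correction X s p \<in> T.PF X"
    and "x \<in> X \<Longrightarrow> u (correction X s p x) = \<ominus> ulin (\<lambda>v. v \<otimes> u (s v x)) p"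
proof -
  have pP: "p \<in> carrier P0" and p0: "ulin (\<lambda>v. v) p = \<zero>" using p by (auto simp: K0_iff)
  let ?F = "{v \<in> carrier U. p v \<noteq> \<zero>\<^bsub>R\<^esub>}"
  have F: "finite ?F" by (rule free_module_finite[OF pP])
  obtain J where J: "J \<in> \<GG>" "\<And>v. v \<in> ?F \<Longrightarrow> J \<subseteq> den v"
    using T.G_INT[OF F, of den] den_in_gabriel by auto
  obtain t where t: "t \<in> T.PF X" "T.approximates J X t a" using T.FS_approx[OF a J(1)] .
  have in_image: "ulin (\<lambda>v. v \<otimes> u (s v x)) p \<in> u ` carrier R" if x: "x \<in> X" for x
  proof -
    have tR: "t x \<in> carrier R" using free_module_closed[OF t(1) x] .
    have sR: "s v x \<in> carrier R" if "v \<in> carrier U" for v using den_familyD(3)[OF s that x] .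
    have c: "(\<lambda>v. v \<otimes> u (s v x)) \<in> carrier U \<rightarrow> carrier UL" "(\<lambda>v. v \<otimes> u (t x)) \<in> carrier U \<rightarrow> carrier UL"
      using sR tR by auto
    have z: "ulin (\<lambda>v. v \<otimes> u (t x)) p = \<zero>"
      using ulin_rmult[OF pP, of "u (t x)" "\<lambda>v. v"] tR p0 by simp
    have "ulin (\<lambda>v. v \<otimes> u (s v x)) p \<in> carrier U"
      using linear_map_closed[OF left_module.lin_ext_linear[OF UL_module c(1)] pP] by simp
    then have "ulin (\<lambda>v. v \<otimes> u (s v x)) p = ulin (\<lambda>v. v \<otimes> u (s v x) \<ominus> v \<otimes> u (t x)) p"
      using left_module.lin_ext_diff[OF UL_module c pP] z by (simp add: a_minus_def)
    also have "\<dots> = finsum U (\<lambda>v. u (p v) \<otimes> (v \<otimes> u (s v x) \<ominus> v \<otimes> u (t x))) ?F"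
      by (simp add: lin_ext_def)
    also have "\<dots> \<in> u ` carrier R"
    proof (rule U.subgroup_finsum[OF image_u_subgroup F])
      fix v assume v: "v \<in> ?F"
      then have vU: "v \<in> carrier U" by simp
      have "T.approximates (den v) X t a"
        by (rule T.approximates_mono[OF t(2) J(1) den_in_gabriel[OF vU] J(2)[OF v] T.FS_funcset[OF a]])
      then have "s v x \<ominus>\<^bsub>R\<^esub> t x \<in> den v"
        by (rule T.approximates_diff[OF den_familyD(2)[OF s vU] _ den_in_gabriel[OF vU] T.FS_funcset[OF a] x])
      then obtain r where r: "r \<in> carrier R" "v \<otimes> u (s v x \<ominus>\<^bsub>R\<^esub> t x) = u r" by (auto simp: colon_def)
      have "v \<otimes> u (s v x) \<ominus> v \<otimes> u (t x) = u r"
        using r(2) vU sR[OF vU] tR by (simp add: a_minus_def U.r_distr U.r_minus)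
      then have "u (p v) \<otimes> (v \<otimes> u (s v x) \<ominus> v \<otimes> u (t x)) = u (p v \<otimes>\<^bsub>R\<^esub> r)"
        using r(1) free_module_closed[OF pP vU] by simp
      then show "u (p v) \<otimes> (v \<otimes> u (s v x) \<ominus> v \<otimes> u (t x)) \<in> u ` carrier R"
        using r(1) free_module_closed[OF pP vU] by (simp only: imageI R.m_closed)
    qed
    finally show ?thesis .
  qed
  have neg: "\<ominus> ulin (\<lambda>v. v \<otimes> u (s v x)) p \<in> u ` carrier R" if "x \<in> X" for x
    by (rule U.subgroup_neg_closed[OF image_u_subgroup in_image[OF that]])
  show "x \<in> X \<Longrightarrow> u (correction X s p x) = \<ominus> ulin (\<lambda>v. v \<otimes> u (s v x)) p"
    using u_unu(1)[OF neg] by (simp add: correction_def)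
  have "finite {x \<in> X. correction X s p x \<noteq> \<zero>\<^bsub>R\<^esub>}"
  proof (rule finite_subset)
    show "finite (\<Union>v \<in> ?F. {x \<in> X. s v x \<noteq> \<zero>\<^bsub>R\<^esub>})"
      using F den_familyD(1)[OF s] free_module_finite by (intro finite_UN_I) auto
    show "{x \<in> X. correction X s p x \<noteq> \<zero>\<^bsub>R\<^esub>} \<subseteq> (\<Union>v \<in> ?F. {x \<in> X. s v x \<noteq> \<zero>\<^bsub>R\<^esub>})"
    proof (rule subsetI, rule ccontr)
      fix x assume x: "x \<in> {x \<in> X. correction X s p x \<noteq> \<zero>\<^bsub>R\<^esub>}" and n: "x \<notin> (\<Union>v \<in> ?F. {x \<in> X. s v x \<noteq> \<zero>\<^bsub>R\<^esub>})"
      have "ulin (\<lambda>v. v \<otimes> u (s v x)) p = \<zero>\<^bsub>UL\<^esub>"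
        by (rule left_module.lin_ext_zero[OF UL_module pP]) (use n x in auto)
      then have "correction X s p x = \<zero>\<^bsub>R\<^esub>" using x by (simp add: correction_def)
      then show False using x by simp
    qed
  qed
  then show "correction X s p \<in> T.PF X"
    using u_unu(2)[OF neg] by (auto simp: free_module_carrier correction_def)
qed

lemma ulin_linear: "(\<And>v. v \<in> carrier U \<Longrightarrow> f v \<in> carrier U) \<Longrightarrow> linear_map R P0 UL (ulin f)"
  by (rule left_module.lin_ext_linear[OF UL_module]) simp

lemma correction_linear:
  assumes a: "a \<in> T.FS X" and s: "den_family X s a"
  shows "linear_map R K0 (free_module R X) (correction X s)"
proof (rule linear_mapI)
  have K0P0: "p \<in> carrier P0" if "p \<in> carrier K0" for p using that by (simp add: K0_iff)
  interpret K0: left_module R K0 by (rule K0_module)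
  note c = correction_props[OF a s]
  have lin: "linear_map R P0 UL (ulin (\<lambda>v. v \<otimes> u (s v x)))" if "x \<in> X" for x
    by (rule ulin_linear) (use den_familyD(3)[OF s _ that] in simp)
  {
    fix p assume "p \<in> carrier K0"
    then show "correction X s p \<in> T.PF X" by (rule c(1))
  next
    fix p q assume p: "p \<in> carrier K0" and q: "q \<in> carrier K0"
    show "correction X s (p \<oplus>\<^bsub>K0\<^esub> q) = correction X s p \<oplus>\<^bsub>free_module R X\<^esub> correction X s q"
    proof (rule PF_u_ext)
      fix x assume x: "x \<in> X"
      show "u (correction X s (p \<oplus>\<^bsub>K0\<^esub> q) x) = u ((correction X s p \<oplus>\<^bsub>free_module R X\<^esub> correction X s q) x)"
        using c(2)[OF p x] c(2)[OF q x] c(2)[OF K0.M.a_closed[OF p q] x]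
          free_module_closed[OF c(1)[OF p] x] free_module_closed[OF c(1)[OF q] x]
          linear_map_add[OF lin[OF x] K0P0[OF p] K0P0[OF q]]
          linear_map_closed[OF lin[OF x] K0P0[OF p]] linear_map_closed[OF lin[OF x] K0P0[OF q]] x
        by (simp add: free_module_apply syzygy_simps U.minus_add)
    qed (intro c(1) K0.M.a_closed R.free_module_add_closed p q)+
  next
    fix r p assume r: "r \<in> carrier R" and p: "p \<in> carrier K0"
    show "correction X s (r \<odot>\<^bsub>K0\<^esub> p) = r \<odot>\<^bsub>free_module R X\<^esub> correction X s p"
    proof (rule PF_u_ext)
      fix x assume x: "x \<in> X"
      show "u (correction X s (r \<odot>\<^bsub>K0\<^esub> p) x) = u ((r \<odot>\<^bsub>free_module R X\<^esub> correction X s p) x)"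
        using c(2)[OF p x] c(2)[OF K0.lsmult_closed[OF r p] x] free_module_closed[OF c(1)[OF p] x]
          linear_map_smult[OF lin[OF x] r K0P0[OF p]] linear_map_closed[OF lin[OF x] K0P0[OF p]] x r
        by (simp add: free_module_apply syzygy_simps U.r_minus)
    qed (intro c(1) K0.lsmult_closed R.free_module_smult_closed p r)+
  }
qed

text \<open>
  \<open>y\<close> is a value at \<open>a\<close> of the linear extension of \<open>g\<close> to formal sums.  Here \<open>\<gamma>\<close> takes the basis
  element of \<open>v\<close> to a candidate for the value at \<open>v (a - s v)\<close>.  On finite sums the value is known,
  which determines \<open>\<gamma>\<close> on the syzygy of \<open>U\<close>; finally \<open>a = 1 (a - s 1) + s 1\<close>.
\<close>

definition formal_value :: "('r, 'm) module \<Rightarrow> 'x set \<Rightarrow> ('x \<Rightarrow> 'm) \<Rightarrow> ('x \<Rightarrow> 'r set \<Rightarrow> 'r set) \<Rightarrow> 'm \<Rightarrow> bool" where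
  "formal_value M X g a y \<longleftrightarrow> (\<exists>s \<gamma>. den_family X s a \<and> linear_map R P0 M \<gamma> \<and>
     (\<forall>p \<in> carrier K0. \<gamma> p = lin_ext R M X g (correction X s p)) \<and>
     y = \<gamma> (eU \<one>) \<oplus>\<^bsub>M\<^esub> lin_ext R M X g (s \<one>))"

lemma eU_closed: "eU v \<in> carrier P0" by (simp add: R.formal_single_closed)

text \<open>
  The prescription for \<open>\<gamma>\<close> on the syzygy is linear there, so \<open>Ext\<^sup>1(U, M) = 0\<close> provides \<open>\<gamma>\<close>.
\<close>

lemma formal_value_exists:
  assumes M: "left_module R M" and ext: "syzygy_maps_extend R UL M" and g: "g \<in> X \<rightarrow> carrier M" and a: "a \<in> T.FS X"
  shows "\<exists>y. formal_value M X g a y"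
proof -
  obtain s where s: "den_family X s a" using den_family_exists[OF a] by blast
  have "linear_map R K0 M (\<lambda>p. lin_ext R M X g (correction X s p))"
    by (rule linear_map_comp[OF correction_linear[OF a s] left_module.lin_ext_linear[OF M g]])
  then obtain \<gamma> where "linear_map R P0 M \<gamma>" "\<forall>p \<in> carrier K0. \<gamma> p = lin_ext R M X g (correction X s p)"
    using ext unfolding syzygy_maps_extend_def by auto
  then show ?thesis using s unfolding formal_value_def by blast
qed

lemma formal_value_closed:
  assumes M: "left_module R M" and g: "g \<in> X \<rightarrow> carrier M" and "formal_value M X g a y"
  shows "y \<in> carrier M"
proof -
  interpret M: left_module R M by fact
  obtain s \<gamma> where s: "den_family X s a" and \<gamma>: "linear_map R P0 M \<gamma>"
    and y: "y = \<gamma> (eU \<one>) \<oplus>\<^bsub>M\<^esub> lin_ext R M X g (s \<one>)"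
    using assms(3) by (auto simp: formal_value_def)
  show ?thesis
    unfolding y using linear_map_closed[OF \<gamma> eU_closed]
      linear_map_closed[OF M.lin_ext_linear[OF g] den_familyD(1)[OF s U.one_closed]] by simp
qed

text \<open>
  For two choices \<open>(s, \<gamma>)\<close> and \<open>(s', \<gamma>')\<close> let \<open>\<Omega>\<close> take the basis element of \<open>v\<close> to
  \<open>\<gamma> v - \<gamma>' v\<close> plus the value of the finite sum \<open>v (s v - s' v)\<close>.  This map vanishes on the
  syzygy, so it is a linear map out of \<open>U\<close>, hence zero; at \<open>v = 1\<close> this says \<open>y = y'\<close>.
\<close>

lemma formal_value_unique:
  assumes M: "left_module R M" and triv: "hom_trivial R UL M" and g: "g \<in> X \<rightarrow> carrier M" and a: "a \<in> T.FS X"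
    and y: "formal_value M X g a y" and y': "formal_value M X g a y'"
  shows "y = y'"
proof -
  interpret M: left_module R M by fact
  let ?P = "free_module R X"
  interpret P: left_module R ?P by (rule R.free_module_left_module)
  let ?ev = "lin_ext R M X g"
  have ev: "linear_map R ?P M ?ev" by (rule M.lin_ext_linear[OF g])
  obtain s \<gamma> where s: "den_family X s a" and \<gamma>: "linear_map R P0 M \<gamma>"
    and \<gamma>K: "\<And>p. p \<in> carrier K0 \<Longrightarrow> \<gamma> p = ?ev (correction X s p)"
    and yy: "y = \<gamma> (eU \<one>) \<oplus>\<^bsub>M\<^esub> ?ev (s \<one>)"
    using y by (auto simp: formal_value_def)
  obtain s' \<gamma>' where s': "den_family X s' a" and \<gamma>': "linear_map R P0 M \<gamma>'"
    and \<gamma>'K: "\<And>p. p \<in> carrier K0 \<Longrightarrow> \<gamma>' p = ?ev (correction X s' p)"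
    and yy': "y' = \<gamma>' (eU \<one>) \<oplus>\<^bsub>M\<^esub> ?ev (s' \<one>)"
    using y' by (auto simp: formal_value_def)
  define d where "d v = dq X v (s v) (s' v)" for v
  have d: "d v \<in> T.PF X" "\<And>x. x \<in> X \<Longrightarrow> u (d v x) = v \<otimes> u (s v x) \<ominus> v \<otimes> u (s' v x)" if v: "v \<in> carrier U" for v
  proof -
    note p = dq_props[OF v a den_familyD(1,2)[OF s v] den_familyD(1,2)[OF s' v]]
    show "d v \<in> T.PF X" unfolding d_def by (rule p(1))
    show "u (d v x) = v \<otimes> u (s v x) \<ominus> v \<otimes> u (s' v x)" if x: "x \<in> X" for x
      unfolding d_def p(2)[OF x] using v den_familyD(3)[OF s v x] den_familyD(3)[OF s' v x]
      by (simp add: a_minus_def U.r_distr U.r_minus)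
  qed
  have df: "d \<in> carrier U \<rightarrow> carrier ?P" using d(1) by auto
  define D where "D = lin_ext R ?P (carrier U) d"
  have D: "linear_map R P0 ?P D" unfolding D_def by (rule P.lin_ext_linear[OF df])
  define \<Omega> where "\<Omega> p = (\<gamma> p \<ominus>\<^bsub>M\<^esub> \<gamma>' p) \<oplus>\<^bsub>M\<^esub> ?ev (D p)" for p
  have \<Omega>: "linear_map R P0 M \<Omega>"
    unfolding \<Omega>_def by (intro linear_map_sum[OF M] linear_map_difference[OF M] \<gamma> \<gamma>' linear_map_comp[OF D ev])
  have coef: "linear_map R ?P UL (\<lambda>f. u (f x))" if x: "x \<in> X" for x
  proof -
    have c: "f x \<in> carrier R" if "f \<in> T.PF X" for f by (rule free_module_closed[OF that x])
    show ?thesis by (rule linear_mapI) (simp_all add: c x free_module_apply)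
  qed
  have uD: "u (D p x) = ulin (\<lambda>v. v \<otimes> u (s v x)) p \<ominus> ulin (\<lambda>v. v \<otimes> u (s' v x)) p"
    if p: "p \<in> carrier P0" and x: "x \<in> X" for p x
  proof -
    have c: "(\<lambda>v. v \<otimes> u (s v x)) \<in> carrier U \<rightarrow> carrier UL" "(\<lambda>v. v \<otimes> u (s' v x)) \<in> carrier U \<rightarrow> carrier UL"
      using den_familyD(3)[OF s _ x] den_familyD(3)[OF s' _ x] by auto
    have "u (D p x) = ulin (\<lambda>v. u (d v x)) p"
      unfolding D_def by (rule P.linear_map_lin_ext[OF UL_module coef[OF x] df p])
    also have "\<dots> = ulin (\<lambda>v. v \<otimes> u (s v x) \<ominus>\<^bsub>UL\<^esub> v \<otimes> u (s' v x)) p"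
      by (rule left_module.lin_ext_cong[OF UL_module p]) (use d(2)[OF _ x] c in auto)
    also have "\<dots> = ulin (\<lambda>v. v \<otimes> u (s v x)) p \<ominus>\<^bsub>UL\<^esub> ulin (\<lambda>v. v \<otimes> u (s' v x)) p"
      by (rule left_module.lin_ext_diff[OF UL_module c p])
    finally show ?thesis by simp
  qed
  have "\<Omega> p = \<zero>\<^bsub>M\<^esub>" if p: "p \<in> carrier K0" for p
  proof -
    have pP: "p \<in> carrier P0" using p by (simp add: K0_iff)
    note cs = correction_props[OF a s p] and cs' = correction_props[OF a s' p]
    have "correction X s p \<oplus>\<^bsub>?P\<^esub> D p = correction X s' p"
    proof (rule PF_u_ext[OF _ cs'(1)])
      show "correction X s p \<oplus>\<^bsub>?P\<^esub> D p \<in> T.PF X"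
        by (intro R.free_module_add_closed cs(1) linear_map_closed[OF D pP])
      fix x assume x: "x \<in> X"
      have c: "ulin (\<lambda>v. v \<otimes> u (s v x)) p \<in> carrier U" "ulin (\<lambda>v. v \<otimes> u (s' v x)) p \<in> carrier U"
        using linear_map_closed[OF ulin_linear pP] den_familyD(3)[OF s _ x] den_familyD(3)[OF s' _ x] by auto
      show "u ((correction X s p \<oplus>\<^bsub>?P\<^esub> D p) x) = u (correction X s' p x)"
        using cs(2)[OF x] cs'(2)[OF x] uD[OF pP x] c x free_module_closed[OF cs(1) x]
          free_module_closed[OF linear_map_closed[OF D pP] x]
        by (simp add: free_module_apply a_minus_def U.r_neg1)
    qed
    then have "?ev (correction X s p) \<oplus>\<^bsub>M\<^esub> ?ev (D p) = ?ev (correction X s' p)"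
      using linear_map_add[OF ev cs(1) linear_map_closed[OF D pP]] by simp
    then have "\<gamma> p \<oplus>\<^bsub>M\<^esub> ?ev (D p) = \<gamma>' p" using \<gamma>K[OF p] \<gamma>'K[OF p] by simp
    moreover have "\<gamma> p \<in> carrier M" "?ev (D p) \<in> carrier M" "\<gamma>' p \<in> carrier M"
      using linear_map_closed[OF \<gamma> pP] linear_map_closed[OF \<gamma>' pP] linear_map_closed[OF ev linear_map_closed[OF D pP]] by auto
    ultimately show ?thesis
      unfolding \<Omega>_def by (metis M.M.a_comm M.M.a_lcomm M.M.a_inv_closed M.M.r_neg a_minus_def M.M.minus_closed)
  qed
  then have "linear_map R UL M (\<lambda>v. \<Omega> (eU v))"
    using linear_map_factors_through_cover[OF UL_module M, of \<Omega>] \<Omega> by simp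
  then have "\<Omega> (eU \<one>) = \<zero>\<^bsub>M\<^esub>" using triv by (auto simp: hom_trivial_def)
  moreover have "D (eU \<one>) = d \<one>" unfolding D_def by (rule P.lin_ext_basis[OF df U.one_closed])
  ultimately have 0: "(\<gamma> (eU \<one>) \<ominus>\<^bsub>M\<^esub> \<gamma>' (eU \<one>)) \<oplus>\<^bsub>M\<^esub> ?ev (d \<one>) = \<zero>\<^bsub>M\<^esub>"
    by (simp add: \<Omega>_def)
  note s1 = den_familyD(1)[OF s U.one_closed] and s1' = den_familyD(1)[OF s' U.one_closed]
  have "d \<one> = s \<one> \<ominus>\<^bsub>?P\<^esub> s' \<one>"
  proof (rule PF_u_ext[OF d(1)[OF U.one_closed]])
    fix x assume x: "x \<in> X"
    show "u (d \<one> x) = u ((s \<one> \<ominus>\<^bsub>?P\<^esub> s' \<one>) x)"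
      using d(2)[OF U.one_closed x] R.free_module_minus_apply(2)[OF s1 s1' x] free_module_closed[OF s1 x] free_module_closed[OF s1' x]
      by simp
  qed (use s1 s1' in simp)
  then have "?ev (d \<one>) = ?ev (s \<one>) \<ominus>\<^bsub>M\<^esub> ?ev (s' \<one>)"
    using linear_map_diff[OF P.left_module_axioms M ev s1 s1'] by simp
  then have "y \<ominus>\<^bsub>M\<^esub> y' = \<zero>\<^bsub>M\<^esub>"
    unfolding yy yy' using 0 linear_map_closed[OF \<gamma> eU_closed] linear_map_closed[OF \<gamma>' eU_closed]
      linear_map_closed[OF ev s1] linear_map_closed[OF ev s1'] by (simp add: M.M.sum_of_diffs)
  then show ?thesis
    using M.M.diff_eq_zero_iff formal_value_closed[OF M g y] formal_value_closed[OF M g y'] by blast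
qed

lemma formal_value_add:
  assumes M: "left_module R M" and g: "g \<in> X \<rightarrow> carrier M" and a: "a \<in> T.FS X" and b: "b \<in> T.FS X"
    and y: "formal_value M X g a y" and z: "formal_value M X g b z"
  shows "formal_value M X g (a \<oplus>\<^bsub>T.formal_module X\<^esub> b) (y \<oplus>\<^bsub>M\<^esub> z)"
proof -
  interpret M: left_module R M by fact
  let ?P = "free_module R X"
  let ?ev = "lin_ext R M X g"
  have ev: "linear_map R ?P M ?ev" by (rule M.lin_ext_linear[OF g])
  obtain s \<gamma> where s: "den_family X s a" and \<gamma>: "linear_map R P0 M \<gamma>"
    and \<gamma>K: "\<And>p. p \<in> carrier K0 \<Longrightarrow> \<gamma> p = ?ev (correction X s p)"
    and yy: "y = \<gamma> (eU \<one>) \<oplus>\<^bsub>M\<^esub> ?ev (s \<one>)"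
    using y by (auto simp: formal_value_def)
  obtain t \<delta> where t: "den_family X t b" and \<delta>: "linear_map R P0 M \<delta>"
    and \<delta>K: "\<And>p. p \<in> carrier K0 \<Longrightarrow> \<delta> p = ?ev (correction X t p)"
    and zz: "z = \<delta> (eU \<one>) \<oplus>\<^bsub>M\<^esub> ?ev (t \<one>)"
    using z by (auto simp: formal_value_def)
  let ?st = "\<lambda>v. s v \<oplus>\<^bsub>?P\<^esub> t v"
  let ?ab = "a \<oplus>\<^bsub>T.formal_module X\<^esub> b"
  have ab: "?ab \<in> T.FS X" by (rule T.formal_add_closed[OF a b])
  have st: "den_family X ?st ?ab"
    unfolding den_family_def
    by (intro ballI conjI R.free_module_add_closed T.formal_add_approximates a b den_in_gabriel
        den_familyD(1,2)[OF s] den_familyD(1,2)[OF t])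
  have "\<gamma> p \<oplus>\<^bsub>M\<^esub> \<delta> p = ?ev (correction X ?st p)" if p: "p \<in> carrier K0" for p
  proof -
    have pP: "p \<in> carrier P0" using p by (simp add: K0_iff)
    note cs = correction_props[OF a s p] and ct = correction_props[OF b t p] and cst = correction_props[OF ab st p]
    have "correction X ?st p = correction X s p \<oplus>\<^bsub>?P\<^esub> correction X t p"
    proof (rule PF_u_ext[OF cst(1)])
      show "correction X s p \<oplus>\<^bsub>?P\<^esub> correction X t p \<in> T.PF X" by (intro R.free_module_add_closed cs ct)
      fix x assume x: "x \<in> X"
      have c: "(\<lambda>v. v \<otimes> u (s v x)) \<in> carrier U \<rightarrow> carrier UL" "(\<lambda>v. v \<otimes> u (t v x)) \<in> carrier U \<rightarrow> carrier UL"
        using den_familyD(3)[OF s _ x] den_familyD(3)[OF t _ x] by auto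
      have "ulin (\<lambda>v. v \<otimes> u (?st v x)) p = ulin (\<lambda>v. v \<otimes> u (s v x) \<oplus>\<^bsub>UL\<^esub> v \<otimes> u (t v x)) p"
        by (rule left_module.lin_ext_cong[OF UL_module pP])
          (use x den_familyD(3)[OF s _ x] den_familyD(3)[OF t _ x] in \<open>auto simp: free_module_apply U.r_distr\<close>)
      also have "\<dots> = ulin (\<lambda>v. v \<otimes> u (s v x)) p \<oplus>\<^bsub>UL\<^esub> ulin (\<lambda>v. v \<otimes> u (t v x)) p"
        by (rule left_module.lin_ext_sum[OF UL_module c pP])
      finally have e: "ulin (\<lambda>v. v \<otimes> u (?st v x)) p = ulin (\<lambda>v. v \<otimes> u (s v x)) p \<oplus> ulin (\<lambda>v. v \<otimes> u (t v x)) p"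
        by simp
      have cc: "ulin (\<lambda>v. v \<otimes> u (s v x)) p \<in> carrier U" "ulin (\<lambda>v. v \<otimes> u (t v x)) p \<in> carrier U"
        using linear_map_closed[OF left_module.lin_ext_linear[OF UL_module c(1)] pP]
          linear_map_closed[OF left_module.lin_ext_linear[OF UL_module c(2)] pP] by auto
      show "u (correction X ?st p x) = u ((correction X s p \<oplus>\<^bsub>?P\<^esub> correction X t p) x)"
        using cs(2)[OF x] ct(2)[OF x] cst(2)[OF x] e cc x free_module_closed[OF cs(1) x] free_module_closed[OF ct(1) x]
        by (simp add: free_module_apply U.minus_add)
    qed
    then show ?thesis
      using \<gamma>K[OF p] \<delta>K[OF p] linear_map_add[OF ev cs(1) ct(1)] by simp
  qed
  moreover have "y \<oplus>\<^bsub>M\<^esub> z = (\<gamma> (eU \<one>) \<oplus>\<^bsub>M\<^esub> \<delta> (eU \<one>)) \<oplus>\<^bsub>M\<^esub> ?ev (?st \<one>)"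
    unfolding yy zz using linear_map_add[OF ev den_familyD(1)[OF s U.one_closed] den_familyD(1)[OF t U.one_closed]]
      linear_map_closed[OF \<gamma> eU_closed] linear_map_closed[OF \<delta> eU_closed]
      linear_map_closed[OF ev den_familyD(1)[OF s U.one_closed]] linear_map_closed[OF ev den_familyD(1)[OF t U.one_closed]]
    by (simp add: M.M.a_ac)
  ultimately show ?thesis
    unfolding formal_value_def
    by (intro exI[of _ ?st] exI[of _ "\<lambda>p. \<gamma> p \<oplus>\<^bsub>M\<^esub> \<delta> p"] conjI ballI st linear_map_sum[OF M \<gamma> \<delta>])
qed

text \<open>
  Since \<open>v (r a) = (v r) a\<close>, data \<open>(s, \<gamma>)\<close> for \<open>a\<close> yield data \<open>v \<mapsto> r s (v r)\<close> and
  \<open>v \<mapsto> \<gamma> (v r)\<close> for \<open>r a\<close>.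
\<close>

lemma formal_value_smult:
  assumes M: "left_module R M" and g: "g \<in> X \<rightarrow> carrier M" and a: "a \<in> T.FS X" and r: "r \<in> carrier R"
    and y: "formal_value M X g a y"
  shows "formal_value M X g (r \<odot>\<^bsub>T.formal_module X\<^esub> a) (r \<odot>\<^bsub>M\<^esub> y)"
proof -
  interpret M: left_module R M by fact
  let ?P = "free_module R X"
  interpret P: left_module R ?P by (rule R.free_module_left_module)
  interpret P0: left_module R P0 by (rule P0_module)
  let ?ev = "lin_ext R M X g"
  have ev: "linear_map R ?P M ?ev" by (rule M.lin_ext_linear[OF g])
  obtain s \<gamma> where s: "den_family X s a" and \<gamma>: "linear_map R P0 M \<gamma>"
    and \<gamma>K: "\<And>p. p \<in> carrier K0 \<Longrightarrow> \<gamma> p = ?ev (correction X s p)"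
    and yy: "y = \<gamma> (eU \<one>) \<oplus>\<^bsub>M\<^esub> ?ev (s \<one>)"
    using y by (auto simp: formal_value_def)
  let ?ra = "r \<odot>\<^bsub>T.formal_module X\<^esub> a"
  have ra: "?ra \<in> T.FS X" by (rule T.formal_smult_closed[OF r a])
  have vr: "v \<otimes> u r \<in> carrier U" if "v \<in> carrier U" for v using that r by simp
  have col: "ideal_colon R (den v) r = den (v \<otimes> u r)" if "v \<in> carrier U" for v
    using that r by (auto simp: ideal_colon_def colon_def U.m_assoc)
  let ?t = "\<lambda>v. r \<odot>\<^bsub>?P\<^esub> s (v \<otimes> u r)"
  have t: "den_family X ?t ?ra"
    unfolding den_family_def
  proof (intro ballI conjI)
    fix v assume v: "v \<in> carrier U"
    show "?t v \<in> T.PF X" by (intro R.free_module_smult_closed r den_familyD(1)[OF s vr[OF v]])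
    show "T.approximates (den v) X (?t v) ?ra"
      by (rule T.formal_smult_approximates[OF r a den_familyD(1)[OF s vr[OF v]] den_in_gabriel[OF v]])
        (use den_familyD(2)[OF s vr[OF v]] col[OF v] in simp)
  qed
  let ?\<psi> = "T.push_fin (carrier U) (carrier U) (\<lambda>v. v \<otimes> u r)"
  have \<psi>: "linear_map R P0 P0 ?\<psi>" by (rule T.push_fin_linear)
  have ulin_\<psi>: "ulin f (?\<psi> p) = ulin (\<lambda>v. f (v \<otimes> u r)) p"
    if p: "p \<in> carrier P0" and f: "\<And>v. v \<in> carrier U \<Longrightarrow> f v \<in> carrier U" for f p
  proof (rule left_module.linear_map_eq_lin_ext[OF UL_module linear_map_comp[OF \<psi> ulin_linear] _ p])
    fix v assume v: "v \<in> carrier U"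
    show "ulin f (?\<psi> (eU v)) = f (v \<otimes> u r)"
      using v vr[OF v] f by (simp add: T.push_fin_single left_module.lin_ext_basis[OF UL_module])
  qed (use f in simp)
  have \<psi>K: "?\<psi> p \<in> carrier K0" if p: "p \<in> carrier K0" for p
  proof -
    have pP: "p \<in> carrier P0" and p0: "ulin (\<lambda>v. v) p = \<zero>" using p by (auto simp: K0_iff)
    have "ulin (\<lambda>v. v) (?\<psi> p) = \<zero>"
      using ulin_\<psi>[OF pP, of "\<lambda>v. v"] ulin_rmult[OF pP, of "u r" "\<lambda>v. v"] r p0 by simp
    then show ?thesis using linear_map_closed[OF \<psi> pP] by (simp add: K0_iff)
  qed
  have "\<gamma> (?\<psi> p) = ?ev (correction X ?t p)" if p: "p \<in> carrier K0" for p
  proof -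
    have pP: "p \<in> carrier P0" using p by (simp add: K0_iff)
    have "correction X s (?\<psi> p) x = correction X ?t p x" if x: "x \<in> X" for x
    proof -
      have sR: "s v x \<in> carrier R" if "v \<in> carrier U" for v by (rule den_familyD(3)[OF s that x])
      have "ulin (\<lambda>v. v \<otimes> u (s v x)) (?\<psi> p) = ulin (\<lambda>v. (v \<otimes> u r) \<otimes> u (s (v \<otimes> u r) x)) p"
        by (rule ulin_\<psi>[OF pP]) (use sR in simp)
      also have "\<dots> = ulin (\<lambda>v. v \<otimes> u (?t v x)) p"
        by (rule left_module.lin_ext_cong[OF UL_module pP])
          (use sR r x in \<open>auto simp: free_module_apply U.m_assoc\<close>)
      finally show ?thesis using x by (simp add: correction_def)
    qed
    then have "correction X s (?\<psi> p) = correction X ?t p"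
      by (intro free_module_ext[OF correction_props(1)[OF a s \<psi>K[OF p]] correction_props(1)[OF ra t p]])
    then show ?thesis using \<gamma>K[OF \<psi>K[OF p]] by simp
  qed
  moreover have "r \<odot>\<^bsub>M\<^esub> y = \<gamma> (?\<psi> (eU \<one>)) \<oplus>\<^bsub>M\<^esub> ?ev (?t \<one>)"
  proof -
    have ur: "u r \<in> carrier U" using r by simp
    have \<psi>1: "?\<psi> (eU \<one>) = eU (u r)" using r by (simp add: T.push_fin_single)
    define k where "k = eU (u r) \<ominus>\<^bsub>P0\<^esub> r \<odot>\<^bsub>P0\<^esub> eU \<one>"
    have k: "k \<in> carrier K0"
      using syzygy_elements(2)[OF UL_module r, of "\<one>"] r by (simp add: k_def)
    note s1 = den_familyD(1)[OF s U.one_closed] and sr = den_familyD(1)[OF s ur]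
    have lin: "linear_map R P0 UL (ulin (\<lambda>v. v \<otimes> u (s v x)))" if "x \<in> X" for x
      by (rule ulin_linear) (use den_familyD(3)[OF s _ that] in simp)
    have "correction X s k = r \<odot>\<^bsub>?P\<^esub> s \<one> \<ominus>\<^bsub>?P\<^esub> r \<odot>\<^bsub>?P\<^esub> s (u r)"
    proof (rule PF_u_ext[OF correction_props(1)[OF a s k]])
      show "r \<odot>\<^bsub>?P\<^esub> s \<one> \<ominus>\<^bsub>?P\<^esub> r \<odot>\<^bsub>?P\<^esub> s (u r) \<in> T.PF X"
        using s1 sr r P.lsmult_closed by simp
      fix x assume x: "x \<in> X"
      have sR: "s v x \<in> carrier R" if "v \<in> carrier U" for v by (rule den_familyD(3)[OF s that x])
      have basis: "ulin (\<lambda>v. v \<otimes> u (s v x)) (eU v) = v \<otimes> u (s v x)" if "v \<in> carrier U" for v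
        by (rule left_module.lin_ext_basis[OF UL_module _ that]) (use sR in auto)
      have "ulin (\<lambda>v. v \<otimes> u (s v x)) k = u r \<otimes> u (s (u r) x) \<ominus> u r \<otimes> u (s \<one> x)"
        unfolding k_def
        using linear_map_diff[OF P0_module UL_module lin[OF x] eU_closed P0.lsmult_closed[OF r eU_closed]]
          linear_map_smult[OF lin[OF x] r eU_closed] basis ur sR[OF U.one_closed] by simp
      then have "u (correction X s k x) = \<ominus> (u r \<otimes> u (s (u r) x) \<ominus> u r \<otimes> u (s \<one> x))"
        using correction_props(2)[OF a s k x] by simp
      then show "u (correction X s k x) = u ((r \<odot>\<^bsub>?P\<^esub> s \<one> \<ominus>\<^bsub>?P\<^esub> r \<odot>\<^bsub>?P\<^esub> s (u r)) x)"
        using R.free_module_minus_apply(2)[OF R.free_module_smult_closed[OF r s1] R.free_module_smult_closed[OF r sr] x]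
          sR[OF U.one_closed] sR[OF ur] r x
        by (simp add: free_module_apply) (simp add: a_minus_def U.minus_add U.a_comm)
    qed
    then have "\<gamma> k = r \<odot>\<^bsub>M\<^esub> ?ev (s \<one>) \<ominus>\<^bsub>M\<^esub> r \<odot>\<^bsub>M\<^esub> ?ev (s (u r))"
      using \<gamma>K[OF k] linear_map_diff[OF P.left_module_axioms M ev P.lsmult_closed[OF r s1] P.lsmult_closed[OF r sr]]
        linear_map_smult[OF ev r s1] linear_map_smult[OF ev r sr] by simp
    moreover have "\<gamma> k = \<gamma> (eU (u r)) \<ominus>\<^bsub>M\<^esub> r \<odot>\<^bsub>M\<^esub> \<gamma> (eU \<one>)"
      unfolding k_def
      using linear_map_diff[OF P0_module M \<gamma> eU_closed P0.lsmult_closed[OF r eU_closed]] linear_map_smult[OF \<gamma> r eU_closed] by simp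
    ultimately have e: "\<gamma> (eU (u r)) \<ominus>\<^bsub>M\<^esub> r \<odot>\<^bsub>M\<^esub> \<gamma> (eU \<one>) = r \<odot>\<^bsub>M\<^esub> ?ev (s \<one>) \<ominus>\<^bsub>M\<^esub> r \<odot>\<^bsub>M\<^esub> ?ev (s (u r))" by simp
    define A where "A = \<gamma> (eU (u r))"
    define B where "B = r \<odot>\<^bsub>M\<^esub> \<gamma> (eU \<one>)"
    define C where "C = r \<odot>\<^bsub>M\<^esub> ?ev (s \<one>)"
    define E where "E = r \<odot>\<^bsub>M\<^esub> ?ev (s (u r))"
    have cl: "A \<in> carrier M" "B \<in> carrier M" "C \<in> carrier M" "E \<in> carrier M"
      using linear_map_closed[OF \<gamma> eU_closed] linear_map_closed[OF ev s1] linear_map_closed[OF ev sr] r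
      by (auto simp: A_def B_def C_def E_def M.lsmult_closed)
    have "A \<ominus>\<^bsub>M\<^esub> B = C \<ominus>\<^bsub>M\<^esub> E" using e by (simp add: A_def B_def C_def E_def)
    then have "(A \<ominus>\<^bsub>M\<^esub> B) \<oplus>\<^bsub>M\<^esub> (B \<oplus>\<^bsub>M\<^esub> E) = (C \<ominus>\<^bsub>M\<^esub> E) \<oplus>\<^bsub>M\<^esub> (E \<oplus>\<^bsub>M\<^esub> B)"
      using M.M.a_comm[OF cl(2,4)] by simp
    moreover have "(A \<ominus>\<^bsub>M\<^esub> B) \<oplus>\<^bsub>M\<^esub> (B \<oplus>\<^bsub>M\<^esub> E) = A \<oplus>\<^bsub>M\<^esub> E"
      "(C \<ominus>\<^bsub>M\<^esub> E) \<oplus>\<^bsub>M\<^esub> (E \<oplus>\<^bsub>M\<^esub> B) = C \<oplus>\<^bsub>M\<^esub> B"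
      using cl by (simp_all add: a_minus_def M.M.a_assoc M.M.r_neg1)
    ultimately have "A \<oplus>\<^bsub>M\<^esub> E = B \<oplus>\<^bsub>M\<^esub> C"
      using M.M.a_comm[OF cl(2,3)] by simp
    moreover have "r \<odot>\<^bsub>M\<^esub> y = B \<oplus>\<^bsub>M\<^esub> C"
      unfolding yy B_def C_def using linear_map_closed[OF \<gamma> eU_closed] linear_map_closed[OF ev s1] r by (simp add: M.lsmult_r_distr)
    moreover have "?ev (?t \<one>) = E" using linear_map_smult[OF ev r sr] r by (simp add: E_def)
    ultimately show ?thesis by (simp add: \<psi>1 A_def)
  qed
  ultimately show ?thesis
    unfolding formal_value_def
    by (intro exI[of _ ?t] exI[of _ "\<lambda>p. \<gamma> (?\<psi> p)"] conjI ballI t linear_map_comp[OF \<psi> \<gamma>])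
qed

lemma formal_value_basis:
  assumes M: "left_module R M" and g: "g \<in> X \<rightarrow> carrier M" and x0: "x0 \<in> X"
  shows "formal_value M X g (T.emb X (formal_single R X \<one>\<^bsub>R\<^esub> x0)) (g x0)"
proof -
  interpret M: left_module R M by fact
  let ?P = "free_module R X"
  interpret P: left_module R ?P by (rule R.free_module_left_module)
  let ?e = "formal_single R X \<one>\<^bsub>R\<^esub> x0"
  let ?ev = "lin_ext R M X g"
  have e: "?e \<in> T.PF X" by (simp add: R.formal_single_closed)
  have s: "den_family X (\<lambda>v. ?e) (T.emb X ?e)"
    unfolding den_family_def by (intro ballI conjI e T.emb_approximates[OF e] den_in_gabriel)
  have "?ev (correction X (\<lambda>v. ?e) p) = \<zero>\<^bsub>M\<^esub>" if p: "p \<in> carrier K0" for p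
  proof -
    have pP: "p \<in> carrier P0" and p0: "ulin (\<lambda>v. v) p = \<zero>" using p by (auto simp: K0_iff)
    have "correction X (\<lambda>v. ?e) p = \<zero>\<^bsub>?P\<^esub>"
    proof (rule free_module_ext[OF correction_props(1)[OF T.emb_closed[OF e] s p] P.M.zero_closed])
      fix x assume x: "x \<in> X"
      have "ulin (\<lambda>v. v \<otimes> u (?e x)) p = \<zero>"
        using ulin_rmult[OF pP, of "u (?e x)" "\<lambda>v. v"] free_module_closed[OF e x] p0 by simp
      then show "correction X (\<lambda>v. ?e) p x = \<zero>\<^bsub>?P\<^esub> x" using x by (simp add: correction_def free_module_apply)
    qed
    then show ?thesis using linear_map_zero[OF P.left_module_axioms M M.lin_ext_linear[OF g]] by simp
  qed
  moreover have "g x0 = \<zero>\<^bsub>M\<^esub> \<oplus>\<^bsub>M\<^esub> ?ev ?e"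
    using M.lin_ext_basis[OF g x0] Pi_mem[OF g x0] by simp
  ultimately show ?thesis
    unfolding formal_value_def
    by (intro exI[of _ "\<lambda>v. ?e"] exI[of _ "\<lambda>p. \<zero>\<^bsub>M\<^esub>"] conjI ballI s zero_linear_map[OF M]) auto
qed

lemma linear_extension_exists:
  assumes M: "left_module R M" and triv: "hom_trivial R UL M" and ext: "syzygy_maps_extend R UL M"
    and g: "g \<in> X \<rightarrow> carrier M"
  obtains \<Phi> where "linear_map R (T.formal_module X) M \<Phi>"
    "\<And>x. x \<in> X \<Longrightarrow> \<Phi> (T.emb X (formal_single R X \<one>\<^bsub>R\<^esub> x)) = g x"
proof -
  define \<Phi> where "\<Phi> a = (SOME y. formal_value M X g a y)" for a
  have \<Phi>: "formal_value M X g a (\<Phi> a)" if "a \<in> T.FS X" for a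
    unfolding \<Phi>_def using formal_value_exists[OF M ext g that] by (rule someI_ex)
  have eq: "\<Phi> a = y" if "a \<in> T.FS X" "formal_value M X g a y" for a y
    using formal_value_unique[OF M triv g that(1) \<Phi>[OF that(1)] that(2)] .
  show thesis
  proof (rule that)
    show "linear_map R (T.formal_module X) M \<Phi>"
    proof (rule linear_mapI)
      fix a assume "a \<in> carrier (T.formal_module X)"
      then show "\<Phi> a \<in> carrier M" using formal_value_closed[OF M g \<Phi>] by simp
    next
      fix a b assume "a \<in> carrier (T.formal_module X)" "b \<in> carrier (T.formal_module X)"
      then have "a \<in> T.FS X" "b \<in> T.FS X" by auto
      then show "\<Phi> (a \<oplus>\<^bsub>T.formal_module X\<^esub> b) = \<Phi> a \<oplus>\<^bsub>M\<^esub> \<Phi> b"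
        by (intro eq T.formal_add_closed formal_value_add[OF M g] \<Phi>)
    next
      fix r a assume "r \<in> carrier R" "a \<in> carrier (T.formal_module X)"
      then show "\<Phi> (r \<odot>\<^bsub>T.formal_module X\<^esub> a) = r \<odot>\<^bsub>M\<^esub> \<Phi> a"
        by (intro eq T.formal_smult_closed formal_value_smult[OF M g] \<Phi>) auto
    qed
    show "\<Phi> (T.emb X (formal_single R X \<one>\<^bsub>R\<^esub> x)) = g x" if "x \<in> X" for x
      by (intro eq T.emb_closed R.formal_single_closed formal_value_basis[OF M g that] R.one_closed)
  qed
qed

text \<open>
  The operation \<open>\<pi>\<close> is the linear extension of the identity map from finite formal sums to all
  formal sums over \<open>M\<close>.  The two sides of the associativity axiom are linear in a formal sum of
  formal sums and agree on the finite ones, hence coincide by uniqueness.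
\<close>

lemma perp_imp_contra:
  assumes M: "left_module R M" and triv: "hom_trivial R UL M" and ext: "syzygy_maps_extend R UL M"
  shows "M \<in> contra_modules R \<GG>"
proof -
  interpret M: left_module R M by fact
  let ?C = "carrier M"
  obtain \<pi> where \<pi>: "linear_map R (T.formal_module ?C) M \<pi>"
    and unit: "\<And>c. c \<in> ?C \<Longrightarrow> \<pi> (T.emb ?C (formal_single R ?C \<one>\<^bsub>R\<^esub> c)) = c"
    by (rule linear_extension_exists[OF M triv ext, of "\<lambda>c. c" ?C]) auto
  have \<pi>C: "\<pi> \<in> T.FS ?C \<rightarrow> ?C" using linear_map_closed[OF \<pi>] by auto
  have contra: "completion_contramodule R \<GG> ?C \<pi>"
    unfolding contramodule_def
  proof (intro conjI ballI \<pi>C)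
    fix c assume "c \<in> ?C"
    then show "\<pi> (formal_single T.S ?C \<one>\<^bsub>T.S\<^esub> c) = c"
      using unit by (simp add: T.emb_single T.cmap_one)
  next
    fix A assume A: "A \<in> T.FS (T.FS ?C)"
    let ?D = "T.FS ?C"
    have id: "(\<lambda>a. a) \<in> ?D \<rightarrow> ?D" by simp
    have L1: "linear_map R (T.formal_module ?D) M (\<lambda>A. \<pi> (open_parentheses T.S T.\<JJ> ?C A))"
      unfolding T.open_parentheses_eq_comp by (rule linear_map_comp[OF T.comp_linear[OF id] \<pi>])
    have L2: "linear_map R (T.formal_module ?D) M (\<lambda>A. \<pi> (T.push ?D ?C \<pi> A))"
      by (rule linear_map_comp[OF T.push_linear[OF \<pi>C] \<pi>])
    show "\<pi> (open_parentheses T.S T.\<JJ> ?C A) = \<pi> (T.push ?D ?C \<pi> A)"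
    proof (rule linear_extension_unique[OF M triv L1 L2 _ A])
      fix p assume p: "p \<in> T.PF ?D"
      show "\<pi> (open_parentheses T.S T.\<JJ> ?C (T.emb ?D p)) = \<pi> (T.push ?D ?C \<pi> (T.emb ?D p))"
      proof (rule R.linear_map_eq_on_basis[OF M linear_map_comp[OF T.emb_linear L1] linear_map_comp[OF T.emb_linear L2] _ p])
        fix a assume a: "a \<in> ?D"
        have "\<pi> a \<in> ?C" using \<pi>C a by auto
        then show "\<pi> (open_parentheses T.S T.\<JJ> ?C (T.emb ?D (formal_single R ?D \<one>\<^bsub>R\<^esub> a))) =
            \<pi> (T.push ?D ?C \<pi> (T.emb ?D (formal_single R ?D \<one>\<^bsub>R\<^esub> a)))"
          using a by (simp add: T.open_parentheses_eq_comp T.comp_single[OF id] T.push_emb[OF \<pi>C]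
              R.formal_single_closed T.push_fin_single unit)
      qed
    qed
  qed
  note simps = T.contra_forget_simps
  have e: "formal_single R ?C r c \<in> T.PF ?C" if "r \<in> carrier R" for r c by (rule R.formal_single_closed[OF that])
  have "linear_map R (contra_forget R \<GG> ?C \<pi>) M (\<lambda>c. c)"
  proof (rule linear_mapI)
    fix c d assume "c \<in> carrier (contra_forget R \<GG> ?C \<pi>)" "d \<in> carrier (contra_forget R \<GG> ?C \<pi>)"
    then show "c \<oplus>\<^bsub>contra_forget R \<GG> ?C \<pi>\<^esub> d = c \<oplus>\<^bsub>M\<^esub> d"
      using linear_map_add[OF linear_map_comp[OF T.emb_linear \<pi>] e e, of "\<one>\<^bsub>R\<^esub>" "\<one>\<^bsub>R\<^esub>" c d] unit
      by (simp add: simps)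
  next
    fix r c assume r: "r \<in> carrier R" and "c \<in> carrier (contra_forget R \<GG> ?C \<pi>)"
    then show "r \<odot>\<^bsub>contra_forget R \<GG> ?C \<pi>\<^esub> c = r \<odot>\<^bsub>M\<^esub> c"
      using linear_map_smult[OF linear_map_comp[OF T.emb_linear \<pi>] r e[OF R.one_closed], of c] unit
      by (simp add: simps R.formal_single_smult)
  qed (simp add: simps)
  then have "linear_map R (contra_forget R \<GG> ?C \<pi>) M (restrict (\<lambda>c. c) ?C)"
    by (rule linear_map_cong[OF _ _ T.contra_left_module[OF contra]]) (simp add: simps)
  then have "restrict (\<lambda>c. c) ?C \<in> mod_hom R (contra_forget R \<GG> ?C \<pi>) M"
    by (simp add: mod_hom_iff simps)
  moreover have "bij_betw (restrict (\<lambda>c. c) ?C) ?C ?C"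
    by (rule bij_betw_byWitness[of _ "\<lambda>c. c"]) auto
  ultimately show ?thesis
    unfolding contra_modules_def using M contra by blast
qed

end

section \<open>Expansions of fractions along a countable base\<close>

lemma (in right_topology) cmap_mult:
  assumes r: "r \<in> carrier R" and s: "s \<in> carrier R"
  shows "cmap (r \<otimes> s) = cmap r \<otimes>\<^bsub>S\<^esub> cmap s"
proof (rule completion_eqI)
  fix I assume I: "I \<in> G"
  have "r \<otimes> s \<in> (cmap r \<otimes>\<^bsub>S\<^esub> cmap s) I"
    by (rule completion_mult_mem(2)[OF cmap_closed[OF r] cmap_mem[OF r I] cmap_closed[OF s] cmap_mem[OF s G_colon[OF I r]] I])
  then show "\<exists>x. x \<in> cmap (r \<otimes> s) I \<and> x \<in> (cmap r \<otimes>\<^bsub>S\<^esub> cmap s) I"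
    using cmap_mem[OF m_closed[OF r s] I] by blast
qed (use r s in \<open>simp_all add: cmap_closed completion_mult_closed\<close>)

context flat_epi
begin

lemma cover_of_ideal_span:
  assumes I: "I \<in> \<GG>" and x: "x \<in> IU I"
  shows "\<exists>p \<in> carrier P0. (\<forall>v \<in> carrier U. p v \<in> I) \<and> ulin (\<lambda>v. v) p = x"
  using x
proof (induction rule: ideal_span.induct)
  case zero
  interpret P0: left_module R P0 by (rule P0_module)
  have "ulin (\<lambda>v. v) \<zero>\<^bsub>P0\<^esub> = \<zero>"
    using linear_map_zero[OF P0_module UL_module ulin_linear, of "\<lambda>v. v"] by simp
  then show ?case
    by (intro bexI[of _ "\<zero>\<^bsub>P0\<^esub>"] conjI ballI) (simp_all add: free_module_apply T.G_zero[OF I])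
next
  case (step x i w)
  obtain p where p: "p \<in> carrier P0" "\<forall>v \<in> carrier U. p v \<in> I" "ulin (\<lambda>v. v) p = x" using step.IH by blast
  have i: "i \<in> carrier R" using T.G_subset[OF I] step.hyps by blast
  let ?s = "formal_single R (carrier U) i w"
  have s: "?s \<in> carrier P0" by (rule R.formal_single_closed[OF i])
  have "ulin (\<lambda>v. v) (p \<oplus>\<^bsub>P0\<^esub> ?s) = x \<oplus> u i \<otimes> w"
    using linear_map_add[OF ulin_linear p(1) s, of "\<lambda>v. v"] p(3) step.hyps
      left_module.lin_ext_single[OF UL_module _ i, of "\<lambda>v. v" "carrier U" w] by simp
  moreover have "\<forall>v \<in> carrier U. (p \<oplus>\<^bsub>P0\<^esub> ?s) v \<in> I"
    using p(2) step.hyps T.G_add[OF I] T.G_zero[OF I] by (simp add: free_module_apply formal_single_def)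
  ultimately show ?case using R.free_module_add_closed[OF p(1) s] by blast
qed

lemma den_add: "v \<in> carrier U \<Longrightarrow> w \<in> carrier U \<Longrightarrow> den v \<inter> den w \<subseteq> den (v \<oplus> w)"
proof
  fix r assume vw: "v \<in> carrier U" "w \<in> carrier U" and "r \<in> den v \<inter> den w"
  then obtain a b where "r \<in> carrier R" "a \<in> carrier R" "b \<in> carrier R" "v \<otimes> u r = u a" "w \<otimes> u r = u b"
    by (auto simp: colon_def)
  then show "r \<in> den (v \<oplus> w)"
    using vw by (auto simp: colon_def U.l_distr intro!: image_eqI[of _ _ "a \<oplus>\<^bsub>R\<^esub> b"])
qed

lemma den_smult: "v \<in> carrier U \<Longrightarrow> r \<in> carrier R \<Longrightarrow> den v \<subseteq> den (u r \<otimes> v)"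
proof
  fix s assume vr: "v \<in> carrier U" "r \<in> carrier R" and "s \<in> den v"
  then obtain a where "s \<in> carrier R" "a \<in> carrier R" "v \<otimes> u s = u a"
    by (auto simp: colon_def)
  then show "s \<in> den (u r \<otimes> v)"
    using vr by (auto simp: colon_def U.m_assoc intro!: image_eqI[of _ _ "r \<otimes>\<^bsub>R\<^esub> a"])
qed

end

text \<open>
  A decreasing base \<open>J\<close> of the topology together with expressions \<open>1 = \<Sum> \<rho>\<^sub>n(w) w\<close> whose
  coefficients lie in \<open>J\<^sub>n\<close>, such that \<open>J\<^bsub>n+1\<^esub>\<close> consists of denominators of all the \<open>w\<close> that occur
  in \<open>\<rho>\<^sub>n\<close>.  A fraction \<open>v\<close> with \<open>v J\<^sub>n \<subseteq> R\<close> is then the combination \<open>v = \<Sum> (v \<rho>\<^sub>n(w)) w\<close> with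
  coefficients in \<open>R\<close>, which tend to zero as \<open>n\<close> grows; and each \<open>w\<close> occurring in it can in turn be
  expressed by \<open>\<rho>\<^bsub>n+1\<^esub>\<close>.
\<close>

locale fraction_chain = flat_epi R U u for R :: "'r ring" and U :: "'u ring" (structure) and u +
  fixes J :: "nat \<Rightarrow> 'r set" and \<rho> :: "nat \<Rightarrow> 'u \<Rightarrow> 'r"
  assumes J_gabriel: "J n \<in> \<GG>" and J_Suc: "J (Suc n) \<subseteq> J n"
    and J_cofinal: "K \<in> \<GG> \<Longrightarrow> \<exists>n. J n \<subseteq> K"
    and \<rho>_closed: "\<rho> n \<in> carrier P0" and \<rho>_mem: "w \<in> carrier U \<Longrightarrow> \<rho> n w \<in> J n"
    and \<rho>_cover: "ulin (\<lambda>v. v) (\<rho> n) = \<one>"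
    and \<rho>_den: "w \<in> carrier U \<Longrightarrow> \<rho> n w \<noteq> \<zero>\<^bsub>R\<^esub> \<Longrightarrow> J (Suc n) \<subseteq> den w"

text \<open>
  Given \<open>\<rho>\<^sub>n\<close>, take \<open>J\<^bsub>n+1\<^esub>\<close> inside \<open>J\<^sub>n\<close>, the next member of the base, and the finitely many
  denominator ideals in question; its membership in the topology provides \<open>\<rho>\<^bsub>n+1\<^esub>\<close>.
\<close>

lemma (in flat_epi) fraction_chain_exists:
  assumes "has_countable_base \<GG>"
  obtains J \<rho> where "fraction_chain R U u J \<rho>"
proof -
  obtain B where B: "B \<subseteq> \<GG>" "countable B" "\<And>K. K \<in> \<GG> \<Longrightarrow> \<exists>I \<in> B. I \<subseteq> K"
    using assms by (auto simp: has_countable_base_def)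
  then have "B \<noteq> {}" using carrier_in_gabriel by blast
  define b where "b = from_nat_into B"
  have rb: "range b = B" unfolding b_def by (rule range_from_nat_into[OF \<open>B \<noteq> {}\<close> B(2)])
  have b: "b n \<in> \<GG>" for n using rb B(1) by blast
  define ok where "ok n x \<longleftrightarrow> fst x \<in> \<GG> \<and> fst x \<subseteq> b n \<and> snd x \<in> carrier P0 \<and>
    (\<forall>w \<in> carrier U. snd x w \<in> fst x) \<and> ulin (\<lambda>v. v) (snd x) = \<one>" for n and x :: "'r set \<times> ('u \<Rightarrow> 'r)"
  define nxt where "nxt x y \<longleftrightarrow> fst y \<subseteq> fst x \<and> (\<forall>w \<in> carrier U. snd x w \<noteq> \<zero>\<^bsub>R\<^esub> \<longrightarrow> fst y \<subseteq> den w)"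
    for x y :: "'r set \<times> ('u \<Rightarrow> 'r)"
  have ex: "\<exists>p. ok n (I, p)" if "I \<in> \<GG>" "I \<subseteq> b n" for I n
    using cover_of_ideal_span[OF that(1), of "\<one>"] that by (auto simp: ok_def gabriel_iff)
  have "\<exists>f. \<forall>n. ok n (f n) \<and> nxt (f n) (f (Suc n))"
  proof (rule dependent_nat_choice[of ok "\<lambda>_. nxt"])
    show "\<exists>x. ok 0 x" using ex[OF b order_refl] by blast
  next
    fix x n assume x: "ok n x"
    then have xP: "snd x \<in> carrier P0" "fst x \<in> \<GG>" by (auto simp: ok_def)
    have F: "finite {w \<in> carrier U. snd x w \<noteq> \<zero>\<^bsub>R\<^esub>}" by (rule free_module_finite[OF xP(1)])
    obtain L where L: "L \<in> \<GG>" "\<And>w. w \<in> {w \<in> carrier U. snd x w \<noteq> \<zero>\<^bsub>R\<^esub>} \<Longrightarrow> L \<subseteq> den w"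
      using T.G_INT[OF F, of den] den_in_gabriel by auto
    let ?I = "L \<inter> fst x \<inter> b (Suc n)"
    have "?I \<in> \<GG>" by (intro gabriel_inter L(1) xP(2) b)
    then obtain p where "ok (Suc n) (?I, p)" using ex[of ?I "Suc n"] by blast
    moreover have "nxt x (?I, p)" using L(2) by (auto simp: nxt_def)
    ultimately show "\<exists>y. ok (Suc n) y \<and> nxt x y" by blast
  qed
  then obtain f where f: "\<And>n. ok n (f n)" "\<And>n. nxt (f n) (f (Suc n))" by blast
  have cof: "\<exists>n. fst (f n) \<subseteq> K" if K: "K \<in> \<GG>" for K
  proof -
    obtain I where "I \<in> B" "I \<subseteq> K" using B(3)[OF K] by blast
    then obtain n where "b n \<subseteq> K" using rb by auto
    then show ?thesis using f(1)[of n] by (auto simp: ok_def)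
  qed
  have "fraction_chain R U u (\<lambda>n. fst (f n)) (\<lambda>n. snd (f n))"
  proof (unfold_locales)
    show "\<exists>n. fst (f n) \<subseteq> K" if "K \<in> \<GG>" for K by (rule cof[OF that])
  qed (use f in \<open>auto simp: ok_def nxt_def\<close>)
  then show thesis by (rule that)
qed

context fraction_chain
begin

lemma J_antimono: "m \<le> n \<Longrightarrow> J n \<subseteq> J m"
  by (rule lift_Suc_antimono_le[of J]) (rule J_Suc)

lemma J_below: "K \<in> \<GG> \<Longrightarrow> \<exists>n. \<forall>k \<ge> n. J k \<subseteq> K"
  using J_cofinal J_antimono by (meson order_trans)

lemma J_den_ex:
  assumes "v \<in> carrier U" shows "\<exists>n. \<forall>k \<ge> n. J k \<subseteq> den v"
  by (rule J_below[OF den_in_gabriel[OF assms]])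

lemma \<rho>_R: "w \<in> carrier U \<Longrightarrow> \<rho> n w \<in> carrier R"
  by (rule free_module_closed[OF \<rho>_closed])

text \<open>
  The combination \<open>v \<rho>\<^sub>n\<close>, a preimage of \<open>v\<close> in the free module on \<open>U\<close>.
\<close>

definition lift :: "nat \<Rightarrow> 'u \<Rightarrow> ('u \<Rightarrow> 'r)" where
  "lift n v = (\<lambda>w \<in> carrier U. unu (v \<otimes> u (\<rho> n w)))"

lemma lift_u:
  assumes "v \<in> carrier U" "J n \<subseteq> den v" "w \<in> carrier U"
  shows "u (lift n v w) = v \<otimes> u (\<rho> n w)" "lift n v w \<in> carrier R"
proof -
  have "\<rho> n w \<in> den v" using \<rho>_mem[OF assms(3)] assms(2) by blast
  note c = colon_unu[OF carrier_in_gabriel this]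
  show "u (lift n v w) = v \<otimes> u (\<rho> n w)" "lift n v w \<in> carrier R" using c(2,3) assms(3) by (simp_all add: lift_def)
qed

lemma lift_zero: "v \<in> carrier U \<Longrightarrow> w \<in> carrier U \<Longrightarrow> \<rho> n w = \<zero>\<^bsub>R\<^esub> \<Longrightarrow> lift n v w = \<zero>\<^bsub>R\<^esub>"
  by (simp add: lift_def)

lemma lift_at_zero: "lift n \<zero> = \<zero>\<^bsub>P0\<^esub>"
  by (rule ext) (simp add: lift_def free_module_def \<rho>_R)

lemma lift_closed:
  assumes "v \<in> carrier U" "J n \<subseteq> den v" shows "lift n v \<in> carrier P0"
proof -
  have "finite {w \<in> carrier U. lift n v w \<noteq> \<zero>\<^bsub>R\<^esub>}"
    by (rule finite_subset[OF _ free_module_finite[OF \<rho>_closed[of n]]]) (use lift_zero[OF assms(1)] in blast)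
  then show ?thesis using lift_u(2)[OF assms] by (auto simp: free_module_carrier lift_def)
qed

lemma lift_cover:
  assumes v: "v \<in> carrier U" "J n \<subseteq> den v" shows "ulin (\<lambda>v. v) (lift n v) = v"
proof -
  let ?F = "{w \<in> carrier U. \<rho> n w \<noteq> \<zero>\<^bsub>R\<^esub>}"
  have F: "finite ?F" by (rule free_module_finite[OF \<rho>_closed])
  have "ulin (\<lambda>v. v) (lift n v) = finsum UL (\<lambda>w. lift n v w \<odot>\<^bsub>UL\<^esub> w) ?F"
    by (rule left_module.lin_ext_over[OF UL_module lift_closed[OF v] _ F]) (use lift_zero[OF v(1)] in auto)
  also have "\<dots> = finsum U (\<lambda>w. v \<otimes> (u (\<rho> n w) \<otimes> w)) ?F"
    by simp (rule U.finsum_cong', use v \<rho>_R in \<open>auto simp: lift_u[OF v] U.m_assoc\<close>)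
  also have "\<dots> = v \<otimes> finsum U (\<lambda>w. u (\<rho> n w) \<otimes> w) ?F"
    by (rule U.finsum_rdistr[symmetric]) (use F v \<rho>_R in auto)
  also have "finsum U (\<lambda>w. u (\<rho> n w) \<otimes> w) ?F = ulin (\<lambda>v. v) (\<rho> n)" by (simp add: lin_ext_def)
  finally show ?thesis using v by (simp add: \<rho>_cover)
qed

lemma lift_add:
  assumes v: "v \<in> carrier U" "J n \<subseteq> den v" and w: "w \<in> carrier U" "J n \<subseteq> den w"
  shows "J n \<subseteq> den (v \<oplus> w)" "lift n (v \<oplus> w) = lift n v \<oplus>\<^bsub>P0\<^esub> lift n w"
proof -
  show J: "J n \<subseteq> den (v \<oplus> w)" using v w den_add by blast
  have c: "v \<oplus> w \<in> carrier U" using v w by simp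
  show "lift n (v \<oplus> w) = lift n v \<oplus>\<^bsub>P0\<^esub> lift n w"
  proof (rule PF_u_ext[OF lift_closed[OF c J] R.free_module_add_closed[OF lift_closed[OF v] lift_closed[OF w]]])
    fix x assume x: "x \<in> carrier U"
    show "u (lift n (v \<oplus> w) x) = u ((lift n v \<oplus>\<^bsub>P0\<^esub> lift n w) x)"
      using x v w \<rho>_R by (simp add: free_module_apply lift_u[OF c J x] lift_u[OF v x] lift_u[OF w x] U.l_distr)
  qed
qed

lemma lift_smult:
  assumes v: "v \<in> carrier U" "J n \<subseteq> den v" and r: "r \<in> carrier R"
  shows "J n \<subseteq> den (u r \<otimes> v)" "lift n (u r \<otimes> v) = r \<odot>\<^bsub>P0\<^esub> lift n v"
proof -
  show J: "J n \<subseteq> den (u r \<otimes> v)" using v den_smult[OF _ r] by blast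
  have c: "u r \<otimes> v \<in> carrier U" using v r by simp
  show "lift n (u r \<otimes> v) = r \<odot>\<^bsub>P0\<^esub> lift n v"
  proof (rule PF_u_ext[OF lift_closed[OF c J] R.free_module_smult_closed[OF r lift_closed[OF v]]])
    fix x assume x: "x \<in> carrier U"
    show "u (lift n (u r \<otimes> v) x) = u ((r \<odot>\<^bsub>P0\<^esub> lift n v) x)"
      using x v r \<rho>_R by (simp add: free_module_apply lift_u[OF c J x] lift_u[OF v x] U.m_assoc)
  qed
qed

text \<open>
  The combination \<open>w \<rho>\<^bsub>n+1\<^esub>\<close> for \<open>w\<close> occurring in \<open>\<rho>\<^sub>n\<close>, and zero where its coefficients might
  not be in \<open>R\<close>.
\<close>

definition expand :: "nat \<Rightarrow> 'u \<Rightarrow> ('u \<Rightarrow> 'r)" where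
  "expand n w = (if J (Suc n) \<subseteq> den w then lift (Suc n) w else \<zero>\<^bsub>P0\<^esub>)"

lemma expand_closed: "w \<in> carrier U \<Longrightarrow> expand n w \<in> carrier P0"
proof -
  interpret P0: left_module R P0 by (rule P0_module)
  show "w \<in> carrier U \<Longrightarrow> expand n w \<in> carrier P0" by (simp add: expand_def lift_closed)
qed

lemma lift_support:
  assumes "v \<in> carrier U" "w \<in> carrier U" "lift n v w \<noteq> \<zero>\<^bsub>R\<^esub>" shows "J (Suc n) \<subseteq> den w"
  using \<rho>_den lift_zero assms by blast

text \<open>
  The coefficient at \<open>z\<close> is \<open>\<Sum> v \<rho>\<^sub>n(w) w \<rho>\<^bsub>n+1\<^esub>(z) = v \<rho>\<^bsub>n+1\<^esub>(z)\<close>, because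
  \<open>\<Sum> \<rho>\<^sub>n(w) w = 1\<close>.
\<close>

lemma expand_lift:
  assumes v: "v \<in> carrier U" "J n \<subseteq> den v"
  shows "lin_ext R P0 (carrier U) (expand n) (lift n v) = lift (Suc n) v"
proof -
  interpret P0: left_module R P0 by (rule P0_module)
  have v': "J (Suc n) \<subseteq> den v" using v J_Suc by blast
  have e: "expand n \<in> carrier U \<rightarrow> carrier P0" using expand_closed by blast
  note lc = lift_closed[OF v]
  show ?thesis
  proof (rule PF_u_ext[OF linear_map_closed[OF P0.lin_ext_linear[OF e] lc] lift_closed[OF v(1) v']])
    fix z assume z: "z \<in> carrier U"
    have c: "f z \<in> carrier R" if "f \<in> carrier P0" for f by (rule free_module_closed[OF that z])
    have "linear_map R P0 UL (\<lambda>f. u (f z))"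
      by (rule linear_mapI) (simp_all add: c z free_module_apply)
    then have "u (lin_ext R P0 (carrier U) (expand n) (lift n v) z) = ulin (\<lambda>w. u (expand n w z)) (lift n v)"
      by (rule P0.linear_map_lin_ext[OF UL_module _ e lc])
    also have "\<dots> = ulin (\<lambda>w. w \<otimes> u (\<rho> (Suc n) z)) (lift n v)"
    proof (rule left_module.lin_ext_cong[OF UL_module lc])
      show "(\<lambda>w. w \<otimes> u (\<rho> (Suc n) z)) \<in> carrier U \<rightarrow> carrier UL" using \<rho>_R[OF z] by simp
      fix w assume w: "w \<in> carrier U" "lift n v w \<noteq> \<zero>\<^bsub>R\<^esub>"
      have "J (Suc n) \<subseteq> den w" by (rule lift_support[OF v(1) w])
      then show "w \<otimes> u (\<rho> (Suc n) z) = u (expand n w z)"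
        using lift_u(1)[OF w(1) _ z] by (simp add: expand_def)
    qed
    also have "\<dots> = v \<otimes> u (\<rho> (Suc n) z)"
      using ulin_rmult[OF lc, of "u (\<rho> (Suc n) z)" "\<lambda>v. v"] \<rho>_R[OF z] lift_cover[OF v] by simp
    also have "\<dots> = u (lift (Suc n) v z)" using lift_u(1)[OF v(1) v' z] by simp
    finally show "u (lin_ext R P0 (carrier U) (expand n) (lift n v) z) = u (lift (Suc n) v z)" .
  qed
qed

subsection \<open>Infinite expansions\<close>

abbreviation Y :: "(nat \<times> 'u) set" where "Y \<equiv> UNIV \<times> carrier U"

abbreviation PY :: "('r, nat \<times> 'u \<Rightarrow> 'r) module" where "PY \<equiv> free_module R Y"

text \<open>
  Formal sums over a disjoint union \<open>Y\<close> of copies of \<open>U\<close>, one for every level: \<open>level n v\<close> is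
  \<open>v \<rho>\<^sub>n\<close> placed in the \<open>n\<close>-th copy, and \<open>tail_sum n v\<close> is the infinite sum of \<open>level k v\<close> over all
  \<open>k \<ge> n\<close>.
\<close>

definition level :: "nat \<Rightarrow> 'u \<Rightarrow> (nat \<times> 'u \<Rightarrow> 'r)" where
  "level n v = T.push_fin (carrier U) Y (\<lambda>w. (n, w)) (lift n v)"

definition tail :: "nat \<Rightarrow> 'u \<Rightarrow> (nat \<times> 'u \<Rightarrow> 'r)" where
  "tail n v = (\<lambda>y \<in> Y. if n \<le> fst y then lift (fst y) v (snd y) else \<zero>\<^bsub>R\<^esub>)"

definition tail_sum :: "nat \<Rightarrow> 'u \<Rightarrow> (nat \<times> 'u \<Rightarrow> 'r set \<Rightarrow> 'r set)" where
  "tail_sum n v = T.emb Y (tail n v)"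

lemma PY_module: "left_module R PY" by (rule R.free_module_left_module)

lemma level_closed:
  assumes "v \<in> carrier U" "J n \<subseteq> den v" shows "level n v \<in> carrier PY"
  unfolding level_def by (rule T.push_fin_closed[OF lift_closed[OF assms]])

lemma level_apply:
  assumes v: "v \<in> carrier U" "J n \<subseteq> den v" and w: "w \<in> carrier U"
  shows "level n v (k, w) = (if k = n then lift n v w else \<zero>\<^bsub>R\<^esub>)"
proof -
  have "level n v (k, w) = T.fsum {x \<in> carrier U. (n, x) = (k, w)} (lift n v)"
    unfolding level_def by (rule T.push_fin_apply[OF lift_closed[OF v]]) (use w in auto)
  also have "\<dots> = finsum R (lift n v) {x \<in> carrier U. (n, x) = (k, w)}"
    by (rule T.fsum_over) (use lift_u(2)[OF v] in \<open>auto intro: finite_subset[of _ "{w}"]\<close>)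
  also have "\<dots> = (if k = n then lift n v w else \<zero>\<^bsub>R\<^esub>)"
  proof (cases "k = n")
    case True
    then have "{x \<in> carrier U. (n, x) = (k, w)} = {w}" using w by auto
    then show ?thesis using lift_u(2)[OF v w] True
      by (simp add: R.finsum_insert[of "{}" w "lift n v"])
  qed auto
  finally show ?thesis .
qed

lemma lin_ext_level:
  assumes N: "left_module R N" and g: "g \<in> Y \<rightarrow> carrier N" and v: "v \<in> carrier U" "J n \<subseteq> den v"
  shows "lin_ext R N Y g (level n v) = lin_ext R N (carrier U) (\<lambda>w. g (n, w)) (lift n v)"
proof (rule left_module.linear_map_eq_lin_ext[OF N _ _ lift_closed[OF v], of "\<lambda>p. lin_ext R N Y g (T.push_fin (carrier U) Y (\<lambda>w. (n, w)) p)", folded level_def])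
  show "linear_map R P0 N (\<lambda>p. lin_ext R N Y g (T.push_fin (carrier U) Y (\<lambda>w. (n, w)) p))"
    by (rule linear_map_comp[OF T.push_fin_linear left_module.lin_ext_linear[OF N g]])
  fix w assume w: "w \<in> carrier U"
  then show "lin_ext R N Y g (T.push_fin (carrier U) Y (\<lambda>w. (n, w)) (eU w)) = g (n, w)"
    using left_module.lin_ext_basis[OF N g, of "(n, w)"] by (simp add: T.push_fin_single)
qed

lemma tail_R:
  assumes "v \<in> carrier U" "J n \<subseteq> den v" "y \<in> Y" shows "tail n v y \<in> carrier R"
proof -
  have "lift (fst y) v (snd y) \<in> carrier R" if "n \<le> fst y"
    by (rule lift_u(2)) (use assms J_antimono[OF that] in auto)
  then show ?thesis using assms(3) by (simp add: tail_def)
qed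

text \<open>
  As \<open>\<rho>\<^sub>k\<close> has coefficients in \<open>J\<^sub>k\<close>, those of \<open>v \<rho>\<^sub>k\<close> lie in \<open>K\<close> as soon as \<open>J\<^sub>k \<subseteq> (K : v)\<close>.
\<close>

lemma tail_small:
  assumes v: "v \<in> carrier U" "J n \<subseteq> den v" and K: "K \<in> \<GG>" and k: "J k \<subseteq> Colon K v" and y: "y \<in> Y" "k \<le> fst y"
  shows "tail n v y \<in> K"
proof -
  have "\<rho> (fst y) (snd y) \<in> Colon K v" using \<rho>_mem[of "snd y" "fst y"] y(1) J_antimono[OF y(2)] k by (auto dest!: subsetD)
  then have "unu (v \<otimes> u (\<rho> (fst y) (snd y))) \<in> K" by (rule colon_unu(2)[OF K])
  then show ?thesis using y(1) T.G_zero[OF K] by (auto simp: tail_def lift_def)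
qed

lemma tail_sum_closed:
  assumes v: "v \<in> carrier U" "J n \<subseteq> den v" shows "tail_sum n v \<in> T.FS Y"
  unfolding tail_sum_def
proof (rule T.emb_null_closed)
  show "tail n v \<in> Y \<rightarrow> carrier R" using tail_R[OF v] by blast
  fix K assume K: "K \<in> \<GG>"
  obtain k where k: "J k \<subseteq> Colon K v" using J_cofinal[OF colon_in_gabriel[OF K v(1)]] by blast
  show "finite {y \<in> Y. tail n v y \<notin> K}"
  proof (rule finite_subset)
    show "finite (\<Union>i < k. {i} \<times> {w \<in> carrier U. \<rho> i w \<noteq> \<zero>\<^bsub>R\<^esub>})"
      using free_module_finite[OF \<rho>_closed] by auto
    show "{y \<in> Y. tail n v y \<notin> K} \<subseteq> (\<Union>i < k. {i} \<times> {w \<in> carrier U. \<rho> i w \<noteq> \<zero>\<^bsub>R\<^esub>})"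
    proof
      fix y assume y: "y \<in> {y \<in> Y. tail n v y \<notin> K}"
      then have "\<not> k \<le> fst y" using tail_small[OF v K k] by blast
      moreover have "\<rho> (fst y) (snd y) \<noteq> \<zero>\<^bsub>R\<^esub>"
      proof
        assume "\<rho> (fst y) (snd y) = \<zero>\<^bsub>R\<^esub>"
        then have "tail n v y = \<zero>\<^bsub>R\<^esub>" using y lift_zero[OF v(1)] by (auto simp: tail_def)
        then show False using y T.G_zero[OF K] by simp
      qed
      ultimately show "y \<in> (\<Union>i < k. {i} \<times> {w \<in> carrier U. \<rho> i w \<noteq> \<zero>\<^bsub>R\<^esub>})" using y by force
    qed
  qed
qed

lemma tail_sum_add:
  assumes v: "v \<in> carrier U" "J n \<subseteq> den v" and w: "w \<in> carrier U" "J n \<subseteq> den w"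
  shows "tail_sum n (v \<oplus> w) = tail_sum n v \<oplus>\<^bsub>T.formal_module Y\<^esub> tail_sum n w"
proof -
  have "tail n (v \<oplus> w) y = tail n v y \<oplus>\<^bsub>R\<^esub> tail n w y" if y: "y \<in> Y" for y
  proof (cases "n \<le> fst y")
    case True
    have J: "J (fst y) \<subseteq> den v" "J (fst y) \<subseteq> den w" using J_antimono[OF True] v w by auto
    show ?thesis
      using lift_add(2)[OF v(1) J(1) w(1) J(2)] y True by (auto simp: tail_def free_module_apply)
  qed (use y in \<open>auto simp: tail_def\<close>)
  then show ?thesis
    using T.cmap_add[OF tail_R[OF v] tail_R[OF w]]
    unfolding tail_sum_def T.emb_def T.formal_module_def by (auto intro!: restrict_ext)
qed

lemma tail_sum_smult:
  assumes v: "v \<in> carrier U" "J n \<subseteq> den v" and r: "r \<in> carrier R"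
  shows "tail_sum n (u r \<otimes> v) = r \<odot>\<^bsub>T.formal_module Y\<^esub> tail_sum n v"
proof -
  have "tail n (u r \<otimes> v) y = r \<otimes>\<^bsub>R\<^esub> tail n v y" if y: "y \<in> Y" for y
  proof (cases "n \<le> fst y")
    case True
    have J: "J (fst y) \<subseteq> den v" using J_antimono[OF True] v by auto
    show ?thesis
      using lift_smult(2)[OF v(1) J r] y True by (auto simp: tail_def free_module_apply)
  qed (use y r in \<open>auto simp: tail_def\<close>)
  then show ?thesis
    using T.cmap_mult[OF r tail_R[OF v]]
    unfolding tail_sum_def T.emb_def T.formal_module_def by (auto intro!: restrict_ext)
qed

lemma tail_sum_step:
  assumes v: "v \<in> carrier U" "J n \<subseteq> den v"
  shows "tail_sum n v = T.emb Y (level n v) \<oplus>\<^bsub>T.formal_module Y\<^esub> tail_sum (Suc n) v"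
proof -
  have v': "J (Suc n) \<subseteq> den v" using v J_Suc by blast
  have eq: "tail n v y = level n v y \<oplus>\<^bsub>R\<^esub> tail (Suc n) v y" if y: "y \<in> Y" for y
  proof -
    obtain k w where kw: "y = (k, w)" "w \<in> carrier U" using y by auto
    have "lift k v w \<in> carrier R" if "n \<le> k"
      by (rule lift_u(2)) (use v kw J_antimono[OF that] in auto)
    then show ?thesis using kw by (auto simp: level_apply[OF v kw(2)] tail_def not_less_eq_eq)
  qed
  show ?thesis
    using eq T.cmap_add[OF free_module_closed[OF level_closed[OF v]] tail_R[OF v(1) v']]
    unfolding tail_sum_def T.emb_def T.formal_module_def by (auto intro!: restrict_ext)
qed

lemma tail_sum_at_zero: "tail_sum n \<zero> = T.emb Y \<zero>\<^bsub>PY\<^esub>"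
  unfolding tail_sum_def
  by (rule arg_cong[of _ _ "T.emb Y"], rule ext)
    (simp add: tail_def lift_at_zero, auto simp: free_module_def)

text \<open>
  The sum of the levels \<open>n, \<dots>, n + d - 1\<close> of \<open>v\<close>, by recursion on the number of levels so that
  expansion shifts it.
\<close>

fun truncation :: "nat \<Rightarrow> nat \<Rightarrow> 'u \<Rightarrow> (nat \<times> 'u \<Rightarrow> 'r)" where
  "truncation n 0 v = \<zero>\<^bsub>PY\<^esub>"
| "truncation n (Suc d) v = level n v \<oplus>\<^bsub>PY\<^esub> truncation (Suc n) d v"

lemma truncation_closed: "v \<in> carrier U \<Longrightarrow> J n \<subseteq> den v \<Longrightarrow> truncation n d v \<in> carrier PY"
proof (induction d arbitrary: n)
  case 0
  interpret PY: left_module R PY by (rule PY_module)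
  show ?case by simp
next
  case (Suc d)
  have "J (Suc n) \<subseteq> den v" using Suc.prems J_Suc by blast
  then show ?case using Suc.IH Suc.prems by (simp add: R.free_module_add_closed level_closed)
qed

lemma truncation_apply:
  "v \<in> carrier U \<Longrightarrow> J n \<subseteq> den v \<Longrightarrow> y \<in> Y \<Longrightarrow>
     truncation n d v y = (if fst y < n + d then tail n v y else \<zero>\<^bsub>R\<^esub>)"
proof (induction d arbitrary: n)
  case 0
  then show ?case by (auto simp: free_module_apply tail_def)
next
  case (Suc d)
  have J: "J (Suc n) \<subseteq> den v" using Suc.prems J_Suc by blast
  obtain k w where kw: "y = (k, w)" "w \<in> carrier U" using Suc.prems(3) by auto
  have "lift k v w \<in> carrier R" if "n \<le> k"
    by (rule lift_u(2)) (use Suc.prems kw J_antimono[OF that] in auto)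
  then show ?case
    using Suc.IH[OF Suc.prems(1) J Suc.prems(3)] kw
    by (cases "k = n") (auto simp: free_module_apply level_apply[OF Suc.prems(1,2) kw(2)] tail_def)
qed

lemma truncation_approximates:
  assumes v: "v \<in> carrier U" "J n \<subseteq> den v" and K: "K \<in> \<GG>" and d: "J (n + d) \<subseteq> Colon K v"
  shows "T.approximates K Y (truncation n d v) (tail_sum n v)"
  unfolding tail_sum_def
proof (rule T.emb_null_approximates[OF _ truncation_closed[OF v] K])
  show "tail n v \<in> Y \<rightarrow> carrier R" using tail_R[OF v] by blast
  fix y assume y: "y \<in> Y"
  show "truncation n d v y \<ominus>\<^bsub>R\<^esub> tail n v y \<in> K"
  proof (cases "fst y < n + d")
    case True
    then show ?thesis
      using truncation_apply[OF v y, of d] tail_R[OF v y] T.G_zero[OF K] by (simp add: a_minus_def R.r_neg)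
  next
    case False
    then have "tail n v y \<in> K" using tail_small[OF v K d y] by simp
    then have "\<zero>\<^bsub>R\<^esub> \<ominus>\<^bsub>R\<^esub> tail n v y \<in> K" by (rule T.G_diff[OF K T.G_zero[OF K]])
    then show ?thesis using truncation_apply[OF v y, of d] False by simp
  qed
qed

text \<open>
  Substitution of \<open>w \<rho>\<^bsub>k+1\<^esub>\<close>, placed in the next copy of \<open>U\<close>, for the element \<open>w\<close> of the \<open>k\<close>-th copy.
\<close>

definition expand_level :: "nat \<times> 'u \<Rightarrow> (nat \<times> 'u \<Rightarrow> 'r)" where
  "expand_level y = T.push_fin (carrier U) Y (\<lambda>z. (Suc (fst y), z)) (expand (fst y) (snd y))"

lemma expand_level_closed: "y \<in> Y \<Longrightarrow> expand_level y \<in> carrier PY"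
  unfolding expand_level_def by (rule T.push_fin_closed) (auto intro: expand_closed)

lemma expand_level_funcset: "expand_level \<in> Y \<rightarrow> carrier PY" using expand_level_closed by blast

lemma expand_level_level:
  assumes v: "v \<in> carrier U" "J n \<subseteq> den v"
  shows "lin_ext R PY Y expand_level (level n v) = level (Suc n) v"
proof -
  have e: "expand n \<in> carrier U \<rightarrow> carrier P0" using expand_closed by blast
  have "lin_ext R PY Y expand_level (level n v) = lin_ext R PY (carrier U) (\<lambda>w. expand_level (n, w)) (lift n v)"
    by (rule lin_ext_level[OF PY_module expand_level_funcset v])
  also have "\<dots> = T.push_fin (carrier U) Y (\<lambda>z. (Suc n, z)) (lin_ext R P0 (carrier U) (expand n) (lift n v))"
    by (subst left_module.linear_map_lin_ext[OF P0_module PY_module T.push_fin_linear e lift_closed[OF v]])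
      (simp add: expand_level_def)
  also have "\<dots> = level (Suc n) v" by (simp add: expand_lift[OF v] level_def)
  finally show ?thesis .
qed

lemma expand_truncation:
  "v \<in> carrier U \<Longrightarrow> J n \<subseteq> den v \<Longrightarrow>
     lin_ext R PY Y expand_level (truncation n d v) = truncation (Suc n) d v"
proof (induction d arbitrary: n)
  case 0
  show ?case
    using linear_map_zero[OF PY_module PY_module left_module.lin_ext_linear[OF PY_module expand_level_funcset]] by simp
next
  case (Suc d)
  have J: "J (Suc n) \<subseteq> den v" using Suc.prems J_Suc by blast
  show ?case
    using linear_map_add[OF left_module.lin_ext_linear[OF PY_module expand_level_funcset]
        level_closed[OF Suc.prems] truncation_closed[OF Suc.prems(1) J, of d]]
      Suc.IH[OF Suc.prems(1) J] expand_level_level[OF Suc.prems] by simp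
qed

text \<open>
  Expanding every term turns \<open>v \<rho>\<^sub>k\<close> into \<open>v \<rho>\<^bsub>k+1\<^esub>\<close>.  Truncations of both sides show that the
  infinite sums behave likewise.
\<close>

lemma tail_sum_shift:
  assumes v: "v \<in> carrier U" "J n \<subseteq> den v"
  shows "T.comp Y Y (tail_sum n v) (\<lambda>y. T.emb Y (expand_level y)) = tail_sum (Suc n) v"
proof -
  have v': "J (Suc n) \<subseteq> den v" using v J_Suc by blast
  have t: "(\<lambda>y. T.emb Y (expand_level y)) \<in> Y \<rightarrow> T.FS Y"
    using T.emb_closed[OF expand_level_closed] by blast
  show ?thesis
  proof (rule T.FS_eqI[OF T.comp_closed[OF tail_sum_closed[OF v] t] tail_sum_closed[OF v(1) v']])
    fix K assume K: "K \<in> \<GG>"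
    obtain d where d: "J d \<subseteq> Colon K v" using J_cofinal[OF colon_in_gabriel[OF K v(1)]] by blast
    have d1: "J (n + d) \<subseteq> Colon K v" and d2: "J (Suc n + d) \<subseteq> Colon K v"
      using d J_antimono[of d "n + d"] J_antimono[of d "Suc n + d"] by auto
    let ?P = "truncation n d v"
    have "T.approximates K Y (lin_ext R PY Y expand_level ?P) (T.comp Y Y (tail_sum n v) (\<lambda>y. T.emb Y (expand_level y)))"
    proof (rule T.comp_approximates[OF tail_sum_closed[OF v] t K truncation_closed[OF v]
          truncation_approximates[OF v K d1] expand_level_funcset])
      fix y assume y: "y \<in> Y"
      show "T.approximates (ideal_colon R K (?P y)) Y (expand_level y) (T.emb Y (expand_level y))"
        by (rule T.emb_approximates[OF expand_level_closed[OF y] T.G_colon[OF K]])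
          (rule free_module_closed[OF truncation_closed[OF v] y])
    qed
    then show "\<exists>p. T.approximates K Y p (T.comp Y Y (tail_sum n v) (\<lambda>y. T.emb Y (expand_level y))) \<and>
        T.approximates K Y p (tail_sum (Suc n) v)"
      unfolding expand_truncation[OF v]
      using truncation_approximates[OF v(1) v' K d2] by blast
  qed
qed

end

section \<open>Contramodules are perpendicular to \<open>U\<close>\<close>

lemma (in right_topology) contra_sum_cong:
  assumes "\<And>x. x \<in> X \<Longrightarrow> g x = h x"
  shows "contra_sum C \<pi> X g a = contra_sum C \<pi> X h a"
proof -
  have "{x \<in> X. g x = c} = {x \<in> X. h x = c}" for c using assms by auto
  then show ?thesis by (simp add: contra_sum_def formal_push_def)
qed

lemma left_module_smult_diff:
  assumes M: "left_module R M" and r: "r \<in> carrier R" and x: "x \<in> carrier M" and y: "y \<in> carrier M"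
  shows "r \<odot>\<^bsub>M\<^esub> (x \<ominus>\<^bsub>M\<^esub> y) = r \<odot>\<^bsub>M\<^esub> x \<ominus>\<^bsub>M\<^esub> r \<odot>\<^bsub>M\<^esub> y"
proof -
  interpret M: left_module R M by (rule M)
  have d: "x \<ominus>\<^bsub>M\<^esub> y \<in> carrier M" by (rule M.M.minus_closed[OF x y])
  have "y \<oplus>\<^bsub>M\<^esub> (x \<ominus>\<^bsub>M\<^esub> y) = (x \<ominus>\<^bsub>M\<^esub> y) \<oplus>\<^bsub>M\<^esub> y" by (rule M.M.a_comm[OF y d])
  also have "\<dots> = x" using x y by (simp add: a_minus_def M.M.a_assoc M.M.l_neg)
  finally have "r \<odot>\<^bsub>M\<^esub> x = r \<odot>\<^bsub>M\<^esub> y \<oplus>\<^bsub>M\<^esub> r \<odot>\<^bsub>M\<^esub> (x \<ominus>\<^bsub>M\<^esub> y)"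
    using M.lsmult_r_distr[OF r y d] by simp
  then show ?thesis using M.M.add_diff_left[OF M.lsmult_closed[OF r y] M.lsmult_closed[OF r d]] by simp
qed

context fraction_chain
begin

text \<open>
  Let \<open>h\<close> be a linear map from \<open>U\<close> to \<open>C\<close> and let \<open>H\<^sub>n\<close> be the sum in \<open>C\<close> of the terms
  \<open>(v \<rho>\<^sub>k(w)) h(w)\<close> over all \<open>k \<ge> n\<close> and all \<open>w\<close>.  The terms with \<open>k = n\<close> add up to \<open>h v\<close>, so
  \<open>H\<^sub>n = h v + H\<^bsub>n+1\<^esub>\<close>.  On the other hand, \<open>h w\<close> is the value of \<open>h\<close> on the expansion of \<open>w\<close>, and
  expanding every \<open>w\<close> turns \<open>H\<^sub>n\<close> into \<open>H\<^bsub>n+1\<^esub>\<close>.  Hence \<open>h v = 0\<close>.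
\<close>

lemma contra_hom_trivial:
  assumes contra: "completion_contramodule R \<GG> C \<pi>"
  shows "hom_trivial R UL (contra_forget R \<GG> C \<pi>)"
  unfolding hom_trivial_def
proof (intro allI impI ballI)
  let ?N = "contra_forget R \<GG> C \<pi>"
  fix h v assume h: "linear_map R UL ?N h" and "v \<in> carrier UL"
  then have v: "v \<in> carrier U" by simp
  have N: "left_module R ?N" by (rule T.contra_left_module[OF contra])
  interpret N: left_module R ?N by (rule N)
  have C: "carrier ?N = C" by (simp add: T.contra_forget_simps)
  have hC: "h \<in> carrier U \<rightarrow> carrier ?N" using linear_map_closed[OF h] by auto
  \<comment> \<open>The zero makes \<open>g\<close> equal to its expansion also where \<open>expand\<close> is zero.\<close>
  define g where "g y = (if J (Suc (fst y)) \<subseteq> den (snd y) then h (snd y) else \<zero>\<^bsub>?N\<^esub>)" for y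
  have gN: "g \<in> Y \<rightarrow> carrier ?N" using Pi_mem[OF hC] by (auto simp: g_def)
  then have gC: "g \<in> Y \<rightarrow> C" by (simp only: C)
  let ?S = "T.contra_sum C \<pi> Y"
  have lin: "linear_map R (T.formal_module Y) ?N (?S g)" by (rule T.contra_sum_linear[OF contra gC])
  have level_value: "lin_ext R ?N Y g (level n w) = h w" if w: "w \<in> carrier U" "J n \<subseteq> den w" for n w
  proof -
    have "lin_ext R ?N Y g (level n w) = lin_ext R ?N (carrier U) (\<lambda>z. g (n, z)) (lift n w)"
      by (rule lin_ext_level[OF N gN w])
    also have "\<dots> = lin_ext R ?N (carrier U) h (lift n w)"
      by (rule N.lin_ext_cong[OF lift_closed[OF w] hC]) (simp add: g_def lift_support[OF w(1)])
    also have "\<dots> = h (ulin (\<lambda>z. z) (lift n w))"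
      using left_module.linear_map_lin_ext[OF UL_module N h _ lift_closed[OF w], of "\<lambda>z. z"] by simp
    finally show ?thesis by (simp add: lift_cover[OF w])
  qed
  have g_expand: "?S g (T.emb Y (expand_level y)) = g y" if y: "y \<in> Y" for y
  proof -
    obtain k w where kw: "y = (k, w)" "w \<in> carrier U" using y by auto
    have "?S g (T.emb Y (expand_level y)) = lin_ext R ?N Y g (expand_level y)"
      by (rule T.contra_sum_finite[OF contra gC expand_level_closed[OF y]])
    also have "\<dots> = g y"
    proof (cases "J (Suc k) \<subseteq> den w")
      case True
      then have "expand_level y = level (Suc k) w" by (simp add: expand_level_def kw expand_def level_def)
      then show ?thesis using level_value[OF kw(2) True] True by (simp add: g_def kw)
    next
      case False
      then have "expand_level y = \<zero>\<^bsub>PY\<^esub>"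
        using linear_map_zero[OF P0_module PY_module T.push_fin_linear]
        by (simp add: expand_level_def kw expand_def)
      then show ?thesis
        using False linear_map_zero[OF PY_module N N.lin_ext_linear[OF gN]] by (simp add: g_def kw)
    qed
    finally show ?thesis .
  qed
  obtain n where n: "J n \<subseteq> den v" using J_den_ex[OF v] by blast
  then have n': "J (Suc n) \<subseteq> den v" using J_Suc by blast
  have "?S g (tail_sum n v) = ?S (\<lambda>y. ?S g (T.emb Y (expand_level y))) (tail_sum n v)"
    by (rule T.contra_sum_cong) (simp add: g_expand)
  also have "\<dots> = ?S g (T.comp Y Y (tail_sum n v) (\<lambda>y. T.emb Y (expand_level y)))"
    by (rule T.contra_sum_assoc[OF contra tail_sum_closed[OF v n] _ gC])
      (use T.emb_closed[OF expand_level_closed] in blast)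
  also have "\<dots> = ?S g (tail_sum (Suc n) v)" by (simp only: tail_sum_shift[OF v n])
  finally have shift: "?S g (tail_sum n v) = ?S g (tail_sum (Suc n) v)" .
  have "?S g (tail_sum n v) = ?S g (T.emb Y (level n v)) \<oplus>\<^bsub>?N\<^esub> ?S g (tail_sum (Suc n) v)"
    unfolding tail_sum_step[OF v n]
    by (rule linear_map_add[OF lin]) (simp_all add: T.emb_closed[OF level_closed[OF v n]] tail_sum_closed[OF v n'])
  also have "?S g (T.emb Y (level n v)) = h v"
    using T.contra_sum_finite[OF contra gC level_closed[OF v n]] level_value[OF v n] by simp
  finally have e: "?S g (tail_sum (Suc n) v) = h v \<oplus>\<^bsub>?N\<^esub> ?S g (tail_sum (Suc n) v)"
    by (rule trans[OF shift[symmetric]])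
  have s: "?S g (tail_sum (Suc n) v) \<in> carrier ?N"
    using linear_map_closed[OF lin] tail_sum_closed[OF v n'] by simp
  have hv: "h v \<in> carrier ?N" using Pi_mem[OF hC v] .
  have "?S g (tail_sum (Suc n) v) \<oplus>\<^bsub>?N\<^esub> h v = ?S g (tail_sum (Suc n) v)"
    by (rule trans[OF N.M.a_comm[OF s hv] e[symmetric]])
  from N.M.add_diff_left[OF s hv, unfolded this]
  show "h v = \<zero>\<^bsub>?N\<^esub>" using N.M.diff_eq_zero_iff[OF s s] by simp
qed

lemma K0_P0: "linear_map R K0 P0 (\<lambda>p. p)"
  by (rule linear_mapI) (simp_all add: K0_iff syzygy_simps)

text \<open>
  Let \<open>\<phi>\<close> be a linear map from the syzygy of \<open>U\<close> to \<open>C\<close>, and let \<open>v\<close> be the image in \<open>U\<close> of the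
  element \<open>p\<close> of the free module.  The telescoping series suggests the extension
  \<open>p \<mapsto> \<phi>(p - v \<rho>\<^sub>n) + \<Sum> \<phi>(v \<rho>\<^sub>k - v \<rho>\<^bsub>k+1\<^esub>)\<close>, with the sum over \<open>k \<ge> n\<close>.  It makes sense in \<open>C\<close>,
  since its \<open>k\<close>-th term is \<open>\<Sum> (v \<rho>\<^sub>k(w)) \<phi>(w - w \<rho>\<^bsub>k+1\<^esub>)\<close>, with coefficients tending to zero.  It
  does not depend on \<open>n\<close>, so that two elements can be compared for a common \<open>n\<close>, and it is equal to
  \<open>\<phi> p\<close> for \<open>v = 0\<close>.
\<close>

lemma contra_syzygy_maps_extend:
  assumes contra: "completion_contramodule R \<GG> C \<pi>"
  shows "syzygy_maps_extend R UL (contra_forget R \<GG> C \<pi>)"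
  unfolding syzygy_maps_extend_def
proof (intro allI impI)
  let ?N = "contra_forget R \<GG> C \<pi>"
  fix \<phi> assume \<phi>: "linear_map R K0 ?N \<phi>"
  have N: "left_module R ?N" by (rule T.contra_left_module[OF contra])
  interpret N: left_module R ?N by (rule N)
  interpret P0: left_module R P0 by (rule P0_module)
  interpret K0: left_module R K0 by (rule K0_module)
  have C: "carrier ?N = C" by (simp add: T.contra_forget_simps)
  let ?cov = "ulin (\<lambda>v. v)"
  have cov: "linear_map R P0 UL ?cov" by (rule ulin_linear)
  have covU: "?cov p \<in> carrier U" if "p \<in> carrier P0" for p using linear_map_closed[OF cov that] by simp
  have in_K0: "p \<ominus>\<^bsub>P0\<^esub> q \<in> carrier K0" if "p \<in> carrier P0" "q \<in> carrier P0" "?cov p = ?cov q" for p q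
    using that linear_map_diff[OF P0_module UL_module cov that(1,2)] covU[OF that(2)]
    by (simp add: K0_iff U.r_neg a_minus_def)
  have cov_e: "?cov (eU w) = w" if "w \<in> carrier U" for w
    by (rule left_module.lin_ext_basis[OF UL_module _ that]) simp
  define q where "q y = (if J (Suc (fst y)) \<subseteq> den (snd y) then eU (snd y) \<ominus>\<^bsub>P0\<^esub> lift (Suc (fst y)) (snd y) else \<zero>\<^bsub>P0\<^esub>)" for y
  have zK: "\<zero>\<^bsub>P0\<^esub> \<in> carrier K0" using K0.M.zero_closed by (simp add: syzygy_simps)
  have qK: "q y \<in> carrier K0" if y: "y \<in> Y" for y
    using in_K0[OF eU_closed lift_closed, of "snd y" "Suc (fst y)"] y zK by (auto simp: q_def cov_e lift_cover)
  define g where "g y = \<phi> (q y)" for y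
  have gN: "g \<in> Y \<rightarrow> carrier ?N" using linear_map_closed[OF \<phi> qK] unfolding g_def by blast
  then have gC: "g \<in> Y \<rightarrow> C" by (simp only: C)
  let ?\<Phi> = "T.contra_sum C \<pi> Y g"
  have lin: "linear_map R (T.formal_module Y) ?N ?\<Phi>" by (rule T.contra_sum_linear[OF contra gC])
  have \<Phi>N: "?\<Phi> a \<in> carrier ?N" if "a \<in> T.FS Y" for a using linear_map_closed[OF lin] that by simp
  have diff_K: "lift n v \<ominus>\<^bsub>P0\<^esub> lift (Suc n) v \<in> carrier K0"
    and level_value: "?\<Phi> (T.emb Y (level n v)) = \<phi> (lift n v \<ominus>\<^bsub>P0\<^esub> lift (Suc n) v)"
    if v: "v \<in> carrier U" "J n \<subseteq> den v" for n v
  proof -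
    have v': "J (Suc n) \<subseteq> den v" using v J_Suc by blast
    show "lift n v \<ominus>\<^bsub>P0\<^esub> lift (Suc n) v \<in> carrier K0"
      using in_K0[OF lift_closed[OF v] lift_closed[OF v(1) v']] lift_cover[OF v] lift_cover[OF v(1) v'] by simp
    let ?p = "lift n v"
    note p = lift_closed[OF v]
    have e: "eU \<in> carrier U \<rightarrow> carrier P0" and ex: "expand n \<in> carrier U \<rightarrow> carrier P0"
      using eU_closed expand_closed by blast+
    have qn: "(\<lambda>w. q (n, w)) \<in> carrier U \<rightarrow> carrier K0" using qK by auto
    have dn: "(\<lambda>w. eU w \<ominus>\<^bsub>P0\<^esub> expand n w) \<in> carrier U \<rightarrow> carrier P0"
      using eU_closed expand_closed by simp
    have id: "lin_ext R P0 (carrier U) eU ?p = ?p"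
      by (rule P0.linear_map_eq_lin_ext[where f = "\<lambda>p. p", OF _ _ p, symmetric]) (simp_all add: linear_map_def)
    have "lin_ext R K0 (carrier U) (\<lambda>w. q (n, w)) ?p = lin_ext R P0 (carrier U) (\<lambda>w. q (n, w)) ?p"
      by (rule K0.linear_map_lin_ext[OF P0_module K0_P0 qn p])
    also have "\<dots> = lin_ext R P0 (carrier U) (\<lambda>w. eU w \<ominus>\<^bsub>P0\<^esub> expand n w) ?p"
      by (rule P0.lin_ext_cong[OF p dn]) (simp add: q_def expand_def lift_support[OF v(1)])
    also have "\<dots> = ?p \<ominus>\<^bsub>P0\<^esub> lift (Suc n) v"
      unfolding P0.lin_ext_diff[OF e ex p] expand_lift[OF v] id ..
    finally have comb: "lin_ext R K0 (carrier U) (\<lambda>w. q (n, w)) ?p = ?p \<ominus>\<^bsub>P0\<^esub> lift (Suc n) v" .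
    have "?\<Phi> (T.emb Y (level n v)) = lin_ext R ?N Y g (level n v)"
      by (rule T.contra_sum_finite[OF contra gC level_closed[OF v]])
    also have "\<dots> = lin_ext R ?N (carrier U) (\<lambda>w. \<phi> (q (n, w))) ?p"
      using lin_ext_level[OF N gN v] by (simp add: g_def)
    also have "\<dots> = \<phi> (lin_ext R K0 (carrier U) (\<lambda>w. q (n, w)) ?p)"
      by (rule K0.linear_map_lin_ext[OF N \<phi> qn p, symmetric])
    finally show "?\<Phi> (T.emb Y (level n v)) = \<phi> (?p \<ominus>\<^bsub>P0\<^esub> lift (Suc n) v)" by (simp only: comb)
  qed
  define G where "G n p = \<phi> (p \<ominus>\<^bsub>P0\<^esub> lift n (?cov p)) \<oplus>\<^bsub>?N\<^esub> ?\<Phi> (tail_sum n (?cov p))" for n p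
  have rest_K: "p \<ominus>\<^bsub>P0\<^esub> lift n (?cov p) \<in> carrier K0" if p: "p \<in> carrier P0" "J n \<subseteq> den (?cov p)" for n p
    using in_K0[OF p(1) lift_closed[OF covU[OF p(1)] p(2)]] lift_cover[OF covU[OF p(1)] p(2)] by simp
  have G_Suc: "G n p = G (Suc n) p" if p: "p \<in> carrier P0" "J n \<subseteq> den (?cov p)" for n p
  proof -
    let ?v = "?cov p"
    have v: "?v \<in> carrier U" by (rule covU[OF p(1)])
    have J': "J (Suc n) \<subseteq> den ?v" using p(2) J_Suc by blast
    note l = lift_closed[OF v p(2)] and l' = lift_closed[OF v J']
    note a = rest_K[OF p] and b = diff_K[OF v p(2)]
    have ts: "tail_sum (Suc n) ?v \<in> T.FS Y" by (rule tail_sum_closed[OF v J'])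
    have sum: "(p \<ominus>\<^bsub>P0\<^esub> lift n ?v) \<oplus>\<^bsub>P0\<^esub> (lift n ?v \<ominus>\<^bsub>P0\<^esub> lift (Suc n) ?v) = p \<ominus>\<^bsub>P0\<^esub> lift (Suc n) ?v"
      using p(1) l l' by (simp add: a_minus_def P0.M.a_assoc P0.M.r_neg1)
    have "?\<Phi> (tail_sum n ?v) = ?\<Phi> (T.emb Y (level n ?v)) \<oplus>\<^bsub>?N\<^esub> ?\<Phi> (tail_sum (Suc n) ?v)"
      unfolding tail_sum_step[OF v p(2)]
      by (rule linear_map_add[OF lin]) (simp_all add: T.emb_closed[OF level_closed[OF v p(2)]] ts)
    then have "G n p = \<phi> (p \<ominus>\<^bsub>P0\<^esub> lift n ?v) \<oplus>\<^bsub>?N\<^esub> (\<phi> (lift n ?v \<ominus>\<^bsub>P0\<^esub> lift (Suc n) ?v) \<oplus>\<^bsub>?N\<^esub> ?\<Phi> (tail_sum (Suc n) ?v))"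
      by (simp add: G_def level_value[OF v p(2)])
    also have "\<dots> = (\<phi> (p \<ominus>\<^bsub>P0\<^esub> lift n ?v) \<oplus>\<^bsub>?N\<^esub> \<phi> (lift n ?v \<ominus>\<^bsub>P0\<^esub> lift (Suc n) ?v)) \<oplus>\<^bsub>?N\<^esub> ?\<Phi> (tail_sum (Suc n) ?v)"
      by (rule N.M.a_assoc[symmetric, OF linear_map_closed[OF \<phi> a] linear_map_closed[OF \<phi> b] \<Phi>N[OF ts]])
    also have "\<phi> (p \<ominus>\<^bsub>P0\<^esub> lift n ?v) \<oplus>\<^bsub>?N\<^esub> \<phi> (lift n ?v \<ominus>\<^bsub>P0\<^esub> lift (Suc n) ?v) = \<phi> (p \<ominus>\<^bsub>P0\<^esub> lift (Suc n) ?v)"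
      using linear_map_add[OF \<phi> a b] sum by (simp add: syzygy_simps)
    finally show ?thesis by (simp add: G_def)
  qed
  have G_const: "G (n + d) p = G n p" if p: "p \<in> carrier P0" "J n \<subseteq> den (?cov p)" for n d p
  proof (induction d)
    case (Suc d)
    have "J (n + d) \<subseteq> den (?cov p)" using p(2) J_antimono[of n "n + d"] by auto
    then show ?case using G_Suc[OF p(1)] Suc by simp
  qed simp
  define g where "g p = G (SOME n. J n \<subseteq> den (?cov p)) p" for p
  have gG: "g p = G n p" if p: "p \<in> carrier P0" "J n \<subseteq> den (?cov p)" for n p
  proof -
    let ?m = "SOME n. J n \<subseteq> den (?cov p)"
    have m: "J ?m \<subseteq> den (?cov p)" by (rule someI[of "\<lambda>n. J n \<subseteq> den (?cov p)", OF p(2)])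
    have "G n p = G (n + ?m) p" by (rule G_const[OF p, symmetric])
    also have "\<dots> = G ?m p" using G_const[OF p(1) m, of n] by (simp add: add.commute)
    finally show ?thesis by (simp add: g_def)
  qed
  have glin: "linear_map R P0 ?N g"
  proof (rule linear_mapI)
    fix p assume p: "p \<in> carrier P0"
    obtain n where n: "J n \<subseteq> den (?cov p)" using J_den_ex[OF covU[OF p]] by blast
    show "g p \<in> carrier ?N"
      unfolding gG[OF p n] G_def
      by (intro N.M.a_closed linear_map_closed[OF \<phi> rest_K[OF p n]] \<Phi>N tail_sum_closed[OF covU[OF p] n])
  next
    fix p p' assume p: "p \<in> carrier P0" and p': "p' \<in> carrier P0"
    obtain n1 where n1: "\<forall>k \<ge> n1. J k \<subseteq> den (?cov p)" using J_den_ex[OF covU[OF p]] by blast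
    obtain n2 where n2: "\<forall>k \<ge> n2. J k \<subseteq> den (?cov p')" using J_den_ex[OF covU[OF p']] by blast
    define n where "n = max n1 n2"
    have n: "J n \<subseteq> den (?cov p)" "J n \<subseteq> den (?cov p')" using n1 n2 by (auto simp: n_def)
    note v = covU[OF p] n(1) and v' = covU[OF p'] n(2)
    have cs: "?cov (p \<oplus>\<^bsub>P0\<^esub> p') = ?cov p \<oplus> ?cov p'" using linear_map_add[OF cov p p'] by simp
    note L = lift_add[OF v v']
    have ns: "J n \<subseteq> den (?cov (p \<oplus>\<^bsub>P0\<^esub> p'))" using L(1) cs by simp
    note a = rest_K[OF p n(1)] and a' = rest_K[OF p' n(2)]
    have "(p \<oplus>\<^bsub>P0\<^esub> p') \<ominus>\<^bsub>P0\<^esub> lift n (?cov (p \<oplus>\<^bsub>P0\<^esub> p')) = (p \<ominus>\<^bsub>P0\<^esub> lift n (?cov p)) \<oplus>\<^bsub>K0\<^esub> (p' \<ominus>\<^bsub>P0\<^esub> lift n (?cov p'))"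
      using P0.M.sum_of_diffs[OF p p' lift_closed[OF v] lift_closed[OF v']] by (simp add: cs L(2) syzygy_simps)
    then have 1: "\<phi> ((p \<oplus>\<^bsub>P0\<^esub> p') \<ominus>\<^bsub>P0\<^esub> lift n (?cov (p \<oplus>\<^bsub>P0\<^esub> p'))) = \<phi> (p \<ominus>\<^bsub>P0\<^esub> lift n (?cov p)) \<oplus>\<^bsub>?N\<^esub> \<phi> (p' \<ominus>\<^bsub>P0\<^esub> lift n (?cov p'))"
      using linear_map_add[OF \<phi> a a'] by simp
    have 2: "?\<Phi> (tail_sum n (?cov (p \<oplus>\<^bsub>P0\<^esub> p'))) = ?\<Phi> (tail_sum n (?cov p)) \<oplus>\<^bsub>?N\<^esub> ?\<Phi> (tail_sum n (?cov p'))"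
      unfolding cs tail_sum_add[OF v v']
      by (rule linear_map_add[OF lin]) (simp_all add: tail_sum_closed[OF v] tail_sum_closed[OF v'])
    show "g (p \<oplus>\<^bsub>P0\<^esub> p') = g p \<oplus>\<^bsub>?N\<^esub> g p'"
      unfolding gG[OF p n(1)] gG[OF p' n(2)] gG[OF R.free_module_add_closed[OF p p'] ns] G_def 1 2
      using linear_map_closed[OF \<phi> a] linear_map_closed[OF \<phi> a'] \<Phi>N[OF tail_sum_closed[OF v]] \<Phi>N[OF tail_sum_closed[OF v']]
      by (simp add: N.M.a_ac)
  next
    fix r p assume r: "r \<in> carrier R" and p: "p \<in> carrier P0"
    obtain n where n: "J n \<subseteq> den (?cov p)" using J_den_ex[OF covU[OF p]] by blast
    note v = covU[OF p] n
    have cs: "?cov (r \<odot>\<^bsub>P0\<^esub> p) = u r \<otimes> ?cov p" using linear_map_smult[OF cov r p] by simp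
    note L = lift_smult[OF v r]
    have ns: "J n \<subseteq> den (?cov (r \<odot>\<^bsub>P0\<^esub> p))" using L(1) cs by simp
    note a = rest_K[OF p n]
    have "(r \<odot>\<^bsub>P0\<^esub> p) \<ominus>\<^bsub>P0\<^esub> lift n (?cov (r \<odot>\<^bsub>P0\<^esub> p)) = r \<odot>\<^bsub>K0\<^esub> (p \<ominus>\<^bsub>P0\<^esub> lift n (?cov p))"
      using left_module_smult_diff[OF P0_module r p lift_closed[OF v]] by (simp add: cs L(2) syzygy_simps)
    then have 1: "\<phi> ((r \<odot>\<^bsub>P0\<^esub> p) \<ominus>\<^bsub>P0\<^esub> lift n (?cov (r \<odot>\<^bsub>P0\<^esub> p))) = r \<odot>\<^bsub>?N\<^esub> \<phi> (p \<ominus>\<^bsub>P0\<^esub> lift n (?cov p))"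
      using linear_map_smult[OF \<phi> r a] by simp
    have 2: "?\<Phi> (tail_sum n (?cov (r \<odot>\<^bsub>P0\<^esub> p))) = r \<odot>\<^bsub>?N\<^esub> ?\<Phi> (tail_sum n (?cov p))"
      unfolding cs tail_sum_smult[OF v r]
      by (rule linear_map_smult[OF lin r]) (simp add: tail_sum_closed[OF v])
    show "g (r \<odot>\<^bsub>P0\<^esub> p) = r \<odot>\<^bsub>?N\<^esub> g p"
      unfolding gG[OF p n] gG[OF R.free_module_smult_closed[OF r p] ns] G_def 1 2
      using linear_map_closed[OF \<phi> a] \<Phi>N[OF tail_sum_closed[OF v]] r
      by (simp add: N.lsmult_r_distr)
  qed
  have "g p = \<phi> p" if p: "p \<in> carrier K0" for p
  proof -
    have pP: "p \<in> carrier P0" and p0: "?cov p = \<zero>" using p by (auto simp: K0_iff)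
    obtain n where n: "J n \<subseteq> den (?cov p)" using J_den_ex[OF covU[OF pP]] by blast
    interpret PY: left_module R PY by (rule PY_module)
    have "?\<Phi> (tail_sum n \<zero>) = \<zero>\<^bsub>?N\<^esub>"
      unfolding tail_sum_at_zero T.contra_sum_finite[OF contra gC PY.M.zero_closed]
      by (rule linear_map_zero[OF PY_module N N.lin_ext_linear[OF gN]])
    moreover have "p \<ominus>\<^bsub>P0\<^esub> \<zero>\<^bsub>P0\<^esub> = p" using pP by (simp add: a_minus_def)
    ultimately show ?thesis
      using linear_map_closed[OF \<phi> p] by (simp add: gG[OF pP n] G_def p0 lift_at_zero)
  qed
  then have "\<exists>g. linear_map R P0 ?N g \<and> (\<forall>p \<in> carrier K0. g p = \<phi> p)" using glin by blast
  then show "\<exists>g. linear_map R (free_module R (carrier UL)) ?N g \<and> (\<forall>p \<in> carrier K0. g p = \<phi> p)" by simp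
qed

end

section \<open>Isomorphisms and extensions\<close>

lemma linear_map_lift_injective:
  assumes A: "left_module R A" and f: "linear_map R A B f" and inj: "inj_on f (carrier A)"
    and h: "linear_map R L B h" and sub: "h ` carrier L \<subseteq> f ` carrier A"
  shows "linear_map R L A (\<lambda>x. inv_into (carrier A) f (h x))"
    and "x \<in> carrier L \<Longrightarrow> f (inv_into (carrier A) f (h x)) = h x"
proof -
  interpret A: left_module R A by (rule A)
  have im: "h x \<in> f ` carrier A" if "x \<in> carrier L" for x using sub that by blast
  let ?k = "\<lambda>x. inv_into (carrier A) f (h x)"
  have fk: "f (?k x) = h x" if "x \<in> carrier L" for x by (rule f_inv_into_f[OF im[OF that]])
  have k: "?k x \<in> carrier A" if "x \<in> carrier L" for x by (rule inv_into_into[OF im[OF that]])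
  have eq: "inv_into (carrier A) f b = a" if "a \<in> carrier A" "f a = b" for a b
    using inv_into_f_f[OF inj that(1)] that(2) by simp
  show "x \<in> carrier L \<Longrightarrow> f (?k x) = h x" by (rule fk)
  show "linear_map R L A ?k"
  proof (rule linear_mapI)
    fix x y assume x: "x \<in> carrier L" and y: "y \<in> carrier L"
    show "?k (x \<oplus>\<^bsub>L\<^esub> y) = ?k x \<oplus>\<^bsub>A\<^esub> ?k y"
      by (rule eq) (simp_all add: k x y linear_map_add[OF f k k] fk linear_map_add[OF h])
  next
    fix r x assume r: "r \<in> carrier R" and x: "x \<in> carrier L"
    show "?k (r \<odot>\<^bsub>L\<^esub> x) = r \<odot>\<^bsub>A\<^esub> ?k x"
      by (rule eq) (simp_all add: k r x linear_map_smult[OF f r k] fk linear_map_smult[OF h] A.lsmult_closed)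
  qed (rule k)
qed

lemma perpendicular_iso:
  assumes N: "left_module R N" and M: "left_module R M" and f: "linear_map R N M f"
    and bij: "bij_betw f (carrier N) (carrier M)"
  shows "hom_trivial R L N \<Longrightarrow> hom_trivial R L M"
    and "syzygy_maps_extend R L N \<Longrightarrow> syzygy_maps_extend R L M"
proof -
  have inj: "inj_on f (carrier N)" and im: "f ` carrier N = carrier M" using bij by (auto simp: bij_betw_def)
  show "hom_trivial R L M" if t: "hom_trivial R L N"
    unfolding hom_trivial_def
  proof (intro allI impI ballI)
    fix h x assume h: "linear_map R L M h" and x: "x \<in> carrier L"
    have hx: "h ` carrier L \<subseteq> f ` carrier N" using linear_map_closed[OF h] im by blast
    note b = linear_map_lift_injective[OF N f inj h hx]
    have "inv_into (carrier N) f (h x) = \<zero>\<^bsub>N\<^esub>" using t b(1) x unfolding hom_trivial_def by blast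
    then show "h x = \<zero>\<^bsub>M\<^esub>" using b(2)[OF x] linear_map_zero[OF N M f] by simp
  qed
  show "syzygy_maps_extend R L M" if e: "syzygy_maps_extend R L N"
    unfolding syzygy_maps_extend_def
  proof (intro allI impI)
    fix h assume h: "linear_map R (syzygy R L) M h"
    have hx: "h ` carrier (syzygy R L) \<subseteq> f ` carrier N" using linear_map_closed[OF h] im by blast
    note b = linear_map_lift_injective[OF N f inj h hx]
    obtain g where g: "linear_map R (free_module R (carrier L)) N g"
      "\<And>p. p \<in> carrier (syzygy R L) \<Longrightarrow> g p = inv_into (carrier N) f (h p)"
      using e b(1) unfolding syzygy_maps_extend_def by blast
    show "\<exists>g. linear_map R (free_module R (carrier L)) M g \<and> (\<forall>p \<in> carrier (syzygy R L). g p = h p)"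
      by (intro exI[of _ "\<lambda>p. f (g p)"] conjI ballI linear_map_comp[OF g(1) f]) (simp add: g(2) b(2))
  qed
qed

text \<open>
  The argument of the long exact sequence.  A map from the syzygy to \<open>B\<close> is first extended after
  composition with \<open>g\<close>; lifting this extension along \<open>g\<close> on the basis leaves an error that takes
  values in the image of \<open>A\<close> and can be extended there.
\<close>

lemma perpendicular_extension:
  assumes L: "left_module R L" and A: "left_module R A" and B: "left_module R B" and C: "left_module R C"
    and ex: "short_exact R A B C f g"
  shows "hom_trivial R L A \<Longrightarrow> hom_trivial R L C \<Longrightarrow> hom_trivial R L B"
    and "syzygy_maps_extend R L A \<Longrightarrow> syzygy_maps_extend R L C \<Longrightarrow> syzygy_maps_extend R L B"
proof -
  interpret B: left_module R B by (rule B)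
  have f: "linear_map R A B f" and g: "linear_map R B C g" and inj: "inj_on f (carrier A)"
    and im: "f ` carrier A = {b \<in> carrier B. g b = \<zero>\<^bsub>C\<^esub>}" and surj: "g ` carrier B = carrier C"
    using ex by (auto simp: short_exact_def mod_hom_iff)
  show "hom_trivial R L B" if tA: "hom_trivial R L A" and tC: "hom_trivial R L C"
    unfolding hom_trivial_def
  proof (intro allI impI ballI)
    fix h x assume h: "linear_map R L B h" and x: "x \<in> carrier L"
    have "g (h y) = \<zero>\<^bsub>C\<^esub>" if "y \<in> carrier L" for y
      using tC linear_map_comp[OF h g] that unfolding hom_trivial_def by blast
    then have hx: "h ` carrier L \<subseteq> f ` carrier A" using linear_map_closed[OF h] im by auto
    note b = linear_map_lift_injective[OF A f inj h hx]
    have "inv_into (carrier A) f (h x) = \<zero>\<^bsub>A\<^esub>" using tA b(1) x unfolding hom_trivial_def by blast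
    then show "h x = \<zero>\<^bsub>B\<^esub>" using b(2)[OF x] linear_map_zero[OF A B f] by simp
  qed
  show "syzygy_maps_extend R L B" if eA: "syzygy_maps_extend R L A" and eC: "syzygy_maps_extend R L C"
    unfolding syzygy_maps_extend_def
  proof (intro allI impI)
    let ?K = "syzygy R L" and ?P = "free_module R (carrier L)"
    let ?e = "formal_single R (carrier L) \<one>\<^bsub>R\<^esub>"
    fix \<phi> assume \<phi>: "linear_map R ?K B \<phi>"
    have KP: "linear_map R ?K ?P (\<lambda>p. p)" by (rule linear_mapI) (simp_all add: syzygy_simps)
    have e: "?e x \<in> carrier ?P" for x by (simp add: B.R.formal_single_closed)
    obtain \<gamma> where \<gamma>: "linear_map R ?P C \<gamma>" "\<And>p. p \<in> carrier ?K \<Longrightarrow> \<gamma> p = g (\<phi> p)"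
      using eC linear_map_comp[OF \<phi> g] unfolding syzygy_maps_extend_def by blast
    define b where "b x = inv_into (carrier B) g (\<gamma> (?e x))" for x
    have \<gamma>e: "\<gamma> (?e x) \<in> g ` carrier B" for x using linear_map_closed[OF \<gamma>(1) e] surj by simp
    have bB: "b \<in> carrier L \<rightarrow> carrier B" unfolding b_def using inv_into_into[OF \<gamma>e] by blast
    have gb: "g (b x) = \<gamma> (?e x)" for x unfolding b_def by (rule f_inv_into_f[OF \<gamma>e])
    let ?\<beta> = "lin_ext R B (carrier L) b"
    have \<beta>: "linear_map R ?P B ?\<beta>" by (rule B.lin_ext_linear[OF bB])
    have g\<beta>: "g (?\<beta> p) = \<gamma> p" if p: "p \<in> carrier ?P" for p
      by (rule B.R.linear_map_eq_on_basis[OF C linear_map_comp[OF \<beta> g] \<gamma>(1) _ p])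
        (simp add: B.lin_ext_basis[OF bB] gb)
    let ?\<delta> = "\<lambda>p. \<phi> p \<ominus>\<^bsub>B\<^esub> ?\<beta> p"
    have \<delta>: "linear_map R ?K B ?\<delta>" by (rule linear_map_difference[OF B \<phi> linear_map_comp[OF KP \<beta>]])
    have "?\<delta> p \<in> f ` carrier A" if p: "p \<in> carrier ?K" for p
    proof -
      have pP: "p \<in> carrier ?P" by (rule linear_map_closed[OF KP p])
      note c = linear_map_closed[OF \<phi> p] linear_map_closed[OF \<beta> pP]
      interpret C: left_module R C by (rule C)
      have "g (?\<delta> p) = g (\<phi> p) \<ominus>\<^bsub>C\<^esub> g (?\<beta> p)" by (rule linear_map_diff[OF B C g c])
      also have "\<dots> = \<zero>\<^bsub>C\<^esub>"
        using C.M.diff_eq_zero_iff[OF linear_map_closed[OF g c(1)] linear_map_closed[OF g c(2)]]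
          g\<beta>[OF pP] \<gamma>(2)[OF p] by simp
      finally show ?thesis using linear_map_closed[OF \<delta> p] im by simp
    qed
    then have \<delta>A: "?\<delta> ` carrier ?K \<subseteq> f ` carrier A" by blast
    note k = linear_map_lift_injective[OF A f inj \<delta> \<delta>A]
    obtain \<alpha> where \<alpha>: "linear_map R ?P A \<alpha>" "\<And>p. p \<in> carrier ?K \<Longrightarrow> \<alpha> p = inv_into (carrier A) f (?\<delta> p)"
      using eA k(1) unfolding syzygy_maps_extend_def by blast
    have "f (\<alpha> p) \<oplus>\<^bsub>B\<^esub> ?\<beta> p = \<phi> p" if p: "p \<in> carrier ?K" for p
      using \<alpha>(2)[OF p] k(2)[OF p] linear_map_closed[OF \<phi> p] linear_map_closed[OF \<beta> linear_map_closed[OF KP p]]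
      by (simp add: a_minus_def B.M.a_assoc B.M.l_neg)
    then show "\<exists>g. linear_map R ?P B g \<and> (\<forall>p \<in> carrier ?K. g p = \<phi> p)"
      by (intro exI[of _ "\<lambda>p. f (\<alpha> p) \<oplus>\<^bsub>B\<^esub> ?\<beta> p"] conjI ballI linear_map_sum[OF B linear_map_comp[OF \<alpha>(1) f] \<beta>]) simp
  qed
qed

context flat_epi
begin

lemma perp_eq_contra_modules:
  assumes "has_countable_base \<GG>"
  shows "perp01 R UL = (contra_modules R \<GG> :: ('r, 'm) module set)"
proof (intro equalityI subsetI)
  fix M :: "('r, 'm) module" assume "M \<in> perp01 R UL"
  then show "M \<in> contra_modules R \<GG>"
    unfolding perp01_iff[OF UL_module] using perp_imp_contra by blast
next
  fix M :: "('r, 'm) module" assume "M \<in> contra_modules R \<GG>"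
  then obtain C :: "'m set" and \<pi> f where M: "left_module R M" and contra: "completion_contramodule R \<GG> C \<pi>"
    and f: "f \<in> mod_hom R (contra_forget R \<GG> C \<pi>) M" and bij: "bij_betw f C (carrier M)"
    unfolding contra_modules_def by blast
  obtain J \<rho> where "fraction_chain R U u J \<rho>" using fraction_chain_exists[OF assms] .
  then interpret F: fraction_chain R U u J \<rho> .
  have lin: "linear_map R (contra_forget R \<GG> C \<pi>) M f" using f by (simp add: mod_hom_iff)
  have bij': "bij_betw f (carrier (contra_forget R \<GG> C \<pi>)) (carrier M)" using bij by (simp add: T.contra_forget_simps)
  note iso = perpendicular_iso[OF T.contra_left_module[OF contra] M lin bij']
  show "M \<in> perp01 R UL"
    unfolding perp01_iff[OF UL_module]
    by (intro conjI M iso F.contra_hom_trivial[OF contra] F.contra_syzygy_maps_extend[OF contra])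
qed

text \<open>
  For a linear map \<open>f\<close>, both sides of the equation defining a homomorphism of contramodules are
  linear in the formal sum and agree on finite sums; so uniqueness of linear extensions applies.
\<close>

lemma contra_hom_eq_mod_hom:
  assumes base: "has_countable_base \<GG>"
    and C: "completion_contramodule R \<GG> C \<pi>" and D: "completion_contramodule R \<GG> D \<rho>"
  shows "completion_contra_hom R \<GG> C \<pi> D \<rho> = mod_hom R (contra_forget R \<GG> C \<pi>) (contra_forget R \<GG> D \<rho>)"
proof (intro equalityI subsetI)
  fix f assume f: "f \<in> completion_contra_hom R \<GG> C \<pi> D \<rho>"
  then have "f \<in> extensional C" by (auto simp: contra_hom_def PiE_def)
  then show "f \<in> mod_hom R (contra_forget R \<GG> C \<pi>) (contra_forget R \<GG> D \<rho>)"
    using T.contra_hom_linear[OF C D f] by (simp add: mod_hom_iff T.contra_forget_simps)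
next
  let ?N = "contra_forget R \<GG> D \<rho>"
  fix f assume "f \<in> mod_hom R (contra_forget R \<GG> C \<pi>) ?N"
  then have f: "linear_map R (contra_forget R \<GG> C \<pi>) ?N f" and ext: "f \<in> extensional C"
    by (simp_all add: mod_hom_iff T.contra_forget_simps)
  have fCD: "f \<in> C \<rightarrow> D" using linear_map_closed[OF f] by (simp add: T.contra_forget_simps)
  obtain J \<rho>' where "fraction_chain R U u J \<rho>'" using fraction_chain_exists[OF base] .
  then interpret F: fraction_chain R U u J \<rho>' .
  have N: "left_module R ?N" by (rule T.contra_left_module[OF D])
  have L1: "linear_map R (T.formal_module C) ?N (\<lambda>a. f (\<pi> a))"
    by (rule linear_map_comp[OF T.contra_linear[OF C] f])
  have L2: "linear_map R (T.formal_module C) ?N (\<lambda>a. \<rho> (T.push C D f a))"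
    by (rule linear_map_comp[OF T.push_linear[OF fCD] T.contra_linear[OF D]])
  have "f (\<pi> a) = \<rho> (T.push C D f a)" if a: "a \<in> T.FS C" for a
  proof (rule linear_extension_unique[OF N F.contra_hom_trivial[OF D] L1 L2 _ a])
    fix p assume p: "p \<in> T.PF C"
    show "f (\<pi> (T.emb C p)) = \<rho> (T.push C D f (T.emb C p))"
    proof (rule R.linear_map_eq_on_basis[OF N linear_map_comp[OF T.emb_linear L1] linear_map_comp[OF T.emb_linear L2] _ p])
      fix c assume c: "c \<in> C"
      have "f c \<in> D" using Pi_mem[OF fCD c] .
      then show "f (\<pi> (T.emb C (formal_single R C \<one>\<^bsub>R\<^esub> c))) = \<rho> (T.push C D f (T.emb C (formal_single R C \<one>\<^bsub>R\<^esub> c)))"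
        using c by (simp add: T.contra_unit[OF C] T.contra_unit[OF D] T.push_emb[OF fCD] R.formal_single_closed T.push_fin_single)
    qed
  qed
  then show "f \<in> completion_contra_hom R \<GG> C \<pi> D \<rho>"
    using fCD ext by (auto simp: contra_hom_def PiE_def)
qed

lemma contra_modules_extension:
  assumes base: "has_countable_base \<GG>" and B: "left_module R B"
    and A: "A \<in> contra_modules R \<GG>" and C: "C \<in> contra_modules R \<GG>" and ex: "short_exact R A B C f g"
  shows "B \<in> contra_modules R \<GG>"
proof -
  have "A \<in> perp01 R UL" "C \<in> perp01 R UL" using A C by (simp_all add: perp_eq_contra_modules[OF base])
  then have pA: "left_module R A" "hom_trivial R UL A" "syzygy_maps_extend R UL A"
    and pC: "left_module R C" "hom_trivial R UL C" "syzygy_maps_extend R UL C"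
    by (simp_all add: perp01_iff[OF UL_module])
  note e = perpendicular_extension[OF UL_module pA(1) B pC(1) ex]
  show ?thesis by (rule perp_imp_contra[OF B e(1)[OF pA(2) pC(2)] e(2)[OF pA(3) pC(3)]])
qed

end

theorem theorem8p10:
  fixes R :: "'r ring" and U :: "'u ring" and u :: "'r \<Rightarrow> 'u"
  assumes "ring R" and "ring U"
    and "ring_epimorphism R U u"
    and "inj_on u (carrier R)"
    and "flat_left_module R (restrict_scalars u (regular_module U))"
    and "has_countable_base (gabriel_topology R U u)"
  shows
    "perp01 R (restrict_scalars u (regular_module U)) =
       (contra_modules R (gabriel_topology R U u) :: ('r, 'm) module set)
     \<and>
     (\<forall>(C :: 'm set) \<pi> (D :: 'n set) \<rho>.
       completion_contramodule R (gabriel_topology R U u) C \<pi> \<and>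
       completion_contramodule R (gabriel_topology R U u) D \<rho> \<longrightarrow>
       completion_contra_hom R (gabriel_topology R U u) C \<pi> D \<rho> =
         mod_hom R (contra_forget R (gabriel_topology R U u) C \<pi>)
                   (contra_forget R (gabriel_topology R U u) D \<rho>))
     \<and>
     (\<forall>(A :: ('r, 'a) module) (B :: ('r, 'b) module) (C :: ('r, 'c) module) f g.
       left_module R B \<and>
       A \<in> contra_modules R (gabriel_topology R U u) \<and>
       C \<in> contra_modules R (gabriel_topology R U u) \<and>
       short_exact R A B C f g \<longrightarrow>
       B \<in> contra_modules R (gabriel_topology R U u))"
proof -
  interpret flat_epi R U u by (rule flat_epi.intro) (fact assms)+
  note base = assms(6)
  show ?thesis
    using perp_eq_contra_modules[OF base] contra_hom_eq_mod_hom[OF base] contra_modules_extension[OF base]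
    by blast
qed

end
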